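(* Let $\beta_1,\beta_2\in(0,1]$ and $L_1,L_2,c_0,C_0>0$ and suppose that for all $x,x'\in[0,1]^d$: (B1) $|a(x)-a(x')|\le L_1\|x-x'\|_\infty^{\beta_1}$; (B2) $|f(x)-f(x')|\le L_2\|x-x'\|_\infty^{\beta_2}$; (B3) $c_0\le f(x)\le C_0$. Suppose further that $\max_{S\in\mathbb S}\lambda_S<\infty$. Then there exists a constant $C\equiv C(d,\beta_1,\beta_2,L_1,L_2,c_0,C_0,\|K\|_\infty)$ such that $$\mathbb E_f\bigl[n\{\check\theta_h^M-\theta(f)\}^2\bigr]\to\inf_{\alpha_{\mathbb S}\in H_{\mathbb S}}\mathcal L(\alpha_{\mathbb S})\qquad(n\to\infty)$$ whenever $h=h_n\in(0,1)$ and $M=M_n\in\mathbb N_0$ are chosen to satisfy $M\to\infty$, $hC^M\to 0$ and $(C/h^d)^{2M+2}/n\to 0$.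
   Context: Setting (no distributional shift). Let $d\ge 2$, $[d]=\{1,\dots,d\}$, let $f$ be a probability density supported on $[0,1]^d$ and $X\sim f$. For $x\in\mathbb R^d$, $S\subseteq[d]$ write $x_S=(x_j:j\in S)$ and $f_S$ for the density of $X_S$. Let $\mathbb S\subseteq 2^{[d]}\setminus\{[d]\}$ be nonempty and $\theta=\theta(f)=\int af$ for a known measurable $a$. For sample sizes $n$ and $n_S\ge 1$ ($S\in\mathbb S$) we observe mutually independent samples $X_1,\dots,X_n$ i.i.d. with density $f$ and, for each $S\in\mathbb S$, $X_{S,1},\dots,X_{S,n_S}$ of which only the coordinates in $S$ are observed, with $(X_{S,i})_S$ i.i.d. with density $f_S$. It is assumed that $n_S/n\to\lambda_S\in(0,\infty)$ and $|n\lambda_S/n_S-1|\le 1/n$ for all $n$ and $S\in\mathbb S$. Objective. $L^2=\{\alpha:\int\alpha^2f<\infty\}$, $H_S=\{\alpha_S\in L^2:\alpha_S(x)\equiv\alpha_S(x_S),\int\alpha_Sf=0\}$, $H_{\mathbb S}=\prod_{S\in\mathbb S}H_S$, and $$\mathcal L(\alpha_{\mathbb S})=\mathrm{Var}\Bigl(a(X)-\sum_{S\in\mathbb S}\alpha_S(X_S)\Bigr)+\sum_{S\in\mathbb S}\frac1{\lambda_S}\mathbb E\{\alpha_S(X_S)^2\}.$$ Estimator. Let $K:\mathbb R^d\to[0,\infty)$ be a bounded kernel with $\int K=1$, $K(u)=0$ when $\|u\|_\infty>1/2$ and $K(\xi_1u_1,\dots,\xi_du_d)=K(u)$ for all $\xi\in\{-1,1\}^d$.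 For $S\in\mathbb S$ and $h\in(0,1)$ let $K^S(u)=\int_{\mathbb R^{S^c}}K(u_S,u'_{S^c})\,du'_{S^c}$ and $K_h^S(u)=h^{-|S|}K^S(u/h)$ (functions of $u_S$), and $$\hat f_S(x)=\frac1{n+n_S}\Bigl\{\sum_{i=1}^{n_S}K_h^S(X_{S,i}-x)+\sum_{i=1}^nK_h^S(X_i-x)\Bigr\}.$$ For $m\in\mathbb N$ let $\mathbb S^{(m)}=\{(S_1,\dots,S_m)\in\mathbb S^m:S_{j+1}\ne S_j\text{ for }j\in[m-1]\}$, and for a tuple $\mathbf S=(S_1,\dots,S_m)$ let $v_{\mathbf S}=\prod_{j=1}^m(1+n/n_{S_j})^{-1}$ (empty product $=1$) and $$\hat k_h^{\mathbf S}(x_1,\dots,x_{m+1})=a(x_1)\prod_{j=1}^m\Bigl\{\frac{K_h^{S_j}(x_{j+1}-x_j)}{\hat f_{S_j}(x_j)}-1\Bigr\},$$ with $0/0=0$. Let $\eta=|\mathbb S|^{-1}$, $b_{M,\eta}(m)=\mathbb P(\mathrm{Bin}(M,\eta)\ge m)$, $(n)_m=n(n-1)\cdots(n-m+1)$, $\mathcal I_m=\{(i_1,\dots,i_m)\in[n]^m:i_1,\dots,i_m\text{ distinct}\}$. Then $$\check\theta_h^M=\frac1n\sum_{i=1}^na(X_i)+\sum_{m=1}^M(-1)^m\sum_{\mathbf S\in\mathbb S^{(m)}}v_{(S_1,\dots,S_{m-1})}\,b_{M,\eta}(m)\,\frac1{(n)_{m+1}}\sum_{\boldsymbol i\in\mathcal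 I_{m+1}}\hat k_h^{\mathbf S}(X_{i_1},\dots,X_{i_{m+1}}).$$ *)

theory Defs
  imports "HOL-Probability.Probability"
begin

text \<open>
  For a finite index set \<open>S\<close> of naturals, \<open>\<real>\<^sup>S\<close> is the space of functions
  \<^typ>\<open>nat \<Rightarrow> real\<close> that are \<^const>\<open>undefined\<close> outside \<open>S\<close>, with Lebesgue measure \<open>leb S\<close>.
  In particular \<open>\<real>\<^sup>d\<close> is \<open>\<real>\<^sup>S\<close> for \<open>S = {1..d}\<close>, and \<open>x\<^sub>S\<close> is \<open>restrict x S\<close>.
\<close>

type_synonym point = "nat \<Rightarrow> real"

abbreviation leb :: "nat set \<Rightarrow> point measure" where
  "leb S \<equiv> Pi\<^sub>M S (\<lambda>_. lborel)"

abbreviation euclid :: "nat \<Rightarrow> point set" where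
  "euclid d \<equiv> {1..d} \<rightarrow>\<^sub>E (UNIV :: real set)"

definition unit_cube :: "nat \<Rightarrow> point set" where
  "unit_cube d = {1..d} \<rightarrow>\<^sub>E {0..1}"

definition sup_norm :: "nat \<Rightarrow> point \<Rightarrow> real" where
  "sup_norm d x = (MAX j\<in>{1..d}. \<bar>x j\<bar>)"

definition holder_on_cube :: "nat \<Rightarrow> real \<Rightarrow> real \<Rightarrow> (point \<Rightarrow> real) \<Rightarrow> bool" where
  "holder_on_cube d \<beta> L g \<longleftrightarrow>
     (\<forall>x\<in>unit_cube d. \<forall>x'\<in>unit_cube d. \<bar>g x - g x'\<bar> \<le> L * sup_norm d (\<lambda>j. x j - x' j) powr \<beta>)"

text \<open>
  Integrating out the coordinates outside \<open>S\<close>. This gives both the marginal density \<open>f\<^sub>S\<close> and the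
  marginal kernel \<open>K\<^sup>S\<close>; for \<open>S = {}\<close> it is the total integral.
\<close>

definition marginal :: "nat \<Rightarrow> nat set \<Rightarrow> (point \<Rightarrow> real) \<Rightarrow> point \<Rightarrow> real" where
  "marginal d S g y = (\<integral>u. g (merge S ({1..d} - S) (y, u)) \<partial>leb ({1..d} - S))"


definition density_on_cube :: "nat \<Rightarrow> (point \<Rightarrow> real) \<Rightarrow> bool" where
  "density_on_cube d f \<longleftrightarrow>
     f \<in> borel_measurable (leb {1..d}) \<and>
     (\<forall>x\<in>euclid d. 0 \<le> f x) \<and>
     (\<forall>x\<in>euclid d - unit_cube d. f x = 0) \<and>
     (\<integral>x. f x \<partial>leb {1..d}) = 1"

definition law :: "nat \<Rightarrow> (point \<Rightarrow> real) \<Rightarrow> point measure" where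
  "law d f = density (leb {1..d}) (\<lambda>x. ennreal (f x))"

definition marginal_law :: "nat \<Rightarrow> (point \<Rightarrow> real) \<Rightarrow> nat set \<Rightarrow> point measure" where
  "marginal_law d f S = density (leb S) (\<lambda>y. ennreal (marginal d S f y))"

definition functional :: "nat \<Rightarrow> (point \<Rightarrow> real) \<Rightarrow> (point \<Rightarrow> real) \<Rightarrow> real" where
  "functional d a f = (\<integral>x. a x * f x \<partial>leb {1..d})"

text \<open>
  Joint law of the data: a pair \<open>(X, Y)\<close> where \<open>X i\<close> (\<open>1 \<le> i \<le> n\<close>) are the complete
  observations and \<open>Y (S, i)\<close> (\<open>1 \<le> i \<le> nS S\<close>) are the observed parts \<open>(X\<^bsub>S,i\<^esub>)\<^sub>S\<close> of the
  incomplete ones, all independent.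
\<close>

type_synonym sample = "(nat \<Rightarrow> point) \<times> (nat set \<times> nat \<Rightarrow> point)"

definition sample_law ::
  "nat \<Rightarrow> (point \<Rightarrow> real) \<Rightarrow> nat set set \<Rightarrow> nat \<Rightarrow> (nat set \<Rightarrow> nat) \<Rightarrow> sample measure" where
  "sample_law d f SS n nS =
     Pi\<^sub>M {1..n} (\<lambda>_. law d f) \<Otimes>\<^sub>M
     Pi\<^sub>M (SIGMA S:SS. {1..nS S}) (\<lambda>(S, i). marginal_law d f S)"

definition sample_sizes :: "nat set set \<Rightarrow> (nat set \<Rightarrow> real) \<Rightarrow> (nat \<Rightarrow> nat set \<Rightarrow> nat) \<Rightarrow> bool" where
  "sample_sizes SS lam nS \<longleftrightarrow>
     (\<forall>S\<in>SS. 0 < lam S \<and>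
        (\<lambda>n. real (nS n S) / real n) \<longlonglongrightarrow> lam S \<and>
        (\<forall>n\<ge>1. 1 \<le> nS n S \<and> \<bar>real n * lam S / real (nS n S) - 1\<bar> \<le> 1 / real n))"


definition L2 :: "nat \<Rightarrow> (point \<Rightarrow> real) \<Rightarrow> (point \<Rightarrow> real) set" where
  "L2 d f = {\<alpha> \<in> borel_measurable (leb {1..d}). integrable (leb {1..d}) (\<lambda>x. (\<alpha> x)\<^sup>2 * f x)}"

definition H :: "nat \<Rightarrow> (point \<Rightarrow> real) \<Rightarrow> nat set \<Rightarrow> (point \<Rightarrow> real) set" where
  "H d f S = {\<alpha> \<in> L2 d f.
     (\<forall>x\<in>euclid d. \<forall>x'\<in>euclid d. restrict x S = restrict x' S \<longrightarrow> \<alpha> x = \<alpha> x') \<and>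
     (\<integral>x. \<alpha> x * f x \<partial>leb {1..d}) = 0}"

definition HH :: "nat \<Rightarrow> (point \<Rightarrow> real) \<Rightarrow> nat set set \<Rightarrow> (nat set \<Rightarrow> point \<Rightarrow> real) set" where
  "HH d f SS = (\<Pi>\<^sub>E S\<in>SS. H d f S)"

definition objective ::
  "nat \<Rightarrow> (point \<Rightarrow> real) \<Rightarrow> (point \<Rightarrow> real) \<Rightarrow> nat set set \<Rightarrow> (nat set \<Rightarrow> real) \<Rightarrow>
   (nat set \<Rightarrow> point \<Rightarrow> real) \<Rightarrow> real" where
  "objective d f a SS lam \<alpha> =
     prob_space.variance (law d f) (\<lambda>x. a x - (\<Sum>S\<in>SS. \<alpha> S x)) +
     (\<Sum>S\<in>SS. 1 / lam S * prob_space.expectation (law d f) (\<lambda>x. (\<alpha> S x)\<^sup>2))"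


definition is_kernel :: "nat \<Rightarrow> (point \<Rightarrow> real) \<Rightarrow> bool" where
  "is_kernel d K \<longleftrightarrow>
     K \<in> borel_measurable (leb {1..d}) \<and>
     (\<forall>u\<in>euclid d. 0 \<le> K u) \<and>
     bdd_above (K ` euclid d) \<and>
     (\<integral>u. K u \<partial>leb {1..d}) = 1 \<and>
     (\<forall>u\<in>euclid d. sup_norm d u > 1/2 \<longrightarrow> K u = 0) \<and>
     (\<forall>\<xi>. (\<forall>j\<in>{1..d}. \<xi> j \<in> {-1, 1}) \<longrightarrow>
        (\<forall>u\<in>euclid d. K (\<lambda>j\<in>{1..d}. \<xi> j * u j) = K u))"

definition kernel_sup :: "nat \<Rightarrow> (point \<Rightarrow> real) \<Rightarrow> real" where
  "kernel_sup d K = (SUP u\<in>euclid d. \<bar>K u\<bar>)"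

definition Kh :: "nat \<Rightarrow> (point \<Rightarrow> real) \<Rightarrow> nat set \<Rightarrow> real \<Rightarrow> point \<Rightarrow> real" where
  "Kh d K S h u = marginal d S K (\<lambda>j\<in>S. u j / h) / h ^ card S"

definition f_hat ::
  "nat \<Rightarrow> (point \<Rightarrow> real) \<Rightarrow> real \<Rightarrow> nat \<Rightarrow> (nat set \<Rightarrow> nat) \<Rightarrow> sample \<Rightarrow> nat set \<Rightarrow> point \<Rightarrow> real" where
  "f_hat d K h n nS = (\<lambda>(X, Y) S x.
     1 / real (n + nS S) *
       ((\<Sum>i=1..nS S. Kh d K S h (\<lambda>j. Y (S, i) j - x j)) +
        (\<Sum>i=1..n. Kh d K S h (\<lambda>j. X i j - x j))))"

text \<open>
  Tuples are lists, so positions in them start at 0. The convention \<open>0 / 0 = 0\<close> needed in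
  \<open>k_hat\<close> is that of real division in HOL.
\<close>

definition adm_tuples :: "nat set set \<Rightarrow> nat \<Rightarrow> nat set list set" where
  "adm_tuples SS m = {Ss. length Ss = m \<and> set Ss \<subseteq> SS \<and> (\<forall>j. Suc j < m \<longrightarrow> Ss ! Suc j \<noteq> Ss ! j)}"

definition index_tuples :: "nat \<Rightarrow> nat \<Rightarrow> nat list set" where
  "index_tuples n m = {is. length is = m \<and> set is \<subseteq> {1..n} \<and> distinct is}"

definition falling :: "nat \<Rightarrow> nat \<Rightarrow> real" where
  "falling n m = (\<Prod>k<m. real n - real k)"

definition weight :: "nat \<Rightarrow> (nat set \<Rightarrow> nat) \<Rightarrow> nat set list \<Rightarrow> real" where
  "weight n nS Ss = (\<Prod>S\<leftarrow>Ss. 1 / (1 + real n / real (nS S)))"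

definition binom_tail :: "nat \<Rightarrow> real \<Rightarrow> nat \<Rightarrow> real" where
  "binom_tail M \<eta> m = measure_pmf.prob (binomial_pmf M \<eta>) {m..}"

definition k_hat ::
  "nat \<Rightarrow> (point \<Rightarrow> real) \<Rightarrow> (point \<Rightarrow> real) \<Rightarrow> real \<Rightarrow> nat \<Rightarrow> (nat set \<Rightarrow> nat) \<Rightarrow> sample \<Rightarrow>
   nat set list \<Rightarrow> point list \<Rightarrow> real" where
  "k_hat d K a h n nS \<omega> Ss xs =
     a (xs ! 0) *
     (\<Prod>j<length Ss.
        Kh d K (Ss ! j) h (\<lambda>l. (xs ! Suc j) l - (xs ! j) l) / f_hat d K h n nS \<omega> (Ss ! j) (xs ! j) - 1)"

definition theta_check ::
  "nat \<Rightarrow> (point \<Rightarrow> real) \<Rightarrow> (point \<Rightarrow> real) \<Rightarrow> nat set set \<Rightarrow> real \<Rightarrow> nat \<Rightarrow> nat \<Rightarrow>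
   (nat set \<Rightarrow> nat) \<Rightarrow> sample \<Rightarrow> real" where
  "theta_check d K a SS h M n nS \<omega> =
     1 / real n * (\<Sum>i=1..n. a (fst \<omega> i)) +
     (\<Sum>m=1..M. (-1) ^ m *
        (\<Sum>Ss\<in>adm_tuples SS m.
           weight n nS (butlast Ss) * binom_tail M (1 / real (card SS)) m *
           (1 / falling n (m + 1) *
             (\<Sum>is\<in>index_tuples n (m + 1). k_hat d K a h n nS \<omega> Ss (map (fst \<omega>) is)))))"

text \<open>
  The expectation is a nonnegative integral, so that a non-integrable error would give \<open>\<infinity>\<close>
  rather than the default value 0 of the Bochner integral.
\<close>

definition scaled_risk ::
  "nat \<Rightarrow> (point \<Rightarrow> real) \<Rightarrow> (point \<Rightarrow> real) \<Rightarrow> (point \<Rightarrow> real) \<Rightarrow> nat set set \<Rightarrow> real \<Rightarrow> nat \<Rightarrow> nat \<Rightarrow>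
   (nat set \<Rightarrow> nat) \<Rightarrow> ennreal" where
  "scaled_risk d f K a SS h M n nS =
     (\<integral>\<^sup>+\<omega>. ennreal (real n * (theta_check d K a SS h M n nS \<omega> - functional d a f)\<^sup>2)
        \<partial>sample_law d f SS n nS)"

end

theory Submission
  imports Defs "HOL-Real_Asymp.Real_Asymp"
begin

text \<open>
  Write \<open>v\<^sub>S = \<lambda>\<^sub>S / (1 + \<lambda>\<^sub>S)\<close> and \<open>T\<^sub>S g (y) = \<integral> g (x) (K\<^sub>h\<^sup>S (y - x) / f\<^sub>S (x) - 1) f (x) dx\<close>, which approximates the
  conditional expectation of \<open>g\<close> given \<open>x\<^sub>S\<close>, centred. The binomial weights satisfy
  \<open>b\<^bsub>M+1\<^esub>(m) = (1 - \<eta>) b\<^sub>M(m) + \<eta> b\<^sub>M(m - 1)\<close>, so the alternating sum over admissible words is the \<open>M\<close>-th iterate of the relaxed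
  Jacobi scheme \<open>\<Gamma>\<^sub>S \<leftarrow> (1 - \<eta>) \<Gamma>\<^sub>S + \<eta> (a - \<Sum>\<^bsub>U \<noteq> S\<^esub> v\<^sub>U T\<^sub>U \<Gamma>\<^sub>U)\<close> with empirical operators \<open>T\<^sub>S\<close>.

  Passing from distinct indices to all indices, and from empirical to population operators (on an event whose
  complement is exponentially small by Hoeffding's inequality), costs \<open>o(n\<^sup>-\<^sup>1\<^sup>/\<^sup>2)\<close>. What remains is a linear statistic whose
  variance is \<open>1 / n\<close> times the objective at \<open>\<alpha>\<^sub>S = v\<^sub>S T\<^sub>S \<Gamma>\<^sub>S\<close>, plus degenerate second order V-statistics.
  The smoothing error of \<open>T\<^sub>S\<close> is controlled in \<open>L\<^sup>1\<close> by a power of \<open>h\<close> times \<open>C\<^sup>M\<close>; for the exact conditional expectations the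
  Jacobi scheme decreases the objective geometrically towards its infimum. Since \<open>\<alpha>\<close> itself is admissible,
  the infimum is also a lower bound.
\<close>

section \<open>Lebesgue measure on coordinate spaces\<close>

text \<open>Averaging the outermost empirical operator over the sample produces
  \<open>fX S - fY S\<close>, the difference of the density estimates from the complete and from the
  incomplete observations. It is already of the order \<open>\<tau>\<close> of the uniform
  deviations, so replacing every other empirical factor by its population version costs only
  \<open>\<tau>\<close> squared. This is what makes the linearisation work, since
  \<open>\<tau>\<close> itself decays more slowly than the inverse square root of \<open>n\<close>.
  The kernel loses mass across the faces of the cube, so the smoothed operators are close to
  conditional expectations only on average; sup bounds free of \<open>h\<close> then turn L1
  closeness into L2 closeness. Regularity is propagated along the exact iterates alone. Whatever
  enters the tail bounds and the linearisation error through \<open>M\<close> or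
  \<open>1 / h\<close> is kept below the 60th root of \<open>n\<close>, and a 60th power in the
  final constant pays for it. That constant must not depend on the collection \<open>SS\<close>,
  whose cardinality is therefore replaced by \<open>2 ^ d\<close>.\<close>

abbreviation bor :: "nat => (point => 'a::topological_space) set" where
  "bor d \<equiv> borel_measurable (leb {1..d})"

abbreviation bor2 :: "nat => (point \<times> point => 'a::topological_space) set" where
  "bor2 d \<equiv> borel_measurable (leb {1..d} \<Otimes>\<^sub>M leb {1..d})"

text \<open>Keeps the simplifier from turning the index set \<open>{1..d}\<close> into
  \<open>{Suc 0..d}\<close>.\<close>

declare One_nat_def [simp del]

interpretation leb: product_sigma_finite "\<lambda>_::nat. lborel :: real measure"
  by (simp add: product_sigma_finite_def lborel.sigma_finite_measure_axioms)

lemma emeasure_lborel_affine: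
  fixes A :: "real set"
  assumes "c \<noteq> 0" and [measurable]: "A \<in> sets borel"
  shows "ennreal \<bar>c\<bar> * emeasure lborel ((\<lambda>x. t + c * x) -` A) = emeasure lborel A"
proof -
  have "emeasure lborel A = emeasure (density (distr lborel borel (\<lambda>x. t + c * x)) (\<lambda>_. ennreal \<bar>c\<bar>)) A"
    using lborel_real_affine[OF assms(1), of t] by simp
  also have "\<dots> = ennreal \<bar>c\<bar> * emeasure lborel ((\<lambda>x. t + c * x) -` A)"
    by (simp add: emeasure_density_const emeasure_distr)
  finally show ?thesis by simp
qed

text \<open>The rescaled pushforward agrees with the product measure on boxes, which determine it.
  Taken with all \<open>c j = h\<close> this rescales kernels, with signs it performs
  reflections.\<close>

lemma nn_integral_leb_affine:
  assumes fin: "finite S" and F: "F \<in> borel_measurable (leb S)" and c: "\<And>j. j \<in> S ==> c j \<noteq> 0"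
  shows "(\<integral>\<^sup>+x. F x \<partial>leb S) =
    ennreal (\<Prod>j\<in>S. \<bar>c j\<bar>) * (\<integral>\<^sup>+u. F (\<lambda>j\<in>S. t j + c j * u j) \<partial>leb S)"
proof -
  let ?aff = "\<lambda>u::point. \<lambda>j\<in>S. t j + c j * u j"
  have meas[measurable]: "?aff \<in> leb S \<rightarrow>\<^sub>M leb S"
    by (rule measurable_restrict) measurable
  define P where "P = density (distr (leb S) (leb S) ?aff) (\<lambda>_. ennreal (\<Prod>j\<in>S. \<bar>c j\<bar>))"
  have "P = leb S"
  proof (rule leb.PiM_eqI[OF fin])
    show "sets P = sets (leb S)" by (simp add: P_def)
    fix A :: "nat => real set" assume "\<And>i. i \<in> S ==> A i \<in> sets lborel"
    then have A: "\<And>i. i \<in> S ==> A i \<in> sets borel" by simp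
    have box: "Pi\<^sub>E S A \<in> sets (leb S)" using A fin by (intro sets_PiM_I_finite) auto
    have vim: "?aff -` Pi\<^sub>E S A \<inter> space (leb S) = Pi\<^sub>E S (\<lambda>j. (\<lambda>x. t j + c j * x) -` A j)"
      by (auto simp: space_PiM PiE_def Pi_def)
    have "emeasure P (Pi\<^sub>E S A) = ennreal (\<Prod>j\<in>S. \<bar>c j\<bar>) *
        emeasure (leb S) (?aff -` Pi\<^sub>E S A \<inter> space (leb S))"
      unfolding P_def using box by (simp add: emeasure_density_const emeasure_distr)
    also have "\<dots> = (\<Prod>j\<in>S. ennreal \<bar>c j\<bar>) *
        (\<Prod>j\<in>S. emeasure lborel ((\<lambda>x. t j + c j * x) -` A j))"
      unfolding vim
    proof (subst leb.emeasure_PiM[OF fin])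
      fix j assume "j \<in> S"
      then have [measurable]: "A j \<in> sets borel" using A by auto
      have "(\<lambda>x. t j + c j * x) \<in> borel \<rightarrow>\<^sub>M borel" by measurable
      from measurable_sets[OF this, of "A j"] show "(\<lambda>x. t j + c j * x) -` A j \<in> sets lborel"
        by simp
    qed (simp add: prod_ennreal)
    also have "\<dots> = (\<Prod>j\<in>S. emeasure lborel (A j))"
      unfolding prod.distrib[symmetric]
      by (intro prod.cong refl emeasure_lborel_affine c A)
    finally show "emeasure P (Pi\<^sub>E S A) = (\<Prod>j\<in>S. emeasure lborel (A j))" .
  qed
  then have "(\<integral>\<^sup>+x. F x \<partial>leb S) = (\<integral>\<^sup>+x. F x \<partial>P)" by simp
  also have "\<dots> = ennreal (\<Prod>j\<in>S. \<bar>c j\<bar>) * (\<integral>\<^sup>+u. F (?aff u) \<partial>leb S)"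
    unfolding P_def using F by (simp add: nn_integral_density nn_integral_distr nn_integral_cmult)
  finally show ?thesis .
qed

lemma leb_fold:
  assumes "S \<subseteq> {1..d}" "F \<in> bor d"
  shows "(\<integral>\<^sup>+x. F x \<partial>leb {1..d}) =
    (\<integral>\<^sup>+y. \<integral>\<^sup>+u. F (merge S ({1..d} - S) (y, u)) \<partial>leb ({1..d} - S) \<partial>leb S)"
proof -
  have eq: "S \<union> ({1..d} - S) = {1..d}" using assms by auto
  show ?thesis
    using leb.product_nn_integral_fold[of S "{1..d} - S" F, unfolded eq] assms finite_subset[OF assms(1)]
    by auto
qed

lemma leb_fold_lebesgue:
  fixes F :: "point => real"
  assumes "S \<subseteq> {1..d}" "integrable (leb {1..d}) F"
  shows "(\<integral>x. F x \<partial>leb {1..d}) =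
    (\<integral>y. \<integral>u. F (merge S ({1..d} - S) (y, u)) \<partial>leb ({1..d} - S) \<partial>leb S)"
proof -
  have eq: "S \<union> ({1..d} - S) = {1..d}" using assms by auto
  show ?thesis
    using leb.product_integral_fold[of S "{1..d} - S" F, unfolded eq] assms finite_subset[OF assms(1)]
    by auto
qed

lemma emeasure_leb_box:
  assumes "finite S" "\<And>j. j \<in> S ==> a j \<le> b j"
  shows "emeasure (leb S) (PiE S (\<lambda>j. {a j..b j})) = ennreal (\<Prod>j\<in>S. b j - a j)"
  using assms by (subst leb.emeasure_PiM) (auto simp: prod_ennreal)

lemma measurable_merge_split [measurable]:
  assumes "S \<subseteq> {1..d}"
  shows "merge S ({1..d} - S) \<in> leb S \<Otimes>\<^sub>M leb ({1..d} - S) \<rightarrow>\<^sub>M leb {1..d}"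
proof -
  have eq: "S \<union> ({1..d} - S) = {1..d}" using assms by auto
  show ?thesis using measurable_merge[of S "{1..d} - S" "\<lambda>_. lborel"] unfolding eq .
qed

section \<open>Marginal kernels on the cube\<close>

lemma space_leb [simp]: "space (leb S) = S \<rightarrow>\<^sub>E UNIV"
  by (simp add: space_PiM)

lemma measurable_leb_component [measurable]: "j \<in> S ==> (\<lambda>x. x j) \<in> borel_measurable (leb S)"
  using measurable_component_singleton[of j S "\<lambda>_. lborel :: real measure"] by simp

lemma unit_cube_sets [measurable]: "unit_cube d \<in> sets (leb {1..d})"
  unfolding unit_cube_def by (intro sets_PiM_I_finite) auto

lemma unit_cube_subset: "unit_cube d \<subseteq> euclid d"
  by (auto simp: unit_cube_def PiE_def Pi_def)

lemma unit_cube_iff: "x \<in> unit_cube d \<longleftrightarrow> x \<in> euclid d \<and> (\<forall>j\<in>{1..d}. 0 \<le> x j \<and> x j \<le> 1)"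
  by (auto simp: unit_cube_def PiE_def Pi_def)

lemma merge_in_euclid: "S \<subseteq> {1..d} ==> merge S ({1..d} - S) (y, u) \<in> euclid d"
  by (auto simp: merge_def PiE_def extensional_def)

lemma merge_in_cube:
  assumes "S \<subseteq> {1..d}"
  shows "merge S ({1..d} - S) (y, u) \<in> unit_cube d \<longleftrightarrow>
    (\<forall>j\<in>S. 0 \<le> y j \<and> y j \<le> 1) \<and> (\<forall>j\<in>{1..d} - S. 0 \<le> u j \<and> u j \<le> 1)"
  using assms by (auto simp: unit_cube_iff merge_in_euclid merge_def)

lemma indicator_slab_meas:
  assumes "finite S" "S \<subseteq> D" "\<And>j. j \<in> S ==> {w. Q j w} \<in> sets (borel :: real measure)"
  shows "(\<lambda>x. indicator {x. \<forall>j\<in>S. Q j (x j)} x :: ennreal) \<in> borel_measurable (leb D)"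
proof (subst measurable_cong)
  let ?A = "{x \<in> space (leb D). \<forall>j\<in>S. Q j (x j)}"
  show "indicator {x. \<forall>j\<in>S. Q j (x j)} w = indicator ?A w"
    if "w \<in> space (leb D)" for w using that by (simp add: indicator_def)
  have "?A \<in> sets (leb D)" if "S \<noteq> {}" using that
  proof (intro sets.sets_Collect_finite_All' assms(1))
    fix j assume j: "j \<in> S"
    then have "(\<lambda>x. x j) \<in> borel_measurable (leb D)" using assms by (intro measurable_leb_component) auto
    from measurable_sets[OF this assms(3)[OF j]] show "{x \<in> space (leb D). Q j (x j)} \<in> sets (leb D)"
      by (simp add: vimage_def Int_def conj_commute)
  qed
  moreover have "?A \<in> sets (leb D)" if "S = {}"
    unfolding that using sets.top[of "leb D"] by (simp del: sets.top space_leb)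
  ultimately have "?A \<in> sets (leb D)" by blast
  then show "indicator ?A \<in> borel_measurable (leb D)" by simp
qed

locale kern =
  fixes d :: nat and K :: "point => real" and \<kappa> h :: real
  assumes is_K: "is_kernel d K" and sup_K: "kernel_sup d K = \<kappa>" and h_pos: "0 < h" and h_lt: "h < 1"
begin

abbreviation k :: "nat set => point => point => real" where
  "k S x y \<equiv> Kh d K S h (\<lambda>l. y l - x l)"

lemma K_meas [measurable]: "K \<in> bor d"
  and K_nonneg: "u \<in> euclid d ==> 0 \<le> K u"
  and K_integral: "(\<integral>u. K u \<partial>leb {1..d}) = 1"
  using is_K by (auto simp: is_kernel_def)

lemma K_reflect:
  "u \<in> euclid d ==> (\<And>j. j \<in> {1..d} ==> \<xi> j \<in> {-1, 1}) ==> K (\<lambda>j\<in>{1..d}. \<xi> j * u j) = K u"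
  using is_K unfolding is_kernel_def by blast

lemma K_le: assumes "u \<in> euclid d" shows "K u \<le> \<kappa>"
proof -
  have "(\<lambda>u. \<bar>K u\<bar>) ` euclid d = K ` euclid d"
    using K_nonneg by (intro image_cong) auto
  then have "bdd_above ((\<lambda>u. \<bar>K u\<bar>) ` euclid d)"
    using is_K by (simp add: is_kernel_def)
  then have "\<bar>K u\<bar> \<le> kernel_sup d K"
    unfolding kernel_sup_def using assms by (intro cSUP_upper)
  then show ?thesis using sup_K by simp
qed

lemma \<kappa>_nonneg: "0 \<le> \<kappa>"
proof -
  have "(\<lambda>j\<in>{1..d}. 0) \<in> euclid d" by auto
  from K_nonneg[OF this] K_le[OF this] show ?thesis by linarith
qed

lemma K_supp: assumes "u \<in> euclid d" "K u \<noteq> 0" "j \<in> {1..d}" shows "\<bar>u j\<bar> \<le> 1/2"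
proof -
  have "\<not> sup_norm d u > 1/2" using is_K assms by (auto simp: is_kernel_def)
  moreover have "\<bar>u j\<bar> \<le> sup_norm d u" unfolding sup_norm_def using assms by (intro Max_ge) auto
  ultimately show ?thesis by linarith
qed

lemma K_nn_integral: "(\<integral>\<^sup>+u. ennreal (K u) \<partial>leb {1..d}) = 1"
proof -
  have "integrable (leb {1..d}) K" using K_integral not_integrable_integral_eq[of "leb {1..d}" K] by auto
  then show ?thesis using K_integral K_nonneg
    by (subst nn_integral_eq_integral) (auto intro!: AE_I2)
qed

context
  fixes S assumes S: "S \<subseteq> {1..d}"
begin

lemma finite_S: "finite S" using S finite_subset by auto

lemma card_S_le: "card S \<le> d" using card_mono[OF _ S] by simp

lemma section_meas [measurable]:
  "y \<in> space (leb S) ==> (\<lambda>u. K (merge S ({1..d} - S) (y, u))) \<in> borel_measurable (leb ({1..d} - S))"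
  using measurable_merge_split[OF S] by measurable

lemma section_le:
  "ennreal (K (merge S ({1..d} - S) (y, u))) \<le>
    ennreal \<kappa> * indicator (PiE ({1..d} - S) (\<lambda>_. {-(1/2)..1/2})) u"
  if "u \<in> space (leb ({1..d} - S))"
proof (cases "K (merge S ({1..d} - S) (y, u)) = 0")
  case False
  have "u \<in> PiE ({1..d} - S) (\<lambda>_. {-(1/2)..1/2})"
  proof (rule PiE_I)
    fix j assume j: "j \<in> {1..d} - S"
    with K_supp[OF merge_in_euclid[OF S] False, of j] show "u j \<in> {-(1/2)..1/2}"
      by (auto simp: merge_def abs_le_iff)
  next
    fix j assume "j \<notin> {1..d} - S" with that show "u j = undefined" by (auto simp: PiE_def extensional_def)
  qed
  then show ?thesis using K_le[OF merge_in_euclid[OF S]] by (auto simp: ennreal_leI)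
qed auto

text \<open>The sections of \<open>K\<close> live on a cube of side 1, hence of volume 1, so
  integrating coordinates out preserves the bound \<open>\<kappa>\<close>.\<close>

lemma section_nn_le: "(\<integral>\<^sup>+u. ennreal (K (merge S ({1..d} - S) (y, u))) \<partial>leb ({1..d} - S)) \<le> ennreal \<kappa>"
proof -
  let ?B = "PiE ({1..d} - S) (\<lambda>_. {-(1/2)..1/2::real})"
  have [measurable]: "?B \<in> sets (leb ({1..d} - S))" by (intro sets_PiM_I_finite) auto
  have "(\<integral>\<^sup>+u. ennreal (K (merge S ({1..d} - S) (y, u))) \<partial>leb ({1..d} - S)) \<le>
      (\<integral>\<^sup>+u. ennreal \<kappa> * indicator ?B u \<partial>leb ({1..d} - S))"
    by (intro nn_integral_mono section_le)
  also have "\<dots> = ennreal \<kappa> * emeasure (leb ({1..d} - S)) ?B"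
    by (subst nn_integral_cmult_indicator) auto
  also have "emeasure (leb ({1..d} - S)) ?B = 1"
    using emeasure_leb_box[of "{1..d} - S" "\<lambda>_. -(1/2)" "\<lambda>_. 1/2"] by simp
  finally show ?thesis by simp
qed

lemma section_integrable:
  "y \<in> space (leb S) ==> integrable (leb ({1..d} - S)) (\<lambda>u. K (merge S ({1..d} - S) (y, u)))"
  using section_nn_le[of y] K_nonneg[OF merge_in_euclid[OF S]]
  by (intro integrableI_nonneg) (auto simp: section_meas intro: le_less_trans)

lemma marginal_nn:
  assumes "y \<in> space (leb S)"
  shows "(\<integral>\<^sup>+u. ennreal (K (merge S ({1..d} - S) (y, u))) \<partial>leb ({1..d} - S)) = ennreal (marginal d S K y)"
  unfolding marginal_def using section_integrable[OF assms] K_nonneg[OF merge_in_euclid[OF S]]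
  by (intro nn_integral_eq_integral) auto

lemma marginal_nonneg: "0 \<le> marginal d S K y"
  unfolding marginal_def using K_nonneg[OF merge_in_euclid[OF S]] by (intro Bochner_Integration.integral_nonneg) auto

lemma marginal_le: "y \<in> space (leb S) ==> marginal d S K y \<le> \<kappa>"
  using section_nn_le[of y] marginal_nn[of y] \<kappa>_nonneg by (simp add: ennreal_le_iff)

lemma marginal_supp: assumes "marginal d S K y \<noteq> 0" "j \<in> S" shows "\<bar>y j\<bar> \<le> 1/2"
proof (rule ccontr)
  assume "\<not> ?thesis"
  moreover have "merge S ({1..d} - S) (y, u) j = y j" for u using assms(2) by (simp add: merge_def)
  ultimately have "K (merge S ({1..d} - S) (y, u)) = 0" for u
    using K_supp[OF merge_in_euclid[OF S], of y u j] assms(2) S by (metis subsetD)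
  then show False using assms by (simp add: marginal_def)
qed

text \<open>Evenness of \<open>K\<close> is assumed in each coordinate separately, so the
  coordinates in \<open>S\<close> can be reflected while those being integrated out stay fixed. This
  yields the symmetry of \<open>k S\<close>, on which the later exchanges of the two arguments
  rest.\<close>

lemma marginal_neg: "marginal d S K (\<lambda>j\<in>S. - y j) = marginal d S K (\<lambda>j\<in>S. y j)"
proof -
  have "K (merge S ({1..d} - S) (\<lambda>j\<in>S. - y j, u)) = K (merge S ({1..d} - S) (\<lambda>j\<in>S. y j, u))" for u
  proof -
    have "K (\<lambda>j\<in>{1..d}. (if j \<in> S then -1 else 1) * merge S ({1..d} - S) (\<lambda>j\<in>S. y j, u) j) =
        K (merge S ({1..d} - S) (\<lambda>j\<in>S. y j, u))"
      by (rule K_reflect[OF merge_in_euclid[OF S]]) auto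
    moreover have "(\<lambda>j\<in>{1..d}. (if j \<in> S then -1 else 1) * merge S ({1..d} - S) (\<lambda>j\<in>S. y j, u) j) =
        merge S ({1..d} - S) (\<lambda>j\<in>S. - y j, u)"
      using S by (auto simp: fun_eq_iff merge_def)
    ultimately show ?thesis by simp
  qed
  then show ?thesis by (simp add: marginal_def)
qed

lemma marginal_meas [measurable]: "marginal d S K \<in> borel_measurable (leb S)"
proof -
  interpret sigma_finite_measure "leb ({1..d} - S)" by (rule leb.sigma_finite) simp
  note [measurable] = measurable_merge_split[OF S]
  show ?thesis unfolding marginal_def[abs_def]
    by (rule borel_measurable_lebesgue_integral) measurable
qed

lemma Kh_nonneg: "0 \<le> Kh d K S h u"
  unfolding Kh_def using marginal_nonneg h_pos by (intro divide_nonneg_pos) auto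

text \<open>As \<open>h < 1\<close>, the exponent \<open>card S\<close> may be raised to
  \<open>d\<close>, giving one bound for all \<open>S\<close>.\<close>

lemma Kh_le: "Kh d K S h u \<le> \<kappa> / h ^ d"
proof -
  have "h ^ d \<le> h ^ card S" using h_pos h_lt card_S_le by (intro power_decreasing) auto
  moreover have "marginal d S K (\<lambda>j\<in>S. u j / h) \<le> \<kappa>" by (rule marginal_le) simp
  ultimately show ?thesis unfolding Kh_def using h_pos \<kappa>_nonneg
    by (intro frac_le) auto
qed

lemma Kh_cong: "(\<And>j. j \<in> S ==> u j = v j) ==> Kh d K S h u = Kh d K S h v"
  unfolding Kh_def by (simp cong: restrict_cong)

lemma Kh_supp: assumes "Kh d K S h u \<noteq> 0" "j \<in> S" shows "\<bar>u j\<bar> \<le> h / 2"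
proof -
  have "marginal d S K (\<lambda>j\<in>S. u j / h) \<noteq> 0" using assms(1) unfolding Kh_def by (metis div_0)
  from marginal_supp[OF this assms(2)] have "\<bar>(\<lambda>j\<in>S. u j / h) j\<bar> \<le> 1/2" .
  then show ?thesis using h_pos assms by (simp add: field_simps)
qed

lemma k_sym: "k S x y = k S y x"
proof -
  have "(\<lambda>j\<in>S. (y j - x j) / h) = (\<lambda>j\<in>S. - ((x j - y j) / h))"
    by (simp add: fun_eq_iff minus_divide_left)
  then show ?thesis unfolding Kh_def using marginal_neg[of "\<lambda>j. (x j - y j) / h"] by simp
qed

lemma Kh_meas:
  assumes "\<And>j. j \<in> S ==> (\<lambda>p. g p j) \<in> borel_measurable N"
  shows "(\<lambda>p. Kh d K S h (g p)) \<in> borel_measurable N"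
proof -
  have [measurable]: "(\<lambda>p. \<lambda>j\<in>S. g p j / h) \<in> N \<rightarrow>\<^sub>M leb S"
    using assms by (intro measurable_restrict) simp
  show ?thesis unfolding Kh_def by measurable
qed

text \<open>The coordinates outside \<open>S\<close> contribute the volume 1 of a lower dimensional
  cube. Substituting \<open>x = y + h * u\<close> in the others removes \<open>h ^ card S\<close>,
  and unfolding the marginal kernel returns to \<open>K\<close> itself, where the support and the
  reflections of \<open>K\<close> can be used.\<close>

lemma mass_eq:
  "(\<integral>\<^sup>+x. ennreal (k S x y) * indicator (unit_cube d) x \<partial>leb {1..d}) =
   (\<integral>\<^sup>+u. ennreal (K u) * indicator {u. \<forall>j\<in>S. 0 \<le> y j + h * u j \<and> y j + h * u j \<le> 1} u \<partial>leb {1..d})"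
proof -
  let ?F = "\<lambda>x. ennreal (Kh d K S h (\<lambda>l. x l - y l)) * indicator (unit_cube d) x"
  let ?B = "{x. \<forall>j\<in>S. 0 \<le> x j \<and> x j \<le> 1} :: point set"
  let ?B' = "{u. \<forall>j\<in>S. 0 \<le> y j + h * u j \<and> y j + h * u j \<le> 1}"
  have B [measurable]: "(\<lambda>x. indicator ?B x :: ennreal) \<in> borel_measurable (leb S)"
    by (rule indicator_slab_meas[OF finite_S subset_refl]) measurable
  have [measurable]: "(\<lambda>x. Kh d K S h (\<lambda>l. x l - y l)) \<in> borel_measurable (leb S)"
    by (rule Kh_meas) measurable
  have [measurable]: "(\<lambda>x. Kh d K S h (\<lambda>l. x l - y l)) \<in> bor d"
    using S by (intro Kh_meas) (measurable, auto)
  have unit: "emeasure (leb ({1..d} - S)) (PiE ({1..d} - S) (\<lambda>_. {0..1::real})) = 1"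
    using emeasure_leb_box[of "{1..d} - S" "\<lambda>_. 0" "\<lambda>_. 1"] by simp
  have unit_sets: "PiE ({1..d} - S) (\<lambda>_. {0..1::real}) \<in> sets (leb ({1..d} - S))"
    by (intro sets_PiM_I_finite) auto
  have "(\<integral>\<^sup>+x. ennreal (k S x y) * indicator (unit_cube d) x \<partial>leb {1..d}) = (\<integral>\<^sup>+x. ?F x \<partial>leb {1..d})"
    by (simp add: k_sym[of _ y])
  also have "\<dots> = (\<integral>\<^sup>+x. \<integral>\<^sup>+u. ?F (merge S ({1..d} - S) (x, u)) \<partial>leb ({1..d} - S) \<partial>leb S)"
    by (rule leb_fold[OF S]) measurable
  also have "\<dots> = (\<integral>\<^sup>+x. \<integral>\<^sup>+u. ennreal (Kh d K S h (\<lambda>l. x l - y l)) * indicator ?B x *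
      indicator (PiE ({1..d} - S) (\<lambda>_. {0..1::real})) u \<partial>leb ({1..d} - S) \<partial>leb S)"
  proof (intro nn_integral_cong)
    fix x u :: point assume u: "u \<in> space (leb ({1..d} - S))"
    have "Kh d K S h (\<lambda>l. merge S ({1..d} - S) (x, u) l - y l) = Kh d K S h (\<lambda>l. x l - y l)"
      by (rule Kh_cong) (auto simp: merge_def)
    moreover have "indicator (unit_cube d) (merge S ({1..d} - S) (x, u)) =
        (indicator ?B x * indicator (PiE ({1..d} - S) (\<lambda>_. {0..1::real})) u :: ennreal)"
      using u by (auto simp: indicator_def merge_in_cube[OF S] PiE_def Pi_def)
    ultimately show "?F (merge S ({1..d} - S) (x, u)) = ennreal (Kh d K S h (\<lambda>l. x l - y l)) * indicator ?B x *
      indicator (PiE ({1..d} - S) (\<lambda>_. {0..1::real})) u" by (simp add: mult.assoc)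
  qed
  also have "\<dots> = (\<integral>\<^sup>+x. ennreal (Kh d K S h (\<lambda>l. x l - y l)) * indicator ?B x \<partial>leb S)"
    by (simp only: nn_integral_cmult_indicator[OF unit_sets] unit mult_1_right)
  also have "\<dots> = ennreal (\<Prod>j\<in>S. \<bar>h\<bar>) * (\<integral>\<^sup>+u. ennreal (Kh d K S h (\<lambda>l. (\<lambda>j\<in>S. y j + h * u j) l - y l)) *
      indicator ?B (\<lambda>j\<in>S. y j + h * u j) \<partial>leb S)"
  proof (rule nn_integral_leb_affine[OF finite_S])
    show "(\<lambda>x. ennreal (Kh d K S h (\<lambda>l. x l - y l)) * indicator ?B x) \<in> borel_measurable (leb S)"
      by measurable
  qed (use h_pos in simp)
  also have "\<dots> = (\<integral>\<^sup>+u. ennreal (h ^ card S) * (ennreal (Kh d K S h (\<lambda>l. (\<lambda>j\<in>S. y j + h * u j) l - y l)) *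
      indicator ?B (\<lambda>j\<in>S. y j + h * u j)) \<partial>leb S)"
  proof -
    have [measurable]: "(\<lambda>u. Kh d K S h (\<lambda>l. (\<lambda>j\<in>S. y j + h * u j) l - y l)) \<in> borel_measurable (leb S)"
      by (rule Kh_meas) (simp, measurable)
    have [measurable]: "(\<lambda>u. \<lambda>j\<in>S. y j + h * u j) \<in> leb S \<rightarrow>\<^sub>M leb S"
      by (rule measurable_restrict) measurable
    have "(\<lambda>u. ennreal (Kh d K S h (\<lambda>l. (\<lambda>j\<in>S. y j + h * u j) l - y l)) *
        indicator ?B (\<lambda>j\<in>S. y j + h * u j)) \<in> borel_measurable (leb S)"
      by (intro borel_measurable_times_ennreal measurable_compose[OF _ B]) measurable
    from nn_integral_cmult[OF this] show ?thesis using h_pos by simp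
  qed
  also have "\<dots> = (\<integral>\<^sup>+u. ennreal (marginal d S K u) * indicator ?B' u \<partial>leb S)"
  proof (rule nn_integral_cong)
    fix u assume u: "u \<in> space (leb S)"
    have "(\<lambda>j\<in>S. ((\<lambda>j\<in>S. y j + h * u j) j - y j) / h) = u"
      using u h_pos by (auto simp: fun_eq_iff PiE_def extensional_def)
    then have "Kh d K S h (\<lambda>l. (\<lambda>j\<in>S. y j + h * u j) l - y l) = marginal d S K u / h ^ card S"
      by (simp add: Kh_def)
    then have "ennreal (h ^ card S) * ennreal (Kh d K S h (\<lambda>l. (\<lambda>j\<in>S. y j + h * u j) l - y l)) =
        ennreal (marginal d S K u)"
      using h_pos marginal_nonneg[of u] by (simp flip: ennreal_mult)
    then show "ennreal (h ^ card S) * (ennreal (Kh d K S h (\<lambda>l. (\<lambda>j\<in>S. y j + h * u j) l - y l)) *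
      indicator ?B (\<lambda>j\<in>S. y j + h * u j)) = ennreal (marginal d S K u) * indicator ?B' u"
      by (simp add: indicator_def flip: mult.assoc)
  qed
  also have "\<dots> = (\<integral>\<^sup>+u. (\<integral>\<^sup>+w. ennreal (K (merge S ({1..d} - S) (u, w))) * indicator ?B' u \<partial>leb ({1..d} - S)) \<partial>leb S)"
    by (intro nn_integral_cong, subst nn_integral_multc) (auto simp: marginal_nn section_meas)
  also have "\<dots> = (\<integral>\<^sup>+u. (\<integral>\<^sup>+w. ennreal (K (merge S ({1..d} - S) (u, w))) *
      indicator ?B' (merge S ({1..d} - S) (u, w)) \<partial>leb ({1..d} - S)) \<partial>leb S)"
    by (intro nn_integral_cong arg_cong2[where f = "(*)"] refl) (simp add: indicator_def merge_def)
  also have "\<dots> = (\<integral>\<^sup>+u. ennreal (K u) * indicator ?B' u \<partial>leb {1..d})"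
  proof (rule leb_fold[OF S, symmetric])
    have [measurable]: "(\<lambda>x. indicator ?B' x :: ennreal) \<in> bor d"
      by (rule indicator_slab_meas[OF finite_S S]) measurable
    show "(\<lambda>u. ennreal (K u) * indicator ?B' u) \<in> bor d"
      by measurable
  qed
  finally show ?thesis .
qed

end

text \<open>The part of the kernel centred at \<open>y\<close> that stays inside the cube. All
  boundary effects of the smoothing enter through this quantity.\<close>

definition mass :: "nat set => point => ennreal" where
  "mass S y = (\<integral>\<^sup>+x. ennreal (k S x y) * indicator (unit_cube d) x \<partial>leb {1..d})"

lemma mass_le: assumes "S \<subseteq> {1..d}" shows "mass S y \<le> 1"
proof -
  have "mass S y \<le> (\<integral>\<^sup>+u. ennreal (K u) \<partial>leb {1..d})"
    unfolding mass_def mass_eq[OF assms] by (intro nn_integral_mono) (auto simp: indicator_def)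
  then show ?thesis using K_nn_integral by simp
qed

lemma mass_interior:
  assumes S: "S \<subseteq> {1..d}" and y: "\<And>j. j \<in> S ==> h / 2 \<le> y j \<and> y j \<le> 1 - h / 2"
  shows "mass S y = 1"
proof -
  have "mass S y = (\<integral>\<^sup>+u. ennreal (K u) \<partial>leb {1..d})"
    unfolding mass_def mass_eq[OF S]
  proof (intro nn_integral_cong)
    fix u assume u: "u \<in> space (leb {1..d})"
    show "ennreal (K u) * indicator {u. \<forall>j\<in>S. 0 \<le> y j + h * u j \<and> y j + h * u j \<le> 1} u = ennreal (K u)"
    proof (cases "K u = 0")
      case False
      have "0 \<le> y j + h * u j \<and> y j + h * u j \<le> 1" if "j \<in> S" for j
      proof -
        have "\<bar>u j\<bar> \<le> 1/2" using K_supp[OF _ False, of j] u S that by auto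
        then have "\<bar>h * u j\<bar> \<le> h / 2" using h_pos by (simp add: abs_mult)
        then show ?thesis using y[OF that] by (auto simp: abs_le_iff)
      qed
      then show ?thesis by (auto simp: indicator_def)
    qed auto
  qed
  then show ?thesis using K_nn_integral by simp
qed

text \<open>The reflections in the coordinate hyperplanes permute the \<open>2\<^sup>d\<close> orthants, so each of them
  carries the same share of the kernel.\<close>

lemma orthant_mass:
  assumes \<sigma>: "\<And>j. j \<in> {1..d} ==> \<sigma> j \<in> {-1, 1}"
  shows "ennreal (1 / 2 ^ d) \<le>
    (\<integral>\<^sup>+u. ennreal (K u) * indicator {u. \<forall>j\<in>{1..d}. 0 \<le> \<sigma> j * u j} u \<partial>leb {1..d})"
proof -
  let ?O = "\<lambda>\<tau>::nat => real. {u. \<forall>j\<in>{1..d}. 0 \<le> \<tau> j * u j} :: point set"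
  let ?I = "\<lambda>\<tau>. (\<integral>\<^sup>+u. ennreal (K u) * indicator (?O \<tau>) u \<partial>leb {1..d})"
  let ?\<Sigma> = "PiE {1..d} (\<lambda>_. {-1, 1::real})"
  have O_meas [measurable]: "(\<lambda>x. indicator (?O \<tau>) x :: ennreal) \<in> bor d" for \<tau>
  proof (rule indicator_slab_meas[where Q = "\<lambda>j w. 0 \<le> \<tau> j * w"])
    show "{w. 0 \<le> \<tau> j * w} \<in> sets borel" for j
      by (intro borel_closed closed_Collect_le continuous_intros)
  qed auto
  have reflect: "?I \<tau> = ?I (\<lambda>_. 1)" if \<tau>: "\<And>j. j \<in> {1..d} ==> \<tau> j \<in> {-1, 1}" for \<tau>
  proof -
    have "?I \<tau> = ennreal (\<Prod>j\<in>{1..d}. \<bar>\<tau> j\<bar>) *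
        (\<integral>\<^sup>+u. ennreal (K (\<lambda>j\<in>{1..d}. 0 + \<tau> j * u j)) * indicator (?O \<tau>) (\<lambda>j\<in>{1..d}. 0 + \<tau> j * u j) \<partial>leb {1..d})"
    proof (rule nn_integral_leb_affine)
      show "\<tau> j \<noteq> 0" if "j \<in> {1..d}" for j using \<tau>[OF that] by auto
    qed (simp, measurable)
    also have "(\<Prod>j\<in>{1..d}. \<bar>\<tau> j\<bar>) = 1"
    proof (intro prod.neutral ballI)
      show "\<bar>\<tau> j\<bar> = 1" if "j \<in> {1..d}" for j using \<tau>[OF that] by auto
    qed
    also have "(\<integral>\<^sup>+u. ennreal (K (\<lambda>j\<in>{1..d}. 0 + \<tau> j * u j)) * indicator (?O \<tau>) (\<lambda>j\<in>{1..d}. 0 + \<tau> j * u j) \<partial>leb {1..d})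
       = ?I (\<lambda>_. 1)"
    proof (intro nn_integral_cong)
      fix u assume u: "u \<in> space (leb {1..d})"
      have "K (\<lambda>j\<in>{1..d}. 0 + \<tau> j * u j) = K u" using K_reflect[OF _ \<tau>, of u] u by simp
      moreover have "\<tau> j * (0 + \<tau> j * u j) = u j" if "j \<in> {1..d}" for j using \<tau>[OF that] by auto
      then have "0 \<le> \<tau> j * (\<lambda>j\<in>{1..d}. 0 + \<tau> j * u j) j \<longleftrightarrow> 0 \<le> 1 * u j" if "j \<in> {1..d}" for j
        using that by (simp only: restrict_apply' mult_1_left)
      then have "(\<lambda>j\<in>{1..d}. 0 + \<tau> j * u j) \<in> ?O \<tau> \<longleftrightarrow> u \<in> ?O (\<lambda>_. 1)" by blast
      ultimately show "ennreal (K (\<lambda>j\<in>{1..d}. 0 + \<tau> j * u j)) * indicator (?O \<tau>) (\<lambda>j\<in>{1..d}. 0 + \<tau> j * u j) =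
         ennreal (K u) * indicator (?O (\<lambda>_. 1)) u" by (simp only: indicator_def)
    qed
    finally show ?thesis by simp
  qed
  have "1 = (\<integral>\<^sup>+u. ennreal (K u) \<partial>leb {1..d})" using K_nn_integral by simp
  also have "\<dots> \<le> (\<integral>\<^sup>+u. (\<Sum>\<tau>\<in>?\<Sigma>. ennreal (K u) * indicator (?O \<tau>) u) \<partial>leb {1..d})"
  proof (intro nn_integral_mono)
    fix u :: point
    let ?\<tau> = "\<lambda>j\<in>{1..d}. if 0 \<le> u j then 1 else - 1 :: real"
    have mem: "?\<tau> \<in> ?\<Sigma>" by (rule PiE_I) auto
    have "u \<in> ?O ?\<tau>" by auto
    have "ennreal (K u) * indicator (?O ?\<tau>) u \<le> (\<Sum>\<tau>\<in>?\<Sigma>. ennreal (K u) * indicator (?O \<tau>) u)"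
      by (rule member_le_sum[OF mem]) (auto intro!: finite_PiE)
    then show "ennreal (K u) \<le> (\<Sum>\<tau>\<in>?\<Sigma>. ennreal (K u) * indicator (?O \<tau>) u)"
      using \<open>u \<in> ?O ?\<tau>\<close> by (simp only: indicator_simps mult_1_right)
  qed
  also have "\<dots> = (\<Sum>\<tau>\<in>?\<Sigma>. ?I \<tau>)" by (rule nn_integral_sum) measurable
  also have "\<dots> = (\<Sum>\<tau>\<in>?\<Sigma>. ?I (\<lambda>_. 1))" by (intro sum.cong refl reflect) auto
  also have "\<dots> = ennreal (2 ^ d) * ?I (\<lambda>_. 1)"
    by (simp add: card_PiE numeral_2_eq_2[symmetric] ennreal_of_nat_eq_real_of_nat)
  finally have 1: "1 \<le> ennreal (2 ^ d) * ?I (\<lambda>_. 1)" .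
  have "ennreal (1 / 2 ^ d) = ennreal (1 / 2 ^ d) * 1" by simp
  also have "\<dots> \<le> ennreal (1 / 2 ^ d) * (ennreal (2 ^ d) * ?I (\<lambda>_. 1))" by (intro mult_left_mono 1) simp
  also have "\<dots> = ?I (\<lambda>_. 1)" by (simp add: mult.assoc[symmetric] flip: ennreal_mult)
  also have "\<dots> = ?I \<sigma>" using reflect[of \<sigma>] \<sigma> by simp
  finally show ?thesis .
qed

text \<open>In each coordinate the orthant pointing away from the nearer face is selected. A step
  \<open>h * u j\<close> has length at most 1/2, so moving in that direction cannot leave the cube,
  and the orthant carries at least the share \<open>1 / 2 ^ d\<close> of the kernel.\<close>

lemma mass_ge:
  assumes S: "S \<subseteq> {1..d}" and y: "y \<in> unit_cube d"
  shows "ennreal (1 / 2 ^ d) \<le> mass S y"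
proof -
  let ?\<sigma> = "\<lambda>j. if y j \<le> 1/2 then 1 else - 1 :: real"
  have "ennreal (1 / 2 ^ d) \<le> (\<integral>\<^sup>+u. ennreal (K u) * indicator {u. \<forall>j\<in>{1..d}. 0 \<le> ?\<sigma> j * u j} u \<partial>leb {1..d})"
    by (rule orthant_mass) auto
  also have "\<dots> \<le> mass S y" unfolding mass_def mass_eq[OF S]
  proof (intro nn_integral_mono)
    fix u assume u: "u \<in> space (leb {1..d})"
    show "ennreal (K u) * indicator {u. \<forall>j\<in>{1..d}. 0 \<le> ?\<sigma> j * u j} u \<le>
      ennreal (K u) * indicator {u. \<forall>j\<in>S. 0 \<le> y j + h * u j \<and> y j + h * u j \<le> 1} u"
    proof (cases "K u = 0 \<or> \<not> (\<forall>j\<in>{1..d}. 0 \<le> ?\<sigma> j * u j)")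
      case False
      have "0 \<le> y j + h * u j \<and> y j + h * u j \<le> 1" if "j \<in> S" for j
      proof -
        have j: "j \<in> {1..d}" using that S by auto
        have uj: "\<bar>u j\<bar> \<le> 1/2" using K_supp[of u j] u j False by auto
        have \<sigma>j: "0 \<le> ?\<sigma> j * u j" using False j by blast
        have yj: "0 \<le> y j" "y j \<le> 1" using y j by (auto simp: unit_cube_iff)
        show ?thesis
        proof (cases "y j \<le> 1/2")
          case True
          then have "0 \<le> u j" using \<sigma>j by simp
          moreover from this have "h * u j \<le> 1 * (1/2)" using uj h_pos h_lt by (intro mult_mono) auto
          ultimately show ?thesis using True yj h_pos by auto
        next
          case F: False
          then have u0: "0 \<le> - u j" using \<sigma>j by simp
          then have "h * (- u j) \<le> 1 * (1/2)" using uj h_pos h_lt by (intro mult_mono) auto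
          moreover have "0 \<le> h * (- u j)" using u0 h_pos by (intro mult_nonneg_nonneg) auto
          ultimately show ?thesis using F yj by auto
        qed
      qed
      then show ?thesis by (auto simp: indicator_def)
    qed (auto simp: indicator_def)
  qed
  finally show ?thesis .
qed

end

section \<open>Densities and conditional expectations\<close>

text \<open>A version of the conditional expectation of \<open>g\<close> given the coordinates in
  \<open>S\<close>, defined at every point; where the marginal density vanishes, division by zero
  gives 0.\<close>

definition cex :: "nat => (point => real) => nat set => (point => real) => point => real" where
  "cex d f S g x = marginal d S (\<lambda>z. g z * f z) (restrict x S) / marginal d S f (restrict x S)"

lemma sets_law [simp, measurable_cong]: "sets (law d f) = sets (leb {1..d})"
  and space_law [simp]: "space (law d f) = euclid d"
  by (simp_all add: law_def)

lemma section_measurable: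
  assumes "S \<subseteq> {1..d}" "F \<in> bor d" "y \<in> space (leb S)"
  shows "(\<lambda>u. F (merge S ({1..d} - S) (y, u))) \<in> borel_measurable (leb ({1..d} - S))"
proof -
  have "(\<lambda>u. merge S ({1..d} - S) (y, u)) \<in> leb ({1..d} - S) \<rightarrow>\<^sub>M leb {1..d}"
    by (rule measurable_compose[OF measurable_Pair1'[OF assms(3)] measurable_merge_split[OF assms(1)]])
  from measurable_compose[OF this assms(2)] show ?thesis .
qed

lemma marginal_measurable:
  assumes "S \<subseteq> {1..d}" "F \<in> bor d"
  shows "marginal d S F \<in> borel_measurable (leb S)"
proof -
  interpret sigma_finite_measure "leb ({1..d} - S)" by (rule leb.sigma_finite) simp
  have "(\<lambda>p. F (merge S ({1..d} - S) p)) \<in> borel_measurable (leb S \<Otimes>\<^sub>M leb ({1..d} - S))"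
    by (rule measurable_compose[OF measurable_merge_split[OF assms(1)] assms(2)])
  then show ?thesis unfolding marginal_def[abs_def]
    by (intro borel_measurable_lebesgue_integral) (simp add: case_prod_unfold)
qed

lemma restrict_measurable_leb: "S \<subseteq> {1..d} ==> (\<lambda>x. restrict x S) \<in> leb {1..d} \<rightarrow>\<^sub>M leb S"
  by (intro measurable_restrict) (auto intro!: measurable_leb_component)

lemma restrict_merge_left: "y \<in> space (leb S) ==> restrict (merge S T (y, u)) S = y"
  by (auto simp: fun_eq_iff merge_def PiE_def extensional_def)

lemma section_integrable_cube:
  assumes S: "S \<subseteq> {1..d}" and F: "F \<in> bor d"
    and B: "\<And>x. x \<in> unit_cube d ==> \<bar>F x\<bar> \<le> B" and out: "\<And>x. x \<in> euclid d - unit_cube d ==> F x = (0::real)"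
    and y: "y \<in> space (leb S)"
  shows "integrable (leb ({1..d} - S)) (\<lambda>u. F (merge S ({1..d} - S) (y, u)))"
    and "\<bar>marginal d S F y\<bar> \<le> B"
proof -
  let ?B = "PiE ({1..d} - S) (\<lambda>_. {0..1::real})"
  have em: "emeasure (leb ({1..d} - S)) ?B = 1"
    using emeasure_leb_box[of "{1..d} - S" "\<lambda>_. 0" "\<lambda>_. 1"] by simp
  have sets: "?B \<in> sets (leb ({1..d} - S))" by (intro sets_PiM_I_finite) auto
  have int: "integrable (leb ({1..d} - S)) (\<lambda>u. \<bar>B\<bar> * indicator ?B u :: real)"
    using em sets by (intro integrable_mult_right integrable_real_indicator) auto
  have le: "\<bar>F (merge S ({1..d} - S) (y, u))\<bar> \<le> \<bar>B\<bar> * indicator ?B u" if "u \<in> space (leb ({1..d} - S))" for u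
  proof (cases "merge S ({1..d} - S) (y, u) \<in> unit_cube d")
    case True
    then have "u \<in> ?B" using that merge_in_cube[OF S] by (auto simp: PiE_def Pi_def)
    then show ?thesis using B[OF True] by simp
  next
    case False
    then have "F (merge S ({1..d} - S) (y, u)) = 0" using out merge_in_euclid[OF S] by blast
    then show ?thesis by simp
  qed
  show i: "integrable (leb ({1..d} - S)) (\<lambda>u. F (merge S ({1..d} - S) (y, u)))"
    using le by (intro Bochner_Integration.integrable_bound[OF int section_measurable[OF S F y]])
      (auto intro!: AE_I2)
  have B0: "0 \<le> B"
    using B[of "\<lambda>j\<in>{1..d}. 0"] by (force simp: unit_cube_iff)
  have "\<bar>marginal d S F y\<bar> \<le> (\<integral>u. \<bar>F (merge S ({1..d} - S) (y, u))\<bar> \<partial>leb ({1..d} - S))"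
    unfolding marginal_def by (rule integral_abs_bound)
  also have "\<dots> \<le> (\<integral>u. \<bar>B\<bar> * indicator ?B u \<partial>leb ({1..d} - S))"
    using i int le by (intro integral_mono) auto
  also have "\<dots> = B"
  proof -
    have "?B \<inter> (({1..d} - S) \<rightarrow>\<^sub>E UNIV) = ?B" by auto
  then show "(\<integral>u. \<bar>B\<bar> * indicator ?B u \<partial>leb ({1..d} - S)) = B" using em sets B0 by (simp add: measure_def)
  qed
  finally show "\<bar>marginal d S F y\<bar> \<le> B" .
qed

definition dep_on :: "nat => nat set => (point => real) => bool" where
  "dep_on d S \<phi> \<longleftrightarrow> (\<forall>x\<in>euclid d. \<forall>x'\<in>euclid d. restrict x S = restrict x' S \<longrightarrow> \<phi> x = \<phi> x')"

lemma dep_onD: "dep_on d S \<phi> ==> x \<in> euclid d ==> x' \<in> euclid d ==> (\<And>j. j \<in> S ==> x j = x' j) ==> \<phi> x = \<phi> x'"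
  unfolding dep_on_def by (metis restrict_ext)

lemma dep_onI: "(\<And>x x'. x \<in> euclid d ==> x' \<in> euclid d ==> (\<And>j. j \<in> S ==> x j = x' j) ==> \<phi> x = \<phi> x') ==> dep_on d S \<phi>"
  unfolding dep_on_def by (metis restrict_apply')

lemma cex_dep_on: "dep_on d S (cex d f S g)"
  by (simp add: dep_on_def cex_def)

section \<open>Densities between two positive constants on the cube\<close>

locale dens =
  fixes d :: nat and f :: "point => real" and c0 C0 :: real
  assumes density: "density_on_cube d f"
    and f_ge: "\<And>x. x \<in> unit_cube d ==> c0 \<le> f x" and f_le: "\<And>x. x \<in> unit_cube d ==> f x \<le> C0"
    and c0_pos: "0 < c0"
begin

abbreviation \<mu> :: "point measure" where "\<mu> \<equiv> law d f"

lemma f_meas [measurable]: "f \<in> bor d"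
  and f_nonneg: "x \<in> euclid d ==> 0 \<le> f x"
  and f_out: "x \<in> euclid d - unit_cube d ==> f x = 0"
  and f_integral: "(\<integral>x. f x \<partial>leb {1..d}) = 1"
  using density by (auto simp: density_on_cube_def)

lemma C0_pos: "0 < C0"
  using f_ge[of "\<lambda>j\<in>{1..d}. 0"] f_le[of "\<lambda>j\<in>{1..d}. 0"] c0_pos by (force simp: unit_cube_iff)

lemma f_le_all: "x \<in> euclid d ==> f x \<le> C0 * indicator (unit_cube d) x"
  using f_le f_out[of x] by (cases "x \<in> unit_cube d") auto

lemma f_ge_all: "x \<in> euclid d ==> c0 * indicator (unit_cube d) x \<le> f x"
  using f_ge f_out[of x] by (cases "x \<in> unit_cube d") auto

sublocale prob_space \<mu>
proof
  have "integrable (leb {1..d}) f" using f_integral not_integrable_integral_eq[of "leb {1..d}" f] by auto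
  then have "(\<integral>\<^sup>+x. ennreal (f x) \<partial>leb {1..d}) = 1" using f_integral f_nonneg
    by (subst nn_integral_eq_integral) (auto intro!: AE_I2)
  then show "emeasure \<mu> (space \<mu>) = 1"
  proof -
    assume 1: "(\<integral>\<^sup>+x. ennreal (f x) \<partial>leb {1..d}) = 1"
    have "emeasure \<mu> (space \<mu>) = (\<integral>\<^sup>+x. ennreal (f x) * indicator (space (leb {1..d})) x \<partial>leb {1..d})"
      unfolding law_def space_density by (intro emeasure_density sets.top) measurable
    also have "\<dots> = (\<integral>\<^sup>+x. ennreal (f x) \<partial>leb {1..d})"
      by (intro nn_integral_cong) (simp add: indicator_def)
    finally show ?thesis using 1 by simp
  qed
qed

lemma prob_euclid [simp]: "prob (euclid d) = 1"
  using prob_space by simp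

lemma nn_integral_law:
  "g \<in> bor d ==> (\<integral>\<^sup>+x. g x \<partial>\<mu>) = (\<integral>\<^sup>+x. ennreal (f x) * g x \<partial>leb {1..d})"
  unfolding law_def by (rule nn_integral_density) auto

lemma integral_law:
  "g \<in> bor d ==> (\<integral>x. g x \<partial>\<mu>) = (\<integral>x. f x * g x \<partial>leb {1..d})"
  for g :: "point => real"
  unfolding law_def using f_nonneg by (subst integral_density) (auto intro!: AE_I2)

lemma integrable_law:
  "g \<in> bor d ==> integrable \<mu> g \<longleftrightarrow> integrable (leb {1..d}) (\<lambda>x. f x * g x)"
  for g :: "point => real"
  unfolding law_def using f_nonneg by (subst integrable_density) (auto intro!: AE_I2)

lemma AE_cube: "AE x in \<mu>. x \<in> unit_cube d"
proof -
  have "AE x in leb {1..d}. 0 < ennreal (f x) \<longrightarrow> x \<in> unit_cube d"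
    using f_out by (intro AE_I2) force
  then show ?thesis unfolding law_def by (subst AE_density) auto
qed

lemma integrable_bdd:
  fixes g :: "point => real"
  assumes "g \<in> bor d" "\<And>x. x \<in> unit_cube d ==> \<bar>g x\<bar> \<le> A"
  shows "integrable \<mu> g"
  using assms AE_cube by (intro integrable_const_bound[of _ A]) auto

lemma integral_abs_le:
  fixes g :: "point => real"
  assumes "\<And>x. x \<in> unit_cube d ==> \<bar>g x\<bar> \<le> A" "g \<in> bor d"
  shows "\<bar>\<integral>x. g x \<partial>\<mu>\<bar> \<le> A"
proof -
  have "\<bar>\<integral>x. g x \<partial>\<mu>\<bar> \<le> (\<integral>x. \<bar>g x\<bar> \<partial>\<mu>)" by (rule integral_abs_bound)
  also have "\<dots> \<le> (\<integral>x. A \<partial>\<mu>)"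
    using assms AE_cube by (intro integral_mono_AE integrable_abs integrable_bdd[of g A]) auto
  finally show ?thesis using prob_space by simp
qed

context
  fixes S assumes S: "S \<subseteq> {1..d}"
begin

lemma marginal_f_le: "y \<in> space (leb S) ==> marginal d S f y \<le> C0"
  using section_integrable_cube(2)[OF S f_meas _ f_out, of C0 y] f_le f_ge c0_pos by force

lemma section_f_integrable:
  "y \<in> space (leb S) ==> integrable (leb ({1..d} - S)) (\<lambda>u. f (merge S ({1..d} - S) (y, u)))"
  using f_le f_ge c0_pos by (intro section_integrable_cube(1)[OF S f_meas _ f_out, of C0]) force+

lemma marginal_f_nonneg: "0 \<le> marginal d S f y"
  unfolding marginal_def using f_nonneg[OF merge_in_euclid[OF S]]
  by (intro Bochner_Integration.integral_nonneg) auto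

text \<open>The section of the cube over \<open>y\<close> has volume 1, so the lower bound
  \<open>c0\<close> survives integration.\<close>

lemma marginal_f_ge:
  assumes y: "y \<in> space (leb S)" "\<And>j. j \<in> S ==> 0 \<le> y j \<and> y j \<le> 1"
  shows "c0 \<le> marginal d S f y"
proof -
  let ?B = "PiE ({1..d} - S) (\<lambda>_. {0..1::real})"
  have em: "emeasure (leb ({1..d} - S)) ?B = 1"
    using emeasure_leb_box[of "{1..d} - S" "\<lambda>_. 0" "\<lambda>_. 1"] by simp
  have sets: "?B \<in> sets (leb ({1..d} - S))" by (intro sets_PiM_I_finite) auto
  have int: "integrable (leb ({1..d} - S)) (\<lambda>u. c0 * indicator ?B u :: real)"
    using em sets by (intro integrable_mult_right integrable_real_indicator) auto
  have "?B \<inter> (({1..d} - S) \<rightarrow>\<^sub>E UNIV) = ?B" by auto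
  then have "c0 = (\<integral>u. c0 * indicator ?B u \<partial>leb ({1..d} - S))"
    using em sets by (simp add: measure_def)
  also have "\<dots> \<le> marginal d S f y" unfolding marginal_def
  proof (intro integral_mono int section_f_integrable y(1))
    fix u assume u: "u \<in> space (leb ({1..d} - S))"
    show "c0 * indicator ?B u \<le> f (merge S ({1..d} - S) (y, u))"
    proof (cases "u \<in> ?B")
      case True
      then have "merge S ({1..d} - S) (y, u) \<in> unit_cube d"
        using y(2) by (auto simp: merge_in_cube[OF S] PiE_def Pi_def)
      from f_ge[OF this] True show ?thesis by simp
    qed (use f_nonneg[OF merge_in_euclid[OF S]] in simp)
  qed
  finally show ?thesis .
qed

lemma marginal_gf:
  assumes g: "g \<in> bor d" "\<And>x. x \<in> unit_cube d ==> \<bar>g x\<bar> \<le> A"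
    and y: "y \<in> space (leb S)"
  shows "integrable (leb ({1..d} - S)) (\<lambda>u. g (merge S ({1..d} - S) (y, u)) * f (merge S ({1..d} - S) (y, u)))"
    and "\<bar>marginal d S (\<lambda>z. g z * f z) y\<bar> \<le> A * marginal d S f y"
proof -
  have bd: "\<bar>g x * f x\<bar> \<le> A * f x" if "x \<in> euclid d" for x
    using g(2)[of x] f_nonneg[OF that] f_out[of x] that
    by (cases "x \<in> unit_cube d") (auto simp: abs_mult intro: mult_right_mono)
  have A: "0 \<le> A" using g(2)[of "\<lambda>j\<in>{1..d}. 0"] by (force simp: unit_cube_iff)
  show i: "integrable (leb ({1..d} - S)) (\<lambda>u. g (merge S ({1..d} - S) (y, u)) * f (merge S ({1..d} - S) (y, u)))"
  proof (rule section_integrable_cube(1)[OF S _ _ _ y, of "\<lambda>z. g z * f z" "A * C0"])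
    fix x assume x: "x \<in> unit_cube d"
    then have "x \<in> euclid d" using unit_cube_subset by auto
    from bd[OF this] f_le[OF x] A show "\<bar>g x * f x\<bar> \<le> A * C0" by (meson mult_left_mono order_trans)
  qed (use g f_out in auto)
  have "\<bar>marginal d S (\<lambda>z. g z * f z) y\<bar> \<le>
      (\<integral>u. \<bar>g (merge S ({1..d} - S) (y, u)) * f (merge S ({1..d} - S) (y, u))\<bar> \<partial>leb ({1..d} - S))"
    unfolding marginal_def by (rule integral_abs_bound)
  also have "\<dots> \<le> (\<integral>u. A * f (merge S ({1..d} - S) (y, u)) \<partial>leb ({1..d} - S))"
    using i section_f_integrable[OF y] bd[OF merge_in_euclid[OF S]]
    by (intro integral_mono integrable_abs integrable_mult_right) auto
  also have "\<dots> = A * marginal d S f y" by (simp add: marginal_def)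
  finally show "\<bar>marginal d S (\<lambda>z. g z * f z) y\<bar> \<le> A * marginal d S f y" .
qed

lemma cex_measurable:
  assumes [measurable]: "g \<in> bor d"
  shows "cex d f S g \<in> bor d"
proof -
  note [measurable] = restrict_measurable_leb[OF S] marginal_measurable[OF S]
  show ?thesis unfolding cex_def[abs_def] by measurable
qed

lemma cex_le:
  assumes g: "g \<in> bor d" "\<And>x. x \<in> unit_cube d ==> \<bar>g x\<bar> \<le> A"
  shows "\<bar>cex d f S g x\<bar> \<le> A"
proof -
  have A: "0 \<le> A" using g(2)[of "\<lambda>j\<in>{1..d}. 0"] by (force simp: unit_cube_iff)
  have "\<bar>marginal d S (\<lambda>z. g z * f z) (restrict x S)\<bar> \<le> A * marginal d S f (restrict x S)"
    using g by (intro marginal_gf) auto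
  then show ?thesis using marginal_f_nonneg[of "restrict x S"] A
    by (cases "marginal d S f (restrict x S) = 0") (auto simp: cex_def abs_divide field_simps)
qed

text \<open>By Fubini both sides become integrals over the coordinates in \<open>S\<close> of
  \<open>\<phi>\<close> times a marginal (this is \<open>gen\<close>), and the denominator of
  \<open>cex\<close> cancels against the marginal density.\<close>

lemma cex_proj:
  assumes \<phi>: "\<phi> \<in> bor d" "dep_on d S \<phi>" "integrable \<mu> \<phi>"
    and g: "g \<in> bor d" "\<And>x. x \<in> unit_cube d ==> \<bar>g x\<bar> \<le> A"
  shows "(\<integral>x. \<phi> x * g x \<partial>\<mu>) = (\<integral>x. \<phi> x * cex d f S g x \<partial>\<mu>)"
proof -
  note [measurable] = \<phi>(1) g(1) cex_measurable[OF g(1)]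
  let ?m = "\<lambda>y u. merge S ({1..d} - S) (y, u)"
  let ?p = "\<lambda>y. \<phi> (?m y (\<lambda>_. 0))"
  have \<phi>m: "\<phi> (?m y u) = ?p y" for y u
    by (rule dep_onD[OF \<phi>(2) merge_in_euclid[OF S] merge_in_euclid[OF S]]) (simp add: merge_def)
  have gen: "(\<integral>x. \<phi> x * G x \<partial>\<mu>) = (\<integral>y. ?p y * marginal d S (\<lambda>z. G z * f z) y \<partial>leb S)"
    if [measurable]: "G \<in> bor d" and G: "\<And>x. x \<in> unit_cube d ==> \<bar>G x\<bar> \<le> A" for G
  proof -
    have "integrable \<mu> (\<lambda>x. A * \<phi> x)" using \<phi>(3) by simp
    then have int: "integrable \<mu> (\<lambda>x. \<phi> x * G x)"
    proof (rule Bochner_Integration.integrable_bound)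
      show "AE x in \<mu>. norm (\<phi> x * G x) \<le> norm (A * \<phi> x)"
        using AE_cube
      proof eventually_elim
        case (elim x)
        then have "\<bar>G x\<bar> \<le> \<bar>A\<bar>" using G[OF elim] by auto
        then show ?case by (simp add: abs_mult mult.commute mult_right_mono)
      qed
    qed measurable
    have "(\<integral>x. \<phi> x * G x \<partial>\<mu>) = (\<integral>x. f x * (\<phi> x * G x) \<partial>leb {1..d})"
      by (rule integral_law) measurable
    also have "\<dots> = (\<integral>y. \<integral>u. f (?m y u) * (\<phi> (?m y u) * G (?m y u)) \<partial>leb ({1..d} - S) \<partial>leb S)"
      using int integrable_law[of "\<lambda>x. \<phi> x * G x"] by (intro leb_fold_lebesgue[OF S]) simp
    also have "\<dots> = (\<integral>y. \<integral>u. ?p y * (G (?m y u) * f (?m y u)) \<partial>leb ({1..d} - S) \<partial>leb S)"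
    proof (intro Bochner_Integration.integral_cong refl)
      show "f (?m y u) * (\<phi> (?m y u) * G (?m y u)) = ?p y * (G (?m y u) * f (?m y u))" for y u
        unfolding \<phi>m[of y u] by (simp only: mult_ac)
    qed
    also have "\<dots> = (\<integral>y. ?p y * marginal d S (\<lambda>z. G z * f z) y \<partial>leb S)"
      by (simp add: marginal_def)
    finally show ?thesis .
  qed
  have "(\<integral>x. \<phi> x * cex d f S g x \<partial>\<mu>) = (\<integral>y. ?p y * marginal d S (\<lambda>z. cex d f S g z * f z) y \<partial>leb S)"
    using cex_le[OF g] by (intro gen) auto
  also have "\<dots> = (\<integral>y. ?p y * marginal d S (\<lambda>z. g z * f z) y \<partial>leb S)"
  proof (intro Bochner_Integration.integral_cong refl arg_cong2[where f = "(*)"])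
    fix y assume y: "y \<in> space (leb S)"
    have "cex d f S g (?m y u) = marginal d S (\<lambda>z. g z * f z) y / marginal d S f y" for u
      unfolding cex_def restrict_merge_left[OF y] ..
    then have "marginal d S (\<lambda>z. cex d f S g z * f z) y =
        marginal d S (\<lambda>z. g z * f z) y / marginal d S f y * marginal d S f y"
      by (simp add: marginal_def)
    \<comment> \<open>If the marginal density is 0, the bound in \<open>marginal_gf\<close> forces
      the numerator to be 0 as well, so the convention for division does no harm.\<close>
    also have "\<dots> = marginal d S (\<lambda>z. g z * f z) y"
      using marginal_gf(2)[OF g y] by (cases "marginal d S f y = 0") auto
    finally show "marginal d S (\<lambda>z. cex d f S g z * f z) y = marginal d S (\<lambda>z. g z * f z) y" .
  qed
  finally show ?thesis using gen[OF g(1) g(2)] by simp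
qed

text \<open>Replaces the joint density by the marginal one inside an integral over the whole cube:
  the free coordinates contribute the factor 1. The kernel integrals can then be compared with the
  Lebesgue quantity \<open>mass\<close>.\<close>

lemma integral_via_marginal:
  assumes \<phi>: "\<phi> \<in> bor d" "dep_on d S \<phi>" "\<And>x. x \<in> unit_cube d ==> \<bar>\<phi> x\<bar> \<le> B"
  shows "(\<integral>x. \<phi> x \<partial>\<mu>) = (\<integral>x. indicator (unit_cube d) x * (\<phi> x * marginal d S f (restrict x S)) \<partial>leb {1..d})"
    and "integrable (leb {1..d}) (\<lambda>x. indicator (unit_cube d) x * (\<phi> x * marginal d S f (restrict x S)))"
proof -
  note [measurable] = \<phi>(1) restrict_measurable_leb[OF S] marginal_measurable[OF S f_meas]
  let ?m = "\<lambda>y u. merge S ({1..d} - S) (y, u)"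
  let ?p = "\<lambda>y. \<phi> (?m y (\<lambda>_. 0))"
  let ?R = "\<lambda>x. indicator (unit_cube d) x * (\<phi> x * marginal d S f (restrict x S))"
  let ?B = "PiE ({1..d} - S) (\<lambda>_. {0..1::real})"
  have em: "measure (leb ({1..d} - S)) ?B = 1"
    using emeasure_leb_box[of "{1..d} - S" "\<lambda>_. 0" "\<lambda>_. 1"] by (simp add: measure_def)
  have sets: "?B \<in> sets (leb ({1..d} - S))" by (intro sets_PiM_I_finite) auto
  have Bi: "?B \<inter> (({1..d} - S) \<rightarrow>\<^sub>E UNIV) = ?B" by auto
  have \<phi>m: "\<phi> (?m y u) = ?p y" for y u
    by (rule dep_onD[OF \<phi>(2) merge_in_euclid[OF S] merge_in_euclid[OF S]]) (simp add: merge_def)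
  have "B \<ge> 0" using \<phi>(3)[of "\<lambda>j\<in>{1..d}. 0"] by (force simp: unit_cube_iff)
  have emc: "emeasure (leb {1..d}) (unit_cube d) = 1"
    using emeasure_leb_box[of "{1..d}" "\<lambda>_. 0" "\<lambda>_. 1"] by (simp add: unit_cube_def)
  have "integrable (leb {1..d}) (\<lambda>x. B * C0 * indicator (unit_cube d) x :: real)"
    using emc by (intro integrable_mult_right integrable_real_indicator) auto
  then show int: "integrable (leb {1..d}) ?R"
  proof (rule Bochner_Integration.integrable_bound)
    show "AE x in leb {1..d}. norm (?R x) \<le> norm (B * C0 * indicator (unit_cube d) x :: real)"
      using \<phi>(3) marginal_f_le marginal_f_nonneg \<open>B \<ge> 0\<close> C0_pos
      by (intro AE_I2) (auto simp: indicator_def abs_mult intro!: mult_mono)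
  qed measurable
  have "(\<integral>x. \<phi> x \<partial>\<mu>) = (\<integral>x. f x * \<phi> x \<partial>leb {1..d})" by (rule integral_law) measurable
  also have "\<dots> = (\<integral>y. \<integral>u. f (?m y u) * \<phi> (?m y u) \<partial>leb ({1..d} - S) \<partial>leb S)"
    using integrable_bdd[of \<phi> B] \<phi>(1,3) integrable_law[OF \<phi>(1)] by (intro leb_fold_lebesgue[OF S]) blast
  also have "\<dots> = (\<integral>y. \<integral>u. ?R (?m y u) \<partial>leb ({1..d} - S) \<partial>leb S)"
  proof (rule Bochner_Integration.integral_cong[OF refl])
    fix y assume y: "y \<in> space (leb S)"
    show "(\<integral>u. f (?m y u) * \<phi> (?m y u) \<partial>leb ({1..d} - S)) = (\<integral>u. ?R (?m y u) \<partial>leb ({1..d} - S))"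
    proof (cases "\<forall>j\<in>S. 0 \<le> y j \<and> y j \<le> 1")
      case True
      have "(\<integral>u. ?R (?m y u) \<partial>leb ({1..d} - S)) =
          (\<integral>u. indicator ?B u * (?p y * marginal d S f y) \<partial>leb ({1..d} - S))"
      proof (intro Bochner_Integration.integral_cong refl)
        fix u assume u: "u \<in> space (leb ({1..d} - S))"
        have "(?m y u \<in> unit_cube d) = (u \<in> ?B)"
          using u True by (auto simp: merge_in_cube[OF S] PiE_def Pi_def)
        then show "?R (?m y u) = indicator ?B u * (?p y * marginal d S f y)"
          unfolding \<phi>m[of y u] restrict_merge_left[OF y] by (simp only: indicator_def)
      qed
      also have "\<dots> = ?p y * marginal d S f y"
        using em sets by (simp add: Bi)
      also have "\<dots> = (\<integral>u. f (?m y u) * ?p y \<partial>leb ({1..d} - S))"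
        by (simp add: marginal_def mult.commute)
      also have "\<dots> = (\<integral>u. f (?m y u) * \<phi> (?m y u) \<partial>leb ({1..d} - S))"
      proof (rule Bochner_Integration.integral_cong[OF refl])
        show "f (?m y u) * ?p y = f (?m y u) * \<phi> (?m y u)" for u unfolding \<phi>m[of y u] ..
      qed
      finally show ?thesis ..
    next
      case False
      then have "?m y u \<notin> unit_cube d" for u using merge_in_cube[OF S] by blast
      then show ?thesis using f_out merge_in_euclid[OF S] by simp
    qed
  qed
  also have "\<dots> = (\<integral>x. ?R x \<partial>leb {1..d})" by (rule leb_fold_lebesgue[OF S int, symmetric])
  finally show "(\<integral>x. \<phi> x \<partial>\<mu>) = (\<integral>x. ?R x \<partial>leb {1..d})" .
qed

end

end

text \<open>A Hoelder modulus with the radius as a variable of its own, which avoids the maximum in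
  \<open>sup_norm\<close>. The restriction \<open>r \<le> 1\<close> allows larger exponents to be
  lowered to a common one.\<close>

definition osc :: "nat => real => real => (point => real) => bool" where
  "osc d \<beta> A g \<longleftrightarrow> (\<forall>x\<in>unit_cube d. \<forall>x'\<in>unit_cube d. \<forall>r. 0 \<le> r \<longrightarrow> r \<le> 1 \<longrightarrow>
     (\<forall>j\<in>{1..d}. \<bar>x j - x' j\<bar> \<le> r) \<longrightarrow> \<bar>g x - g x'\<bar> \<le> A * r powr \<beta>)"

section \<open>Population versions of the density estimator and of the kernel operators\<close>

locale tilde = kern d K \<kappa> h + dens d f c0 C0
  for d K \<kappa> h f c0 C0
begin

text \<open>A lower bound for the smoothed density on the cube: \<open>c0\<close> times the lower
  bound \<open>1 / 2 ^ d\<close> for \<open>mass\<close>.\<close>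

definition c1 :: real where "c1 = c0 / 2 ^ d"

text \<open>The expectation of the density estimate \<open>f_hat\<close> at
  \<open>x\<close>.\<close>

definition ft :: "nat set => point => real" where
  "ft S x = (\<integral>y. k S x y \<partial>\<mu>)"

text \<open>Truncation from below changes nothing on the cube and keeps the kernels bounded everywhere.\<close>

definition fb :: "nat set => point => real" where
  "fb S x = max c1 (ft S x)"

definition Tt :: "nat set => (point => real) => point => real" where
  "Tt S g y = (\<integral>x. g x * (k S x y / fb S x - 1) \<partial>\<mu>)"

lemma c1_pos: "0 < c1" using c0_pos by (simp add: c1_def)

lemma fb_pos: "0 < fb S x" and fb_ge: "c1 \<le> fb S x"
  using c1_pos by (auto simp: fb_def)

context
  fixes S assumes S: "S \<subseteq> {1..d}"
begin

lemma k_joint [measurable]: "(\<lambda>p. k S (fst p) (snd p)) \<in> bor2 d"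
proof (rule Kh_meas[OF S])
  fix j assume "j \<in> S"
  then have [measurable]: "(\<lambda>x. x j) \<in> bor d"
    using S by (intro measurable_leb_component) auto
  show "(\<lambda>p. snd p j - fst p j) \<in> bor2 d"
    by measurable
qed

lemma k_meas [measurable]: "(\<lambda>y. k S x y) \<in> bor d"
  and k_meas' [measurable]: "(\<lambda>y. k S y x) \<in> bor d"
proof -
  have [measurable]: "(\<lambda>x. x j) \<in> bor d" if "j \<in> S" for j
    using S that by (intro measurable_leb_component) auto
  show "(\<lambda>y. k S x y) \<in> bor d"
    by (rule Kh_meas[OF S]) simp
  show "(\<lambda>y. k S y x) \<in> bor d"
    by (rule Kh_meas[OF S]) simp
qed

lemma k_nonneg: "0 \<le> k S x y" by (rule Kh_nonneg[OF S])

lemma k_le: "k S x y \<le> \<kappa> / h ^ d" by (rule Kh_le[OF S])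

lemma k_integrable: "integrable \<mu> (\<lambda>y. k S x y)" "integrable \<mu> (\<lambda>y. k S y x)"
  using k_nonneg k_le by (auto intro!: integrable_const_bound[of _ "\<kappa> / h ^ d"])

lemma k_cong: "(\<And>j. j \<in> S ==> x j = x' j) ==> (\<And>j. j \<in> S ==> y j = y' j) ==> k S x y = k S x' y'"
  by (rule Kh_cong[OF S]) auto

lemma ft_nn: "ennreal (ft S x) = (\<integral>\<^sup>+y. ennreal (f y) * ennreal (k S x y) \<partial>leb {1..d})"
proof -
  have "ennreal (ft S x) = (\<integral>\<^sup>+y. ennreal (k S x y) \<partial>\<mu>)"
    unfolding ft_def using k_integrable k_nonneg by (intro nn_integral_eq_integral[symmetric]) auto
  also have "\<dots> = (\<integral>\<^sup>+y. ennreal (f y) * ennreal (k S x y) \<partial>leb {1..d})"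
    by (rule nn_integral_law) measurable
  finally show ?thesis .
qed

lemma ft_nonneg: "0 \<le> ft S x"
  unfolding ft_def using k_nonneg by (intro Bochner_Integration.integral_nonneg) auto

lemma mass_alt: "mass S x = (\<integral>\<^sup>+y. ennreal (k S x y) * indicator (unit_cube d) y \<partial>leb {1..d})"
  unfolding mass_def by (simp add: k_sym[OF S, of _ x])

lemma ft_le: "ft S x \<le> C0"
proof -
  have "ennreal (ft S x) \<le> (\<integral>\<^sup>+y. ennreal C0 * (ennreal (k S x y) * indicator (unit_cube d) y) \<partial>leb {1..d})"
    unfolding ft_nn
  proof (intro nn_integral_mono)
    fix y assume "y \<in> space (leb {1..d})"
    then have "f y \<le> C0 * indicator (unit_cube d) y" using f_le_all by simp
    then have "ennreal (f y) \<le> ennreal C0 * indicator (unit_cube d) y"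
      using C0_pos by (auto simp: indicator_def ennreal_leI ennreal_neg)
    from mult_right_mono[OF this, of "ennreal (k S x y)"]
    show "ennreal (f y) * ennreal (k S x y) \<le> ennreal C0 * (ennreal (k S x y) * indicator (unit_cube d) y)"
      by (simp add: mult_ac)
  qed
  also have "\<dots> = ennreal C0 * mass S x" unfolding mass_alt by (rule nn_integral_cmult) measurable
  also have "\<dots> \<le> ennreal C0 * 1" by (intro mult_left_mono mass_le[OF S]) simp
  finally show ?thesis using C0_pos by (simp add: ennreal_le_iff)
qed

lemma ft_ge: assumes x: "x \<in> unit_cube d" shows "c1 \<le> ft S x"
proof -
  have "ennreal c1 = ennreal c0 * ennreal (1 / 2 ^ d)"
    using c0_pos by (simp add: c1_def flip: ennreal_mult)
  also have "\<dots> \<le> ennreal c0 * mass S x" by (intro mult_left_mono mass_ge[OF S x]) simp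
  also have "\<dots> = (\<integral>\<^sup>+y. ennreal c0 * (ennreal (k S x y) * indicator (unit_cube d) y) \<partial>leb {1..d})"
    unfolding mass_alt by (rule nn_integral_cmult[symmetric]) measurable
  also have "\<dots> \<le> ennreal (ft S x)"
    unfolding ft_nn
  proof (intro nn_integral_mono)
    fix y assume "y \<in> space (leb {1..d})"
    then have "c0 * indicator (unit_cube d) y \<le> f y" using f_ge_all by simp
    then have "ennreal c0 * indicator (unit_cube d) y \<le> ennreal (f y)"
      using c0_pos by (auto simp: indicator_def ennreal_leI)
    from mult_right_mono[OF this, of "ennreal (k S x y)"]
    show "ennreal c0 * (ennreal (k S x y) * indicator (unit_cube d) y) \<le> ennreal (f y) * ennreal (k S x y)"
      by (simp add: mult_ac)
  qed
  finally show ?thesis using ft_nonneg by (simp add: ennreal_le_iff)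
qed

lemma fb_eq: "x \<in> unit_cube d ==> fb S x = ft S x"
  using ft_ge by (simp add: fb_def)

lemma ft_meas [measurable]: "ft S \<in> bor d"
proof -
  have "(\<lambda>p. k S (fst p) (snd p)) \<in> borel_measurable (leb {1..d} \<Otimes>\<^sub>M \<mu>)" by measurable
  then show ?thesis unfolding ft_def[abs_def]
    by (intro borel_measurable_lebesgue_integral) (simp add: case_prod_unfold)
qed

lemma fb_meas [measurable]: "fb S \<in> bor d"
  unfolding fb_def[abs_def] by measurable

lemma fb_dep: "dep_on d S (fb S)"
  unfolding fb_def ft_def using k_cong by (intro dep_onI) metis

lemma ratio_meas [measurable]: "(\<lambda>x. k S x y / fb S x) \<in> bor d"
  by measurable

lemma ratio_bound: "0 \<le> k S x y / fb S x" "k S x y / fb S x \<le> k S x y / c1" "k S x y / fb S x \<le> \<kappa> / h ^ d / c1"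
proof -
  show "0 \<le> k S x y / fb S x" using k_nonneg fb_pos[of S x] by simp
  show le: "k S x y / fb S x \<le> k S x y / c1" using k_nonneg
    by (intro divide_left_mono fb_ge mult_pos_pos c1_pos fb_pos)
  also have "\<dots> \<le> \<kappa> / h ^ d / c1" using k_le c1_pos by (intro divide_right_mono) auto
  finally show "k S x y / fb S x \<le> \<kappa> / h ^ d / c1" .
qed

lemma ratio_integrable: "integrable \<mu> (\<lambda>x. k S x y / fb S x)"
proof (rule integrable_const_bound[OF AE_I2])
  show "norm (k S x y / fb S x) \<le> \<kappa> / h ^ d / c1" for x
    by (simp only: real_norm_def abs_of_nonneg[OF ratio_bound(1)] ratio_bound(3))
qed measurable

text \<open>The ratio alone can be as large as a multiple of \<open>h ^ -d\<close>. Integrated over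
  \<open>x\<close>, the symmetry of the kernel turns it into \<open>ft S y / c1\<close>, whose bound
  is free of \<open>h\<close>. All sup bounds for the iterates are free of \<open>h\<close> for this
  reason.\<close>

lemma ratio_integral_le: "(\<integral>x. k S x y / fb S x \<partial>\<mu>) \<le> C0 / c1"
proof -
  have "(\<integral>x. k S x y / fb S x \<partial>\<mu>) \<le> (\<integral>x. k S x y / c1 \<partial>\<mu>)"
    using ratio_bound k_integrable by (intro integral_mono ratio_integrable) auto
  also have "\<dots> = ft S y / c1" by (simp add: ft_def k_sym[OF S, of _ y])
  also have "\<dots> \<le> C0 / c1" using ft_le c1_pos by (intro divide_right_mono) auto
  finally show ?thesis .
qed

lemma Tt_integrable:
  assumes g: "integrable \<mu> g"
  shows "integrable \<mu> (\<lambda>x. g x * (k S x y / fb S x - 1))"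
    and "integrable \<mu> (\<lambda>x. g x * (k S x y / fb S x))"
proof -
  have m [measurable]: "g \<in> bor d" using g borel_measurable_integrable by fastforce
  have "integrable \<mu> (\<lambda>x. \<kappa> / h ^ d / c1 * g x)" using g by simp
  then show 1: "integrable \<mu> (\<lambda>x. g x * (k S x y / fb S x))"
  proof (rule Bochner_Integration.integrable_bound)
    show "AE x in \<mu>. norm (g x * (k S x y / fb S x)) \<le> norm (\<kappa> / h ^ d / c1 * g x)"
    proof (intro AE_I2)
      fix x
      have "\<bar>k S x y / fb S x\<bar> \<le> \<bar>\<kappa> / h ^ d / c1\<bar>" using ratio_bound[of y x] by linarith
      from mult_left_mono[OF this abs_ge_zero[of "g x"]]
      show "norm (g x * (k S x y / fb S x)) \<le> norm (\<kappa> / h ^ d / c1 * g x)"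
        by (simp only: real_norm_def abs_mult mult_ac)
    qed
  qed measurable
  show "integrable \<mu> (\<lambda>x. g x * (k S x y / fb S x - 1))"
    using Bochner_Integration.integrable_diff[OF 1 g] by (simp add: right_diff_distrib)
qed

lemma Tt_eq: "integrable \<mu> g ==> Tt S g y = (\<integral>x. g x * (k S x y / fb S x) \<partial>\<mu>) - (\<integral>x. g x \<partial>\<mu>)"
  using Bochner_Integration.integral_diff[OF Tt_integrable(2)[of g y], of g]
  by (simp add: Tt_def right_diff_distrib)

lemma Tt_diff: "integrable \<mu> g ==> integrable \<mu> g' ==> Tt S (\<lambda>x. g x - g' x) y = Tt S g y - Tt S g' y"
  unfolding Tt_def
  by (subst Bochner_Integration.integral_diff[symmetric]) (auto intro: Tt_integrable simp: left_diff_distrib)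

lemma Tt_joint: "g \<in> bor d ==>
  (\<lambda>p. g (snd p) * (k S (snd p) (fst p) / fb S (snd p) - 1)) \<in> bor2 d"
proof -
  assume [measurable]: "g \<in> bor d"
  have "(\<lambda>p. k S (snd (fst p, snd p)) (fst (fst p, snd p))) \<in> bor2 d"
    using k_joint by (simp add: k_sym[OF S, of "snd _"])
  then have [measurable]: "(\<lambda>p. k S (snd p) (fst p)) \<in> bor2 d" by simp
  show ?thesis by measurable
qed

lemma Tt_meas [measurable]:
  assumes "g \<in> bor d"
  shows "Tt S g \<in> bor d"
proof -
  have "(\<lambda>p. g (snd p) * (k S (snd p) (fst p) / fb S (snd p) - 1)) \<in> borel_measurable (leb {1..d} \<Otimes>\<^sub>M \<mu>)"
    using Tt_joint[OF assms] by measurable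
  then show ?thesis unfolding Tt_def[abs_def]
    by (intro borel_measurable_lebesgue_integral) (simp add: case_prod_unfold)
qed

lemma Tt_dep: "dep_on d S (Tt S g)"
proof (rule dep_onI)
  fix x x' :: point assume *: "\<And>j. j \<in> S ==> x j = x' j"
  have "k S z x = k S z x'" for z by (rule k_cong) (auto simp: *)
  then show "Tt S g x = Tt S g x'" by (simp add: Tt_def)
qed

lemma Tt_le:
  assumes g: "g \<in> bor d" "\<And>x. x \<in> unit_cube d ==> \<bar>g x\<bar> \<le> A"
  shows "\<bar>Tt S g y\<bar> \<le> A * (C0 / c1 + 1)"
proof -
  have A: "0 \<le> A" using g(2)[of "\<lambda>j\<in>{1..d}. 0"] by (force simp: unit_cube_iff)
  have gi: "integrable \<mu> g" using g by (rule integrable_bdd)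
  have "\<bar>Tt S g y\<bar> \<le> (\<integral>x. \<bar>g x * (k S x y / fb S x - 1)\<bar> \<partial>\<mu>)"
    unfolding Tt_def by (rule integral_abs_bound)
  also have "\<dots> \<le> (\<integral>x. A * (k S x y / fb S x + 1) \<partial>\<mu>)"
  proof (intro integral_mono_AE)
    show "AE x in \<mu>. \<bar>g x * (k S x y / fb S x - 1)\<bar> \<le> A * (k S x y / fb S x + 1)"
      using AE_cube
    proof eventually_elim
      case (elim x)
      have "\<bar>k S x y / fb S x - 1\<bar> \<le> k S x y / fb S x + 1" using ratio_bound(1)[of y x] by linarith
      then show ?case using g(2)[OF elim] A by (auto simp: abs_mult intro!: mult_mono)
    qed
  qed (use gi ratio_integrable in \<open>auto intro: Tt_integrable\<close>)
  also have "\<dots> = A * ((\<integral>x. k S x y / fb S x \<partial>\<mu>) + 1)" using ratio_integrable by (simp add: prob_space)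
  also have "\<dots> \<le> A * (C0 / c1 + 1)" using A ratio_integral_le by (intro mult_left_mono) auto
  finally show ?thesis .
qed

lemma ratio_integral_y: "x \<in> unit_cube d ==> (\<integral>y. k S x y / fb S x \<partial>\<mu>) = 1"
  using fb_eq[of x] fb_pos[of S x] by (simp add: ft_def[symmetric])

text \<open>The normalisation sits at the point \<open>x\<close> that is integrated out, so
  integrating over \<open>y\<close> first gives exactly 1 minus 1 for every \<open>x\<close> in the
  cube.\<close>

lemma Tt_mean_zero:
  assumes g: "g \<in> bor d" "\<And>x. x \<in> unit_cube d ==> \<bar>g x\<bar> \<le> A"
  shows "(\<integral>y. Tt S g y \<partial>\<mu>) = 0"
proof -
  interpret P: pair_sigma_finite \<mu> \<mu> ..
  let ?F = "\<lambda>y x. g x * (k S x y / fb S x - 1)"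
  let ?F' = "\<lambda>x y. g x * (k S x y / fb S x - 1)"
  have J: "case_prod ?F' \<in> borel_measurable (\<mu> \<Otimes>\<^sub>M \<mu>)"
  proof -
    note [measurable] = g(1)
    have "(\<lambda>p. g (fst p) * (k S (fst p) (snd p) / fb S (fst p) - 1)) \<in> bor2 d"
      by measurable
    then show ?thesis by (simp add: case_prod_unfold cong: measurable_cong_sets)
  qed
  have inner: "integrable \<mu> (?F' x)" for x
    using k_integrable by simp
  have int: "integrable (\<mu> \<Otimes>\<^sub>M \<mu>) (case_prod ?F')"
  proof (rule P.Fubini_integrable[OF J])
    have "(\<lambda>x. \<integral>y. norm (case_prod ?F' (x, y)) \<partial>\<mu>) \<in> borel_measurable \<mu>"
      using borel_measurable_lebesgue_integral[of "\<lambda>x y. norm (?F' x y)" \<mu>] J by (simp add: case_prod_unfold)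
    then show "integrable \<mu> (\<lambda>x. \<integral>y. norm (case_prod ?F' (x, y)) \<partial>\<mu>)"
    proof (rule integrable_const_bound[rotated, where B = "\<bar>A\<bar> * (\<kappa> / h ^ d / c1 + 1)"])
      show "AE x in \<mu>. norm (\<integral>y. norm (case_prod ?F' (x, y)) \<partial>\<mu>) \<le> \<bar>A\<bar> * (\<kappa> / h ^ d / c1 + 1)"
        using AE_cube
      proof eventually_elim
        case (elim x)
        have "\<bar>?F' x y\<bar> \<le> \<bar>A\<bar> * (\<kappa> / h ^ d / c1 + 1)" for y
        proof -
          have "\<bar>k S x y / fb S x - 1\<bar> \<le> \<kappa> / h ^ d / c1 + 1" using ratio_bound[of y x] by linarith
          then show ?thesis using g(2)[OF elim] by (auto simp: abs_mult intro!: mult_mono)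
        qed
        then have "\<bar>\<integral>y. norm (?F' x y) \<partial>\<mu>\<bar> \<le> \<bar>A\<bar> * (\<kappa> / h ^ d / c1 + 1)"
          using inner[of x] by (intro integral_abs_le) auto
        then show ?case by simp
      qed
    qed
    show "AE x in \<mu>. integrable \<mu> (\<lambda>y. case_prod ?F' (x, y))" using inner by simp
  qed
  have "(\<integral>y. Tt S g y \<partial>\<mu>) = (\<integral>y. (\<integral>x. ?F' x y \<partial>\<mu>) \<partial>\<mu>)" by (simp add: Tt_def)
  also have "\<dots> = (\<integral>x. (\<integral>y. ?F' x y \<partial>\<mu>) \<partial>\<mu>)" by (rule P.Fubini_integral[OF int])
  also have "\<dots> = (\<integral>x. 0 \<partial>\<mu>)"
  proof (intro integral_cong_AE)
    show "AE x in \<mu>. (\<integral>y. ?F' x y \<partial>\<mu>) = 0" using AE_cube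
    proof eventually_elim
      case (elim x)
      then show ?case using ratio_integral_y[OF elim] k_integrable by (simp add: prob_space)
    qed
    show "(\<lambda>x. \<integral>y. ?F' x y \<partial>\<mu>) \<in> borel_measurable \<mu>"
      using borel_measurable_lebesgue_integral[of ?F' \<mu>] J by simp
  qed simp
  finally show ?thesis by simp
qed

text \<open>With \<open>w = k S x y / fb S x\<close>, nonnegativity gives
  \<open>\<bar>w - 1\<bar> \<le> (w - 1) + 2\<close>. The first part is the operator applied to
  \<open>\<bar>g\<bar>\<close>, which has mean zero, and the second gives the constant 2.\<close>

lemma Tt_L1:
  assumes g: "g \<in> bor d" "\<And>x. x \<in> unit_cube d ==> \<bar>g x\<bar> \<le> A"
  shows "(\<integral>y. \<bar>Tt S g y\<bar> \<partial>\<mu>) \<le> 2 * (\<integral>x. \<bar>g x\<bar> \<partial>\<mu>)"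
proof -
  note [measurable] = g(1)
  have gi: "integrable \<mu> g" using g by (rule integrable_bdd)
  have ga: "(\<lambda>x. \<bar>g x\<bar>) \<in> bor d" "\<And>x. x \<in> unit_cube d ==> \<bar>\<bar>g x\<bar>\<bar> \<le> A"
    using g by auto
  have pt: "\<bar>Tt S g y\<bar> \<le> Tt S (\<lambda>x. \<bar>g x\<bar>) y + 2 * (\<integral>x. \<bar>g x\<bar> \<partial>\<mu>)" for y
  proof -
    have "\<bar>Tt S g y\<bar> \<le> (\<integral>x. \<bar>g x * (k S x y / fb S x - 1)\<bar> \<partial>\<mu>)"
      unfolding Tt_def by (rule integral_abs_bound)
    also have "\<dots> \<le> (\<integral>x. \<bar>g x\<bar> * (k S x y / fb S x - 1) + 2 * \<bar>g x\<bar> \<partial>\<mu>)"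
    proof (intro integral_mono)
      fix x
      have "\<bar>k S x y / fb S x - 1\<bar> \<le> k S x y / fb S x - 1 + 2" using ratio_bound(1)[of y x] by linarith
      from mult_left_mono[OF this abs_ge_zero[of "g x"]]
      show "\<bar>g x * (k S x y / fb S x - 1)\<bar> \<le> \<bar>g x\<bar> * (k S x y / fb S x - 1) + 2 * \<bar>g x\<bar>"
        by (simp only: abs_mult distrib_left mult.commute[of _ "2::real"])
    next
      show "integrable \<mu> (\<lambda>x. \<bar>g x * (k S x y / fb S x - 1)\<bar>)"
        using gi by (intro integrable_abs Tt_integrable)
      show "integrable \<mu> (\<lambda>x. \<bar>g x\<bar> * (k S x y / fb S x - 1) + 2 * \<bar>g x\<bar>)"
        using gi by (intro Bochner_Integration.integrable_add Tt_integrable integrable_abs integrable_mult_right)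
    qed
    also have "\<dots> = Tt S (\<lambda>x. \<bar>g x\<bar>) y + 2 * (\<integral>x. \<bar>g x\<bar> \<partial>\<mu>)"
      unfolding Tt_def using gi by (subst Bochner_Integration.integral_add) (auto intro: Tt_integrable)
    finally show ?thesis .
  qed
  have i1: "integrable \<mu> (Tt S g)" using Tt_le[OF g] by (intro integrable_bdd) auto
  have i2: "integrable \<mu> (Tt S (\<lambda>x. \<bar>g x\<bar>))" using Tt_le[OF ga] Tt_meas[OF ga(1)] by (intro integrable_bdd) auto
  have "(\<integral>y. \<bar>Tt S g y\<bar> \<partial>\<mu>) \<le> (\<integral>y. Tt S (\<lambda>x. \<bar>g x\<bar>) y + 2 * (\<integral>x. \<bar>g x\<bar> \<partial>\<mu>) \<partial>\<mu>)"
    using pt i1 i2 by (intro integral_mono) auto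
  also have "\<dots> = 2 * (\<integral>x. \<bar>g x\<bar> \<partial>\<mu>)"
    using i2 Tt_mean_zero[OF ga] by (simp add: prob_space)
  finally show ?thesis .
qed

end

end

section \<open>Smoothing error of the kernel operators\<close>

lemma oscD:
  "osc d \<beta> A g ==> x \<in> unit_cube d ==> x' \<in> unit_cube d ==> 0 \<le> r ==> r \<le> 1 ==>
    (\<And>j. j \<in> {1..d} ==> \<bar>x j - x' j\<bar> \<le> r) ==> \<bar>g x - g x'\<bar> \<le> A * r powr \<beta>"
  unfolding osc_def by blast

lemma osc_nonneg:
  assumes "osc d \<beta> A g"
  shows "0 \<le> A"
proof -
  have "(\<lambda>j\<in>{1..d}. 0) \<in> unit_cube d" by (simp add: unit_cube_iff)
  from oscD[OF assms this this, of 1] show ?thesis by simp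
qed

context dens begin

text \<open>Only the coordinates in \<open>S\<close> have to be close, since the others are
  integrated out over the same section; this is \<open>key\<close>. The constant comes from a
  quotient rule: \<open>C0 + L\<close> from the numerator, another \<open>L\<close> from the
  denominator.\<close>

lemma cex_osc_on:
  assumes S: "S \<subseteq> {1..d}"
    and f_osc: "osc d \<beta> L f"
    and g: "g \<in> bor d" "\<And>x. x \<in> unit_cube d ==> \<bar>g x\<bar> \<le> A" "osc d \<beta> A g"
    and x: "x \<in> unit_cube d" "x' \<in> unit_cube d" and r: "0 \<le> r" "r \<le> 1" "\<And>j. j \<in> S ==> \<bar>x j - x' j\<bar> \<le> r"
  shows "\<bar>marginal d S f (restrict x S) - marginal d S f (restrict x' S)\<bar> \<le> L * r powr \<beta>"
    and "\<bar>cex d f S g x - cex d f S g x'\<bar> \<le> A * ((C0 + 2 * L) / c0) * r powr \<beta>"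
proof -
  let ?T = "{1..d} - S" let ?B = "PiE ?T (\<lambda>_. {0..1::real})"
  let ?m = "\<lambda>x u. merge S ?T (restrict x S, u)"
  have em: "measure (leb ?T) ?B = 1"
    using emeasure_leb_box[of ?T "\<lambda>_. 0" "\<lambda>_. 1"] by (simp add: measure_def)
  have emf: "emeasure (leb ?T) ?B < \<infinity>"
    using emeasure_leb_box[of ?T "\<lambda>_. 0" "\<lambda>_. 1"] by simp
  have sets: "?B \<in> sets (leb ?T)" by (intro sets_PiM_I_finite) auto
  have Bi: "?B \<inter> (?T \<rightarrow>\<^sub>E UNIV) = ?B" by auto
  have sp: "restrict x S \<in> space (leb S)" "restrict x' S \<in> space (leb S)" by auto
  have ci: "integrable (leb ?T) (\<lambda>u. c * indicator ?B u :: real)" for c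
    using emf sets by (intro integrable_mult_right integrable_real_indicator) auto
  have key: "\<bar>marginal d S F (restrict x S) - marginal d S F (restrict x' S)\<bar> \<le> c"
    if Fi: "\<And>x. integrable (leb ?T) (\<lambda>u. F (?m x u))"
      and out: "\<And>x. x \<in> euclid d - unit_cube d ==> F x = (0::real)"
      and le: "\<And>z z'. z \<in> unit_cube d ==> z' \<in> unit_cube d ==> (\<And>j. j \<in> {1..d} ==> \<bar>z j - z' j\<bar> \<le> r) ==> \<bar>F z - F z'\<bar> \<le> c"
    for F c
  proof -
    have "\<bar>marginal d S F (restrict x S) - marginal d S F (restrict x' S)\<bar> =
        \<bar>\<integral>u. F (?m x u) - F (?m x' u) \<partial>leb ?T\<bar>"
      unfolding marginal_def using Fi by simp
    also have "\<dots> \<le> (\<integral>u. \<bar>F (?m x u) - F (?m x' u)\<bar> \<partial>leb ?T)" by (rule integral_abs_bound)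
    also have "\<dots> \<le> (\<integral>u. c * indicator ?B u \<partial>leb ?T)"
    proof (intro integral_mono ci)
      fix u assume u: "u \<in> space (leb ?T)"
      show "\<bar>F (?m x u) - F (?m x' u)\<bar> \<le> c * indicator ?B u"
      proof (cases "u \<in> ?B")
        case True
        have uu: "\<forall>j\<in>?T. 0 \<le> u j \<and> u j \<le> 1" using True by (auto simp: PiE_def Pi_def)
        have "\<forall>j\<in>S. 0 \<le> restrict w S j \<and> restrict w S j \<le> 1" if "w \<in> unit_cube d" for w
          using that S by (simp add: unit_cube_iff subset_iff)
        with uu x have "?m x u \<in> unit_cube d" "?m x' u \<in> unit_cube d"
          unfolding merge_in_cube[OF S] by blast+
        moreover have "\<bar>?m x u j - ?m x' u j\<bar> \<le> r" if "j \<in> {1..d}" for j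
          using r(1,3) by (auto simp: merge_def)
        ultimately show ?thesis using le True by simp
      next
        case False
        then have "\<not> (\<forall>j\<in>?T. 0 \<le> u j \<and> u j \<le> 1)"
          using u by (auto simp: PiE_def Pi_def)
        then have "?m x u \<notin> unit_cube d" "?m x' u \<notin> unit_cube d"
          unfolding merge_in_cube[OF S] by blast+
        then show ?thesis using out merge_in_euclid[OF S] False by simp
      qed
    qed (use Fi in auto)
    also have "\<dots> = c" using em sets Bi by simp
    finally show ?thesis .
  qed
  have A: "0 \<le> A" using g(3) by (rule osc_nonneg)
  have L: "0 \<le> L" using f_osc by (rule osc_nonneg)
  show D: "\<bar>marginal d S f (restrict x S) - marginal d S f (restrict x' S)\<bar> \<le> L * r powr \<beta>"
  proof (rule key)
    show "integrable (leb ?T) (\<lambda>u. f (?m x u))" for x by (rule section_f_integrable[OF S]) simp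
  qed (use f_out r in \<open>auto intro: oscD[OF f_osc]\<close>)
  have N: "\<bar>marginal d S (\<lambda>z. g z * f z) (restrict x S) - marginal d S (\<lambda>z. g z * f z) (restrict x' S)\<bar>
      \<le> (A * C0 + A * L) * r powr \<beta>"
  proof (intro key)
    fix z z' assume z: "z \<in> unit_cube d" "z' \<in> unit_cube d" "\<And>j. j \<in> {1..d} ==> \<bar>z j - z' j\<bar> \<le> r"
    have "\<bar>g z - g z'\<bar> * \<bar>f z\<bar> \<le> (A * r powr \<beta>) * C0"
      using oscD[OF g(3) z(1,2) r(1,2) z(3)] f_le[OF z(1)] f_ge[OF z(1)] c0_pos A by (intro mult_mono) auto
    moreover have "\<bar>g z'\<bar> * \<bar>f z - f z'\<bar> \<le> A * (L * r powr \<beta>)"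
      using oscD[OF f_osc z(1,2) r(1,2) z(3)] g(2)[OF z(2)] A by (intro mult_mono) auto
    moreover have "g z * f z - g z' * f z' = (g z - g z') * f z + g z' * (f z - f z')" by (simp add: algebra_simps)
    then have "\<bar>g z * f z - g z' * f z'\<bar> \<le> \<bar>g z - g z'\<bar> * \<bar>f z\<bar> + \<bar>g z'\<bar> * \<bar>f z - f z'\<bar>"
      by (metis abs_mult abs_triangle_ineq)
    ultimately show "\<bar>g z * f z - g z' * f z'\<bar> \<le> (A * C0 + A * L) * r powr \<beta>"
      by (simp add: algebra_simps)
  next
    show "integrable (leb ?T) (\<lambda>u. g (?m x u) * f (?m x u))" for x by (rule marginal_gf(1)[OF S g(1,2)]) auto
  qed (use f_out in auto)
  let ?N = "marginal d S (\<lambda>z. g z * f z) (restrict x S)" let ?N' = "marginal d S (\<lambda>z. g z * f z) (restrict x' S)"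
  let ?D = "marginal d S f (restrict x S)" let ?D' = "marginal d S f (restrict x' S)"
  have D0: "c0 \<le> ?D" "c0 \<le> ?D'" using x S by (auto intro!: marginal_f_ge[OF S] simp: unit_cube_iff)
  have q: "\<bar>?N' / ?D'\<bar> \<le> A" using cex_le[OF S g(1,2), of x'] by (simp add: cex_def)
  \<comment> \<open>Written with \<open>?N' / ?D'\<close>, a conditional expectation, because this
    factor is at most \<open>A\<close> whereas a separate bound for the numerator would cost
    \<open>C0 / c0\<close>.\<close>
  have "?N / ?D - ?N' / ?D' = ((?N - ?N') + ?N' / ?D' * (?D' - ?D)) / ?D"
    using D0 c0_pos by (simp add: field_simps)
  then have "\<bar>?N / ?D - ?N' / ?D'\<bar> = \<bar>(?N - ?N') + ?N' / ?D' * (?D' - ?D)\<bar> / ?D"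
    using D0 c0_pos by (simp add: abs_divide)
  also have "\<dots> \<le> ((A * C0 + A * L) * r powr \<beta> + A * (L * r powr \<beta>)) / c0"
  proof (intro frac_le D0 c0_pos)
    have "\<bar>?N' / ?D' * (?D' - ?D)\<bar> \<le> A * (L * r powr \<beta>)"
      unfolding abs_mult using q D A by (intro mult_mono) auto
    then show "\<bar>?N - ?N' + ?N' / ?D' * (?D' - ?D)\<bar> \<le> (A * C0 + A * L) * r powr \<beta> + A * (L * r powr \<beta>)"
      using N by linarith
    show "0 \<le> (A * C0 + A * L) * r powr \<beta> + A * (L * r powr \<beta>)" using A L C0_pos by simp
  qed
  also have "\<dots> = A * ((C0 + 2 * L) / c0) * r powr \<beta>" by (simp add: algebra_simps add_divide_distrib)
  finally show "\<bar>cex d f S g x - cex d f S g x'\<bar> \<le> A * ((C0 + 2 * L) / c0) * r powr \<beta>"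
    by (simp add: cex_def)
qed

end

locale tilde_osc = tilde +
  fixes \<beta> L :: real
  assumes \<beta>: "0 < \<beta>" "\<beta> \<le> 1" and f_osc: "osc d \<beta> L f"
begin

lemma L_nonneg: "0 \<le> L" using f_osc by (rule osc_nonneg)

lemma h_le_powr: "h \<le> h powr \<beta>"
  using h_pos h_lt \<beta> powr_mono'[of \<beta> 1 h] by simp

context
  fixes S assumes S: "S \<subseteq> {1..d}"
begin

text \<open>The kernel weights integrate to 1 in \<open>y\<close>, but not in \<open>x\<close>,
  where the normaliser varies. The difference \<open>kap y - 1\<close> is the defect of the operator
  on constants.\<close>

abbreviation kap :: "point => real" where
  "kap y \<equiv> (\<integral>x. k S x y / fb S x \<partial>\<mu>)"

lemma kap_eq_Tt: "kap y - 1 = Tt S (\<lambda>_. 1) y"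
  by (subst Tt_eq[OF S]) (auto simp: prob_space)

lemma mass_real: "mass S y = ennreal (\<integral>x. k S x y * indicator (unit_cube d) x \<partial>leb {1..d})"
    "integrable (leb {1..d}) (\<lambda>x. k S x y * indicator (unit_cube d) x)"
proof -
  note [measurable] = k_meas'[OF S]
  have emc: "emeasure (leb {1..d}) (unit_cube d) = 1"
    using emeasure_leb_box[of "{1..d}" "\<lambda>_. 0" "\<lambda>_. 1"] by (simp add: unit_cube_def)
  have "integrable (leb {1..d}) (\<lambda>x. \<kappa> / h ^ d * indicator (unit_cube d) x :: real)"
    using emc by (intro integrable_mult_right integrable_real_indicator) auto
  then show int: "integrable (leb {1..d}) (\<lambda>x. k S x y * indicator (unit_cube d) x)"
  proof (rule Bochner_Integration.integrable_bound)
    show "AE x in leb {1..d}. norm (k S x y * indicator (unit_cube d) x) \<le> norm (\<kappa> / h ^ d * indicator (unit_cube d) x :: real)"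
      using k_le[OF S] k_nonneg[OF S] \<kappa>_nonneg h_pos
      by (intro AE_I2) (auto simp: indicator_def)
  qed measurable
  have "mass S y = (\<integral>\<^sup>+x. ennreal (k S x y * indicator (unit_cube d) x) \<partial>leb {1..d})"
    unfolding mass_def by (intro nn_integral_cong) (simp add: indicator_def)
  also have "\<dots> = ennreal (\<integral>x. k S x y * indicator (unit_cube d) x \<partial>leb {1..d})"
    using k_nonneg[OF S] by (intro nn_integral_eq_integral int) auto
  finally show "mass S y = ennreal (\<integral>x. k S x y * indicator (unit_cube d) x \<partial>leb {1..d})" .
qed

lemma k_near: "k S x y \<noteq> 0 ==> j \<in> S ==> \<bar>x j - y j\<bar> \<le> h"
  using Kh_supp[OF S, of "\<lambda>l. y l - x l" j] h_pos by (simp add: abs_minus_commute)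

lemma k_dep: "dep_on d S (\<lambda>z. k S z x)"
  by (intro dep_onI k_cong[OF S]) simp_all

lemma k_abs_le: "\<bar>k S z x\<bar> \<le> \<kappa> / h ^ d"
  by (simp only: abs_of_nonneg[OF k_nonneg[OF S]] k_le[OF S])

lemma ratio_dep: "dep_on d S (\<lambda>x. k S x y / fb S x)"
proof (rule dep_onI)
  fix x x' :: point assume *: "x \<in> euclid d" "x' \<in> euclid d" "\<And>j. j \<in> S ==> x j = x' j"
  have "k S x y = k S x' y" by (rule k_cong[OF S]) (simp_all add: *(3))
  then show "k S x y / fb S x = k S x' y / fb S x'"
    using dep_onD[OF fb_dep[OF S] *] by simp
qed

text \<open>Within the support of the kernel the marginal density changes by at most
  \<open>L * h powr \<beta>\<close>. The bound is one-sided because mass lost across the boundary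
  can make the smoothed density much smaller than the marginal one.\<close>

lemma fb_le_marginal:
  assumes x: "x \<in> unit_cube d"
  shows "fb S x \<le> marginal d S f (restrict x S) + L * h powr \<beta>"
proof -
  let ?M = "marginal d S f (restrict x S)"
  let ?U = "\<integral>z. k S z x * indicator (unit_cube d) z \<partial>leb {1..d}"
  have M0: "0 \<le> ?M" by (rule marginal_f_nonneg[OF S])
  have "?U \<le> 1"
    using mass_le[OF S, of x] mass_real(1)[of x] by (simp add: ennreal_le_1)
  have "fb S x = (\<integral>z. k S x z \<partial>\<mu>)" using fb_eq[OF S x] by (simp add: ft_def)
  also have "\<dots> = (\<integral>z. k S z x \<partial>\<mu>)" by (simp add: k_sym[OF S, of x])
  also have "\<dots> = (\<integral>z. indicator (unit_cube d) z * (k S z x * marginal d S f (restrict z S)) \<partial>leb {1..d})"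
    by (rule integral_via_marginal(1)[OF S k_meas'[OF S] k_dep k_abs_le])
  also have "\<dots> \<le> (\<integral>z. (?M + L * h powr \<beta>) * (k S z x * indicator (unit_cube d) z) \<partial>leb {1..d})"
  proof (intro integral_mono)
    show "integrable (leb {1..d}) (\<lambda>z. indicator (unit_cube d) z * (k S z x * marginal d S f (restrict z S)))"
      by (rule integral_via_marginal(2)[OF S k_meas'[OF S] k_dep k_abs_le])
    show "integrable (leb {1..d}) (\<lambda>z. (?M + L * h powr \<beta>) * (k S z x * indicator (unit_cube d) z))"
      using mass_real(2) by (intro integrable_mult_right) auto
    fix z
    show "indicator (unit_cube d) z * (k S z x * marginal d S f (restrict z S)) \<le>
        (?M + L * h powr \<beta>) * (k S z x * indicator (unit_cube d) z)"
    proof (cases "z \<in> unit_cube d \<and> k S z x \<noteq> 0")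
      case True
      have "\<bar>marginal d S f (restrict z S) - ?M\<bar> \<le> L * h powr \<beta>"
        using True x h_pos h_lt k_near osc_nonneg
        by (intro cex_osc_on(1)[OF S f_osc, where g = "\<lambda>_. 0" and A = 0]) (auto simp: osc_def)
      then have "marginal d S f (restrict z S) \<le> ?M + L * h powr \<beta>" by linarith
      then show ?thesis using True k_nonneg[OF S, of x z] by (simp add: mult_left_mono mult.commute)
    qed auto
  qed
  also have "\<dots> = (?M + L * h powr \<beta>) * ?U" by simp
  also have "\<dots> \<le> (?M + L * h powr \<beta>) * 1"
    using \<open>?U \<le> 1\<close> M0 L_nonneg by (intro mult_left_mono) auto
  finally show ?thesis by simp
qed

text \<open>Where no mass is lost at \<open>y\<close>, the weights are bounded below by inserting
  the upper bound on \<open>fb\<close>. The points \<open>z\<close> near \<open>y\<close> may still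
  have lost mass, which only increases \<open>kap y\<close>, so no upper bound of this kind is
  available.\<close>

lemma kap_ge:
  assumes "mass S y = 1"
  shows "1 \<le> kap y + L * h powr \<beta> / c0"
proof -
  let ?\<rho> = "L * h powr \<beta> / c0"
  let ?U = "\<integral>z. k S z y * indicator (unit_cube d) z \<partial>leb {1..d}"
  have \<rho>: "0 \<le> ?\<rho>" using L_nonneg c0_pos by simp
  have U: "?U = 1"
  proof -
    have "0 \<le> ?U" using k_nonneg[OF S] by (intro Bochner_Integration.integral_nonneg) auto
    then show ?thesis using assms mass_real(1)[of y] by (simp add: ennreal_eq_1)
  qed
  have rb: "\<bar>k S x y / fb S x\<bar> \<le> \<kappa> / h ^ d / c1" for x
    by (simp only: abs_of_nonneg[OF ratio_bound(1)[OF S]] ratio_bound(3)[OF S])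
  have "1 / (1 + ?\<rho>) = (\<integral>z. 1 / (1 + ?\<rho>) * (k S z y * indicator (unit_cube d) z) \<partial>leb {1..d})"
    using U by simp
  also have "\<dots> \<le> (\<integral>z. indicator (unit_cube d) z * (k S z y / fb S z * marginal d S f (restrict z S)) \<partial>leb {1..d})"
  proof (intro integral_mono)
    show "integrable (leb {1..d}) (\<lambda>z. 1 / (1 + ?\<rho>) * (k S z y * indicator (unit_cube d) z))"
      using mass_real(2) by (intro integrable_mult_right) auto
    show "integrable (leb {1..d}) (\<lambda>z. indicator (unit_cube d) z * (k S z y / fb S z * marginal d S f (restrict z S)))"
      by (rule integral_via_marginal(2)[OF S ratio_meas[OF S] ratio_dep rb])
    fix z
    show "1 / (1 + ?\<rho>) * (k S z y * indicator (unit_cube d) z) \<le>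
        indicator (unit_cube d) z * (k S z y / fb S z * marginal d S f (restrict z S))"
    proof (cases "z \<in> unit_cube d")
      case True
      let ?M = "marginal d S f (restrict z S)"
      have M: "c0 \<le> ?M" using True S by (auto intro!: marginal_f_ge[OF S] simp: unit_cube_iff)
      have "?\<rho> * c0 \<le> ?\<rho> * ?M" using M \<rho> by (rule mult_left_mono)
      then have "fb S z \<le> ?M * (1 + ?\<rho>)"
        using fb_le_marginal[OF True] c0_pos by (simp add: algebra_simps)
      then have "1 / (1 + ?\<rho>) \<le> ?M / fb S z"
        using fb_pos[of S z] \<rho> by (simp add: field_simps add_pos_nonneg)
      from mult_left_mono[OF this k_nonneg[OF S, of y z]] True show ?thesis
        by (simp add: mult_ac)
    qed simp
  qed
  also have "\<dots> = kap y"
    by (rule integral_via_marginal(1)[OF S ratio_meas[OF S] ratio_dep rb, symmetric])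
  finally have "1 / (1 + ?\<rho>) \<le> kap y" .
  moreover have "1 - ?\<rho> \<le> 1 / (1 + ?\<rho>)"
  proof -
    have "(1 - r) * (1 + r) \<le> 1" for r :: real by (simp add: algebra_simps)
    then show ?thesis using \<rho> by (simp add: pos_le_divide_eq add_pos_nonneg)
  qed
  ultimately show "1 \<le> kap y + ?\<rho>" by linarith
qed

text \<open>The inner cube has volume \<open>(1 - h) ^ d\<close>, which is at least
  \<open>1 - d * h\<close> by Bernoulli's inequality.\<close>

lemma boundary_layer:
  "\<exists>I\<in>sets (leb {1..d}). (\<forall>y\<in>I. mass S y = 1) \<and> measure \<mu> (euclid d - I) \<le> C0 * (real d * h)"
proof -
  let ?I = "PiE {1..d} (\<lambda>_. {h/2..1 - h/2})"
  have I: "?I \<in> sets (leb {1..d})" by (intro sets_PiM_I_finite) auto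
  have IC: "?I \<subseteq> unit_cube d" using h_pos by (auto simp: unit_cube_def PiE_def Pi_def)
  have mI: "emeasure (leb {1..d}) ?I = ennreal ((1 - h) ^ d)"
    using emeasure_leb_box[of "{1..d}" "\<lambda>_. h/2" "\<lambda>_. 1 - h/2"] h_lt by simp
  have emc: "emeasure (leb {1..d}) (unit_cube d) = 1"
    using emeasure_leb_box[of "{1..d}" "\<lambda>_. 0" "\<lambda>_. 1"] by (simp add: unit_cube_def)
  have "emeasure \<mu> (euclid d - ?I) = (\<integral>\<^sup>+x. indicator (euclid d - ?I) x \<partial>\<mu>)"
    using I by (subst nn_integral_indicator) (auto intro!: sets.Diff simp flip: space_leb)
  also have "\<dots> = (\<integral>\<^sup>+x. ennreal (f x) * indicator (euclid d - ?I) x \<partial>leb {1..d})"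
    using I by (intro nn_integral_law borel_measurable_indicator) (auto intro!: sets.Diff simp flip: space_leb)
  also have "\<dots> \<le> (\<integral>\<^sup>+x. ennreal C0 * indicator (unit_cube d - ?I) x \<partial>leb {1..d})"
  proof (intro nn_integral_mono)
    fix x assume x: "x \<in> space (leb {1..d})"
    show "ennreal (f x) * indicator (euclid d - ?I) x \<le> ennreal C0 * indicator (unit_cube d - ?I) x"
      using x f_out[of x] f_le[of x] by (cases "x \<in> unit_cube d") (auto simp: indicator_def ennreal_leI)
  qed
  also have "\<dots> = ennreal C0 * emeasure (leb {1..d}) (unit_cube d - ?I)"
    using I by (intro nn_integral_cmult_indicator) auto
  also have "emeasure (leb {1..d}) (unit_cube d - ?I) = 1 - ennreal ((1 - h) ^ d)"
    using emeasure_Diff[OF _ unit_cube_sets I IC] mI emc by simp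
  also have "1 - ennreal ((1 - h) ^ d) = ennreal (1 - (1 - h) ^ d)"
    using h_lt ennreal_minus[of "(1 - h) ^ d" 1] by simp
  also have "ennreal C0 * ennreal (1 - (1 - h) ^ d) \<le> ennreal C0 * ennreal (real d * h)"
  proof (intro mult_left_mono ennreal_leI)
    have "1 + real d * (- h) \<le> (1 + (- h)) ^ d" using h_lt by (intro Bernoulli_inequality) auto
    then show "1 - (1 - h) ^ d \<le> real d * h" by simp
  qed simp
  finally have "emeasure \<mu> (euclid d - ?I) \<le> ennreal (C0 * (real d * h))"
    using C0_pos by (simp add: ennreal_mult')
  then have "measure \<mu> (euclid d - ?I) \<le> C0 * (real d * h)"
    using C0_pos h_pos by (simp add: emeasure_eq_measure ennreal_le_iff)
  moreover have "mass S y = 1" if "y \<in> ?I" for y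
    using that S by (intro mass_interior) (auto simp: PiE_def Pi_def)
  ultimately show ?thesis using I by blast
qed

text \<open>Since \<open>kap - 1\<close> has mean zero, its L1 norm is twice the integral of its
  negative part. The one-sided bound \<open>kap_ge\<close> therefore suffices; on the boundary layer
  the negative part is at most 1 and the layer has probability of order \<open>h\<close>.\<close>

lemma kap_L1: "(\<integral>y. \<bar>kap y - 1\<bar> \<partial>\<mu>) \<le> 2 * (C0 * real d + L / c0) * h powr \<beta>"
proof -
  obtain I where I: "I \<in> sets (leb {1..d})" "\<And>y. y \<in> I ==> mass S y = 1"
    "measure \<mu> (euclid d - I) \<le> C0 * (real d * h)" using boundary_layer by blast
  let ?\<rho> = "L * h powr \<beta> / c0"
  have \<rho>: "0 \<le> ?\<rho>" using L_nonneg c0_pos by simp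
  have one: "(\<lambda>_. 1) \<in> bor d" "\<And>x. x \<in> unit_cube d ==> \<bar>1::real\<bar> \<le> 1" by auto
  have m: "(\<lambda>y. kap y - 1) \<in> bor d"
    unfolding kap_eq_Tt by (rule Tt_meas[OF S]) simp
  have ki: "integrable \<mu> (\<lambda>y. kap y - 1)"
  proof (rule integrable_bdd[OF m])
    show "\<bar>kap y - 1\<bar> \<le> 1 * (C0 / c1 + 1)" for y unfolding kap_eq_Tt by (rule Tt_le[OF S]) auto
  qed
  have E: "euclid d - I \<in> sets \<mu>" using I(1) sets.compl_sets[OF I(1)] by simp
  have ii: "integrable \<mu> (\<lambda>y. indicator (euclid d - I) y :: real)"
    using E by (intro integrable_real_indicator) (auto simp: emeasure_eq_measure)
  have "\<bar>kap y - 1\<bar> \<le> (kap y - 1) + 2 * (indicator (euclid d - I) y + ?\<rho>)" if "y \<in> space \<mu>" for y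
  proof (cases "y \<in> I")
    case True
    then show ?thesis using kap_ge[OF I(2)[OF True]] \<rho> by (simp add: indicator_def)
  next
    case False
    have "0 \<le> kap y" using ratio_bound(1)[OF S] by (intro Bochner_Integration.integral_nonneg) auto
    then show ?thesis using False that \<rho> by (simp add: indicator_def)
  qed
  then have "(\<integral>y. \<bar>kap y - 1\<bar> \<partial>\<mu>) \<le> (\<integral>y. (kap y - 1) + 2 * (indicator (euclid d - I) y + ?\<rho>) \<partial>\<mu>)"
    using ki ii by (intro integral_mono) auto
  also have "\<dots> = (\<integral>y. kap y - 1 \<partial>\<mu>) + 2 * (measure \<mu> (euclid d - I) + ?\<rho>)"
  proof -
    have "(euclid d - I) \<inter> euclid d = euclid d - I" by auto
    then show ?thesis using ki ii E
      by (subst Bochner_Integration.integral_add) (auto simp: prob_space)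
  qed
  also have "(\<integral>y. kap y - 1 \<partial>\<mu>) = 0"
    unfolding kap_eq_Tt by (rule Tt_mean_zero[OF S one])
  also have "0 + 2 * (measure \<mu> (euclid d - I) + ?\<rho>) \<le> 2 * (C0 * (real d * h powr \<beta>) + ?\<rho>)"
  proof -
    have "C0 * (real d * h) \<le> C0 * (real d * h powr \<beta>)"
      using h_le_powr C0_pos by (intro mult_left_mono) auto
    with I(3) have "measure \<mu> (euclid d - I) \<le> C0 * (real d * h powr \<beta>)" by (rule order_trans)
    then show ?thesis by simp
  qed
  also have "\<dots> = 2 * (C0 * real d + L / c0) * h powr \<beta>" by (simp add: algebra_simps)
  finally show ?thesis .
qed

text \<open>The weights depend on \<open>x\<close> through \<open>S\<close> only, so
  \<open>g\<close> may first be replaced by its conditional expectation. What is left is the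
  variation of that regular function over distances \<open>h\<close>, plus its value times the
  defect \<open>kap y - 1\<close>.\<close>

lemma Tt_close:
  assumes g: "g \<in> bor d" "\<And>x. x \<in> unit_cube d ==> \<bar>g x\<bar> \<le> A" "osc d \<beta> A g"
  shows "(\<integral>y. \<bar>Tt S g y - (cex d f S g y - (\<integral>x. g x \<partial>\<mu>))\<bar> \<partial>\<mu>) \<le>
     A * ((C0 + 2 * L) / c0 + 2 * (C0 * real d + L / c0)) * h powr \<beta>"
proof -
  let ?Ch = "(C0 + 2 * L) / c0"
  have A: "0 \<le> A" using g(3) by (rule osc_nonneg)
  have gi: "integrable \<mu> g" using g(1,2) by (rule integrable_bdd)
  have cm: "cex d f S g \<in> bor d" by (rule cex_measurable[OF S g(1)])
  have cle: "\<bar>cex d f S g x\<bar> \<le> A" for x by (rule cex_le[OF S g(1,2)])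
  have ci: "integrable \<mu> (cex d f S g)" using cm cle by (intro integrable_bdd) auto
  have km: "(\<lambda>y. kap y - 1) \<in> bor d"
    unfolding kap_eq_Tt by (rule Tt_meas[OF S]) simp
  have kle: "\<bar>kap y - 1\<bar> \<le> 1 * (C0 / c1 + 1)" for y unfolding kap_eq_Tt by (rule Tt_le[OF S]) auto
  have ki: "integrable \<mu> (\<lambda>y. kap y - 1)" using km kle by (rule integrable_bdd)
  have pt: "\<bar>Tt S g y - (cex d f S g y - (\<integral>x. g x \<partial>\<mu>))\<bar> \<le> A * ?Ch * h powr \<beta> * (kap y - 1) + A * ?Ch * h powr \<beta> + A * \<bar>kap y - 1\<bar>"
    if y: "y \<in> unit_cube d" for y
  proof -
    let ?r = "\<lambda>x. k S x y / fb S x"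
    have "Tt S g y + (\<integral>x. g x \<partial>\<mu>) = (\<integral>x. ?r x * g x \<partial>\<mu>)"
      unfolding Tt_eq[OF S gi] by (simp add: mult.commute)
    also have "\<dots> = (\<integral>x. ?r x * cex d f S g x \<partial>\<mu>)"
      by (rule cex_proj[OF S ratio_meas[OF S] ratio_dep ratio_integrable[OF S] g(1,2)])
    also have "\<dots> = (\<integral>x. ?r x * (cex d f S g x - cex d f S g y) \<partial>\<mu>) + cex d f S g y * kap y"
    proof -
      have i1: "integrable \<mu> (\<lambda>x. ?r x * cex d f S g x)"
        using Tt_integrable(2)[OF S ci, of y] by (simp add: mult.commute)
      have "(\<integral>x. ?r x * (cex d f S g x - cex d f S g y) \<partial>\<mu>) = (\<integral>x. ?r x * cex d f S g x - cex d f S g y * ?r x \<partial>\<mu>)"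
        by (simp only: right_diff_distrib mult.commute[of "cex d f S g y"])
      also have "\<dots> = (\<integral>x. ?r x * cex d f S g x \<partial>\<mu>) - cex d f S g y * kap y"
        using Bochner_Integration.integral_diff[OF i1 integrable_mult_right[OF ratio_integrable[OF S, of y], of "cex d f S g y"]]
        by (simp only: integral_mult_right_zero)
      finally show ?thesis by linarith
    qed
    finally have eq: "Tt S g y - (cex d f S g y - (\<integral>x. g x \<partial>\<mu>)) =
      (\<integral>x. ?r x * (cex d f S g x - cex d f S g y) \<partial>\<mu>) + cex d f S g y * (kap y - 1)"
      by (simp add: algebra_simps)
    have "\<bar>\<integral>x. ?r x * (cex d f S g x - cex d f S g y) \<partial>\<mu>\<bar> \<le> (\<integral>x. \<bar>?r x * (cex d f S g x - cex d f S g y)\<bar> \<partial>\<mu>)"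
      by (rule integral_abs_bound)
    also have "\<dots> \<le> (\<integral>x. A * ?Ch * h powr \<beta> * ?r x \<partial>\<mu>)"
    proof (intro integral_mono_AE)
      have "integrable \<mu> (\<lambda>x. cex d f S g x - cex d f S g y)" using ci by simp
      from Tt_integrable(2)[OF S this, of y]
      show "integrable \<mu> (\<lambda>x. \<bar>?r x * (cex d f S g x - cex d f S g y)\<bar>)"
        by (intro integrable_abs) (simp add: mult.commute)
      show "AE x in \<mu>. \<bar>?r x * (cex d f S g x - cex d f S g y)\<bar> \<le> A * ?Ch * h powr \<beta> * ?r x"
        using AE_cube
      proof eventually_elim
        case (elim x)
        show ?case
        proof (cases "k S x y = 0")
          case False
          have "\<bar>cex d f S g x - cex d f S g y\<bar> \<le> A * ?Ch * h powr \<beta>"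
            using False h_pos h_lt k_near
            by (intro cex_osc_on(2)[OF S f_osc g elim y]) auto
          from mult_left_mono[OF this ratio_bound(1)[OF S, of y x]] show ?thesis
            unfolding abs_mult abs_of_nonneg[OF ratio_bound(1)[OF S, of y x]] by (simp only: mult.commute)
        qed simp
      qed
    next
      show "integrable \<mu> (\<lambda>x. A * ?Ch * h powr \<beta> * ?r x)" by (rule integrable_mult_right[OF ratio_integrable[OF S]])
    qed
    also have "\<dots> = A * ?Ch * h powr \<beta> * kap y" by (simp only: integral_mult_right_zero)
    finally have 1: "\<bar>\<integral>x. ?r x * (cex d f S g x - cex d f S g y) \<partial>\<mu>\<bar> \<le> A * ?Ch * h powr \<beta> * (kap y - 1) + A * ?Ch * h powr \<beta>"
      by (simp add: algebra_simps)
    have "\<bar>cex d f S g y * (kap y - 1)\<bar> \<le> A * \<bar>kap y - 1\<bar>"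
      unfolding abs_mult using cle by (intro mult_right_mono) auto
    then show ?thesis unfolding eq using 1 by linarith
  qed
  have "(\<integral>y. \<bar>Tt S g y - (cex d f S g y - (\<integral>x. g x \<partial>\<mu>))\<bar> \<partial>\<mu>) \<le>
     (\<integral>y. A * ?Ch * h powr \<beta> * (kap y - 1) + A * ?Ch * h powr \<beta> + A * \<bar>kap y - 1\<bar> \<partial>\<mu>)"
  proof (intro integral_mono_AE)
    have "integrable \<mu> (Tt S g)" using Tt_le[OF S g(1,2)] Tt_meas[OF S g(1)] by (intro integrable_bdd) auto
    then show "integrable \<mu> (\<lambda>y. \<bar>Tt S g y - (cex d f S g y - (\<integral>x. g x \<partial>\<mu>))\<bar>)"
      using ci by (intro integrable_abs Bochner_Integration.integrable_diff) auto
    show "AE y in \<mu>. \<bar>Tt S g y - (cex d f S g y - (\<integral>x. g x \<partial>\<mu>))\<bar> \<le> A * ?Ch * h powr \<beta> * (kap y - 1) + A * ?Ch * h powr \<beta> + A * \<bar>kap y - 1\<bar>"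
      using AE_cube by eventually_elim (rule pt)
    show "integrable \<mu> (\<lambda>y. A * ?Ch * h powr \<beta> * (kap y - 1) + A * ?Ch * h powr \<beta> + A * \<bar>kap y - 1\<bar>)"
      by (intro Bochner_Integration.integrable_add integrable_mult_right integrable_abs ki) auto
  qed
  also have "\<dots> = A * ?Ch * h powr \<beta> * (\<integral>y. kap y - 1 \<partial>\<mu>) + A * ?Ch * h powr \<beta> + A * (\<integral>y. \<bar>kap y - 1\<bar> \<partial>\<mu>)"
    using ki integrable_abs[OF ki]
    by (subst Bochner_Integration.integral_add Bochner_Integration.integral_mult_right,
       (intro Bochner_Integration.integrable_add integrable_mult_right, auto)[2])+ (simp add: prob_space)
  also have "(\<integral>y. kap y - 1 \<partial>\<mu>) = 0"
    unfolding kap_eq_Tt by (rule Tt_mean_zero[OF S, of _ 1]) auto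
  also have "A * ?Ch * h powr \<beta> * 0 + A * ?Ch * h powr \<beta> + A * (\<integral>y. \<bar>kap y - 1\<bar> \<partial>\<mu>) \<le>
      A * ?Ch * h powr \<beta> + A * (2 * (C0 * real d + L / c0) * h powr \<beta>)"
    using mult_left_mono[OF kap_L1 A] by simp
  also have "\<dots> = A * (?Ch + 2 * (C0 * real d + L / c0)) * h powr \<beta>" by (simp add: algebra_simps)
  finally show ?thesis .
qed

end

end

section \<open>Relaxed Jacobi iteration for the quadratic objective\<close>

text \<open>One recursion serves three families of operators: the empirical \<open>That\<close>, the
  smoothed \<open>Tt\<close> and the exact \<open>Pp\<close>. Comparing iterates is thereby reduced
  to comparing operators.\<close>

fun Gam :: "nat set set => (nat set => real) => (point => real) => (nat set => (point => real) => point => real) =>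
   nat => nat set => point => real" where
  "Gam SS v a T 0 S = (\<lambda>_. 0)"
| "Gam SS v a T (Suc m) S = (\<lambda>x. (1 - 1 / real (card SS)) * Gam SS v a T m S x +
     1 / real (card SS) * (a x - (\<Sum>U\<in>SS - {S}. v U * T U (Gam SS v a T m U) x)))"

text \<open>A seminorm given as the relation "at most", so that measurability and boundedness can be
  built into it. The instances are the sup norm, a Hoelder norm, the L1 norm and the maximum over
  the sample points.\<close>

locale seminorm_like =
  fixes N :: "(point => real) => real => bool"
  assumes N_zero: "N (\<lambda>_. 0) 0"
    and N_add: "N g A ==> N g' B ==> N (\<lambda>x. g x + g' x) (A + B)"
    and N_scale: "N g A ==> N (\<lambda>x. c * g x) (\<bar>c\<bar> * A)"
    and N_mono: "N g A ==> A \<le> B ==> N g B"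
begin

lemma N_sum:
  assumes "finite I" "\<And>i. i \<in> I ==> N (g i) B"
  shows "N (\<lambda>x. \<Sum>i\<in>I. g i x) (real (card I) * B)"
  using assms
proof (induction rule: finite_induct)
  case (insert i I)
  have "N (\<lambda>x. g i x + (\<Sum>i\<in>I. g i x)) (B + real (card I) * B)"
    using insert by (intro N_add) auto
  then show ?case using insert by (simp add: algebra_simps)
qed (simp add: N_zero)

text \<open>The relaxation factor turns the sum into something smaller than an average, so growth
  rates do not depend on the number of sets in \<open>SS\<close>.\<close>

lemma N_weighted_sum:
  assumes SS: "finite SS" "S \<in> SS" and v: "\<And>U. U \<in> SS ==> 0 \<le> v U \<and> v U \<le> 1"
    and g: "\<And>U. U \<in> SS ==> N (g U) B" and B: "0 \<le> B"
  shows "N (\<lambda>x. - (1 / real (card SS)) * (\<Sum>U\<in>SS - {S}. v U * g U x)) B"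
proof -
  have "N (\<lambda>x. \<Sum>U\<in>SS - {S}. v U * g U x) (real (card (SS - {S})) * B)"
  proof (intro N_sum)
    fix U assume U: "U \<in> SS - {S}"
    have "\<bar>v U\<bar> * B \<le> B" using v[of U] U B by (simp add: mult_left_le_one_le)
    with N_scale[OF g[of U], of "v U"] U show "N (\<lambda>x. v U * g U x) B" by (auto elim: N_mono)
  qed (use SS in auto)
  from N_scale[OF this, of "- (1 / real (card SS))"] show ?thesis
  proof (rule N_mono)
    have "real (card (SS - {S})) * B \<le> real (card SS) * B"
      using SS B by (intro mult_right_mono) (auto intro: card_mono)
    then show "\<bar>- (1 / real (card SS))\<bar> * (real (card (SS - {S})) * B) \<le> B"
      using SS card_gt_0_iff[of SS] by (auto simp: divide_le_eq mult.commute)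
  qed
qed

text \<open>One step maps a bound \<open>G\<close> to at most \<open>G + A + C * G\<close>: the
  retained iterate, the source \<open>a\<close> and the operators. As \<open>A \<le> G\<close>, the
  factor per step is \<open>2 + C\<close>.\<close>

lemma Gam_le:
  assumes SS: "finite SS" and v: "\<And>U. U \<in> SS ==> 0 \<le> v U \<and> v U \<le> 1"
    and a: "N a A" "0 \<le> A" and C: "0 \<le> C"
    and T: "\<And>U g B. U \<in> SS ==> 0 \<le> B ==> N g B ==> N (T U g) (C * B)"
  shows "S \<in> SS ==> N (Gam SS v a T m S) (A * (2 + C) ^ m)"
proof (induction m arbitrary: S)
  case 0
  show ?case using N_mono[OF N_zero, of A] a by simp
next
  case (Suc m)
  let ?e = "1 / real (card SS)" let ?G = "A * (2 + C) ^ m"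
  have "0 < card SS" using Suc.prems SS by (auto simp: card_gt_0_iff)
  then have c: "1 \<le> real (card SS)" by linarith
  then have e: "0 \<le> ?e" "?e \<le> 1" by auto
  have G: "0 \<le> ?G" using a C by simp
  have 1: "N (\<lambda>x. (1 - ?e) * Gam SS v a T m S x) ?G"
    using e G by (intro N_mono[OF N_scale[OF Suc.IH[OF Suc.prems]]]) (simp add: mult_left_le_one_le)
  have 2: "N (\<lambda>x. ?e * a x) A"
    using mult_right_mono[OF e(2) a(2)] e by (intro N_mono[OF N_scale[OF a(1)]]) simp
  have 3: "N (\<lambda>x. - ?e * (\<Sum>U\<in>SS - {S}. v U * T U (Gam SS v a T m U) x)) (C * ?G)"
  proof (rule N_weighted_sum[OF SS Suc.prems v])
    show "N (T U (Gam SS v a T m U)) (C * ?G)" if "U \<in> SS" for U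
      by (rule T[OF that G Suc.IH[OF that]])
    show "0 \<le> C * ?G" using C G by simp
  qed
  have all: "N (\<lambda>x. (1 - ?e) * Gam SS v a T m S x + (?e * a x + - ?e * (\<Sum>U\<in>SS - {S}. v U * T U (Gam SS v a T m U) x)))
     (?G + (A + C * ?G))"
    by (rule N_add[OF 1 N_add[OF 2 3]])
  have eq: "(\<lambda>x. (1 - ?e) * Gam SS v a T m S x + (?e * a x + - ?e * (\<Sum>U\<in>SS - {S}. v U * T U (Gam SS v a T m U) x))) =
     Gam SS v a T (Suc m) S"
  proof
    have "(1 - e) * g + (e * z + - e * s) = (1 - e) * g + e * (z - s)" for e g z s :: real
      by (simp add: algebra_simps)
    then show "(1 - ?e) * Gam SS v a T m S x + (?e * a x + - ?e * (\<Sum>U\<in>SS - {S}. v U * T U (Gam SS v a T m U) x)) =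
      Gam SS v a T (Suc m) S x" for x
      unfolding Gam.simps .
  qed
  have le: "?G + (A + C * ?G) \<le> A * (2 + C) ^ Suc m"
  proof -
    have "A * 1 \<le> A * (2 + C) ^ m" using a C by (intro mult_left_mono one_le_power) auto
    then show ?thesis by (simp add: algebra_simps)
  qed
  show ?case using N_mono[OF all le] unfolding eq .
qed

text \<open>The same growth argument with the consistency error \<open>\<tau>\<close> in the place
  of \<open>a\<close>, which cancels in the difference.\<close>

lemma Gam_diff_le:
  assumes SS: "finite SS" and v: "\<And>U. U \<in> SS ==> 0 \<le> v U \<and> v U \<le> 1"
    and \<tau>: "0 \<le> \<tau>" and C: "0 \<le> C"
    and step: "\<And>m U e. m < M ==> U \<in> SS ==> 0 \<le> e ==> N (\<lambda>x. Gam SS v a T m U x - Gam SS v a T' m U x) e ==>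
      N (\<lambda>x. T U (Gam SS v a T m U) x - T' U (Gam SS v a T' m U) x) (C * e + \<tau>)"
  shows "m \<le> M ==> S \<in> SS ==> N (\<lambda>x. Gam SS v a T m S x - Gam SS v a T' m S x) (\<tau> * (2 + C) ^ m)"
proof (induction m arbitrary: S)
  case 0
  show ?case using N_mono[OF N_zero, of \<tau>] \<tau> by simp
next
  case (Suc m)
  let ?e = "1 / real (card SS)" let ?G = "\<tau> * (2 + C) ^ m"
  have "0 < card SS" using Suc.prems SS by (auto simp: card_gt_0_iff)
  then have c: "1 \<le> real (card SS)" by linarith
  then have e: "0 \<le> ?e" "?e \<le> 1" by auto
  have G: "0 \<le> ?G" using \<tau> C by simp
  have IH: "N (\<lambda>x. Gam SS v a T m S x - Gam SS v a T' m S x) ?G" if "S \<in> SS" for S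
    using Suc.IH[of S] that Suc.prems by simp
  have 1: "N (\<lambda>x. (1 - ?e) * (Gam SS v a T m S x - Gam SS v a T' m S x)) ?G"
    using e G by (intro N_mono[OF N_scale[OF IH[OF Suc.prems(2)]]]) (simp add: mult_left_le_one_le)
  have 3: "N (\<lambda>x. - ?e * (\<Sum>U\<in>SS - {S}. v U * (T U (Gam SS v a T m U) x - T' U (Gam SS v a T' m U) x))) (C * ?G + \<tau>)"
  proof (rule N_weighted_sum[OF SS Suc.prems(2) v])
    show "N (\<lambda>x. T U (Gam SS v a T m U) x - T' U (Gam SS v a T' m U) x) (C * ?G + \<tau>)" if "U \<in> SS" for U
      using Suc.prems(1) by (intro step[OF _ that G IH[OF that]]) simp
    show "0 \<le> C * ?G + \<tau>" using C G \<tau> by simp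
  qed
  have all: "N (\<lambda>x. (1 - ?e) * (Gam SS v a T m S x - Gam SS v a T' m S x) +
      - ?e * (\<Sum>U\<in>SS - {S}. v U * (T U (Gam SS v a T m U) x - T' U (Gam SS v a T' m U) x))) (?G + (C * ?G + \<tau>))"
    by (rule N_add[OF 1 3])
  have eq: "(\<lambda>x. (1 - ?e) * (Gam SS v a T m S x - Gam SS v a T' m S x) +
      - ?e * (\<Sum>U\<in>SS - {S}. v U * (T U (Gam SS v a T m U) x - T' U (Gam SS v a T' m U) x))) =
     (\<lambda>x. Gam SS v a T (Suc m) S x - Gam SS v a T' (Suc m) S x)"
  proof
    fix x
    have eq: "(\<Sum>U\<in>SS - {S}. v U * (T U (Gam SS v a T m U) x - T' U (Gam SS v a T' m U) x)) =
      (\<Sum>U\<in>SS - {S}. v U * T U (Gam SS v a T m U) x) - (\<Sum>U\<in>SS - {S}. v U * T' U (Gam SS v a T' m U) x)"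
      by (simp add: right_diff_distrib sum_subtractf)
    have "(1 - e) * (p - q) + - e * (s - t) = ((1 - e) * p + e * (z - s)) - ((1 - e) * q + e * (z - t))" for e p q s t z :: real
      by (simp add: algebra_simps)
    then show "(1 - ?e) * (Gam SS v a T m S x - Gam SS v a T' m S x) +
      - ?e * (\<Sum>U\<in>SS - {S}. v U * (T U (Gam SS v a T m U) x - T' U (Gam SS v a T' m U) x)) =
      Gam SS v a T (Suc m) S x - Gam SS v a T' (Suc m) S x"
      unfolding eq Gam.simps .
  qed
  have le: "?G + (C * ?G + \<tau>) \<le> \<tau> * (2 + C) ^ Suc m"
  proof -
    have "\<tau> * 1 \<le> \<tau> * (2 + C) ^ m" using \<tau> C by (intro mult_left_mono one_le_power) auto
    then show ?thesis by (simp add: algebra_simps)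
  qed
  show ?case using N_mono[OF all le] unfolding eq .
qed

end

section \<open>Square integrable functions and descent for the quadratic objective\<close>

context dens begin

definition sq :: "(point => real) => bool" where
  "sq u \<longleftrightarrow> u \<in> bor d \<and> integrable \<mu> (\<lambda>x. (u x)\<^sup>2)"

lemma sq_meas: "sq u ==> u \<in> bor d" by (simp add: sq_def)

lemma sq_mult: assumes "sq u" "sq w" shows "integrable \<mu> (\<lambda>x. u x * w x)"
proof (rule Bochner_Integration.integrable_bound)
  show "integrable \<mu> (\<lambda>x. (u x)\<^sup>2 + (w x)\<^sup>2)" using assms by (simp add: sq_def)
  show "(\<lambda>x. u x * w x) \<in> borel_measurable \<mu>" using assms[THEN sq_meas] by simp
  show "AE x in \<mu>. norm (u x * w x) \<le> norm ((u x)\<^sup>2 + (w x)\<^sup>2)"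
  proof (intro AE_I2)
    fix x
    have "2 * (\<bar>u x\<bar> * \<bar>w x\<bar>) \<le> (u x)\<^sup>2 + (w x)\<^sup>2"
      using sum_squares_bound[of "\<bar>u x\<bar>" "\<bar>w x\<bar>"] by simp
    moreover have "0 \<le> \<bar>u x\<bar> * \<bar>w x\<bar>" by simp
    ultimately show "norm (u x * w x) \<le> norm ((u x)\<^sup>2 + (w x)\<^sup>2)" unfolding real_norm_def abs_mult by linarith
  qed
qed

lemma sq_add: assumes "sq u" "sq w" shows "sq (\<lambda>x. u x + w x)"
proof -
  have "integrable \<mu> (\<lambda>x. (u x)\<^sup>2 + (w x)\<^sup>2 + 2 * (u x * w x))"
    using assms sq_mult[OF assms] by (simp add: sq_def)
  moreover have "(\<lambda>x. u x + w x) \<in> bor d"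
    using assms[THEN sq_meas] by (rule borel_measurable_add)
  ultimately show ?thesis by (simp add: sq_def power2_sum mult_ac)
qed

lemma sq_cmult: assumes "sq u" shows "sq (\<lambda>x. c * u x)"
  using assms borel_measurable_times[OF borel_measurable_const[of c] sq_meas[OF assms]]
  by (simp add: sq_def power_mult_distrib)

lemma sq_diff: assumes "sq u" "sq w" shows "sq (\<lambda>x. u x - w x)"
  using sq_add[OF assms(1) sq_cmult[OF assms(2), of "-1"]] by simp

lemma sq_bdd: "u \<in> bor d ==> (\<And>x. x \<in> unit_cube d ==> \<bar>u x\<bar> \<le> B) ==> sq u"
proof -
  assume u: "u \<in> bor d" "\<And>x. x \<in> unit_cube d ==> \<bar>u x\<bar> \<le> B"
  have "\<bar>(u x)\<^sup>2\<bar> \<le> B\<^sup>2" if "x \<in> unit_cube d" for x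
    using power_mono[OF u(2)[OF that] abs_ge_zero, of 2] by simp
  then have "integrable \<mu> (\<lambda>x. (u x)\<^sup>2)" using u(1) by (intro integrable_bdd) auto
  with u(1) show "sq u" by (simp add: sq_def)
qed

lemma sq_sum: "finite I ==> (\<And>i. i \<in> I ==> sq (u i)) ==> sq (\<lambda>x. \<Sum>i\<in>I. u i x)"
proof (induction rule: finite_induct)
  case empty
  show ?case by (simp add: sq_def)
next
  case (insert i I)
  then show ?case using sq_add[of "u i" "\<lambda>x. \<Sum>i\<in>I. u i x"] by simp
qed

lemma sq_integrable: "sq u ==> integrable \<mu> u"
  using sq_mult[of u "\<lambda>_. 1"] by (simp add: sq_def)

text \<open>The objective with the variance replaced by a second moment. The two agree when
  \<open>b\<close> is the centred \<open>a\<close> and all components of \<open>\<alpha>\<close>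
  have mean zero.\<close>

definition Lob :: "nat set set => (nat set => real) => (point => real) => (nat set => point => real) => real" where
  "Lob SS lam b \<alpha> = (\<integral>x. (b x - (\<Sum>S\<in>SS. \<alpha> S x))\<^sup>2 \<partial>\<mu>) + (\<Sum>S\<in>SS. 1 / lam S * (\<integral>x. (\<alpha> S x)\<^sup>2 \<partial>\<mu>))"

text \<open>The exact second order expansion in direction \<open>\<epsilon>\<close>. The hypothesis
  \<open>opt\<close> is the normal equation of the blockwise minimiser \<open>w S\<close>, tested
  against \<open>\<epsilon> S\<close> only; it turns the linear term into an inner product with
  \<open>w S - \<alpha> S\<close>.\<close>

lemma Lob_expand:
  assumes SS: "finite SS" and b: "sq b"
    and \<alpha>: "\<And>S. S \<in> SS ==> sq (\<alpha> S)" and \<epsilon>: "\<And>S. S \<in> SS ==> sq (\<epsilon> S)" and w: "\<And>S. S \<in> SS ==> sq (w S)"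
    and opt: "\<And>S. S \<in> SS ==> (\<integral>x. (b x - (\<Sum>U\<in>SS - {S}. \<alpha> U x)) * \<epsilon> S x \<partial>\<mu>) = (1 + 1 / lam S) * (\<integral>x. w S x * \<epsilon> S x \<partial>\<mu>)"
  shows "Lob SS lam b (\<lambda>S x. \<alpha> S x + \<epsilon> S x) - Lob SS lam b \<alpha> =
    (\<Sum>S\<in>SS. 1 / lam S * (\<integral>x. (\<epsilon> S x)\<^sup>2 \<partial>\<mu>) - 2 * (1 + 1 / lam S) * (\<integral>x. (w S x - \<alpha> S x) * \<epsilon> S x \<partial>\<mu>))
    + (\<integral>x. (\<Sum>S\<in>SS. \<epsilon> S x)\<^sup>2 \<partial>\<mu>)"
proof -
  let ?A = "\<lambda>x. \<Sum>S\<in>SS. \<alpha> S x" let ?E = "\<lambda>x. \<Sum>S\<in>SS. \<epsilon> S x"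
  have sA: "sq ?A" and sE: "sq ?E" using sq_sum[OF SS] \<alpha> \<epsilon> by auto
  have sbA: "sq (\<lambda>x. b x - ?A x)" by (rule sq_diff[OF b sA])
  have 1: "(\<integral>x. (b x - (\<Sum>S\<in>SS. \<alpha> S x + \<epsilon> S x))\<^sup>2 \<partial>\<mu>) =
      (\<integral>x. (b x - ?A x)\<^sup>2 \<partial>\<mu>) - 2 * (\<integral>x. (b x - ?A x) * ?E x \<partial>\<mu>) + (\<integral>x. (?E x)\<^sup>2 \<partial>\<mu>)"
  proof -
    have "(\<integral>x. (b x - (\<Sum>S\<in>SS. \<alpha> S x + \<epsilon> S x))\<^sup>2 \<partial>\<mu>) =
        (\<integral>x. (b x - ?A x)\<^sup>2 - 2 * ((b x - ?A x) * ?E x) + (?E x)\<^sup>2 \<partial>\<mu>)"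
      by (intro Bochner_Integration.integral_cong refl) (simp add: sum.distrib power2_eq_square algebra_simps)
    also have "\<dots> = (\<integral>x. (b x - ?A x)\<^sup>2 \<partial>\<mu>) - (\<integral>x. 2 * ((b x - ?A x) * ?E x) \<partial>\<mu>) + (\<integral>x. (?E x)\<^sup>2 \<partial>\<mu>)"
    proof -
      have i1: "integrable \<mu> (\<lambda>x. (b x - ?A x)\<^sup>2)" using sbA by (simp add: sq_def)
      have i2: "integrable \<mu> (\<lambda>x. 2 * ((b x - ?A x) * ?E x))" using sq_mult[OF sbA sE] by simp
      have i3: "integrable \<mu> (\<lambda>x. (?E x)\<^sup>2)" using sE by (simp add: sq_def)
      show ?thesis
        using Bochner_Integration.integral_add[OF Bochner_Integration.integrable_diff[OF i1 i2] i3]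
          Bochner_Integration.integral_diff[OF i1 i2] by simp
    qed
    finally show ?thesis by simp
  qed
  have 2: "(\<integral>x. (b x - ?A x) * ?E x \<partial>\<mu>) = (\<Sum>S\<in>SS. (1 + 1 / lam S) * (\<integral>x. w S x * \<epsilon> S x \<partial>\<mu>) - (\<integral>x. \<alpha> S x * \<epsilon> S x \<partial>\<mu>))"
  proof -
    have "(\<integral>x. (b x - ?A x) * ?E x \<partial>\<mu>) = (\<integral>x. (\<Sum>S\<in>SS. (b x - ?A x) * \<epsilon> S x) \<partial>\<mu>)"
      by (simp add: sum_distrib_left)
    also have "\<dots> = (\<Sum>S\<in>SS. (\<integral>x. (b x - ?A x) * \<epsilon> S x \<partial>\<mu>))"
      using sq_mult[OF sbA \<epsilon>] by (intro Bochner_Integration.integral_sum) auto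
    also have "\<dots> = (\<Sum>S\<in>SS. (1 + 1 / lam S) * (\<integral>x. w S x * \<epsilon> S x \<partial>\<mu>) - (\<integral>x. \<alpha> S x * \<epsilon> S x \<partial>\<mu>))"
    proof (intro sum.cong refl)
      fix S assume S: "S \<in> SS"
      have sr: "sq (\<lambda>x. b x - (\<Sum>U\<in>SS - {S}. \<alpha> U x))"
        using SS \<alpha> by (intro sq_diff[OF b] sq_sum) auto
      have "(\<integral>x. (b x - ?A x) * \<epsilon> S x \<partial>\<mu>) = (\<integral>x. (b x - (\<Sum>U\<in>SS - {S}. \<alpha> U x)) * \<epsilon> S x - \<alpha> S x * \<epsilon> S x \<partial>\<mu>)"
        using SS S by (intro Bochner_Integration.integral_cong refl) (simp add: sum.remove[OF SS S] algebra_simps)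
      also have "\<dots> = (\<integral>x. (b x - (\<Sum>U\<in>SS - {S}. \<alpha> U x)) * \<epsilon> S x \<partial>\<mu>) - (\<integral>x. \<alpha> S x * \<epsilon> S x \<partial>\<mu>)"
        by (rule Bochner_Integration.integral_diff[OF sq_mult[OF sr \<epsilon>[OF S]] sq_mult[OF \<alpha>[OF S] \<epsilon>[OF S]]])
      finally show "(\<integral>x. (b x - ?A x) * \<epsilon> S x \<partial>\<mu>) = (1 + 1 / lam S) * (\<integral>x. w S x * \<epsilon> S x \<partial>\<mu>) - (\<integral>x. \<alpha> S x * \<epsilon> S x \<partial>\<mu>)"
        using opt[OF S] by simp
    qed
    finally show ?thesis .
  qed
  have 3: "(\<integral>x. (\<alpha> S x + \<epsilon> S x)\<^sup>2 \<partial>\<mu>) = (\<integral>x. (\<alpha> S x)\<^sup>2 \<partial>\<mu>) + 2 * (\<integral>x. \<alpha> S x * \<epsilon> S x \<partial>\<mu>) + (\<integral>x. (\<epsilon> S x)\<^sup>2 \<partial>\<mu>)"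
    if S: "S \<in> SS" for S
  proof -
    have i1: "integrable \<mu> (\<lambda>x. (\<alpha> S x)\<^sup>2)" "integrable \<mu> (\<lambda>x. (\<epsilon> S x)\<^sup>2)" using \<alpha>[OF S] \<epsilon>[OF S] by (simp_all add: sq_def)
    have i2: "integrable \<mu> (\<lambda>x. 2 * (\<alpha> S x * \<epsilon> S x))" using sq_mult[OF \<alpha>[OF S] \<epsilon>[OF S]] by simp
    have "(\<integral>x. (\<alpha> S x + \<epsilon> S x)\<^sup>2 \<partial>\<mu>) = (\<integral>x. (\<alpha> S x)\<^sup>2 + 2 * (\<alpha> S x * \<epsilon> S x) + (\<epsilon> S x)\<^sup>2 \<partial>\<mu>)"
      by (intro Bochner_Integration.integral_cong refl) (simp add: power2_eq_square algebra_simps)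
    also have "\<dots> = (\<integral>x. (\<alpha> S x)\<^sup>2 \<partial>\<mu>) + (\<integral>x. 2 * (\<alpha> S x * \<epsilon> S x) \<partial>\<mu>) + (\<integral>x. (\<epsilon> S x)\<^sup>2 \<partial>\<mu>)"
      using Bochner_Integration.integral_add[OF Bochner_Integration.integrable_add[OF i1(1) i2] i1(2)]
        Bochner_Integration.integral_add[OF i1(1) i2] by simp
    finally show ?thesis by simp
  qed
  have 4: "(\<integral>x. (w S x - \<alpha> S x) * \<epsilon> S x \<partial>\<mu>) = (\<integral>x. w S x * \<epsilon> S x \<partial>\<mu>) - (\<integral>x. \<alpha> S x * \<epsilon> S x \<partial>\<mu>)" if S: "S \<in> SS" for S
    unfolding left_diff_distrib
    by (rule Bochner_Integration.integral_diff[OF sq_mult[OF w[OF S] \<epsilon>[OF S]] sq_mult[OF \<alpha>[OF S] \<epsilon>[OF S]]])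
  have "Lob SS lam b (\<lambda>S x. \<alpha> S x + \<epsilon> S x) - Lob SS lam b \<alpha> =
    (\<integral>x. (?E x)\<^sup>2 \<partial>\<mu>) - 2 * (\<Sum>S\<in>SS. (1 + 1 / lam S) * (\<integral>x. w S x * \<epsilon> S x \<partial>\<mu>) - (\<integral>x. \<alpha> S x * \<epsilon> S x \<partial>\<mu>))
    + ((\<Sum>S\<in>SS. 1 / lam S * ((\<integral>x. (\<alpha> S x)\<^sup>2 \<partial>\<mu>) + 2 * (\<integral>x. \<alpha> S x * \<epsilon> S x \<partial>\<mu>) + (\<integral>x. (\<epsilon> S x)\<^sup>2 \<partial>\<mu>)))
       - (\<Sum>S\<in>SS. 1 / lam S * (\<integral>x. (\<alpha> S x)\<^sup>2 \<partial>\<mu>)))"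
    unfolding Lob_def 1 2 using 3 by simp
  also have "\<dots> = (\<Sum>S\<in>SS. 1 / lam S * (\<integral>x. (\<epsilon> S x)\<^sup>2 \<partial>\<mu>) - 2 * (1 + 1 / lam S) * (\<integral>x. (w S x - \<alpha> S x) * \<epsilon> S x \<partial>\<mu>))
    + (\<integral>x. (?E x)\<^sup>2 \<partial>\<mu>)"
  proof -
    have "(\<Sum>S\<in>SS. 1 / lam S * (\<integral>x. (\<epsilon> S x)\<^sup>2 \<partial>\<mu>) - 2 * (1 + 1 / lam S) * (\<integral>x. (w S x - \<alpha> S x) * \<epsilon> S x \<partial>\<mu>)) =
      (\<Sum>S\<in>SS. 1 / lam S * (\<integral>x. (\<epsilon> S x)\<^sup>2 \<partial>\<mu>) - 2 * (1 + 1 / lam S) * ((\<integral>x. w S x * \<epsilon> S x \<partial>\<mu>) - (\<integral>x. \<alpha> S x * \<epsilon> S x \<partial>\<mu>)))"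
      using 4 by simp
    then show ?thesis
      by (simp add: sum_distrib_left sum_subtractf[symmetric] sum.distrib[symmetric] del: sum.distrib)
         (intro sum.cong refl, simp add: algebra_simps add_divide_distrib)
  qed
  finally show ?thesis .
qed

text \<open>One damped Jacobi step contracts the gap to any competitor: the gap is controlled by the weighted
  distance from \<open>\<alpha>\<close> to its coordinatewise minimisers \<open>w\<close>, which is also what the step gains.\<close>

lemma Lob_descent:
  assumes SS: "finite SS" "SS \<noteq> {}" and b: "sq b" and lam: "\<And>S. S \<in> SS ==> 0 < lam S \<and> lam S \<le> \<Lambda>"
    and \<alpha>: "\<And>S. S \<in> SS ==> sq (\<alpha> S)" and \<beta>: "\<And>S. S \<in> SS ==> sq (\<beta> S)" and w: "\<And>S. S \<in> SS ==> sq (w S)"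
    and opt1: "\<And>S. S \<in> SS ==> (\<integral>x. (b x - (\<Sum>U\<in>SS - {S}. \<alpha> U x)) * (w S x - \<alpha> S x) \<partial>\<mu>) =
      (1 + 1 / lam S) * (\<integral>x. w S x * (w S x - \<alpha> S x) \<partial>\<mu>)"
    and opt2: "\<And>S. S \<in> SS ==> (\<integral>x. (b x - (\<Sum>U\<in>SS - {S}. \<alpha> U x)) * (\<beta> S x - \<alpha> S x) \<partial>\<mu>) =
      (1 + 1 / lam S) * (\<integral>x. w S x * (\<beta> S x - \<alpha> S x) \<partial>\<mu>)"
  defines "\<eta> \<equiv> 1 / real (card SS)"
  shows "Lob SS lam b (\<lambda>S x. \<alpha> S x + \<eta> * (w S x - \<alpha> S x)) - Lob SS lam b \<beta> \<le>
    (1 - \<eta> / (1 + \<Lambda>)) * (Lob SS lam b \<alpha> - Lob SS lam b \<beta>)"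
proof -
  let ?\<delta> = "\<lambda>S x. w S x - \<alpha> S x"
  let ?D = "\<Sum>S\<in>SS. (1 + 1 / lam S) * (\<integral>x. (?\<delta> S x)\<^sup>2 \<partial>\<mu>)"
  have \<delta>: "sq (?\<delta> S)" if "S \<in> SS" for S using sq_diff w \<alpha> that by auto
  have "0 < card SS" using SS by (auto simp: card_gt_0_iff)
  then have s: "1 \<le> real (card SS)" by linarith
  then have \<eta>: "0 < \<eta>" "\<eta> * real (card SS) = 1" by (auto simp: \<eta>_def)
  obtain S0 where "S0 \<in> SS" using SS by auto
  then have \<Lambda>: "0 < \<Lambda>" using lam[of S0] by auto
  have g1: "Lob SS lam b (\<lambda>S x. \<alpha> S x + \<eta> * ?\<delta> S x) - Lob SS lam b \<alpha> \<le> - \<eta> * ?D"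
  proof -
    have "Lob SS lam b (\<lambda>S x. \<alpha> S x + \<eta> * ?\<delta> S x) - Lob SS lam b \<alpha> =
      (\<Sum>S\<in>SS. 1 / lam S * (\<integral>x. (\<eta> * ?\<delta> S x)\<^sup>2 \<partial>\<mu>) - 2 * (1 + 1 / lam S) * (\<integral>x. ?\<delta> S x * (\<eta> * ?\<delta> S x) \<partial>\<mu>))
      + (\<integral>x. (\<Sum>S\<in>SS. \<eta> * ?\<delta> S x)\<^sup>2 \<partial>\<mu>)"
    proof (rule Lob_expand[OF SS(1) b \<alpha> _ w])
      fix S assume S: "S \<in> SS"
      show "sq (\<lambda>x. \<eta> * ?\<delta> S x)" by (rule sq_cmult[OF \<delta>[OF S]])
      have "(\<integral>x. (b x - (\<Sum>U\<in>SS - {S}. \<alpha> U x)) * (\<eta> * ?\<delta> S x) \<partial>\<mu>) = \<eta> * (\<integral>x. (b x - (\<Sum>U\<in>SS - {S}. \<alpha> U x)) * ?\<delta> S x \<partial>\<mu>)"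
        by (simp only: mult.left_commute[of _ \<eta>] integral_mult_right_zero)
      also have "\<dots> = (1 + 1 / lam S) * (\<integral>x. w S x * (\<eta> * ?\<delta> S x) \<partial>\<mu>)"
        unfolding opt1[OF S] by (simp only: mult.left_commute[of _ \<eta>] integral_mult_right_zero)
      finally show "(\<integral>x. (b x - (\<Sum>U\<in>SS - {S}. \<alpha> U x)) * (\<eta> * ?\<delta> S x) \<partial>\<mu>) = (1 + 1 / lam S) * (\<integral>x. w S x * (\<eta> * ?\<delta> S x) \<partial>\<mu>)" .
    qed
    also have "\<dots> = (\<Sum>S\<in>SS. \<eta>\<^sup>2 * (1 / lam S * (\<integral>x. (?\<delta> S x)\<^sup>2 \<partial>\<mu>)) - 2 * \<eta> * ((1 + 1 / lam S) * (\<integral>x. (?\<delta> S x)\<^sup>2 \<partial>\<mu>)))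
      + (\<integral>x. \<eta>\<^sup>2 * (\<Sum>S\<in>SS. ?\<delta> S x)\<^sup>2 \<partial>\<mu>)"
    proof -
      have t1: "(\<integral>x. ?\<delta> S x * (\<eta> * ?\<delta> S x) \<partial>\<mu>) = \<eta> * (\<integral>x. (?\<delta> S x)\<^sup>2 \<partial>\<mu>)" for S
        by (simp only: mult.left_commute[of _ \<eta>] integral_mult_right_zero power2_eq_square)
      have t2: "(\<integral>x. (\<eta> * ?\<delta> S x)\<^sup>2 \<partial>\<mu>) = \<eta>\<^sup>2 * (\<integral>x. (?\<delta> S x)\<^sup>2 \<partial>\<mu>)" for S
        by (simp only: power_mult_distrib integral_mult_right_zero)
      have t3: "(\<Sum>S\<in>SS. \<eta> * ?\<delta> S x)\<^sup>2 = \<eta>\<^sup>2 * (\<Sum>S\<in>SS. ?\<delta> S x)\<^sup>2" for x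
        by (simp add: sum_distrib_left[symmetric] power_mult_distrib)
      show ?thesis unfolding t1 t2 t3 by (simp only: mult_ac)
    qed
    \<comment> \<open>Updating all blocks at once creates cross terms. By Cauchy-Schwarz they cost a
      factor \<open>card SS\<close>, which the damping absorbs because
      \<open>\<eta>\<^sup>2 * card SS = \<eta>\<close>.\<close>
    also have "(\<integral>x. \<eta>\<^sup>2 * (\<Sum>S\<in>SS. ?\<delta> S x)\<^sup>2 \<partial>\<mu>) \<le> (\<integral>x. \<eta>\<^sup>2 * (real (card SS) * (\<Sum>S\<in>SS. (?\<delta> S x)\<^sup>2)) \<partial>\<mu>)"
    proof (intro integral_mono integrable_mult_right Bochner_Integration.integrable_sum)
      show "integrable \<mu> (\<lambda>x. (\<Sum>S\<in>SS. ?\<delta> S x)\<^sup>2)" using sq_sum[OF SS(1), of ?\<delta>] \<delta> by (auto simp: sq_def)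
      show "integrable \<mu> (\<lambda>x. (?\<delta> S x)\<^sup>2)" if "S \<in> SS" for S using \<delta>[OF that] by (simp add: sq_def)
      show "\<eta>\<^sup>2 * (\<Sum>S\<in>SS. ?\<delta> S x)\<^sup>2 \<le> \<eta>\<^sup>2 * (real (card SS) * (\<Sum>S\<in>SS. (?\<delta> S x)\<^sup>2))" for x
        using sum_squared_le_sum_of_squares[of "\<lambda>S. ?\<delta> S x" SS]
        by (intro mult_left_mono) (auto simp: mult.commute)
    qed
    also have "\<dots> = \<eta>\<^sup>2 * (real (card SS) * (\<Sum>S\<in>SS. (\<integral>x. (?\<delta> S x)\<^sup>2 \<partial>\<mu>)))"
      using \<delta> by (simp only: integral_mult_right_zero) (subst Bochner_Integration.integral_sum, auto simp: sq_def)
    also have "\<dots> = (\<Sum>S\<in>SS. \<eta> * (\<integral>x. (?\<delta> S x)\<^sup>2 \<partial>\<mu>))"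
    proof -
      have "\<eta>\<^sup>2 * real (card SS) = \<eta>" using \<eta> by (simp add: power2_eq_square mult.assoc)
      then show ?thesis by (simp add: sum_distrib_left[symmetric] mult.assoc[symmetric])
    qed
    also have "(\<Sum>S\<in>SS. \<eta>\<^sup>2 * (1 / lam S * (\<integral>x. (?\<delta> S x)\<^sup>2 \<partial>\<mu>)) - 2 * \<eta> * ((1 + 1 / lam S) * (\<integral>x. (?\<delta> S x)\<^sup>2 \<partial>\<mu>))) +
       (\<Sum>S\<in>SS. \<eta> * (\<integral>x. (?\<delta> S x)\<^sup>2 \<partial>\<mu>)) \<le> - \<eta> * ?D"
      unfolding sum.distrib[symmetric] sum_distrib_left
    proof (rule sum_mono)
      fix S assume S: "S \<in> SS"
      let ?q = "\<integral>x. (?\<delta> S x)\<^sup>2 \<partial>\<mu>"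
      have q: "0 \<le> 1 / lam S * ?q" using lam[OF S] by simp
      have "\<eta> * \<eta> \<le> \<eta> * 1" using \<eta> s by (intro mult_left_mono) (auto simp: \<eta>_def)
      then have "\<eta>\<^sup>2 * (1 / lam S * ?q) \<le> \<eta> * (1 / lam S * ?q)" using q by (intro mult_right_mono) (auto simp: power2_eq_square)
      moreover have "(1 + 1 / lam S) * ?q = ?q + 1 / lam S * ?q" by (simp add: algebra_simps)
      ultimately show "\<eta>\<^sup>2 * (1 / lam S * ?q) - 2 * \<eta> * ((1 + 1 / lam S) * ?q) + \<eta> * ?q \<le> - \<eta> * ((1 + 1 / lam S) * ?q)"
        by (simp add: distrib_left mult.assoc)
    qed
    finally show ?thesis by simp
  qed
  have g2: "Lob SS lam b \<beta> - Lob SS lam b \<alpha> \<ge> - (1 + \<Lambda>) * ?D"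
  proof -
    let ?\<epsilon> = "\<lambda>S x. \<beta> S x - \<alpha> S x"
    have \<epsilon>: "sq (?\<epsilon> S)" if "S \<in> SS" for S using sq_diff \<beta> \<alpha> that by auto
    have e1: "Lob SS lam b (\<lambda>S x. \<alpha> S x + ?\<epsilon> S x) - Lob SS lam b \<alpha> =
      (\<Sum>S\<in>SS. 1 / lam S * (\<integral>x. (?\<epsilon> S x)\<^sup>2 \<partial>\<mu>) - 2 * (1 + 1 / lam S) * (\<integral>x. ?\<delta> S x * ?\<epsilon> S x \<partial>\<mu>))
      + (\<integral>x. (\<Sum>S\<in>SS. ?\<epsilon> S x)\<^sup>2 \<partial>\<mu>)"
      by (rule Lob_expand[OF SS(1) b \<alpha> \<epsilon> w opt2])
    have e2: "(\<integral>x. (\<Sum>S\<in>SS. ?\<epsilon> S x)\<^sup>2 \<partial>\<mu>) \<ge> 0" by (intro Bochner_Integration.integral_nonneg) auto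
    have e3: "(\<Sum>S\<in>SS. 1 / lam S * (\<integral>x. (?\<epsilon> S x)\<^sup>2 \<partial>\<mu>) - 2 * (1 + 1 / lam S) * (\<integral>x. ?\<delta> S x * ?\<epsilon> S x \<partial>\<mu>)) \<ge>
       (\<Sum>S\<in>SS. - (1 + \<Lambda>) * ((1 + 1 / lam S) * (\<integral>x. (?\<delta> S x)\<^sup>2 \<partial>\<mu>)))"
    proof (rule sum_mono)
      fix S assume S: "S \<in> SS"
      let ?l = "lam S"
      have l: "0 < ?l" "?l \<le> \<Lambda>" using lam[OF S] by auto
      have i: "integrable \<mu> (\<lambda>x. (?\<epsilon> S x)\<^sup>2)" "integrable \<mu> (\<lambda>x. (?\<delta> S x)\<^sup>2)" "integrable \<mu> (\<lambda>x. ?\<delta> S x * ?\<epsilon> S x)"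
        using \<epsilon>[OF S] \<delta>[OF S] sq_mult[OF \<delta>[OF S] \<epsilon>[OF S]] by (auto simp: sq_def)
      \<comment> \<open>Completing the square in \<open>t\<close>; the quadratic is smallest at
        \<open>t = (1 + lam S) * e\<close>.\<close>
      have pt: "2 * (1 + 1 / ?l) * (e * t) \<le> 1 / ?l * t\<^sup>2 + (1 + \<Lambda>) * (1 + 1 / ?l) * e\<^sup>2" for e t :: real
      proof -
        have "0 \<le> 1 / ?l * (t - (1 + ?l) * e)\<^sup>2" using l by simp
        also have "\<dots> = 1 / ?l * t\<^sup>2 - 2 * (1 + 1 / ?l) * (e * t) + (1 + ?l) * (1 + 1 / ?l) * e\<^sup>2"
          using l by (simp add: field_simps power2_eq_square)
        finally have "2 * (1 + 1 / ?l) * (e * t) \<le> 1 / ?l * t\<^sup>2 + (1 + ?l) * (1 + 1 / ?l) * e\<^sup>2" by linarith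
        moreover have "(1 + ?l) * (1 + 1 / ?l) * e\<^sup>2 \<le> (1 + \<Lambda>) * (1 + 1 / ?l) * e\<^sup>2"
          using l by (intro mult_right_mono) auto
        ultimately show ?thesis by linarith
      qed
      have "(\<integral>x. 2 * (1 + 1 / ?l) * (?\<delta> S x * ?\<epsilon> S x) \<partial>\<mu>) \<le> (\<integral>x. 1 / ?l * (?\<epsilon> S x)\<^sup>2 + (1 + \<Lambda>) * (1 + 1 / ?l) * (?\<delta> S x)\<^sup>2 \<partial>\<mu>)"
      proof (rule integral_mono)
        show "2 * (1 + 1 / ?l) * (?\<delta> S x * ?\<epsilon> S x) \<le> 1 / ?l * (?\<epsilon> S x)\<^sup>2 + (1 + \<Lambda>) * (1 + 1 / ?l) * (?\<delta> S x)\<^sup>2" for x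
          by (rule pt)
        show "integrable \<mu> (\<lambda>x. 2 * (1 + 1 / ?l) * (?\<delta> S x * ?\<epsilon> S x))"
          by (intro integrable_mult_right i)
        show "integrable \<mu> (\<lambda>x. 1 / ?l * (?\<epsilon> S x)\<^sup>2 + (1 + \<Lambda>) * (1 + 1 / ?l) * (?\<delta> S x)\<^sup>2)"
          by (intro Bochner_Integration.integrable_add integrable_mult_right i)
      qed
      also have "\<dots> = 1 / ?l * (\<integral>x. (?\<epsilon> S x)\<^sup>2 \<partial>\<mu>) + (1 + \<Lambda>) * (1 + 1 / ?l) * (\<integral>x. (?\<delta> S x)\<^sup>2 \<partial>\<mu>)"
        using Bochner_Integration.integral_add[OF integrable_mult_right[OF i(1), of "1 / ?l"] integrable_mult_right[OF i(2), of "(1 + \<Lambda>) * (1 + 1 / ?l)"]]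
        by (simp only: integral_mult_right_zero)
      finally have "2 * (1 + 1 / ?l) * (\<integral>x. ?\<delta> S x * ?\<epsilon> S x \<partial>\<mu>) \<le>
         1 / ?l * (\<integral>x. (?\<epsilon> S x)\<^sup>2 \<partial>\<mu>) + (1 + \<Lambda>) * (1 + 1 / ?l) * (\<integral>x. (?\<delta> S x)\<^sup>2 \<partial>\<mu>)"
        by (simp only: integral_mult_right_zero)
      then show "- (1 + \<Lambda>) * ((1 + 1 / ?l) * (\<integral>x. (?\<delta> S x)\<^sup>2 \<partial>\<mu>)) \<le>
         1 / ?l * (\<integral>x. (?\<epsilon> S x)\<^sup>2 \<partial>\<mu>) - 2 * (1 + 1 / ?l) * (\<integral>x. ?\<delta> S x * ?\<epsilon> S x \<partial>\<mu>)"
        by (simp only: mult_minus_left mult.assoc)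
    qed
    have e4: "(\<lambda>S x. \<alpha> S x + ?\<epsilon> S x) = \<beta>" by simp
    show ?thesis using e1[unfolded e4] e2 e3 unfolding sum_distrib_left by linarith
  qed
  let ?X = "Lob SS lam b \<alpha> - Lob SS lam b \<beta>"
  have "?X \<le> (1 + \<Lambda>) * ?D" using g2 by (simp add: algebra_simps)
  then have "?X / (1 + \<Lambda>) \<le> ?D" using \<Lambda> by (simp add: divide_le_eq mult.commute)
  then have 2: "\<eta> * (?X / (1 + \<Lambda>)) \<le> \<eta> * ?D" using \<eta> by (intro mult_left_mono) auto
  define u where "u = \<eta> * ?D"
  have "Lob SS lam b (\<lambda>S x. \<alpha> S x + \<eta> * ?\<delta> S x) - Lob SS lam b \<alpha> \<le> - u"
    using g1 unfolding u_def mult_minus_left .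
  then have "Lob SS lam b (\<lambda>S x. \<alpha> S x + \<eta> * ?\<delta> S x) - Lob SS lam b \<beta> \<le> ?X - \<eta> * (?X / (1 + \<Lambda>))"
    using 2[folded u_def] by linarith
  then show ?thesis by (simp only: left_diff_distrib mult_1_left times_divide_eq_left times_divide_eq_right)
qed

end

lemma dep_on_map: "dep_on d S \<phi> ==> dep_on d S (\<lambda>x. F (\<phi> x))"
  unfolding dep_on_def by metis

lemma dep_on_map2: "dep_on d S \<phi> ==> dep_on d S \<psi> ==> dep_on d S (\<lambda>x. F (\<phi> x) (\<psi> x))"
  unfolding dep_on_def by metis

section \<open>Exact centred conditional expectations\<close>

context dens begin

definition Pp :: "nat set => (point => real) => point => real" where
  "Pp S g x = cex d f S g x - (\<integral>x. g x \<partial>\<mu>)"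

lemma cex_linear:
  assumes S: "S \<subseteq> {1..d}"
    and g: "g \<in> bor d" "\<And>x. x \<in> unit_cube d ==> \<bar>g x\<bar> \<le> B"
    and g': "g' \<in> bor d" "\<And>x. x \<in> unit_cube d ==> \<bar>g' x\<bar> \<le> B'"
  shows "cex d f S (\<lambda>x. c * g x + c' * g' x) x = c * cex d f S g x + c' * cex d f S g' x"
proof -
  have sp: "restrict x S \<in> space (leb S)" by simp
  have "marginal d S (\<lambda>z. (c * g z + c' * g' z) * f z) (restrict x S) =
    (\<integral>u. c * (g (merge S ({1..d} - S) (restrict x S, u)) * f (merge S ({1..d} - S) (restrict x S, u))) +
      c' * (g' (merge S ({1..d} - S) (restrict x S, u)) * f (merge S ({1..d} - S) (restrict x S, u))) \<partial>leb ({1..d} - S))"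
    unfolding marginal_def by (intro Bochner_Integration.integral_cong refl) (simp only: distrib_right mult.assoc)
  also have "\<dots> = c * marginal d S (\<lambda>z. g z * f z) (restrict x S) + c' * marginal d S (\<lambda>z. g' z * f z) (restrict x S)"
    unfolding marginal_def
    using Bochner_Integration.integral_add[OF integrable_mult_right[OF marginal_gf(1)[OF S g sp]]
      integrable_mult_right[OF marginal_gf(1)[OF S g' sp]], of c c']
    by (simp only: integral_mult_right_zero)
  finally show ?thesis unfolding cex_def by (simp add: add_divide_distrib)
qed

lemma Pp_linear:
  assumes S: "S \<subseteq> {1..d}"
    and g: "g \<in> bor d" "\<And>x. x \<in> unit_cube d ==> \<bar>g x\<bar> \<le> B"
    and g': "g' \<in> bor d" "\<And>x. x \<in> unit_cube d ==> \<bar>g' x\<bar> \<le> B'"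
  shows "Pp S (\<lambda>x. c * g x + c' * g' x) x = c * Pp S g x + c' * Pp S g' x"
proof -
  have "(\<integral>x. c * g x + c' * g' x \<partial>\<mu>) = c * (\<integral>x. g x \<partial>\<mu>) + c' * (\<integral>x. g' x \<partial>\<mu>)"
    using Bochner_Integration.integral_add[OF integrable_mult_right[OF integrable_bdd[OF g]]
      integrable_mult_right[OF integrable_bdd[OF g']], of c c'] by (simp only: integral_mult_right_zero)
  with cex_linear[OF assms, of c c' x] show ?thesis by (simp add: Pp_def algebra_simps)
qed

lemma Pp_dep: "dep_on d S (Pp S g)"
  unfolding Pp_def[abs_def] by (rule dep_on_map[OF cex_dep_on])

lemma Pp_zero: "Pp S (\<lambda>_. 0) x = 0"
  by (simp add: Pp_def cex_def marginal_def)

lemma Pp_le: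
  assumes S: "S \<subseteq> {1..d}"
    and g: "g \<in> bor d" "\<And>x. x \<in> unit_cube d ==> \<bar>g x\<bar> \<le> B"
  shows "Pp S g \<in> bor d" "\<bar>Pp S g x\<bar> \<le> 2 * B"
proof -
  show "Pp S g \<in> bor d"
    unfolding Pp_def[abs_def] by (intro borel_measurable_diff cex_measurable[OF S g(1)]) simp
  show "\<bar>Pp S g x\<bar> \<le> 2 * B"
    using cex_le[OF S g, of x] integral_abs_le[OF g(2,1)] by (simp add: Pp_def)
qed

lemma Pp_mean_zero:
  assumes S: "S \<subseteq> {1..d}"
    and g: "g \<in> bor d" "\<And>x. x \<in> unit_cube d ==> \<bar>g x\<bar> \<le> B"
  shows "(\<integral>x. Pp S g x \<partial>\<mu>) = 0"
proof -
  have ci: "integrable \<mu> (cex d f S g)"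
    by (rule integrable_bdd[OF cex_measurable[OF S g(1)] cex_le[OF S g]])
  have "(\<integral>x. cex d f S g x \<partial>\<mu>) = (\<integral>x. g x \<partial>\<mu>)"
  proof -
    have "dep_on d S (\<lambda>_. 1::real)" unfolding dep_on_def by blast
    have "(\<integral>x. 1 * g x \<partial>\<mu>) = (\<integral>x. 1 * cex d f S g x \<partial>\<mu>)"
      by (rule cex_proj[OF S borel_measurable_const \<open>dep_on d S (\<lambda>_. 1)\<close> integrable_const g])
    then show ?thesis by simp
  qed
  then show ?thesis unfolding Pp_def using ci by (simp add: prob_space)
qed

text \<open>Constants are orthogonal to the mean zero \<open>\<epsilon>\<close>, so both the shift
  \<open>t\<close> and the centring inside \<open>Pp\<close> disappear. This is the normal equation
  behind the blockwise minimisers.\<close>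

lemma Pp_adjoint:
  assumes S: "S \<subseteq> {1..d}"
    and g: "g \<in> bor d" "\<And>x. x \<in> unit_cube d ==> \<bar>g x\<bar> \<le> B"
    and \<epsilon>: "sq \<epsilon>" "dep_on d S \<epsilon>" "(\<integral>x. \<epsilon> x \<partial>\<mu>) = 0"
  shows "(\<integral>x. (g x - t) * \<epsilon> x \<partial>\<mu>) = (\<integral>x. Pp S g x * \<epsilon> x \<partial>\<mu>)"
proof -
  have cm: "cex d f S g \<in> bor d" by (rule cex_measurable[OF S g(1)])
  have i: "integrable \<mu> (\<lambda>x. u x * \<epsilon> x)" if "u \<in> bor d" "\<And>x. x \<in> unit_cube d ==> \<bar>u x\<bar> \<le> B" for u
    by (rule sq_mult[OF sq_bdd[OF that] \<epsilon>(1)])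
  have sub: "(\<integral>x. (u x - t) * \<epsilon> x \<partial>\<mu>) = (\<integral>x. u x * \<epsilon> x \<partial>\<mu>)"
    if "u \<in> bor d" "\<And>x. x \<in> unit_cube d ==> \<bar>u x\<bar> \<le> B" for u t
    using Bochner_Integration.integral_diff[OF i[OF that] integrable_mult_right[OF sq_integrable[OF \<epsilon>(1)], of t]] \<epsilon>(3)
    by (simp add: left_diff_distrib)
  have "(\<integral>x. (g x - t) * \<epsilon> x \<partial>\<mu>) = (\<integral>x. \<epsilon> x * g x \<partial>\<mu>)"
    using sub[OF g] by (simp add: mult.commute)
  also have "\<dots> = (\<integral>x. cex d f S g x * \<epsilon> x \<partial>\<mu>)"
    using cex_proj[OF S sq_meas[OF \<epsilon>(1)] \<epsilon>(2) sq_integrable[OF \<epsilon>(1)] g] by (simp add: mult.commute)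
  also have "\<dots> = (\<integral>x. Pp S g x * \<epsilon> x \<partial>\<mu>)"
    unfolding Pp_def using sub[OF cm cex_le[OF S g], of "\<integral>x. g x \<partial>\<mu>"] by simp
  finally show ?thesis .
qed

end

text \<open>The single constant \<open>A\<close> bounds \<open>a\<close> at every point and is also
  its Hoelder constant. Boundedness off the cube is arranged in the theorem by setting
  \<open>a\<close> to 0 there.\<close>

locale jacobi = tilde_osc d K \<kappa> h f c0 C0 \<beta> L for d K \<kappa> h f c0 C0 \<beta> L +
  fixes SS :: "nat set set" and lam :: "nat set => real" and a :: "point => real" and A :: real
  assumes SS: "SS \<subseteq> Pow {1..d}" "SS \<noteq> {}" and lam: "\<And>S. S \<in> SS ==> 0 < lam S"
    and a_meas: "a \<in> bor d" and a_le: "\<And>x. \<bar>a x\<bar> \<le> A" and a_osc: "osc d \<beta> A a"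
begin

text \<open>Written so that \<open>lam S = nS S / n\<close> makes it equal to the factor in the
  weights of the estimator.\<close>

definition v :: "nat set => real" where "v S = 1 / (1 + 1 / lam S)"

abbreviation \<Gamma>t :: "nat => nat set => point => real" where "\<Gamma>t \<equiv> Gam SS v a Tt"
abbreviation \<Gamma>p :: "nat => nat set => point => real" where "\<Gamma>p \<equiv> Gam SS v a Pp"

definition \<alpha>t :: "nat => nat set => point => real" where "\<alpha>t m S x = v S * Tt S (\<Gamma>t m S) x"
definition \<alpha>p :: "nat => nat set => point => real" where "\<alpha>p m S x = v S * Pp S (\<Gamma>p m S) x"

text \<open>\<open>C1\<close> is the sup norm constant of \<open>Tt\<close>, \<open>CH\<close> the
  Hoelder norm constant of \<open>Pp\<close>, and \<open>Cc\<close> measures the L1 distance between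
  the two. None of them involves \<open>h\<close> or \<open>SS\<close>, which is essential for the
  constant in the theorem.\<close>

definition C1 :: real where "C1 = C0 / c1 + 1"
definition CH :: real where "CH = 2 + (C0 + 2 * L) / c0"
definition Cc :: real where "Cc = (C0 + 2 * L) / c0 + 2 * (C0 * real d + L / c0)"

lemma finite_SS: "finite SS" using SS(1) by (rule finite_subset) simp
lemma SS_sub: "S \<in> SS ==> S \<subseteq> {1..d}" using SS(1) by auto
lemma v_bounds: "S \<in> SS ==> 0 \<le> v S \<and> v S \<le> 1" "S \<in> SS ==> 0 < v S"
  using lam[of S] by (auto simp: v_def divide_le_eq add_pos_pos)
lemma v_inverse: "S \<in> SS ==> (1 + 1 / lam S) * v S = 1"
proof -
  assume "S \<in> SS"
  then have "0 < 1 + 1 / lam S" using lam by (intro add_pos_pos) auto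
  then show ?thesis by (simp add: v_def)
qed
lemma A_nonneg: "0 \<le> A" using a_le[of undefined] abs_ge_zero order_trans by blast
lemma C1_pos: "0 < C1" using C0_pos c1_pos by (simp add: C1_def add_pos_pos)
lemma CH_pos: "0 < CH" using C0_pos c0_pos L_nonneg by (simp add: CH_def add_pos_nonneg)
lemma Cc_nonneg: "0 \<le> Cc" using C0_pos c0_pos L_nonneg by (simp add: Cc_def)

definition Nsup :: "(point => real) => real => bool" where
  "Nsup g B \<longleftrightarrow> g \<in> bor d \<and> (\<forall>x. \<bar>g x\<bar> \<le> B)"
definition Nosc :: "(point => real) => real => bool" where
  "Nosc g B \<longleftrightarrow> g \<in> bor d \<and> (\<forall>x\<in>unit_cube d. \<bar>g x\<bar> \<le> B) \<and> osc d \<beta> B g"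
text \<open>Some sup bound is demanded because the estimates for \<open>Tt\<close> are stated for
  bounded functions, but its size does not enter the norm.\<close>

definition NL1 :: "(point => real) => real => bool" where
  "NL1 g B \<longleftrightarrow> g \<in> bor d \<and> (\<exists>B'. \<forall>x\<in>unit_cube d. \<bar>g x\<bar> \<le> B') \<and> (\<integral>x. \<bar>g x\<bar> \<partial>\<mu>) \<le> B"

lemma abs_cmult_le: "\<bar>g\<bar> \<le> B ==> \<bar>c * g\<bar> \<le> \<bar>c\<bar> * B" for g :: real
  by (simp add: abs_mult mult_left_mono)

interpretation sup: seminorm_like Nsup
proof
  fix g g' :: "point => real" and A B c :: real
  show "Nsup (\<lambda>_. 0) 0" by (simp add: Nsup_def)
  show "Nsup g A ==> Nsup g' B ==> Nsup (\<lambda>x. g x + g' x) (A + B)"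
    unfolding Nsup_def by (auto intro: order_trans[OF abs_triangle_ineq] add_mono)
  show "Nsup g A ==> Nsup (\<lambda>x. c * g x) (\<bar>c\<bar> * A)"
    unfolding Nsup_def by (auto intro: abs_cmult_le)
  show "Nsup g A ==> A \<le> B ==> Nsup g B" unfolding Nsup_def by (meson order_trans)
qed

interpretation osc: seminorm_like Nosc
proof
  fix g g' :: "point => real" and A B c :: real
  show "Nosc (\<lambda>_. 0) 0" by (simp add: Nosc_def osc_def)
  show "Nosc (\<lambda>x. g x + g' x) (A + B)" if "Nosc g A" "Nosc g' B"
  proof -
    have "osc d \<beta> (A + B) (\<lambda>x. g x + g' x)"
      unfolding osc_def
    proof (intro ballI allI impI)
      fix x x' r assume *: "x \<in> unit_cube d" "x' \<in> unit_cube d" "(0::real) \<le> r" "r \<le> 1" "\<forall>j\<in>{1..d}. \<bar>x j - x' j\<bar> \<le> r"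
      have "\<bar>g x - g x'\<bar> \<le> A * r powr \<beta>" "\<bar>g' x - g' x'\<bar> \<le> B * r powr \<beta>"
        using that * by (auto simp: Nosc_def intro: oscD)
      then show "\<bar>g x + g' x - (g x' + g' x')\<bar> \<le> (A + B) * r powr \<beta>"
        unfolding distrib_right by linarith
    qed
    with that show ?thesis
      unfolding Nosc_def by (auto intro: order_trans[OF abs_triangle_ineq] add_mono)
  qed
  show "Nosc (\<lambda>x. c * g x) (\<bar>c\<bar> * A)" if "Nosc g A"
  proof -
    have "osc d \<beta> (\<bar>c\<bar> * A) (\<lambda>x. c * g x)"
      unfolding osc_def
    proof (intro ballI allI impI)
      fix x x' r assume *: "x \<in> unit_cube d" "x' \<in> unit_cube d" "(0::real) \<le> r" "r \<le> 1" "\<forall>j\<in>{1..d}. \<bar>x j - x' j\<bar> \<le> r"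
      have "\<bar>g x - g x'\<bar> \<le> A * r powr \<beta>" using that * by (auto simp: Nosc_def intro: oscD)
      from abs_cmult_le[OF this, of c] show "\<bar>c * g x - c * g x'\<bar> \<le> \<bar>c\<bar> * A * r powr \<beta>"
        by (simp add: right_diff_distrib mult.assoc)
    qed
    with that show ?thesis unfolding Nosc_def by (auto intro: abs_cmult_le)
  qed
  show "Nosc g B" if "Nosc g A" "A \<le> B"
  proof -
    have "osc d \<beta> B g" unfolding osc_def
    proof (intro ballI allI impI)
      fix x x' r assume *: "x \<in> unit_cube d" "x' \<in> unit_cube d" "(0::real) \<le> r" "r \<le> 1" "\<forall>j\<in>{1..d}. \<bar>x j - x' j\<bar> \<le> r"
      have "\<bar>g x - g x'\<bar> \<le> A * r powr \<beta>" using that * by (auto simp: Nosc_def intro: oscD)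
      also have "\<dots> \<le> B * r powr \<beta>" using that by (intro mult_right_mono) auto
      finally show "\<bar>g x - g x'\<bar> \<le> B * r powr \<beta>" .
    qed
    with that show ?thesis unfolding Nosc_def by (meson order_trans)
  qed
qed

lemma NL1_integrable: "NL1 g B ==> integrable \<mu> g"
  unfolding NL1_def by (auto intro: integrable_bdd)

interpretation L1: seminorm_like NL1
proof
  fix g g' :: "point => real" and A B c :: real
  show "NL1 (\<lambda>_. 0) 0" by (auto simp: NL1_def)
  show "NL1 (\<lambda>x. g x + g' x) (A + B)" if *: "NL1 g A" "NL1 g' B"
  proof -
    obtain B1 B2 where B: "\<forall>x\<in>unit_cube d. \<bar>g x\<bar> \<le> B1" "\<forall>x\<in>unit_cube d. \<bar>g' x\<bar> \<le> B2"
      using *(1) *(2) unfolding NL1_def by blast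
    have i: "integrable \<mu> g" "integrable \<mu> g'" using that NL1_integrable by auto
    have "(\<integral>x. \<bar>g x + g' x\<bar> \<partial>\<mu>) \<le> (\<integral>x. \<bar>g x\<bar> + \<bar>g' x\<bar> \<partial>\<mu>)"
      using i by (intro integral_mono) auto
    also have "\<dots> = (\<integral>x. \<bar>g x\<bar> \<partial>\<mu>) + (\<integral>x. \<bar>g' x\<bar> \<partial>\<mu>)" using i by simp
    also have "\<dots> \<le> A + B" using that by (auto simp: NL1_def)
    finally have "(\<integral>x. \<bar>g x + g' x\<bar> \<partial>\<mu>) \<le> A + B" .
    moreover have "\<forall>x\<in>unit_cube d. \<bar>g x + g' x\<bar> \<le> B1 + B2"
      using B by (auto intro: order_trans[OF abs_triangle_ineq] add_mono)
    ultimately show ?thesis using that unfolding NL1_def by auto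
  qed
  show "NL1 (\<lambda>x. c * g x) (\<bar>c\<bar> * A)" if *: "NL1 g A"
  proof -
    obtain B1 where B: "\<forall>x\<in>unit_cube d. \<bar>g x\<bar> \<le> B1" using * unfolding NL1_def by blast
    have "\<forall>x\<in>unit_cube d. \<bar>c * g x\<bar> \<le> \<bar>c\<bar> * B1" using B by (auto intro: abs_cmult_le)
    moreover have "(\<integral>x. \<bar>c * g x\<bar> \<partial>\<mu>) \<le> \<bar>c\<bar> * A"
      using that by (simp add: abs_mult NL1_def mult_left_mono)
    ultimately show ?thesis using that unfolding NL1_def by auto
  qed
  show "NL1 g A ==> A \<le> B ==> NL1 g B" unfolding NL1_def by (meson order_trans)
qed

lemma \<Gamma>t_le:
  assumes "S \<in> SS"
  shows "\<Gamma>t m S \<in> bor d" "\<bar>\<Gamma>t m S x\<bar> \<le> A * (2 + C1) ^ m"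
proof -
  have "Nsup (\<Gamma>t m S) (A * (2 + C1) ^ m)"
  proof (rule sup.Gam_le[OF finite_SS v_bounds(1) _ A_nonneg _ _ assms])
    show "Nsup a A" using a_meas a_le by (simp add: Nsup_def)
    show "0 \<le> C1" using C1_pos by simp
    show "Nsup (Tt U g) (C1 * B)" if "U \<in> SS" "Nsup g B" for U g B
      using that Tt_meas[OF SS_sub[OF that(1)]] Tt_le[OF SS_sub[OF that(1)], of g B]
      by (auto simp: Nsup_def C1_def mult.commute)
  qed
  then show "\<Gamma>t m S \<in> bor d" "\<bar>\<Gamma>t m S x\<bar> \<le> A * (2 + C1) ^ m"
    by (auto simp: Nsup_def)
qed

text \<open>Conditional expectations preserve the Hoelder class because \<open>f\<close> itself is
  Hoelder. The exact iterates are therefore regular enough for \<open>Tt_close\<close>.\<close>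

lemma \<Gamma>p_le:
  assumes "S \<in> SS"
  shows "\<Gamma>p m S \<in> bor d"
    "x \<in> unit_cube d ==> \<bar>\<Gamma>p m S x\<bar> \<le> A * (2 + CH) ^ m" "osc d \<beta> (A * (2 + CH) ^ m) (\<Gamma>p m S)"
proof -
  have "Nosc (\<Gamma>p m S) (A * (2 + CH) ^ m)"
  proof (rule osc.Gam_le[OF finite_SS v_bounds(1) _ A_nonneg _ _ assms])
    show "Nosc a A" using a_meas a_le a_osc by (simp add: Nosc_def)
    show "0 \<le> CH" using CH_pos by simp
    show "Nosc (Pp U g) (CH * B)" if U: "U \<in> SS" and B: "0 \<le> B" and g: "Nosc g B" for U g B
    proof -
      note Us = SS_sub[OF U]
      have g': "g \<in> bor d" "\<And>x. x \<in> unit_cube d ==> \<bar>g x\<bar> \<le> B" "osc d \<beta> B g"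
        using g by (auto simp: Nosc_def)
      have q: "0 \<le> (C0 + 2 * L) / c0" using C0_pos c0_pos L_nonneg by simp
      have "osc d \<beta> (CH * B) (Pp U g)" unfolding osc_def
      proof (intro ballI allI impI)
        fix x x' r assume *: "x \<in> unit_cube d" "x' \<in> unit_cube d" "(0::real) \<le> r" "r \<le> 1" "\<forall>j\<in>{1..d}. \<bar>x j - x' j\<bar> \<le> r"
        have "\<bar>cex d f U g x - cex d f U g x'\<bar> \<le> B * ((C0 + 2 * L) / c0) * r powr \<beta>"
          using * Us by (intro cex_osc_on(2)[OF Us f_osc g']) auto
        also have "\<dots> \<le> CH * B * r powr \<beta>"
          using B q by (intro mult_right_mono) (auto simp: CH_def algebra_simps)
        finally show "\<bar>Pp U g x - Pp U g x'\<bar> \<le> CH * B * r powr \<beta>" by (simp add: Pp_def)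
      qed
      moreover have "2 * B \<le> CH * B" using B q by (intro mult_right_mono) (auto simp: CH_def)
      ultimately show ?thesis using Pp_le[OF Us g'(1,2)] unfolding Nosc_def by (meson order_trans)
    qed
  qed
  then show "\<Gamma>p m S \<in> bor d"
    "x \<in> unit_cube d ==> \<bar>\<Gamma>p m S x\<bar> \<le> A * (2 + CH) ^ m" "osc d \<beta> (A * (2 + CH) ^ m) (\<Gamma>p m S)"
    by (auto simp: Nosc_def)
qed

definition \<tau>L :: "nat => real" where "\<tau>L M = A * (2 + CH) ^ M * Cc * h powr \<beta>"

lemma \<tau>L_nonneg: "0 \<le> \<tau>L M" using A_nonneg CH_pos Cc_nonneg by (simp add: \<tau>L_def)

text \<open>The difference is split as \<open>Tt\<close> applied to the difference of the iterates,
  controlled in L1 with constant 2, plus \<open>Tt - Pp\<close> applied to the exact iterate. In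
  this order regularity is only required of the exact one.\<close>

lemma step_L1:
  assumes m: "m \<le> M" and U: "U \<in> SS" and N: "NL1 (\<lambda>x. \<Gamma>t m U x - \<Gamma>p m U x) e"
  shows "NL1 (\<lambda>x. Tt U (\<Gamma>t m U) x - Pp U (\<Gamma>p m U) x) (2 * e + \<tau>L M)"
proof -
  note Us = SS_sub[OF U]
  let ?\<Delta> = "\<lambda>x. \<Gamma>t m U x - \<Gamma>p m U x"
  obtain B where \<Delta>: "?\<Delta> \<in> bor d" "\<And>x. x \<in> unit_cube d ==> \<bar>?\<Delta> x\<bar> \<le> B"
    "(\<integral>x. \<bar>?\<Delta> x\<bar> \<partial>\<mu>) \<le> e" using N by (auto simp: NL1_def)
  have it: "integrable \<mu> (\<Gamma>t m U)" using \<Gamma>t_le[OF U, of m] by (intro integrable_bdd) auto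
  have ip: "integrable \<mu> (\<Gamma>p m U)" by (rule integrable_bdd[OF \<Gamma>p_le(1,2)[OF U]])
  have "(\<integral>x. \<bar>Tt U ?\<Delta> x\<bar> \<partial>\<mu>) \<le> 2 * e" using Tt_L1[OF Us \<Delta>(1,2)] \<Delta>(3) by simp
  then have 1: "NL1 (Tt U ?\<Delta>) (2 * e)"
    using Tt_le[OF Us \<Delta>(1,2)] Tt_meas[OF Us \<Delta>(1)] unfolding NL1_def by blast
  have tm: "Tt U (\<Gamma>p m U) \<in> bor d" by (rule Tt_meas[OF Us \<Gamma>p_le(1)[OF U]])
  have pm: "Pp U (\<Gamma>p m U) \<in> bor d" by (rule Pp_le(1)[OF Us \<Gamma>p_le(1,2)[OF U]])
  have bd: "\<bar>Tt U (\<Gamma>p m U) x - Pp U (\<Gamma>p m U) x\<bar> \<le> A * (2 + CH) ^ m * (C0 / c1 + 1) + 2 * (A * (2 + CH) ^ m)" for x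
    using Tt_le[OF Us \<Gamma>p_le(1,2)[OF U], of m x] Pp_le(2)[OF Us \<Gamma>p_le(1,2)[OF U], of m x] by linarith
  have "(\<integral>x. \<bar>Tt U (\<Gamma>p m U) x - Pp U (\<Gamma>p m U) x\<bar> \<partial>\<mu>) \<le> A * (2 + CH) ^ m * Cc * h powr \<beta>"
    using Tt_close[OF Us \<Gamma>p_le[OF U], of m] unfolding Pp_def Cc_def .
  also have "\<dots> \<le> \<tau>L M"
    unfolding \<tau>L_def using m CH_pos A_nonneg Cc_nonneg
    by (intro mult_right_mono mult_left_mono power_increasing) auto
  finally have 2: "NL1 (\<lambda>x. Tt U (\<Gamma>p m U) x - Pp U (\<Gamma>p m U) x) (\<tau>L M)"
    unfolding NL1_def
    by (intro conjI exI[of _ "A * (2 + CH) ^ m * (C0 / c1 + 1) + 2 * (A * (2 + CH) ^ m)"] ballI bd borel_measurable_diff tm pm)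
  have "Tt U ?\<Delta> x = Tt U (\<Gamma>t m U) x - Tt U (\<Gamma>p m U) x" for x by (rule Tt_diff[OF Us it ip])
  then have "(\<lambda>x. Tt U ?\<Delta> x + (Tt U (\<Gamma>p m U) x - Pp U (\<Gamma>p m U) x)) = (\<lambda>x. Tt U (\<Gamma>t m U) x - Pp U (\<Gamma>p m U) x)"
    by (simp add: fun_eq_iff)
  with L1.N_add[OF 1 2] show ?thesis by simp
qed

lemma \<Gamma>_diff_L1: "m \<le> M ==> S \<in> SS ==> NL1 (\<lambda>x. \<Gamma>t m S x - \<Gamma>p m S x) (\<tau>L M * (2 + 2) ^ m)"
  by (rule L1.Gam_diff_le[OF finite_SS v_bounds(1) \<tau>L_nonneg]) (auto intro: step_L1)

lemma \<alpha>t_props: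
  assumes S: "S \<in> SS"
  shows "\<alpha>t m S \<in> bor d" "\<bar>\<alpha>t m S x\<bar> \<le> A * (2 + C1) ^ m * C1"
    "dep_on d S (\<alpha>t m S)" "(\<integral>x. \<alpha>t m S x \<partial>\<mu>) = 0" "sq (\<alpha>t m S)"
proof -
  note Us = SS_sub[OF S]
  have g: "\<Gamma>t m S \<in> bor d" "\<And>x. x \<in> unit_cube d ==> \<bar>\<Gamma>t m S x\<bar> \<le> A * (2 + C1) ^ m"
    using \<Gamma>t_le[OF S] by auto
  show m: "\<alpha>t m S \<in> bor d"
    unfolding \<alpha>t_def[abs_def] by (intro borel_measurable_times Tt_meas[OF Us g(1)]) simp
  show le: "\<bar>\<alpha>t m S x\<bar> \<le> A * (2 + C1) ^ m * C1" for x
  proof -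
    have "\<bar>\<alpha>t m S x\<bar> \<le> 1 * \<bar>Tt S (\<Gamma>t m S) x\<bar>"
      unfolding \<alpha>t_def abs_mult using v_bounds[OF S] by (intro mult_right_mono) auto
    also have "\<dots> \<le> A * (2 + C1) ^ m * C1" using Tt_le[OF Us g, of x] by (simp add: C1_def)
    finally show ?thesis .
  qed
  show "dep_on d S (\<alpha>t m S)" unfolding \<alpha>t_def[abs_def] by (rule dep_on_map[OF Tt_dep[OF Us]])
  show "(\<integral>x. \<alpha>t m S x \<partial>\<mu>) = 0" unfolding \<alpha>t_def by (simp add: Tt_mean_zero[OF Us g])
  show "sq (\<alpha>t m S)" by (rule sq_bdd[OF m le])
qed

lemma \<alpha>p_props:
  assumes S: "S \<in> SS"
  shows "\<alpha>p m S \<in> bor d" "\<bar>\<alpha>p m S x\<bar> \<le> 2 * (A * (2 + CH) ^ m)"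
    "dep_on d S (\<alpha>p m S)" "(\<integral>x. \<alpha>p m S x \<partial>\<mu>) = 0" "sq (\<alpha>p m S)"
proof -
  note Us = SS_sub[OF S]
  note g = \<Gamma>p_le(1,2)[OF S, where m = m]
  show m: "\<alpha>p m S \<in> bor d"
    unfolding \<alpha>p_def[abs_def] by (intro borel_measurable_times Pp_le(1)[OF Us g]) simp
  show le: "\<bar>\<alpha>p m S x\<bar> \<le> 2 * (A * (2 + CH) ^ m)" for x
  proof -
    have "\<bar>\<alpha>p m S x\<bar> \<le> 1 * \<bar>Pp S (\<Gamma>p m S) x\<bar>"
      unfolding \<alpha>p_def abs_mult using v_bounds[OF S] by (intro mult_right_mono) auto
    also have "\<dots> \<le> 2 * (A * (2 + CH) ^ m)" using Pp_le(2)[OF Us g, of x] by simp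
    finally show ?thesis .
  qed
  show "dep_on d S (\<alpha>p m S)" unfolding \<alpha>p_def[abs_def] by (rule dep_on_map[OF Pp_dep])
  show "(\<integral>x. \<alpha>p m S x \<partial>\<mu>) = 0" unfolding \<alpha>p_def by (simp add: Pp_mean_zero[OF Us g])
  show "sq (\<alpha>p m S)" by (rule sq_bdd[OF m le])
qed

definition W :: real where "W = (2 + C1) * (2 + CH)"

text \<open>The second moment is at most the sup norm times the L1 norm. The sup norm grows like
  \<open>W ^ M\<close>, the L1 norm like \<open>(4 * W) ^ M * h powr \<beta>\<close>, where
  \<open>W\<close> dominates the growth rates of both families of iterates.\<close>

lemma \<alpha>_diff_sq:
  assumes S: "S \<in> SS"
  shows "(\<integral>x. (\<alpha>t M S x - \<alpha>p M S x)\<^sup>2 \<partial>\<mu>) \<le> 3 * A\<^sup>2 * (C1 + 2) * Cc * (4 * W\<^sup>2) ^ M * h powr \<beta>"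
proof -
  let ?e = "\<tau>L M * (2 + 2) ^ M" let ?B = "A * (C1 + 2) * W ^ M"
  have "NL1 (\<lambda>x. Tt S (\<Gamma>t M S) x - Pp S (\<Gamma>p M S) x) (2 * ?e + \<tau>L M)"
    by (rule step_L1[OF order_refl S \<Gamma>_diff_L1[OF order_refl S]])
  from L1.N_scale[OF this, of "v S"] have N: "NL1 (\<lambda>x. \<alpha>t M S x - \<alpha>p M S x) (\<bar>v S\<bar> * (2 * ?e + \<tau>L M))"
    by (simp add: \<alpha>t_def \<alpha>p_def right_diff_distrib)
  have W: "(2 + C1) ^ M \<le> W ^ M" "(2 + CH) ^ M \<le> W ^ M"
    unfolding W_def using C1_pos CH_pos by (auto intro!: power_mono)
  have bd: "\<bar>\<alpha>t M S x - \<alpha>p M S x\<bar> \<le> ?B" for x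
  proof -
    have "A * (2 + C1) ^ M * C1 \<le> A * W ^ M * C1" "2 * (A * (2 + CH) ^ M) \<le> 2 * (A * W ^ M)"
      using W A_nonneg C1_pos by (auto intro!: mult_right_mono mult_left_mono)
    then have "\<bar>\<alpha>t M S x - \<alpha>p M S x\<bar> \<le> A * W ^ M * C1 + 2 * (A * W ^ M)"
      using \<alpha>t_props(2)[OF S, of M x] \<alpha>p_props(2)[OF S, of M x] by linarith
    then show ?thesis by (simp add: algebra_simps)
  qed
  have W0: "0 \<le> W" using C1_pos CH_pos by (simp add: W_def)
  have i: "integrable \<mu> (\<lambda>x. \<alpha>t M S x - \<alpha>p M S x)" using N by (rule NL1_integrable)
  have "(\<integral>x. (\<alpha>t M S x - \<alpha>p M S x)\<^sup>2 \<partial>\<mu>) \<le> (\<integral>x. ?B * \<bar>\<alpha>t M S x - \<alpha>p M S x\<bar> \<partial>\<mu>)"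
  proof (rule integral_mono)
    show "integrable \<mu> (\<lambda>x. (\<alpha>t M S x - \<alpha>p M S x)\<^sup>2)"
      using sq_diff[OF \<alpha>t_props(5)[OF S] \<alpha>p_props(5)[OF S]] by (simp add: sq_def)
    show "(\<alpha>t M S x - \<alpha>p M S x)\<^sup>2 \<le> ?B * \<bar>\<alpha>t M S x - \<alpha>p M S x\<bar>" for x
      using mult_right_mono[OF bd abs_ge_zero, of x "\<alpha>t M S x - \<alpha>p M S x"] by (simp flip: power2_eq_square)
  qed (use i in auto)
  also have "\<dots> = ?B * (\<integral>x. \<bar>\<alpha>t M S x - \<alpha>p M S x\<bar> \<partial>\<mu>)" by (simp only: integral_mult_right_zero)
  also have "\<dots> \<le> ?B * (3 * (A * Cc * h powr \<beta>) * (4 * W) ^ M)"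
  proof (rule mult_left_mono)
    have "(\<integral>x. \<bar>\<alpha>t M S x - \<alpha>p M S x\<bar> \<partial>\<mu>) \<le> \<bar>v S\<bar> * (2 * ?e + \<tau>L M)" using N by (simp add: NL1_def)
    also have "\<dots> \<le> 1 * (2 * ?e + \<tau>L M * 4 ^ M)"
    proof (intro mult_mono)
      have "\<tau>L M * 1 \<le> \<tau>L M * 4 ^ M" by (intro mult_left_mono \<tau>L_nonneg) simp
      then show "2 * ?e + \<tau>L M \<le> 2 * ?e + \<tau>L M * 4 ^ M" by linarith
    qed (use v_bounds[OF S] \<tau>L_nonneg[of M] in auto)
    also have "\<dots> = 3 * (A * Cc * h powr \<beta>) * ((2 + CH) ^ M * 4 ^ M)" by (simp add: \<tau>L_def)
    also have "\<dots> \<le> 3 * (A * Cc * h powr \<beta>) * (4 * W) ^ M"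
      unfolding power_mult_distrib using W A_nonneg Cc_nonneg by (intro mult_left_mono) (auto simp: mult.commute)
    finally show "(\<integral>x. \<bar>\<alpha>t M S x - \<alpha>p M S x\<bar> \<partial>\<mu>) \<le> 3 * (A * Cc * h powr \<beta>) * (4 * W) ^ M" .
    show "0 \<le> ?B" using A_nonneg C1_pos W0 by simp
  qed
  also have "\<dots> = 3 * A\<^sup>2 * (C1 + 2) * Cc * (4 * W\<^sup>2) ^ M * h powr \<beta>"
    by (simp add: power_mult_distrib power2_eq_square)
  finally show ?thesis .
qed

text \<open>The minimiser of the objective in the block \<open>S\<close> when the other blocks are
  fixed at \<open>\<alpha>p\<close>; the penalty \<open>1 / lam S\<close> accounts for the factor
  \<open>v S\<close>.\<close>

definition w :: "nat => nat set => point => real" where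
  "w m S x = v S * Pp S (\<lambda>x. a x - (\<Sum>U\<in>SS - {S}. \<alpha>p m U x)) x"

lemma residual_props:
  shows "(\<lambda>x. a x - (\<Sum>U\<in>SS - {S}. \<alpha>p m U x)) \<in> bor d"
    "\<bar>a x - (\<Sum>U\<in>SS - {S}. \<alpha>p m U x)\<bar> \<le> A + real (card SS) * (2 * (A * (2 + CH) ^ m))"
proof -
  show "(\<lambda>x. a x - (\<Sum>U\<in>SS - {S}. \<alpha>p m U x)) \<in> bor d"
    by (intro borel_measurable_diff a_meas borel_measurable_sum \<alpha>p_props(1)) auto
  have "\<bar>\<Sum>U\<in>SS - {S}. \<alpha>p m U x\<bar> \<le> (\<Sum>U\<in>SS - {S}. \<bar>\<alpha>p m U x\<bar>)" by (rule sum_abs)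
  also have "\<dots> \<le> (\<Sum>U\<in>SS. 2 * (A * (2 + CH) ^ m))"
    using \<alpha>p_props(2) finite_SS A_nonneg CH_pos
    by (intro order_trans[OF sum_mono2 sum_mono]) auto
  finally show "\<bar>a x - (\<Sum>U\<in>SS - {S}. \<alpha>p m U x)\<bar> \<le> A + real (card SS) * (2 * (A * (2 + CH) ^ m))"
    using a_le[of x] by simp
qed

text \<open>Linearity of \<open>Pp\<close> carries the recursion for the iterates over to a damped
  Jacobi step for \<open>\<alpha>p\<close>.\<close>

lemma \<alpha>p_Suc:
  assumes S: "S \<in> SS"
  shows "\<alpha>p (Suc m) S x = \<alpha>p m S x + 1 / real (card SS) * (w m S x - \<alpha>p m S x)"
proof -
  let ?e = "1 / real (card SS)"
  have eq: "\<Gamma>p (Suc m) S = (\<lambda>x. (1 - ?e) * \<Gamma>p m S x + ?e * (a x - (\<Sum>U\<in>SS - {S}. \<alpha>p m U x)))"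
    by (simp add: \<alpha>p_def)
  have "Pp S (\<Gamma>p (Suc m) S) x = (1 - ?e) * Pp S (\<Gamma>p m S) x + ?e * Pp S (\<lambda>x. a x - (\<Sum>U\<in>SS - {S}. \<alpha>p m U x)) x"
    unfolding eq by (rule Pp_linear[OF SS_sub[OF S] \<Gamma>p_le(1,2)[OF S] residual_props])
  then have "\<alpha>p (Suc m) S x = v S * ((1 - ?e) * Pp S (\<Gamma>p m S) x + ?e * Pp S (\<lambda>x. a x - (\<Sum>U\<in>SS - {S}. \<alpha>p m U x)) x)"
    by (simp only: \<alpha>p_def[of "Suc m"])
  moreover have "t * ((1 - e) * p + e * q) = t * p + e * (t * q - t * p)" for t e p q :: real
    by (simp add: algebra_simps)
  ultimately show ?thesis unfolding w_def by (simp only: \<alpha>p_def[of m S x])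
qed

definition \<theta> :: real where "\<theta> = (\<integral>x. a x \<partial>\<mu>)"

lemma \<theta>_le: "\<bar>\<theta>\<bar> \<le> A" unfolding \<theta>_def using a_le a_meas by (intro integral_abs_le) auto

text \<open>Iterates \<open>Lob_descent\<close> from \<open>\<alpha>p 0 = 0\<close>, where the
  objective is the variance of \<open>a\<close>. The competitor is arbitrary, so no minimiser has to
  exist.\<close>

lemma Lob_\<alpha>p:
  assumes \<Lambda>: "\<And>S. S \<in> SS ==> lam S \<le> \<Lambda>"
    and \<beta>: "\<And>S. S \<in> SS ==> sq (\<gamma> S)" "\<And>S. S \<in> SS ==> dep_on d S (\<gamma> S)" "\<And>S. S \<in> SS ==> (\<integral>x. \<gamma> S x \<partial>\<mu>) = 0"
  shows "Lob SS lam (\<lambda>x. a x - \<theta>) (\<alpha>p m) \<le> Lob SS lam (\<lambda>x. a x - \<theta>) \<gamma> +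
    (1 - 1 / real (card SS) / (1 + \<Lambda>)) ^ m * (2 * A)\<^sup>2"
proof -
  let ?b = "\<lambda>x. a x - \<theta>" let ?r = "1 - 1 / real (card SS) / (1 + \<Lambda>)"
  obtain S0 where "S0 \<in> SS" using SS by auto
  then have \<Lambda>0: "0 < \<Lambda>" using lam[of S0] \<Lambda>[of S0] by linarith
  have "0 < card SS" using SS finite_SS by (auto simp: card_gt_0_iff)
  then have s: "1 \<le> real (card SS)" by linarith
  have "1 / real (card SS) / (1 + \<Lambda>) \<le> 1"
  proof -
    have "1 * 1 \<le> real (card SS) * (1 + \<Lambda>)" using s \<Lambda>0 by (intro mult_mono) auto
    then show ?thesis using s \<Lambda>0 by (simp add: divide_le_eq)
  qed
  then have r: "0 \<le> ?r" by simp
  have b_le: "\<bar>?b x\<bar> \<le> 2 * A" for x using a_le[of x] \<theta>_le by linarith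
  have b_meas: "?b \<in> bor d" using a_meas by simp
  have sb: "sq ?b" by (rule sq_bdd[OF b_meas b_le])
  have wp: "sq (w m S)" "dep_on d S (w m S)" "(\<integral>x. w m S x \<partial>\<mu>) = 0" if S: "S \<in> SS" for m S
  proof -
    note R = residual_props[where S = S and m = m]
    have "sq (Pp S (\<lambda>x. a x - (\<Sum>U\<in>SS - {S}. \<alpha>p m U x)))"
      by (rule sq_bdd[OF Pp_le[OF SS_sub[OF S] R]])
    from sq_cmult[OF this] show "sq (w m S)" by (simp add: w_def[abs_def])
    show "dep_on d S (w m S)"
      unfolding w_def[abs_def] by (rule dep_on_map[OF Pp_dep])
    show "(\<integral>x. w m S x \<partial>\<mu>) = 0" unfolding w_def by (simp add: Pp_mean_zero[OF SS_sub[OF S] R])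
  qed
  have opt: "(\<integral>x. (?b x - (\<Sum>U\<in>SS - {S}. \<alpha>p m U x)) * (\<zeta> x - \<alpha>p m S x) \<partial>\<mu>) =
      (1 + 1 / lam S) * (\<integral>x. w m S x * (\<zeta> x - \<alpha>p m S x) \<partial>\<mu>)"
    if S: "S \<in> SS" and \<zeta>: "sq \<zeta>" "dep_on d S \<zeta>" "(\<integral>x. \<zeta> x \<partial>\<mu>) = 0" for m S \<zeta>
  proof -
    let ?\<epsilon> = "\<lambda>x. \<zeta> x - \<alpha>p m S x" let ?g = "\<lambda>x. a x - (\<Sum>U\<in>SS - {S}. \<alpha>p m U x)"
    have \<epsilon>: "sq ?\<epsilon>" by (rule sq_diff[OF \<zeta>(1) \<alpha>p_props(5)[OF S]])
    have dep: "dep_on d S ?\<epsilon>" by (rule dep_on_map2[OF \<zeta>(2) \<alpha>p_props(3)[OF S]])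
    have mz: "(\<integral>x. ?\<epsilon> x \<partial>\<mu>) = 0"
      using \<zeta>(3) \<alpha>p_props(4)[OF S] sq_integrable[OF \<zeta>(1)] sq_integrable[OF \<alpha>p_props(5)[OF S]] by simp
    have "(\<integral>x. (?b x - (\<Sum>U\<in>SS - {S}. \<alpha>p m U x)) * ?\<epsilon> x \<partial>\<mu>) = (\<integral>x. (?g x - \<theta>) * ?\<epsilon> x \<partial>\<mu>)"
      by (simp add: algebra_simps)
    also have "\<dots> = (\<integral>x. Pp S ?g x * ?\<epsilon> x \<partial>\<mu>)"
      by (rule Pp_adjoint[OF SS_sub[OF S] residual_props \<epsilon> dep mz])
    also have "\<dots> = (1 + 1 / lam S) * v S * (\<integral>x. Pp S ?g x * ?\<epsilon> x \<partial>\<mu>)" by (simp add: v_inverse[OF S])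
    also have "\<dots> = (1 + 1 / lam S) * (\<integral>x. w m S x * ?\<epsilon> x \<partial>\<mu>)"
      unfolding w_def mult.assoc by (simp only: integral_mult_right_zero)
    finally show ?thesis .
  qed
  have step: "Lob SS lam ?b (\<alpha>p (Suc m)) - Lob SS lam ?b \<gamma> \<le> ?r * (Lob SS lam ?b (\<alpha>p m) - Lob SS lam ?b \<gamma>)" for m
  proof -
    have eq: "Lob SS lam ?b (\<alpha>p (Suc m)) = Lob SS lam ?b (\<lambda>S x. \<alpha>p m S x + 1 / real (card SS) * (w m S x - \<alpha>p m S x))"
      unfolding Lob_def by (simp add: \<alpha>p_Suc cong: sum.cong)
    show ?thesis unfolding eq
    proof (rule Lob_descent[OF finite_SS SS(2) sb])
      fix S assume S: "S \<in> SS"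
      show "0 < lam S \<and> lam S \<le> \<Lambda>" using lam[OF S] \<Lambda>[OF S] by blast
      show "sq (\<alpha>p m S)" by (rule \<alpha>p_props(5)[OF S])
      show "sq (\<gamma> S)" by (rule \<beta>(1)[OF S])
      show "sq (w m S)" by (rule wp(1)[OF S])
      show "(\<integral>x. (?b x - (\<Sum>U\<in>SS - {S}. \<alpha>p m U x)) * (w m S x - \<alpha>p m S x) \<partial>\<mu>) =
        (1 + 1 / lam S) * (\<integral>x. w m S x * (w m S x - \<alpha>p m S x) \<partial>\<mu>)"
        by (rule opt[OF S wp[OF S]])
      show "(\<integral>x. (?b x - (\<Sum>U\<in>SS - {S}. \<alpha>p m U x)) * (\<gamma> S x - \<alpha>p m S x) \<partial>\<mu>) =
        (1 + 1 / lam S) * (\<integral>x. w m S x * (\<gamma> S x - \<alpha>p m S x) \<partial>\<mu>)"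
        by (rule opt[OF S \<beta>[OF S]])
    qed
  qed
  have "Lob SS lam ?b (\<alpha>p m) - Lob SS lam ?b \<gamma> \<le> ?r ^ m * (Lob SS lam ?b (\<alpha>p 0) - Lob SS lam ?b \<gamma>)"
  proof (induction m)
    case (Suc m)
    have "?r * (Lob SS lam ?b (\<alpha>p m) - Lob SS lam ?b \<gamma>) \<le> ?r * (?r ^ m * (Lob SS lam ?b (\<alpha>p 0) - Lob SS lam ?b \<gamma>))"
      using Suc r by (intro mult_left_mono)
    from order_trans[OF step this] show ?case by (simp only: power_Suc mult.assoc)
  qed (simp only: power_0 mult_1_left order_refl)
  also have "\<dots> \<le> ?r ^ m * (2 * A)\<^sup>2"
  proof (rule mult_left_mono)
    have "0 \<le> Lob SS lam ?b \<gamma>" unfolding Lob_def using lam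
      by (intro add_nonneg_nonneg sum_nonneg mult_nonneg_nonneg Bochner_Integration.integral_nonneg) (auto simp: less_imp_le)
    moreover have "Lob SS lam ?b (\<alpha>p 0) = (\<integral>x. (?b x)\<^sup>2 \<partial>\<mu>)"
      by (simp add: Lob_def \<alpha>p_def Pp_zero)
    moreover have "(\<integral>x. (?b x)\<^sup>2 \<partial>\<mu>) \<le> (2 * A)\<^sup>2"
    proof -
      have "\<bar>(?b x)\<^sup>2\<bar> \<le> (2 * A)\<^sup>2" for x using power_mono[OF b_le abs_ge_zero, of x 2] by simp
      from integral_abs_le[OF this] show ?thesis using b_meas by simp
    qed
    ultimately show "Lob SS lam ?b (\<alpha>p 0) - Lob SS lam ?b \<gamma> \<le> (2 * A)\<^sup>2" by linarith
    show "0 \<le> ?r ^ m" using r by simp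
  qed
  finally show ?thesis by simp
qed

text \<open>Young's inequality with a free \<open>\<epsilon>\<close> separates the exact objective
  from the smoothing error; \<open>\<epsilon>\<close> is sent to 0 only after \<open>n\<close> has
  gone to infinity.\<close>

lemma Lob_\<alpha>t:
  assumes \<epsilon>: "0 < \<epsilon>" and l: "0 < l" "\<And>S. S \<in> SS ==> l \<le> lam S"
  shows "Lob SS lam (\<lambda>x. a x - \<theta>) (\<alpha>t M) \<le> (1 + \<epsilon>) * Lob SS lam (\<lambda>x. a x - \<theta>) (\<alpha>p M) +
    (1 + 1 / \<epsilon>) * ((real (card SS) + 1 / l) * (real (card SS) *
      (3 * A\<^sup>2 * (C1 + 2) * Cc * (4 * W\<^sup>2) ^ M * h powr \<beta>)))"
proof -
  let ?b = "\<lambda>x. a x - \<theta>" let ?\<delta> = "\<lambda>S x. \<alpha>t M S x - \<alpha>p M S x" let ?s = "real (card SS)"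
  let ?\<Delta> = "\<Sum>S\<in>SS. (\<integral>x. (?\<delta> S x)\<^sup>2 \<partial>\<mu>)"
  have young: "(p + q)\<^sup>2 \<le> (1 + \<epsilon>) * p\<^sup>2 + (1 + 1 / \<epsilon>) * q\<^sup>2" for p q :: real
  proof -
    have "0 \<le> (\<epsilon> * p - q)\<^sup>2 / \<epsilon>" using \<epsilon> by simp
    also have "\<dots> = \<epsilon> * p\<^sup>2 - 2 * p * q + 1 / \<epsilon> * q\<^sup>2" using \<epsilon> by (simp add: field_simps power2_eq_square)
    finally show ?thesis by (simp add: power2_sum algebra_simps)
  qed
  have sqs: "sq (?\<delta> S)" "sq (\<alpha>t M S)" "sq (\<alpha>p M S)" if "S \<in> SS" for S
    using sq_diff[OF \<alpha>t_props(5)[OF that] \<alpha>p_props(5)[OF that]] \<alpha>t_props(5)[OF that] \<alpha>p_props(5)[OF that] by auto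
  have b_le: "\<bar>?b x\<bar> \<le> 2 * A" for x using a_le[of x] \<theta>_le by linarith
  have b_meas: "?b \<in> bor d" using a_meas by simp
  have sb: "sq ?b" by (rule sq_bdd[OF b_meas b_le])
  have st: "sq (\<lambda>x. ?b x - (\<Sum>S\<in>SS. \<alpha>t M S x))" and sp: "sq (\<lambda>x. ?b x - (\<Sum>S\<in>SS. \<alpha>p M S x))"
    and sd: "sq (\<lambda>x. \<Sum>S\<in>SS. ?\<delta> S x)"
    using sqs by (auto intro!: sq_diff[OF sb] sq_sum finite_SS)
  have 1: "(\<integral>x. (?b x - (\<Sum>S\<in>SS. \<alpha>t M S x))\<^sup>2 \<partial>\<mu>) \<le>
    (1 + \<epsilon>) * (\<integral>x. (?b x - (\<Sum>S\<in>SS. \<alpha>p M S x))\<^sup>2 \<partial>\<mu>) + (1 + 1 / \<epsilon>) * (?s * ?\<Delta>)"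
  proof -
    have "(\<integral>x. (?b x - (\<Sum>S\<in>SS. \<alpha>t M S x))\<^sup>2 \<partial>\<mu>) \<le>
      (\<integral>x. (1 + \<epsilon>) * (?b x - (\<Sum>S\<in>SS. \<alpha>p M S x))\<^sup>2 + (1 + 1 / \<epsilon>) * (?s * (\<Sum>S\<in>SS. (?\<delta> S x)\<^sup>2)) \<partial>\<mu>)"
    proof (rule integral_mono)
      show "integrable \<mu> (\<lambda>x. (?b x - (\<Sum>S\<in>SS. \<alpha>t M S x))\<^sup>2)" using st by (simp add: sq_def)
      show "integrable \<mu> (\<lambda>x. (1 + \<epsilon>) * (?b x - (\<Sum>S\<in>SS. \<alpha>p M S x))\<^sup>2 + (1 + 1 / \<epsilon>) * (?s * (\<Sum>S\<in>SS. (?\<delta> S x)\<^sup>2)))"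
        using sp sqs(1) by (intro Bochner_Integration.integrable_add integrable_mult_right Bochner_Integration.integrable_sum) (auto simp: sq_def)
      fix x
      have eq: "?b x - (\<Sum>S\<in>SS. \<alpha>t M S x) = (?b x - (\<Sum>S\<in>SS. \<alpha>p M S x)) + - (\<Sum>S\<in>SS. ?\<delta> S x)"
        by (simp add: sum_subtractf)
      have "(?b x - (\<Sum>S\<in>SS. \<alpha>t M S x))\<^sup>2 \<le> (1 + \<epsilon>) * (?b x - (\<Sum>S\<in>SS. \<alpha>p M S x))\<^sup>2 + (1 + 1 / \<epsilon>) * (\<Sum>S\<in>SS. ?\<delta> S x)\<^sup>2"
        unfolding eq using young[of "?b x - (\<Sum>S\<in>SS. \<alpha>p M S x)" "- (\<Sum>S\<in>SS. ?\<delta> S x)"]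
        unfolding power2_minus .
      also have "(1 + 1 / \<epsilon>) * (\<Sum>S\<in>SS. ?\<delta> S x)\<^sup>2 \<le> (1 + 1 / \<epsilon>) * (?s * (\<Sum>S\<in>SS. (?\<delta> S x)\<^sup>2))"
        using sum_squared_le_sum_of_squares[of "\<lambda>S. ?\<delta> S x" SS] \<epsilon>
        by (intro mult_left_mono) (auto simp: mult.commute)
      finally show "(?b x - (\<Sum>S\<in>SS. \<alpha>t M S x))\<^sup>2 \<le> (1 + \<epsilon>) * (?b x - (\<Sum>S\<in>SS. \<alpha>p M S x))\<^sup>2 + (1 + 1 / \<epsilon>) * (?s * (\<Sum>S\<in>SS. (?\<delta> S x)\<^sup>2))"
        by simp
    qed
    also have "\<dots> = (1 + \<epsilon>) * (\<integral>x. (?b x - (\<Sum>S\<in>SS. \<alpha>p M S x))\<^sup>2 \<partial>\<mu>) + (1 + 1 / \<epsilon>) * (?s * (\<integral>x. (\<Sum>S\<in>SS. (?\<delta> S x)\<^sup>2) \<partial>\<mu>))"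
    proof -
      have i1: "integrable \<mu> (\<lambda>x. (1 + \<epsilon>) * (?b x - (\<Sum>S\<in>SS. \<alpha>p M S x))\<^sup>2)" using sp by (simp add: sq_def)
      have i2: "integrable \<mu> (\<lambda>x. (1 + 1 / \<epsilon>) * (?s * (\<Sum>S\<in>SS. (?\<delta> S x)\<^sup>2)))"
        using sqs(1) by (intro integrable_mult_right Bochner_Integration.integrable_sum) (auto simp: sq_def)
      from Bochner_Integration.integral_add[OF i1 i2] show ?thesis by (simp only: integral_mult_right_zero)
    qed
    also have "(\<integral>x. (\<Sum>S\<in>SS. (?\<delta> S x)\<^sup>2) \<partial>\<mu>) = ?\<Delta>"
      using sqs(1) by (intro Bochner_Integration.integral_sum) (auto simp: sq_def)
    finally show ?thesis .
  qed
  have 2: "(\<Sum>S\<in>SS. 1 / lam S * (\<integral>x. (\<alpha>t M S x)\<^sup>2 \<partial>\<mu>)) \<le>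
    (1 + \<epsilon>) * (\<Sum>S\<in>SS. 1 / lam S * (\<integral>x. (\<alpha>p M S x)\<^sup>2 \<partial>\<mu>)) + (1 + 1 / \<epsilon>) * (1 / l * ?\<Delta>)"
    unfolding sum_distrib_left sum.distrib[symmetric]
  proof (rule sum_mono)
    fix S assume S: "S \<in> SS"
    have i1: "integrable \<mu> (\<lambda>x. (1 + \<epsilon>) * (\<alpha>p M S x)\<^sup>2)" and i2: "integrable \<mu> (\<lambda>x. (1 + 1 / \<epsilon>) * (?\<delta> S x)\<^sup>2)"
      using sqs[OF S] by (auto simp: sq_def)
    have "(\<integral>x. (\<alpha>t M S x)\<^sup>2 \<partial>\<mu>) \<le> (\<integral>x. (1 + \<epsilon>) * (\<alpha>p M S x)\<^sup>2 + (1 + 1 / \<epsilon>) * (?\<delta> S x)\<^sup>2 \<partial>\<mu>)"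
    proof (rule integral_mono)
      show "(\<alpha>t M S x)\<^sup>2 \<le> (1 + \<epsilon>) * (\<alpha>p M S x)\<^sup>2 + (1 + 1 / \<epsilon>) * (?\<delta> S x)\<^sup>2" for x
        using young[of "\<alpha>p M S x" "?\<delta> S x"] by simp
    qed (use sqs[OF S] i1 i2 in \<open>auto simp: sq_def\<close>)
    also have "\<dots> = (1 + \<epsilon>) * (\<integral>x. (\<alpha>p M S x)\<^sup>2 \<partial>\<mu>) + (1 + 1 / \<epsilon>) * (\<integral>x. (?\<delta> S x)\<^sup>2 \<partial>\<mu>)"
      using Bochner_Integration.integral_add[OF i1 i2] by (simp only: integral_mult_right_zero)
    finally have "1 / lam S * (\<integral>x. (\<alpha>t M S x)\<^sup>2 \<partial>\<mu>) \<le> 1 / lam S * ((1 + \<epsilon>) * (\<integral>x. (\<alpha>p M S x)\<^sup>2 \<partial>\<mu>) + (1 + 1 / \<epsilon>) * (\<integral>x. (?\<delta> S x)\<^sup>2 \<partial>\<mu>))"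
      using lam[OF S] by (intro mult_left_mono) auto
    also have "\<dots> = (1 + \<epsilon>) * (1 / lam S * (\<integral>x. (\<alpha>p M S x)\<^sup>2 \<partial>\<mu>)) + 1 / lam S * ((1 + 1 / \<epsilon>) * (\<integral>x. (?\<delta> S x)\<^sup>2 \<partial>\<mu>))"
      by (simp only: distrib_left mult.left_commute)
    also have "1 / lam S * ((1 + 1 / \<epsilon>) * (\<integral>x. (?\<delta> S x)\<^sup>2 \<partial>\<mu>)) \<le> 1 / l * ((1 + 1 / \<epsilon>) * (\<integral>x. (?\<delta> S x)\<^sup>2 \<partial>\<mu>))"
      using l(1) l(2)[OF S] \<epsilon> by (intro mult_right_mono frac_le mult_nonneg_nonneg) auto
    finally show "1 / lam S * (\<integral>x. (\<alpha>t M S x)\<^sup>2 \<partial>\<mu>) \<le> (1 + \<epsilon>) * (1 / lam S * (\<integral>x. (\<alpha>p M S x)\<^sup>2 \<partial>\<mu>)) + (1 + 1 / \<epsilon>) * (1 / l * (\<integral>x. (?\<delta> S x)\<^sup>2 \<partial>\<mu>))"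
      by (simp only: mult.left_commute)
  qed
  have "?\<Delta> \<le> (\<Sum>S\<in>SS. 3 * A\<^sup>2 * (C1 + 2) * Cc * (4 * W\<^sup>2) ^ M * h powr \<beta>)"
    by (intro sum_mono \<alpha>_diff_sq)
  then have 3: "?\<Delta> \<le> ?s * (3 * A\<^sup>2 * (C1 + 2) * Cc * (4 * W\<^sup>2) ^ M * h powr \<beta>)" by simp
  have "Lob SS lam ?b (\<alpha>t M) \<le> (1 + \<epsilon>) * Lob SS lam ?b (\<alpha>p M) + (1 + 1 / \<epsilon>) * ((?s + 1 / l) * ?\<Delta>)"
    using 1 2 unfolding Lob_def by (simp add: algebra_simps)
  also have "\<dots> \<le> (1 + \<epsilon>) * Lob SS lam ?b (\<alpha>p M) + (1 + 1 / \<epsilon>) * ((?s + 1 / l) * (?s * (3 * A\<^sup>2 * (C1 + 2) * Cc * (4 * W\<^sup>2) ^ M * h powr \<beta>)))"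
    using \<epsilon> l(1) by (intro add_left_mono mult_left_mono 3) auto
  finally show ?thesis .
qed

end

section \<open>Words, index tuples and binomial weights\<close>

lemma sum_from_1: "(\<Sum>m=1..M. F m) = (\<Sum>m<M. F (Suc m))" for F :: "nat => real"
  using sum.atLeast1_atMost_eq[of F M] by (simp add: One_nat_def)

lemma binom_tail_0: "binom_tail M \<eta> 0 = 1"
  by (simp add: binom_tail_def)

lemma binom_tail_gt:
  assumes "0 \<le> \<eta>" "\<eta> \<le> 1" "M < m"
  shows "binom_tail M \<eta> m = 0"
proof -
  have "set_pmf (binomial_pmf M \<eta>) \<inter> {m..} = {}"
    using assms by (auto simp: set_pmf_binomial_eq split: if_splits)
  then show ?thesis unfolding binom_tail_def by (simp add: measure_pmf_zero_iff)
qed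

lemma binom_tail_bounds: "0 \<le> binom_tail M \<eta> m" "binom_tail M \<eta> m \<le> 1"
  by (simp_all add: binom_tail_def)

text \<open>Conditioning on one Bernoulli summand. The two outcomes correspond to keeping and to
  updating an iterate.\<close>

lemma binom_tail_Suc:
  assumes \<eta>: "0 \<le> \<eta>" "\<eta> \<le> 1"
  shows "binom_tail (Suc M) \<eta> (Suc m) = (1 - \<eta>) * binom_tail M \<eta> (Suc m) + \<eta> * binom_tail M \<eta> m"
proof -
  have shift: "emeasure (measure_pmf (bind_pmf (binomial_pmf M \<eta>) (\<lambda>k. return_pmf (j + k)))) {Suc m..} =
      emeasure (measure_pmf (binomial_pmf M \<eta>)) {k. Suc m \<le> j + k}" for j
  proof -
    have "bind_pmf (binomial_pmf M \<eta>) (\<lambda>k. return_pmf (j + k)) = map_pmf (\<lambda>k. j + k) (binomial_pmf M \<eta>)"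
      by (simp add: map_pmf_def)
    then show ?thesis by (simp add: vimage_def)
  qed
  have "ennreal (binom_tail (Suc M) \<eta> (Suc m)) = emeasure (measure_pmf (binomial_pmf (Suc M) \<eta>)) {Suc m..}"
    by (simp add: binom_tail_def measure_pmf.emeasure_eq_measure)
  also have "\<dots> = (\<integral>\<^sup>+b. emeasure (measure_pmf (bind_pmf (binomial_pmf M \<eta>) (\<lambda>k. return_pmf ((if b then 1 else 0) + k)))) {Suc m..} \<partial>bernoulli_pmf \<eta>)"
    using \<eta> by (subst binomial_pmf_Suc) (simp_all only: atLeastAtMost_iff emeasure_bind_pmf)
  also have "\<dots> = (\<integral>\<^sup>+b. emeasure (measure_pmf (binomial_pmf M \<eta>)) {k. Suc m \<le> (if b then 1 else 0) + k} \<partial>bernoulli_pmf \<eta>)"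
    by (simp only: shift)
  also have "\<dots> = emeasure (measure_pmf (binomial_pmf M \<eta>)) {m..} * \<eta> + emeasure (measure_pmf (binomial_pmf M \<eta>)) {Suc m..} * (1 - \<eta>)"
    using \<eta> by (simp add: atLeast_def)
  also have "\<dots> = ennreal (binom_tail M \<eta> m) * ennreal \<eta> + ennreal (binom_tail M \<eta> (Suc m)) * ennreal (1 - \<eta>)"
    using \<eta> by (simp add: binom_tail_def measure_pmf.emeasure_eq_measure ennreal_minus flip: ennreal_1)
  also have "\<dots> = ennreal ((1 - \<eta>) * binom_tail M \<eta> (Suc m) + \<eta> * binom_tail M \<eta> m)"
    using \<eta> by (simp add: binom_tail_def mult.commute add.commute flip: ennreal_mult ennreal_plus)
  finally show ?thesis
    using \<eta> by (subst (asm) ennreal_inj) (auto simp: binom_tail_def)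
qed

definition all_tuples :: "nat => nat => nat list set" where
  "all_tuples n m = {is. length is = m \<and> set is \<subseteq> {1..n}}"

lemma finite_all_tuples: "finite (all_tuples n m)"
  unfolding all_tuples_def using finite_lists_length_eq[of "{1..n}" m] by (simp add: conj_commute)

lemma card_all_tuples: "card (all_tuples n m) = n ^ m"
  unfolding all_tuples_def using card_lists_length_eq[of "{1..n}" m] by (simp add: conj_commute)

lemma sum_all_tuples_Suc:
  "(\<Sum>is\<in>all_tuples n (Suc m). F is) = (\<Sum>l=1..n. \<Sum>is\<in>all_tuples n m. F (is @ [l]))" for F :: "nat list => real"
proof -
  have "(\<Sum>(l, is)\<in>{1..n} \<times> all_tuples n m. F (is @ [l])) = (\<Sum>is\<in>all_tuples n (Suc m). F is)"
  proof (rule sum.reindex_bij_witness[where j = "\<lambda>(l, is). is @ [l]" and i = "\<lambda>is. (last is, butlast is)"])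
    fix "is" assume "is \<in> all_tuples n (Suc m)"
    then have "is \<noteq> []" "length is = Suc m" "set is \<subseteq> {1..n}" by (auto simp: all_tuples_def)
    then show "(case (last is, butlast is) of (l, is) => is @ [l]) = is" "(last is, butlast is) \<in> {1..n} \<times> all_tuples n m"
      using last_in_set[of "is"] in_set_butlastD[of _ "is"] by (auto simp: all_tuples_def subset_iff)
  qed (auto simp: all_tuples_def)
  then show ?thesis by (simp add: sum.cartesian_product)
qed

lemma index_tuples_subset: "index_tuples n m \<subseteq> all_tuples n m"
  by (auto simp: index_tuples_def all_tuples_def)

lemma card_index_tuples: assumes "m \<le> n" shows "real (card (index_tuples n m)) = falling n m"
proof -
  have "card (index_tuples n m) = \<Prod>{n - m + 1..n}"
    using card_lists_distinct_length_eq[of "{1..n}" m] assms by (simp add: index_tuples_def conj_commute conj_left_commute)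
  also have "\<dots> = (\<Prod>k<m. n - k)"
    using assms by (intro prod.reindex_bij_witness[where j = "\<lambda>i. n - i" and i = "\<lambda>k. n - k"]) auto
  finally have "real (card (index_tuples n m)) = (\<Prod>k<m. real (n - k))" by simp
  also have "\<dots> = falling n m" unfolding falling_def using assms by (intro prod.cong refl) (simp add: of_nat_diff)
  finally show ?thesis .
qed

text \<open>The ratio is the product of the factors \<open>1 - k / n\<close>, bounded below by
  Weierstrass' product inequality.\<close>

lemma falling_ratio:
  assumes "m \<le> n" "0 < n"
  shows "1 - falling n m / real n ^ m \<le> real m ^ 2 / real n" "falling n m / real n ^ m \<le> 1" "0 < falling n m"
proof -
  have eq: "falling n m / real n ^ m = (\<Prod>k<m. 1 - real k / real n)"
  proof -
    have "(\<Prod>k<m. 1 - real k / real n) = (\<Prod>k<m. (real n - real k) / real n)"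
      using assms(2) by (intro prod.cong refl) (simp add: diff_divide_distrib)
    then show ?thesis by (simp add: falling_def prod_dividef)
  qed
  have "1 - (\<Sum>k<m. real k / real n) \<le> (\<Prod>k<m. 1 - real k / real n)"
    using assms by (intro Weierstrass_prod_ineq) (auto simp: divide_le_eq)
  moreover have "(\<Sum>k<m. real k / real n) \<le> (\<Sum>k<m. real m / real n)"
    by (intro sum_mono divide_right_mono) auto
  ultimately show "1 - falling n m / real n ^ m \<le> real m ^ 2 / real n"
    unfolding eq by (simp add: power2_eq_square)
  show "falling n m / real n ^ m \<le> 1" unfolding eq using assms by (intro prod_le_1) (auto simp: divide_le_eq)
  show "0 < falling n m" unfolding falling_def using assms by (intro prod_pos) auto
qed

text \<open>Tuples with a repeated index form a share of at most \<open>m ^ 2 / n\<close> of all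
  tuples. They matter twice, through the changed normalisation and through the additional summands,
  hence the factor 2.\<close>

lemma U_minus_V:
  fixes F :: "nat list => real"
  assumes m: "m \<le> n" "0 < n" and F: "\<And>is. is \<in> all_tuples n m ==> \<bar>F is\<bar> \<le> B"
  shows "\<bar>1 / falling n m * (\<Sum>is\<in>index_tuples n m. F is) - 1 / real n ^ m * (\<Sum>is\<in>all_tuples n m. F is)\<bar>
    \<le> 2 * B * (real m ^ 2 / real n)"
proof -
  let ?I = "index_tuples n m" let ?D = "all_tuples n m - index_tuples n m"
  let ?p = "falling n m / real n ^ m"
  have fin: "finite ?I" "finite ?D" using finite_all_tuples finite_subset[OF index_tuples_subset] by auto
  have f0: "0 < falling n m" and p1: "?p \<le> 1" using falling_ratio[OF m] by auto
  have N: "0 < real n ^ m" using m by simp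
  have split: "(\<Sum>is\<in>all_tuples n m. F is) = (\<Sum>is\<in>?I. F is) + (\<Sum>is\<in>?D. F is)"
    using sum.subset_diff[OF index_tuples_subset finite_all_tuples, of F n m] by simp
  have cD: "real (card ?D) = real n ^ m - falling n m"
    using card_Diff_subset[OF fin(1) index_tuples_subset] card_mono[OF finite_all_tuples index_tuples_subset, of n m]
    by (simp add: card_all_tuples of_nat_diff card_index_tuples[OF m(1)])
  have I: "\<bar>\<Sum>is\<in>?I. F is\<bar> \<le> falling n m * B"
  proof -
    have "\<bar>\<Sum>is\<in>?I. F is\<bar> \<le> (\<Sum>is\<in>?I. B)"
      using F index_tuples_subset by (intro order_trans[OF sum_abs sum_mono]) auto
    then show ?thesis by (simp add: card_index_tuples[OF m(1)])
  qed
  have D: "\<bar>\<Sum>is\<in>?D. F is\<bar> \<le> (real n ^ m - falling n m) * B"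
  proof -
    have "\<bar>\<Sum>is\<in>?D. F is\<bar> \<le> (\<Sum>is\<in>?D. B)"
      using F by (intro order_trans[OF sum_abs sum_mono]) auto
    then show ?thesis by (simp add: cD)
  qed
  have B: "0 \<le> B"
  proof -
    have "0 < card (all_tuples n m)" using m by (simp add: card_all_tuples)
    then obtain t where "t \<in> all_tuples n m" by (auto simp: card_gt_0_iff)
    from F[OF this] show ?thesis by linarith
  qed
  let ?P = "(1 - ?p) * ((\<Sum>is\<in>?I. F is) / falling n m)" let ?Q = "(\<Sum>is\<in>?D. F is) / real n ^ m"
  have e1: "1 / falling n m * (\<Sum>is\<in>?I. F is) - 1 / real n ^ m * (\<Sum>is\<in>all_tuples n m. F is) = ?P - ?Q"
    unfolding split using f0 N by (simp add: field_simps)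
  have e2: "\<bar>?P\<bar> \<le> (1 - ?p) * B"
    unfolding abs_mult using p1 I f0 by (intro mult_mono) (auto simp: abs_divide divide_le_eq mult.commute)
  have e3: "\<bar>?Q\<bar> \<le> (1 - ?p) * B"
    using D N by (simp add: abs_divide field_simps)
  have e4: "(1 - ?p) * B \<le> (real m ^ 2 / real n) * B"
    using falling_ratio(1)[OF m] B by (intro mult_right_mono)
  have "\<bar>?P - ?Q\<bar> \<le> (real m ^ 2 / real n) * B + (real m ^ 2 / real n) * B"
    by (rule order_trans[OF abs_triangle_ineq4 add_mono[OF order_trans[OF e2 e4] order_trans[OF e3 e4]]])
  then show ?thesis unfolding e1 by (simp only: mult_2[symmetric] mult.commute mult.left_commute)
qed

text \<open>Summing over unrestricted index tuples turns the chain of kernels into a word of operators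
  acting on functions of one point.\<close>

locale words =
  fixes SS :: "nat set set" and n :: nat and X :: "nat => point" and B :: "nat set => point => point => real"
    and a :: "point => real" and v :: "nat set => real"
  assumes finite_SS: "finite SS" and SS_ne: "SS \<noteq> {}" and n: "0 < n"
begin

definition T :: "nat set => (point => real) => point => real" where
  "T S g y = 1 / real n * (\<Sum>i=1..n. g (X i) * B S (X i) y)"

definition Wd :: "nat set list => point => real" where
  "Wd Ss = fold T Ss a"

lemma Wd_Nil [simp]: "Wd [] = a" and Wd_snoc [simp]: "Wd (Ss @ [S]) = T S (Wd Ss)"
  by (simp_all add: Wd_def)

definition chain :: "nat set list => nat list => real" where
  "chain Ss is = a (X (is ! 0)) * (\<Prod>j<length Ss. B (Ss ! j) (X (is ! j)) (X (is ! Suc j)))"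

lemma chain_snoc:
  assumes "length is = length Ss"
  shows "chain (Ss @ [S]) (is @ [i, l]) = chain Ss (is @ [i]) * B S (X i) (X l)"
proof -
  have "(\<Prod>j<length Ss. B ((Ss @ [S]) ! j) (X ((is @ [i, l]) ! j)) (X ((is @ [i, l]) ! Suc j))) =
      (\<Prod>j<length Ss. B (Ss ! j) (X ((is @ [i]) ! j)) (X ((is @ [i]) ! Suc j)))"
    using assms by (intro prod.cong refl) (auto simp: nth_append less_Suc_eq nth_Cons split: nat.splits)
  moreover have "(is @ [i, l]) ! 0 = (is @ [i]) ! 0" by (cases "is") auto
  moreover have "(is @ [i, l]) ! length Ss = i" "(is @ [i, l]) ! Suc (length Ss) = l"
    using assms by (auto simp: nth_append)
  ultimately show ?thesis using assms by (simp add: chain_def nth_append)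
qed

text \<open>With the last index held fixed, the sum over the index before it applies the operator of
  the last letter. Unrestricted indices are what allows the sums to be carried out one after
  another.\<close>

lemma sum_chain:
  "(\<Sum>is\<in>all_tuples n (length Ss). chain Ss (is @ [l])) = real n ^ length Ss * Wd Ss (X l)"
proof (induction Ss arbitrary: l rule: rev_induct)
  case Nil
  have "all_tuples n 0 = {[]}" by (auto simp: all_tuples_def)
  then show ?case by (simp add: chain_def)
next
  case (snoc S Ss)
  have "(\<Sum>is\<in>all_tuples n (length (Ss @ [S])). chain (Ss @ [S]) (is @ [l])) =
      (\<Sum>i=1..n. \<Sum>is\<in>all_tuples n (length Ss). chain (Ss @ [S]) ((is @ [i]) @ [l]))"
    by (simp add: sum_all_tuples_Suc)
  also have "\<dots> = (\<Sum>i=1..n. \<Sum>is\<in>all_tuples n (length Ss). chain Ss (is @ [i]) * B S (X i) (X l))"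
    by (intro sum.cong refl) (simp add: chain_snoc all_tuples_def)
  also have "\<dots> = (\<Sum>i=1..n. real n ^ length Ss * Wd Ss (X i) * B S (X i) (X l))"
    by (simp add: sum_distrib_right[symmetric] snoc.IH)
  also have "\<dots> = real n ^ length (Ss @ [S]) * Wd (Ss @ [S]) (X l)"
    using n by (simp add: T_def sum_distrib_left mult_ac)
  finally show ?case .
qed

lemma V_stat_eq:
  "1 / real n ^ (length Ss + 1) * (\<Sum>is\<in>all_tuples n (length Ss + 1). chain Ss is) =
    1 / real n * (\<Sum>l=1..n. Wd Ss (X l))"
  unfolding Suc_eq_plus1[symmetric] sum_all_tuples_Suc sum_chain sum_distrib_left[symmetric] using n by simp

lemma T_sum: "T S (\<lambda>x. \<Sum>i\<in>I. c i * g i x) y = (\<Sum>i\<in>I. c i * T S (g i) y)"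
proof -
  have "(\<Sum>j=1..n. (\<Sum>i\<in>I. c i * g i (X j)) * B S (X j) y) = (\<Sum>i\<in>I. \<Sum>j=1..n. c i * (g i (X j) * B S (X j) y))"
    by (subst sum.swap) (simp add: sum_distrib_right mult.assoc)
  then show ?thesis by (simp add: T_def sum_distrib_left mult_ac)
qed

text \<open>The words that stay admissible when the letter \<open>S\<close> is appended.\<close>

definition pre :: "nat => nat set => nat set list set" where
  "pre m S = {Ss \<in> adm_tuples SS m. Ss = [] \<or> last Ss \<noteq> S}"

lemma finite_adm: "finite (adm_tuples SS m)"
  by (rule finite_subset[OF _ finite_lists_length_eq[OF finite_SS, of m]]) (auto simp: adm_tuples_def)

lemma card_adm: "card (adm_tuples SS m) \<le> card SS ^ m"
proof -
  have "card (adm_tuples SS m) \<le> card {Ss. set Ss \<subseteq> SS \<and> length Ss = m}"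
    by (intro card_mono finite_lists_length_eq finite_SS) (auto simp: adm_tuples_def)
  then show ?thesis by (simp add: card_lists_length_eq[OF finite_SS])
qed

lemma finite_pre: "finite (pre m S)" using finite_adm by (simp add: pre_def)

lemma adm_snoc: "Ss @ [S] \<in> adm_tuples SS (Suc m) \<longleftrightarrow> S \<in> SS \<and> Ss \<in> pre m S"
proof (cases "Ss = []")
  case False
  then obtain Us U where Ss: "Ss = Us @ [U]" by (metis append_butlast_last_id)
  have "(\<forall>j. Suc j < Suc m \<longrightarrow> (Ss @ [S]) ! Suc j \<noteq> (Ss @ [S]) ! j) \<longleftrightarrow>
     (\<forall>j. Suc j < m \<longrightarrow> Ss ! Suc j \<noteq> Ss ! j) \<and> last Ss \<noteq> S" if m: "length Ss = m"
  proof -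
    have last: "Ss ! (m - 1) = last Ss" "0 < m" using False m by (auto simp: last_conv_nth)
    have *: "(Ss @ [S]) ! Suc j \<noteq> (Ss @ [S]) ! j \<longleftrightarrow> (if Suc j < m then Ss ! Suc j \<noteq> Ss ! j else S \<noteq> last Ss)"
      if "Suc j < Suc m" for j
    proof (cases "Suc j < m")
      case False
      then have "j = m - 1" "Suc j = m" using that last by auto
      then show ?thesis using m last by (auto simp: nth_append)
    qed (use m in \<open>auto simp: nth_append\<close>)
    show ?thesis
    proof
      assume L: "\<forall>j. Suc j < Suc m \<longrightarrow> (Ss @ [S]) ! Suc j \<noteq> (Ss @ [S]) ! j"
      have "Suc (m - 1) < Suc m" "\<not> Suc (m - 1) < m" using last by auto
      then have "S \<noteq> last Ss" using L * by metis
      moreover have "Ss ! Suc j \<noteq> Ss ! j" if "Suc j < m" for j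
        using L *[of j] that by auto
      ultimately show "(\<forall>j. Suc j < m \<longrightarrow> Ss ! Suc j \<noteq> Ss ! j) \<and> last Ss \<noteq> S" by auto
    qed (use * in auto)
  qed
  then show ?thesis using False by (auto simp: adm_tuples_def pre_def)
qed (auto simp: adm_tuples_def pre_def)

lemma sum_adm_Suc:
  "(\<Sum>Ss\<in>adm_tuples SS (Suc m). F Ss) = (\<Sum>S\<in>SS. \<Sum>Ss\<in>pre m S. F (Ss @ [S]))" for F :: "nat set list => real"
proof -
  have "(\<Sum>(S, Ss)\<in>Sigma SS (pre m). F (Ss @ [S])) = (\<Sum>Ss\<in>adm_tuples SS (Suc m). F Ss)"
  proof (rule sum.reindex_bij_witness[where j = "\<lambda>(S, Ss). Ss @ [S]" and i = "\<lambda>Ss. (last Ss, butlast Ss)"])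
    fix Ss assume Ss: "Ss \<in> adm_tuples SS (Suc m)"
    then have ne: "Ss \<noteq> []" by (auto simp: adm_tuples_def)
    then show "(case (last Ss, butlast Ss) of (S, Ss) => Ss @ [S]) = Ss" by simp
    show "(last Ss, butlast Ss) \<in> Sigma SS (pre m)"
      using adm_snoc[of "butlast Ss" "last Ss" m] Ss ne by simp
  qed (auto simp: adm_snoc)
  then show ?thesis using finite_SS finite_pre by (simp add: sum.Sigma)
qed

lemma sum_pre_Suc:
  "(\<Sum>Ss\<in>pre (Suc m) S. F Ss) = (\<Sum>U\<in>SS - {S}. \<Sum>Ss\<in>pre m U. F (Ss @ [U]))" for F :: "nat set list => real"
proof -
  have "(\<Sum>Ss\<in>pre (Suc m) S. F Ss) = (\<Sum>Ss\<in>adm_tuples SS (Suc m). if last Ss \<noteq> S then F Ss else 0)"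
  proof -
    have "pre (Suc m) S = {Ss \<in> adm_tuples SS (Suc m). last Ss \<noteq> S}"
      by (auto simp: pre_def adm_tuples_def)
    then show ?thesis by (simp add: sum.inter_filter[OF finite_adm])
  qed
  also have "\<dots> = (\<Sum>U\<in>SS. if U \<noteq> S then (\<Sum>Ss\<in>pre m U. F (Ss @ [U])) else 0)"
    unfolding sum_adm_Suc by (intro sum.cong refl) auto
  also have "\<dots> = (\<Sum>U\<in>SS - {S}. \<Sum>Ss\<in>pre m U. F (Ss @ [U]))"
    using finite_SS by (intro sum.mono_neutral_cong_right) auto
  finally show ?thesis .
qed

text \<open>The terms of order \<open>m\<close> in the formal expansion of the fixed point equation
  \<open>\<Gamma> S = a - (\<Sum>U\<in>SS - {S}. v U * T U (\<Gamma> U))\<close>.\<close>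

definition Bm :: "nat => nat set => point => real" where
  "Bm m S x = (\<Sum>Ss\<in>pre m S. (-1) ^ m * prod_list (map v Ss) * Wd Ss x)"

lemma Bm_0: "Bm 0 S x = a x"
proof -
  have "pre 0 S = {[]}" by (auto simp: pre_def adm_tuples_def)
  then show ?thesis by (simp add: Bm_def)
qed

lemma T_Bm: "T U (Bm m S) y = (\<Sum>Ss\<in>pre m S. (-1) ^ m * prod_list (map v Ss) * T U (Wd Ss) y)"
  unfolding Bm_def[abs_def] by (rule T_sum)

lemma Bm_Suc: "Bm (Suc m) S x = - (\<Sum>U\<in>SS - {S}. v U * T U (Bm m U) x)"
  unfolding Bm_def[of "Suc m"] sum_pre_Suc T_Bm
  by (simp add: sum_distrib_left sum_negf[symmetric] mult_ac)

text \<open>If each of \<open>M\<close> steps is thought of as an update with probability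
  \<open>1 / card SS\<close>, a word of length \<open>m\<close> needs \<open>m + 1\<close> updates:
  one to bring in \<open>a\<close> and one for each letter. This explains the shift in the
  weight.\<close>

lemma Gam_eq_Bm:
  "Gam SS v a T M S x = (\<Sum>m<M. binom_tail M (1 / real (card SS)) (Suc m) * Bm m S x)"
proof (induction M arbitrary: S x)
  case (Suc M)
  let ?e = "1 / real (card SS)"
  let ?b = "\<lambda>M m. binom_tail M ?e m"
  have "0 < card SS" using finite_SS SS_ne by (simp add: card_gt_0_iff)
  then have e: "0 \<le> ?e" "?e \<le> 1" by auto
  have IH: "Gam SS v a T M U = (\<lambda>x. \<Sum>m<M. ?b M (Suc m) * Bm m U x)" for U
    using Suc by auto
  have "(\<Sum>U\<in>SS - {S}. v U * T U (Gam SS v a T M U) x) = (\<Sum>m<M. ?b M (Suc m) * (\<Sum>U\<in>SS - {S}. v U * T U (Bm m U) x))"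
    unfolding IH T_sum sum_distrib_left by (subst sum.swap) (simp only: mult.left_commute)
  also have "\<dots> = - (\<Sum>m<M. ?b M (Suc m) * Bm (Suc m) S x)"
    by (simp add: Bm_Suc sum_negf)
  finally have "a x - (\<Sum>U\<in>SS - {S}. v U * T U (Gam SS v a T M U) x) =
      ?b M 0 * Bm 0 S x + (\<Sum>m<M. ?b M (Suc m) * Bm (Suc m) S x)"
    by (simp add: binom_tail_0 Bm_0)
  also have "\<dots> = (\<Sum>m<Suc M. ?b M m * Bm m S x)" by (subst sum.lessThan_Suc_shift) simp
  finally have "Gam SS v a T (Suc M) S x =
      (1 - ?e) * (\<Sum>m<M. ?b M (Suc m) * Bm m S x) + ?e * (\<Sum>m<Suc M. ?b M m * Bm m S x)"
    by (simp add: IH)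
  \<comment> \<open>The added term has weight zero: \<open>M\<close> trials cannot have
    \<open>M + 1\<close> successes.\<close>
  also have "(\<Sum>m<M. ?b M (Suc m) * Bm m S x) = (\<Sum>m<Suc M. ?b M (Suc m) * Bm m S x)"
    using binom_tail_gt[OF e, of M "Suc M"] by simp
  also have "(1 - ?e) * (\<Sum>m<Suc M. ?b M (Suc m) * Bm m S x) + ?e * (\<Sum>m<Suc M. ?b M m * Bm m S x) =
      (\<Sum>m<Suc M. ?b (Suc M) (Suc m) * Bm m S x)"
    unfolding binom_tail_Suc[OF e] by (simp only: sum_distrib_left sum.distrib[symmetric] distrib_right mult.assoc)
  finally show ?case .
qed simp

text \<open>The estimator attaches no \<open>v\<close> to the last letter of a word. That letter
  becomes the outer operator, and the remaining word of length one less belongs to the expansion of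
  the iterate with the same binomial weight. The odd power of -1 left over gives the sign.\<close>

lemma V_estimator_eq:
  "(\<Sum>m=1..M. (-1) ^ m * (\<Sum>Ss\<in>adm_tuples SS m. prod_list (map v (butlast Ss)) * binom_tail M (1 / real (card SS)) m *
      (1 / real n ^ (m + 1) * (\<Sum>is\<in>all_tuples n (m + 1). chain Ss is)))) =
   - (\<Sum>S\<in>SS. 1 / real n * (\<Sum>l=1..n. T S (Gam SS v a T M S) (X l)))"
proof -
  let ?b = "\<lambda>m. binom_tail M (1 / real (card SS)) m"
  let ?mean = "\<lambda>g. 1 / real n * (\<Sum>l=1..n. g (X l))"
  have "(\<Sum>m=1..M. (-1) ^ m * (\<Sum>Ss\<in>adm_tuples SS m. prod_list (map v (butlast Ss)) * ?b m *
      (1 / real n ^ (m + 1) * (\<Sum>is\<in>all_tuples n (m + 1). chain Ss is)))) =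
    (\<Sum>m<M. (-1) ^ Suc m * (\<Sum>Ss\<in>adm_tuples SS (Suc m). prod_list (map v (butlast Ss)) * ?b (Suc m) * ?mean (Wd Ss)))"
    unfolding sum_from_1[of _ M]
  proof (rule sum.cong[OF refl])
    fix m
    have "1 / real n ^ (Suc m + 1) * (\<Sum>is\<in>all_tuples n (Suc m + 1). chain Ss is) = ?mean (Wd Ss)"
      if "Ss \<in> adm_tuples SS (Suc m)" for Ss
      using V_stat_eq[of Ss] that by (simp add: adm_tuples_def)
    then show "(-1) ^ Suc m * (\<Sum>Ss\<in>adm_tuples SS (Suc m). prod_list (map v (butlast Ss)) * ?b (Suc m) *
        (1 / real n ^ (Suc m + 1) * (\<Sum>is\<in>all_tuples n (Suc m + 1). chain Ss is))) =
      (-1) ^ Suc m * (\<Sum>Ss\<in>adm_tuples SS (Suc m). prod_list (map v (butlast Ss)) * ?b (Suc m) * ?mean (Wd Ss))"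
      by (simp only: cong: sum.cong)
  qed
  also have "\<dots> = (\<Sum>m<M. - (\<Sum>S\<in>SS. ?b (Suc m) * ?mean (T S (Bm m S))))"
  proof (intro sum.cong refl)
    fix m
    have "?mean (T S (Bm m S)) = (\<Sum>Ss\<in>pre m S. (-1) ^ m * prod_list (map v Ss) * ?mean (T S (Wd Ss)))" for S
      unfolding T_Bm by (subst sum.swap) (simp add: sum_distrib_left mult_ac)
    then show "(-1) ^ Suc m * (\<Sum>Ss\<in>adm_tuples SS (Suc m). prod_list (map v (butlast Ss)) * ?b (Suc m) * ?mean (Wd Ss)) =
      - (\<Sum>S\<in>SS. ?b (Suc m) * ?mean (T S (Bm m S)))"
      unfolding sum_adm_Suc by (simp add: sum_distrib_left sum_negf[symmetric] mult_ac)
  qed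
  also have "\<dots> = - (\<Sum>S\<in>SS. \<Sum>m<M. ?b (Suc m) * ?mean (T S (Bm m S)))"
    by (subst sum.swap) (simp add: sum_negf)
  also have "\<dots> = - (\<Sum>S\<in>SS. ?mean (T S (Gam SS v a T M S)))"
  proof -
    have "Gam SS v a T M S = (\<lambda>x. \<Sum>m<M. ?b (Suc m) * Bm m S x)" for S using Gam_eq_Bm by auto
    then have "?mean (T S (Gam SS v a T M S)) = (\<Sum>m<M. ?b (Suc m) * ?mean (T S (Bm m S)))" for S
      by (simp only: T_sum) (subst sum.swap, simp add: sum_distrib_left mult_ac)
    then show ?thesis by simp
  qed
  finally show ?thesis .
qed

end

lemma sum_avg_le:
  assumes "0 < n" "\<And>i. i \<in> {1..n} ==> \<bar>F i\<bar> \<le> B"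
  shows "\<bar>1 / real n * (\<Sum>i=1..n. F i)\<bar> \<le> B"
proof -
  have "\<bar>\<Sum>i=1..n. F i\<bar> \<le> (\<Sum>i=1..n. B)" using assms(2) by (intro order_trans[OF sum_abs sum_mono])
  then have "\<bar>\<Sum>i=1..n. F i\<bar> \<le> B * real n" by (simp add: mult.commute)
  then show ?thesis using assms(1) by (simp add: abs_mult divide_le_eq)
qed

section \<open>Deterministic comparison of empirical and population quantities\<close>

context jacobi begin

text \<open>The effect of coinciding indices: \<open>M\<close> word lengths, at most
  \<open>card SS ^ M\<close> words each, a bound \<open>B\<close> for every kernel factor, and the
  share \<open>(M + 1)\<^sup>2 / n\<close> of tuples with a repetition.\<close>

definition UV :: "nat => nat => real => real" where
  "UV n M B = 2 * A * (real M * (real M + 1)\<^sup>2 * (real (card SS) * B) ^ M) / real n"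

text \<open>The norm of the empirical operators in the maximum over the sample points, once the
  kernel averages are at most \<open>C0 + 1\<close> and the density estimates at least
  \<open>c1 / 2\<close>.\<close>

definition C2 :: real where "C2 = (C0 + 1) * 2 / c1 + 1"

text \<open>Quadratic in \<open>\<tau>\<close>: the outer factor \<open>2 * \<tau>\<close> bounds
  \<open>fX - fY\<close>, and each term inside contains the error of a replaced factor.\<close>

definition HE :: "nat => real => real" where
  "HE M \<tau> = real (card SS) * (2 * \<tau> * ((\<tau> + A * (2 + C1) ^ M * (2 * \<tau> / c1\<^sup>2) * (C0 + 1)) * (2 + C2) ^ M * (2 / c1) +
     A * (2 + C1) ^ M * (2 * \<tau> / c1\<^sup>2)))"

end

text \<open>One realisation of the sample, treated deterministically. The ratios
  \<open>nS S / n\<close> stand in for \<open>lam\<close>, so \<open>v\<close> is exactly the weight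
  that the estimator uses; the passage to the limiting ratios is postponed to the objective.\<close>

locale data = jacobi d K \<kappa> h f c0 C0 \<beta> L SS "\<lambda>S. real (nS S) / real n" a A
  for d K \<kappa> h f c0 C0 \<beta> L SS a A and nS :: "nat set => nat" and n :: nat +
  fixes X :: "nat => point" and Y :: "nat set \<times> nat => point"
begin

lemma nS_pos: "S \<in> SS ==> 0 < nS S" and n_pos: "0 < n"
proof -
  show "S \<in> SS ==> 0 < nS S" using lam[of S] by (cases "nS S") auto
  obtain S where "S \<in> SS" using SS(2) by auto
  then show "0 < n" using lam[of S] by (cases n) auto
qed

definition fX :: "nat set => point => real" where "fX S x = 1 / real n * (\<Sum>i=1..n. k S x (X i))"
definition fY :: "nat set => point => real" where "fY S x = 1 / real (nS S) * (\<Sum>i=1..nS S. k S x (Y (S, i)))"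
definition fh :: "nat set => point => real" where "fh S x = f_hat d K h n nS (X, Y) S x"

lemma fh_alt: "S \<in> SS ==> fh S x = (real n * fX S x + real (nS S) * fY S x) / real (n + nS S)"
  using nS_pos[of S] n_pos by (simp add: fh_def f_hat_def fX_def fY_def add.commute)

lemma v_alt: "S \<in> SS ==> v S = real (nS S) / real (n + nS S)"
  using nS_pos[of S] n_pos by (simp add: v_def field_simps)

text \<open>The density estimate is a convex combination of \<open>fX\<close> and \<open>fY\<close>
  with weight \<open>v S\<close> on the incomplete observations. This is how \<open>v S\<close> gets
  back to the last letter of a word.\<close>

lemma fX_minus_fh: "S \<in> SS ==> fX S x - fh S x = v S * (fX S x - fY S x)"
proof -
  assume S: "S \<in> SS"
  have "0 < real (n + nS S)" using n_pos by simp
  then show ?thesis unfolding fh_alt[OF S] v_alt[OF S] by (simp add: field_simps)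
qed

definition That :: "nat set => (point => real) => point => real" where
  "That S g y = 1 / real n * (\<Sum>i=1..n. g (X i) * (k S (X i) y / fh S (X i) - 1))"

interpretation W: words SS n X "\<lambda>S x y. k S x y / fh S x - 1" a v
  by unfold_locales (use finite_SS SS n_pos in auto)

lemma That_eq: "W.T = That" by (simp add: fun_eq_iff W.T_def That_def)

abbreviation \<Gamma>h :: "nat => nat set => point => real" where "\<Gamma>h \<equiv> Gam SS v a That"

lemma weight_eq: "set Ss \<subseteq> SS ==> weight n nS Ss = prod_list (map v Ss)"
  unfolding weight_def using nS_pos n_pos
  by (intro arg_cong[where f = prod_list] map_cong refl) (auto simp: v_def)

lemma weight_bounds: "set Ss \<subseteq> SS ==> 0 \<le> weight n nS Ss \<and> weight n nS Ss \<le> 1"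
  unfolding weight_eq
proof (induction Ss)
  case (Cons S Ss)
  then have "0 \<le> v S" "v S \<le> 1" using v_bounds(1)[of S] by auto
  then show ?case using Cons by (auto intro: mult_le_one)
qed simp

lemma k_hat_eq:
  assumes "length is = length Ss + 1"
  shows "k_hat d K a h n nS (X, Y) Ss (map X is) = W.chain Ss is"
  unfolding k_hat_def W.chain_def
  using assms by (intro arg_cong2[where f = "(*)"] prod.cong refl) (auto simp: fh_def[symmetric] nth_map)

definition thetaV :: "nat => real" where
  "thetaV M = 1 / real n * (\<Sum>i=1..n. a (X i)) - (\<Sum>S\<in>SS. 1 / real n * (\<Sum>l=1..n. That S (\<Gamma>h M S) (X l)))"

text \<open>\<open>U_minus_V\<close> is applied word by word; the weights and the binomial tails are
  at most 1.\<close>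

lemma theta_check_minus_thetaV:
  assumes M: "M + 1 \<le> n" and B: "1 \<le> B"
    "\<And>S i l. S \<in> SS ==> i \<in> {1..n} ==> l \<in> {1..n} ==> \<bar>k S (X i) (X l) / fh S (X i) - 1\<bar> \<le> B"
  shows "\<bar>theta_check d K a SS h M n nS (X, Y) - thetaV M\<bar> \<le> UV n M B"
proof -
  let ?b = "\<lambda>m. binom_tail M (1 / real (card SS)) m" let ?s = "real (card SS)"
  let ?U = "\<lambda>m Ss. 1 / falling n (m + 1) * (\<Sum>is\<in>index_tuples n (m + 1). W.chain Ss is)"
  let ?V = "\<lambda>m Ss. 1 / real n ^ (m + 1) * (\<Sum>is\<in>all_tuples n (m + 1). W.chain Ss is)"
  have "0 < card SS" using finite_SS SS(2) by (simp add: card_gt_0_iff)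
  then have s: "1 \<le> ?s" by linarith
  have 1: "theta_check d K a SS h M n nS (X, Y) = 1 / real n * (\<Sum>i=1..n. a (X i)) +
     (\<Sum>m=1..M. (-1) ^ m * (\<Sum>Ss\<in>adm_tuples SS m. weight n nS (butlast Ss) * ?b m * ?U m Ss))"
    unfolding theta_check_def fst_conv
  proof (intro arg_cong2[where f = "(+)"] refl sum.cong arg_cong2[where f = "(*)"])
    fix m Ss "is" assume "Ss \<in> adm_tuples SS m" "is \<in> index_tuples n (m + 1)"
    then have "length is = length Ss + 1" by (auto simp: adm_tuples_def index_tuples_def)
    then show "k_hat d K a h n nS (X, Y) Ss (map X is) = W.chain Ss is" by (rule k_hat_eq)
  qed
  have 2: "thetaV M = 1 / real n * (\<Sum>i=1..n. a (X i)) +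
     (\<Sum>m=1..M. (-1) ^ m * (\<Sum>Ss\<in>adm_tuples SS m. weight n nS (butlast Ss) * ?b m * ?V m Ss))"
  proof -
    have w: "weight n nS (butlast Ss) = prod_list (map v (butlast Ss))" if "Ss \<in> adm_tuples SS m" for Ss m
      using that by (intro weight_eq) (auto simp: adm_tuples_def dest: in_set_butlastD)
    have "(\<Sum>m=1..M. (-1) ^ m * (\<Sum>Ss\<in>adm_tuples SS m. weight n nS (butlast Ss) * ?b m * ?V m Ss)) =
      (\<Sum>m=1..M. (-1) ^ m * (\<Sum>Ss\<in>adm_tuples SS m. prod_list (map v (butlast Ss)) * ?b m * ?V m Ss))"
      by (simp only: w cong: sum.cong)
    then show ?thesis unfolding W.V_estimator_eq thetaV_def That_eq by simp
  qed
  have chain_le: "\<bar>W.chain Ss is\<bar> \<le> A * B ^ m" if Ss: "Ss \<in> adm_tuples SS m" and "is": "is \<in> all_tuples n (m + 1)" for m Ss "is"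
  proof -
    have len: "length Ss = m" "set Ss \<subseteq> SS" "length is = m + 1" "set is \<subseteq> {1..n}"
      using that by (auto simp: adm_tuples_def all_tuples_def)
    have "\<bar>\<Prod>j<length Ss. k (Ss ! j) (X (is ! j)) (X (is ! Suc j)) / fh (Ss ! j) (X (is ! j)) - 1\<bar> \<le> (\<Prod>j<length Ss. B)"
      unfolding abs_prod
    proof (intro prod_mono conjI abs_ge_zero)
      fix j assume j: "j \<in> {..<length Ss}"
      have "Ss ! j \<in> SS" using len j by (intro subsetD[OF len(2)] nth_mem) simp
      moreover have "is ! j \<in> {1..n}" using len j by (intro subsetD[OF len(4)] nth_mem) simp
      moreover have "is ! Suc j \<in> {1..n}" using len j by (intro subsetD[OF len(4)] nth_mem) simp
      ultimately show "\<bar>k (Ss ! j) (X (is ! j)) (X (is ! Suc j)) / fh (Ss ! j) (X (is ! j)) - 1\<bar> \<le> B" by (rule B(2))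
    qed
    then have "\<bar>\<Prod>j<length Ss. k (Ss ! j) (X (is ! j)) (X (is ! Suc j)) / fh (Ss ! j) (X (is ! j)) - 1\<bar> \<le> B ^ m"
      using len by simp
    then show ?thesis unfolding W.chain_def abs_mult using a_le A_nonneg by (intro mult_mono) auto
  qed
  have term_le: "\<bar>(-1) ^ m * (\<Sum>Ss\<in>adm_tuples SS m. weight n nS (butlast Ss) * ?b m * ?U m Ss) -
      (-1) ^ m * (\<Sum>Ss\<in>adm_tuples SS m. weight n nS (butlast Ss) * ?b m * ?V m Ss)\<bar> \<le>
      2 * A * (?s * B) ^ M * ((real M + 1)\<^sup>2 / real n)" if m: "m \<in> {1..M}" for m
  proof -
    have "\<bar>(-1) ^ m * (\<Sum>Ss\<in>adm_tuples SS m. weight n nS (butlast Ss) * ?b m * ?U m Ss) -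
      (-1) ^ m * (\<Sum>Ss\<in>adm_tuples SS m. weight n nS (butlast Ss) * ?b m * ?V m Ss)\<bar> =
      \<bar>\<Sum>Ss\<in>adm_tuples SS m. weight n nS (butlast Ss) * ?b m * (?U m Ss - ?V m Ss)\<bar>"
      by (simp only: right_diff_distrib[symmetric] sum_subtractf[symmetric] abs_mult power_abs abs_neg_one power_one mult_1_left)
    also have "\<dots> \<le> (\<Sum>Ss\<in>adm_tuples SS m. 2 * (A * B ^ m) * (real (m + 1) ^ 2 / real n))"
    proof (intro order_trans[OF sum_abs sum_mono])
      fix Ss assume Ss: "Ss \<in> adm_tuples SS m"
      have w: "0 \<le> weight n nS (butlast Ss) \<and> weight n nS (butlast Ss) \<le> 1"
        using Ss by (intro weight_bounds) (auto simp: adm_tuples_def dest: in_set_butlastD)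
      have u: "\<bar>?U m Ss - ?V m Ss\<bar> \<le> 2 * (A * B ^ m) * (real (m + 1) ^ 2 / real n)"
        using M m n_pos by (intro U_minus_V chain_le[OF Ss]) auto
      have w1: "\<bar>weight n nS (butlast Ss) * ?b m\<bar> \<le> 1"
        using w binom_tail_bounds[of M "1 / ?s" m] by (simp add: abs_mult mult_le_one)
      from mult_mono[OF w1 u zero_le_one abs_ge_zero] show "\<bar>weight n nS (butlast Ss) * ?b m * (?U m Ss - ?V m Ss)\<bar> \<le> 2 * (A * B ^ m) * (real (m + 1) ^ 2 / real n)"
        by (simp only: abs_mult mult_1_left)
    qed
    also have "\<dots> = real (card (adm_tuples SS m)) * (2 * (A * B ^ m) * (real (m + 1) ^ 2 / real n))" by simp
    also have "\<dots> \<le> ?s ^ m * (2 * (A * B ^ m) * ((real M + 1) ^ 2 / real n))"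
    proof (intro mult_mono)
      show "real (card (adm_tuples SS m)) \<le> ?s ^ m"
        using W.card_adm[of m] by (metis of_nat_le_iff of_nat_power)
      show "real (m + 1) ^ 2 / real n \<le> (real M + 1) ^ 2 / real n"
        using m by (intro divide_right_mono power_mono) auto
    qed (use A_nonneg B in auto)
    also have "\<dots> = 2 * A * (?s * B) ^ m * ((real M + 1)\<^sup>2 / real n)" by (simp add: power_mult_distrib)
    also have "\<dots> \<le> 2 * A * (?s * B) ^ M * ((real M + 1)\<^sup>2 / real n)"
    proof (intro mult_right_mono mult_left_mono power_increasing)
      show "1 \<le> ?s * B" using mult_mono[OF s B(1)] s by simp
    qed (use m A_nonneg in auto)
    finally show ?thesis .
  qed
  have "\<bar>theta_check d K a SS h M n nS (X, Y) - thetaV M\<bar> \<le> (\<Sum>m=1..M. 2 * A * (?s * B) ^ M * ((real M + 1)\<^sup>2 / real n))"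
    unfolding 1 2 add_diff_cancel_left sum_subtractf[symmetric]
    by (intro order_trans[OF sum_abs sum_mono] term_le)
  also have "\<dots> = UV n M B" by (simp add: UV_def)
  finally show ?thesis .
qed

text \<open>The estimator with the iterates and the denominators replaced by population versions,
  but with the fluctuating factor \<open>fX - fY\<close> left in place.\<close>

definition MV :: "nat => real" where
  "MV M = 1 / real n * (\<Sum>i=1..n. a (X i)) -
    (\<Sum>S\<in>SS. v S * (1 / real n * (\<Sum>i=1..n. \<Gamma>t M S (X i) / fb S (X i) * (fX S (X i) - fY S (X i)))))"

text \<open>Averaging over the second argument of the kernel produces \<open>fX\<close>, and
  \<open>fX / fh - 1\<close> is proportional to \<open>fX - fY\<close>. The mean of an empirical
  operator is thus small before anything is replaced.\<close>

lemma That_mean: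
  assumes S: "S \<in> SS" and nz: "\<And>i. i \<in> {1..n} ==> fh S (X i) \<noteq> 0"
  shows "1 / real n * (\<Sum>l=1..n. That S g (X l)) = v S * (1 / real n * (\<Sum>i=1..n. g (X i) / fh S (X i) * (fX S (X i) - fY S (X i))))"
proof -
  have "(\<Sum>l=1..n. That S g (X l)) = (\<Sum>i=1..n. 1 / real n * (\<Sum>l=1..n. g (X i) * (k S (X i) (X l) / fh S (X i) - 1)))"
    unfolding That_def sum_distrib_left by (rule sum.swap)
  also have "\<dots> = (\<Sum>i=1..n. g (X i) * (fX S (X i) / fh S (X i) - 1))"
  proof (intro sum.cong refl)
    fix i
    have "(\<Sum>l=1..n. k S (X i) (X l) / fh S (X i) - 1) = (\<Sum>l=1..n. k S (X i) (X l)) / fh S (X i) - real n"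
      by (simp add: sum_subtractf sum_divide_distrib)
    moreover have "1 / N * (y * (T / F - N)) = y * (1 / N * T / F - 1)" if "N \<noteq> 0" for N y T F :: real
      using that by (simp add: right_diff_distrib)
    ultimately show "1 / real n * (\<Sum>l=1..n. g (X i) * (k S (X i) (X l) / fh S (X i) - 1)) = g (X i) * (fX S (X i) / fh S (X i) - 1)"
      unfolding sum_distrib_left[symmetric] fX_def using n_pos by simp
  qed
  also have "\<dots> = (\<Sum>i=1..n. v S * (g (X i) / fh S (X i) * (fX S (X i) - fY S (X i))))"
  proof (intro sum.cong refl)
    fix i assume i: "i \<in> {1..n}"
    have "fX S (X i) / fh S (X i) - 1 = (fX S (X i) - fh S (X i)) / fh S (X i)" using nz[OF i] by (simp add: diff_divide_distrib)
    then show "g (X i) * (fX S (X i) / fh S (X i) - 1) = v S * (g (X i) / fh S (X i) * (fX S (X i) - fY S (X i)))"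
      unfolding fX_minus_fh[OF S] by simp
  qed
  finally have "(\<Sum>l=1..n. That S g (X l)) = v S * (\<Sum>i=1..n. g (X i) / fh S (X i) * (fX S (X i) - fY S (X i)))"
    by (simp only: sum_distrib_left)
  then show ?thesis by (simp only: mult.left_commute)
qed

text \<open>Both replacements, of the iterate and of the denominator, have an error of order
  \<open>\<tau>\<close> and multiply a factor of order \<open>\<tau>\<close>. Deviations are
  required only at the sample points, and only for the finitely many population iterates, which are
  not random.\<close>

lemma thetaV_minus_MV:
  assumes \<tau>: "0 \<le> \<tau>" "\<tau> \<le> c1 / 2" "\<tau> \<le> 1" and Xc: "\<And>i. i \<in> {1..n} ==> X i \<in> unit_cube d"
    and gX: "\<And>S l. S \<in> SS ==> l \<in> {1..n} ==> \<bar>fX S (X l) - ft S (X l)\<bar> \<le> \<tau>"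
    and gY: "\<And>S l. S \<in> SS ==> l \<in> {1..n} ==> \<bar>fY S (X l) - ft S (X l)\<bar> \<le> \<tau>"
    and gT: "\<And>S m l. S \<in> SS ==> m < M ==> l \<in> {1..n} ==>
      \<bar>1 / real n * (\<Sum>i=1..n. \<Gamma>t m S (X i) * (k S (X i) (X l) / fb S (X i) - 1)) - Tt S (\<Gamma>t m S) (X l)\<bar> \<le> \<tau>"
  shows "\<bar>thetaV M - MV M\<bar> \<le> HE M \<tau>"
    and "S \<in> SS ==> i \<in> {1..n} ==> l \<in> {1..n} ==> \<bar>k S (X i) (X l) / fh S (X i) - 1\<bar> \<le> 2 * (\<kappa> / h ^ d) / c1 + 1"
proof -
  let ?G = "A * (2 + C1) ^ M"
  have G0: "0 \<le> ?G" using A_nonneg C1_pos by simp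
  have gh: "\<bar>fh S (X l) - ft S (X l)\<bar> \<le> \<tau>" if S: "S \<in> SS" and l: "l \<in> {1..n}" for S l
  proof -
    let ?N = "real (n + nS S)"
    have N: "0 < ?N" using n_pos by simp
    have "fh S (X l) - ft S (X l) = (real n * (fX S (X l) - ft S (X l)) + real (nS S) * (fY S (X l) - ft S (X l))) / ?N"
      unfolding fh_alt[OF S] using N by (simp add: field_simps)
    moreover have "\<bar>real n * (fX S (X l) - ft S (X l)) + real (nS S) * (fY S (X l) - ft S (X l))\<bar> \<le> real n * \<tau> + real (nS S) * \<tau>"
    proof (rule order_trans[OF abs_triangle_ineq add_mono])
      show "\<bar>real n * (fX S (X l) - ft S (X l))\<bar> \<le> real n * \<tau>"
        unfolding abs_mult abs_of_nat by (intro mult_left_mono gX[OF S l]) simp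
      show "\<bar>real (nS S) * (fY S (X l) - ft S (X l))\<bar> \<le> real (nS S) * \<tau>"
        unfolding abs_mult abs_of_nat by (intro mult_left_mono gY[OF S l]) simp
    qed
    then have "\<bar>(real n * (fX S (X l) - ft S (X l)) + real (nS S) * (fY S (X l) - ft S (X l))) / ?N\<bar> \<le> \<tau>"
      using N by (simp add: abs_divide divide_le_eq algebra_simps)
    ultimately show ?thesis by simp
  qed
  have ftc: "c1 \<le> ft S (X l)" "fb S (X l) = ft S (X l)" if "S \<in> SS" "l \<in> {1..n}" for S l
    using ft_ge[OF SS_sub[OF that(1)] Xc[OF that(2)]] fb_eq[OF SS_sub[OF that(1)] Xc[OF that(2)]] by auto
  have fh_ge: "c1 / 2 \<le> fh S (X l)" if "S \<in> SS" "l \<in> {1..n}" for S l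
    using gh[OF that] ftc(1)[OF that] \<tau>(2) by linarith
  have fh_pos: "0 < fh S (X l)" if "S \<in> SS" "l \<in> {1..n}" for S l
    using fh_ge[OF that] c1_pos by linarith
  have inv: "1 / fh S (X l) \<le> 2 / c1" if "S \<in> SS" "l \<in> {1..n}" for S l
    using fh_ge[OF that] fh_pos[OF that] c1_pos by (simp add: field_simps)
  have inv_diff: "\<bar>1 / fh S (X l) - 1 / fb S (X l)\<bar> \<le> 2 * \<tau> / c1\<^sup>2" if "S \<in> SS" "l \<in> {1..n}" for S l
  proof -
    have p: "0 < fh S (X l)" "0 < fb S (X l)" using fh_pos[OF that] fb_pos by auto
    have "\<bar>1 / fh S (X l) - 1 / fb S (X l)\<bar> = \<bar>fb S (X l) - fh S (X l)\<bar> / (fh S (X l) * fb S (X l))"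
      using p by (simp add: abs_divide[symmetric] abs_mult[symmetric] field_simps)
    also have "\<dots> \<le> \<tau> / (c1 / 2 * c1)"
      using gh[OF that] ftc[OF that] fh_ge[OF that] \<tau> c1_pos by (intro frac_le mult_mono) auto
    also have "\<dots> = 2 * \<tau> / c1\<^sup>2" by (simp add: power2_eq_square field_simps)
    finally show ?thesis .
  qed
  show "\<bar>k S (X i) (X l) / fh S (X i) - 1\<bar> \<le> 2 * (\<kappa> / h ^ d) / c1 + 1" if S: "S \<in> SS" and i: "i \<in> {1..n}" and l: "l \<in> {1..n}" for S i l
  proof -
    have "k S (X i) (X l) * (1 / fh S (X i)) \<le> \<kappa> / h ^ d * (2 / c1)"
      using k_le[OF SS_sub[OF S], of "X l" "X i"] inv[OF S i] k_nonneg[OF SS_sub[OF S]] \<kappa>_nonneg h_pos fh_pos[OF S i]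
      by (intro mult_mono) auto
    moreover have "0 \<le> k S (X i) (X l) * (1 / fh S (X i))"
      using k_nonneg[OF SS_sub[OF S], of "X l" "X i"] fh_pos[OF S i] by simp
    ultimately show ?thesis by (simp add: abs_le_iff mult.commute)
  qed
  let ?N = "\<lambda>(g::point => real) e. \<forall>l\<in>{1..n}. \<bar>g (X l)\<bar> \<le> e"
  \<comment> \<open>The empirical operators look at a function only at the sample points, so its
    maximum there is a sufficient norm.\<close>
  interpret E: seminorm_like ?N
  proof
    fix g g' :: "point => real" and A B c :: real
    show "?N (\<lambda>_. 0) 0" by simp
    show "?N g A ==> ?N g' B ==> ?N (\<lambda>x. g x + g' x) (A + B)"
      by (auto intro: order_trans[OF abs_triangle_ineq] add_mono)
    show "?N g A ==> ?N (\<lambda>x. c * g x) (\<bar>c\<bar> * A)" by (auto intro: abs_cmult_le)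
    show "?N g A ==> A \<le> B ==> ?N g B" by (meson order_trans)
  qed
  have fX_le: "fX S (X l) \<le> C0 + 1" if "S \<in> SS" "l \<in> {1..n}" for S l
    using gX[OF that] ft_le[OF SS_sub[OF that(1)], of "X l"] \<tau> by linarith
  have ksum: "(\<Sum>i=1..n. k S (X i) (X l)) = real n * fX S (X l)" if "S \<in> SS" for S l
    using n_pos by (simp add: fX_def k_sym[OF SS_sub[OF that], of _ "X l"])
  \<comment> \<open>Bounding the kernel by its supremum would cost \<open>h ^ -d\<close>. Its sum
    over the sample is \<open>n * fX\<close>, which stays bounded under the assumed
    deviations.\<close>
  have That_le: "\<bar>That S g (X l)\<bar> \<le> C2 * e" if S: "S \<in> SS" and l: "l \<in> {1..n}" and g: "?N g e" for S l g e
  proof -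
    have e: "0 \<le> e" using g l abs_ge_zero order_trans by blast
    have "\<bar>\<Sum>i=1..n. g (X i) * (k S (X i) (X l) / fh S (X i) - 1)\<bar> \<le> (\<Sum>i=1..n. e * (k S (X i) (X l) * (2 / c1) + 1))"
    proof (intro order_trans[OF sum_abs sum_mono])
      fix i assume i: "i \<in> {1..n}"
      have k0: "0 \<le> k S (X i) (X l)" by (rule k_nonneg[OF SS_sub[OF S]])
      have "k S (X i) (X l) * (1 / fh S (X i)) \<le> k S (X i) (X l) * (2 / c1)" by (intro mult_left_mono inv[OF S i] k0)
      moreover have "0 \<le> k S (X i) (X l) * (1 / fh S (X i))" using k0 fh_pos[OF S i] by simp
      ultimately have "\<bar>k S (X i) (X l) / fh S (X i) - 1\<bar> \<le> k S (X i) (X l) * (2 / c1) + 1" by simp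
      then show "\<bar>g (X i) * (k S (X i) (X l) / fh S (X i) - 1)\<bar> \<le> e * (k S (X i) (X l) * (2 / c1) + 1)"
        unfolding abs_mult using g i e by (intro mult_mono) auto
    qed
    also have "\<dots> = e * ((\<Sum>i=1..n. k S (X i) (X l)) * (2 / c1) + real n)"
    proof -
      have "(\<Sum>i=1..n. e * (k S (X i) (X l) * (2 / c1) + 1)) = e * ((\<Sum>i=1..n. k S (X i) (X l)) * (2 / c1) + (\<Sum>i=1..n. 1))"
        by (simp only: sum_distrib_left[symmetric] sum_distrib_right[symmetric] sum.distrib)
      then show ?thesis by simp
    qed
    also have "\<dots> = real n * (e * (fX S (X l) * (2 / c1) + 1))" unfolding ksum[OF S] by (simp add: algebra_simps)
    also have "\<dots> \<le> real n * (C2 * e)"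
    proof (intro mult_left_mono)
      have "fX S (X l) * (2 / c1) \<le> (C0 + 1) * (2 / c1)" using fX_le[OF S l] c1_pos by (intro mult_right_mono) auto
      then have "e * (fX S (X l) * (2 / c1) + 1) \<le> e * C2" using e by (intro mult_left_mono) (auto simp: C2_def)
      then show "e * (fX S (X l) * (2 / c1) + 1) \<le> C2 * e" by (simp only: mult.commute)
    qed simp
    finally have "\<bar>\<Sum>i=1..n. g (X i) * (k S (X i) (X l) / fh S (X i) - 1)\<bar> \<le> real n * (C2 * e)" .
    then show ?thesis unfolding That_def using n_pos by (simp add: abs_mult divide_le_eq mult.commute)
  qed
  let ?\<tau>' = "\<tau> + ?G * (2 * \<tau> / c1\<^sup>2) * (C0 + 1)"
  have G_mono: "A * (2 + C1) ^ m \<le> ?G" if "m \<le> M" for m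
    using that A_nonneg C1_pos by (intro mult_left_mono power_increasing) auto
  \<comment> \<open>The only change beyond the deviation \<open>gT\<close> is that of the
    denominator; again the kernel is summed and not bounded pointwise.\<close>
  have dev: "\<bar>That S (\<Gamma>t m S) (X l) - Tt S (\<Gamma>t m S) (X l)\<bar> \<le> ?\<tau>'" if S: "S \<in> SS" and l: "l \<in> {1..n}" and m: "m < M" for S l m
  proof -
    let ?R = "1 / real n * (\<Sum>i=1..n. \<Gamma>t m S (X i) * (k S (X i) (X l) / fb S (X i) - 1))"
    have "That S (\<Gamma>t m S) (X l) - ?R = 1 / real n * (\<Sum>i=1..n. \<Gamma>t m S (X i) * k S (X i) (X l) * (1 / fh S (X i) - 1 / fb S (X i)))"
      unfolding That_def by (simp add: sum_subtractf[symmetric] diff_divide_distrib[symmetric] right_diff_distrib)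
    also have "\<bar>\<dots>\<bar> \<le> ?G * (2 * \<tau> / c1\<^sup>2) * (C0 + 1)"
    proof -
      have "\<bar>\<Sum>i=1..n. \<Gamma>t m S (X i) * k S (X i) (X l) * (1 / fh S (X i) - 1 / fb S (X i))\<bar> \<le>
        (\<Sum>i=1..n. ?G * (2 * \<tau> / c1\<^sup>2) * k S (X i) (X l))"
      proof (intro order_trans[OF sum_abs sum_mono])
        fix i assume i: "i \<in> {1..n}"
        have k0: "0 \<le> k S (X i) (X l)" by (rule k_nonneg[OF SS_sub[OF S]])
        have "\<bar>\<Gamma>t m S (X i)\<bar> \<le> ?G" using \<Gamma>t_le(2)[OF S, of m "X i"] G_mono[of m] m by linarith
        then have "\<bar>\<Gamma>t m S (X i)\<bar> * k S (X i) (X l) * \<bar>1 / fh S (X i) - 1 / fb S (X i)\<bar> \<le> ?G * k S (X i) (X l) * (2 * \<tau> / c1\<^sup>2)"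
          using inv_diff[OF S i] k0 G0 by (intro mult_mono) auto
        then show "\<bar>\<Gamma>t m S (X i) * k S (X i) (X l) * (1 / fh S (X i) - 1 / fb S (X i))\<bar> \<le> ?G * (2 * \<tau> / c1\<^sup>2) * k S (X i) (X l)"
          unfolding abs_mult abs_of_nonneg[OF k0] by (simp only: mult_ac)
      qed
      also have "\<dots> = ?G * (2 * \<tau> / c1\<^sup>2) * (real n * fX S (X l))" unfolding sum_distrib_left[symmetric] ksum[OF S] ..
      also have "\<dots> \<le> ?G * (2 * \<tau> / c1\<^sup>2) * (real n * (C0 + 1))"
        using fX_le[OF S l] G0 \<tau> by (intro mult_left_mono) auto
      finally show ?thesis using n_pos unfolding abs_mult by (simp add: divide_le_eq mult_ac)
    qed
    finally have "\<bar>That S (\<Gamma>t m S) (X l) - ?R\<bar> \<le> ?G * (2 * \<tau> / c1\<^sup>2) * (C0 + 1)" .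
    then show ?thesis using gT[OF S m l] by linarith
  qed
  have \<tau>'0: "0 \<le> ?\<tau>'" using \<tau> G0 C0_pos by simp
  have C20: "0 \<le> C2" using C0_pos c1_pos by (simp add: C2_def)
  have diff: "?N (\<lambda>x. \<Gamma>h M S x - \<Gamma>t M S x) (?\<tau>' * (2 + C2) ^ M)" if S: "S \<in> SS" for S
  proof (rule E.Gam_diff_le[OF finite_SS v_bounds(1) \<tau>'0 C20 _ order_refl S])
    fix m U e assume m: "m < M" and U: "U \<in> SS" and N: "?N (\<lambda>x. \<Gamma>h m U x - \<Gamma>t m U x) e"
    show "?N (\<lambda>x. That U (\<Gamma>h m U) x - Tt U (\<Gamma>t m U) x) (C2 * e + ?\<tau>')"
    proof
      fix l assume l: "l \<in> {1..n}"
      have "That U (\<Gamma>h m U) (X l) - That U (\<Gamma>t m U) (X l) = That U (\<lambda>x. \<Gamma>h m U x - \<Gamma>t m U x) (X l)"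
        unfolding That_def by (simp add: sum_subtractf[symmetric] diff_divide_distrib[symmetric] left_diff_distrib)
      then have "\<bar>That U (\<Gamma>h m U) (X l) - That U (\<Gamma>t m U) (X l)\<bar> \<le> C2 * e" using That_le[OF U l N] by simp
      then show "\<bar>That U (\<Gamma>h m U) (X l) - Tt U (\<Gamma>t m U) (X l)\<bar> \<le> C2 * e + ?\<tau>'" using dev[OF U l m] by linarith
    qed
  qed
  let ?e = "?\<tau>' * (2 + C2) ^ M"
  have e0: "0 \<le> ?e" using \<tau>'0 C20 by simp
  have one: "\<bar>v S * (1 / real n * (\<Sum>i=1..n. \<Gamma>h M S (X i) / fh S (X i) * (fX S (X i) - fY S (X i)))) -
      v S * (1 / real n * (\<Sum>i=1..n. \<Gamma>t M S (X i) / fb S (X i) * (fX S (X i) - fY S (X i))))\<bar> \<le>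
      2 * \<tau> * (?e * (2 / c1) + ?G * (2 * \<tau> / c1\<^sup>2))" if S: "S \<in> SS" for S
  proof -
    let ?D = "\<lambda>i. (\<Gamma>h M S (X i) / fh S (X i) - \<Gamma>t M S (X i) / fb S (X i)) * (fX S (X i) - fY S (X i))"
    have "\<bar>1 / real n * (\<Sum>i=1..n. ?D i)\<bar> \<le> 2 * \<tau> * (?e * (2 / c1) + ?G * (2 * \<tau> / c1\<^sup>2))"
    proof (rule sum_avg_le[OF n_pos])
      fix i assume i: "i \<in> {1..n}"
      have "\<Gamma>h M S (X i) / fh S (X i) - \<Gamma>t M S (X i) / fb S (X i) =
        (\<Gamma>h M S (X i) - \<Gamma>t M S (X i)) * (1 / fh S (X i)) + \<Gamma>t M S (X i) * (1 / fh S (X i) - 1 / fb S (X i))"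
        by (simp add: algebra_simps diff_divide_distrib)
      also have "\<bar>\<dots>\<bar> \<le> ?e * (2 / c1) + ?G * (2 * \<tau> / c1\<^sup>2)"
      proof (rule order_trans[OF abs_triangle_ineq add_mono])
        show "\<bar>(\<Gamma>h M S (X i) - \<Gamma>t M S (X i)) * (1 / fh S (X i))\<bar> \<le> ?e * (2 / c1)"
          unfolding abs_mult using diff[OF S] i inv[OF S i] fh_pos[OF S i] e0 by (intro mult_mono) auto
        show "\<bar>\<Gamma>t M S (X i) * (1 / fh S (X i) - 1 / fb S (X i))\<bar> \<le> ?G * (2 * \<tau> / c1\<^sup>2)"
          unfolding abs_mult using \<Gamma>t_le(2)[OF S, of M "X i"] inv_diff[OF S i] G0 by (intro mult_mono) auto
      qed
      finally have 1: "\<bar>\<Gamma>h M S (X i) / fh S (X i) - \<Gamma>t M S (X i) / fb S (X i)\<bar> \<le> ?e * (2 / c1) + ?G * (2 * \<tau> / c1\<^sup>2)" .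
      have 2: "\<bar>fX S (X i) - fY S (X i)\<bar> \<le> 2 * \<tau>" using gX[OF S i] gY[OF S i] by linarith
      have "\<bar>?D i\<bar> \<le> (?e * (2 / c1) + ?G * (2 * \<tau> / c1\<^sup>2)) * (2 * \<tau>)"
        unfolding abs_mult using 1 2 \<tau> by (intro mult_mono) (auto intro: order_trans[OF abs_ge_zero])
      then show "\<bar>?D i\<bar> \<le> 2 * \<tau> * (?e * (2 / c1) + ?G * (2 * \<tau> / c1\<^sup>2))" by (simp only: mult.commute)
    qed
    moreover have "v S * (1 / real n * (\<Sum>i=1..n. \<Gamma>h M S (X i) / fh S (X i) * (fX S (X i) - fY S (X i)))) -
      v S * (1 / real n * (\<Sum>i=1..n. \<Gamma>t M S (X i) / fb S (X i) * (fX S (X i) - fY S (X i)))) = v S * (1 / real n * (\<Sum>i=1..n. ?D i))"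
      by (simp only: left_diff_distrib sum_subtractf right_diff_distrib)
    moreover have "\<bar>v S * (1 / real n * (\<Sum>i=1..n. ?D i))\<bar> \<le> 1 * \<bar>1 / real n * (\<Sum>i=1..n. ?D i)\<bar>"
      unfolding abs_mult[of "v S"] using v_bounds[OF S] by (intro mult_right_mono) auto
    ultimately show ?thesis by linarith
  qed
  have tV: "thetaV M = 1 / real n * (\<Sum>i=1..n. a (X i)) -
    (\<Sum>S\<in>SS. v S * (1 / real n * (\<Sum>i=1..n. \<Gamma>h M S (X i) / fh S (X i) * (fX S (X i) - fY S (X i)))))"
    unfolding thetaV_def
  proof (intro arg_cong2[where f = "(-)"] refl sum.cong)
    fix S assume S: "S \<in> SS"
    show "1 / real n * (\<Sum>l=1..n. That S (\<Gamma>h M S) (X l)) = v S * (1 / real n * (\<Sum>i=1..n. \<Gamma>h M S (X i) / fh S (X i) * (fX S (X i) - fY S (X i))))"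
      by (rule That_mean[OF S]) (use fh_pos[OF S] in force)
  qed
  have "\<bar>MV M - thetaV M\<bar> \<le> (\<Sum>S\<in>SS. 2 * \<tau> * (?e * (2 / c1) + ?G * (2 * \<tau> / c1\<^sup>2)))"
  proof -
    have gen: "(m - q) - (m - p) = p - q" for m p q :: real by simp
    show ?thesis unfolding tV MV_def gen sum_subtractf[symmetric]
      by (intro order_trans[OF sum_abs sum_mono] one)
  qed
  then show "\<bar>thetaV M - MV M\<bar> \<le> HE M \<tau>"
    by (simp add: HE_def abs_minus_commute)
qed

end

section \<open>Moment and tail bounds for independent samples\<close>

locale iid = prob_space M for M :: "'a measure" +
  fixes J :: "'i set"
  assumes fin: "finite J"
begin

abbreviation \<Omega> :: "('i => 'a) measure" where "\<Omega> \<equiv> Pi\<^sub>M J (\<lambda>_. M)"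

lemma product_prob: "product_prob_space (\<lambda>_::'b. M)"
  by unfold_locales

lemma prob_\<Omega>: "prob_space \<Omega>"
  by (intro prob_space_PiM prob_space_axioms)

lemma component_measurable [measurable]: "j \<in> J ==> (\<lambda>z. z j) \<in> \<Omega> \<rightarrow>\<^sub>M M"
  by (rule measurable_component_singleton)

lemma distr_component: "j \<in> J ==> distr \<Omega> M (\<lambda>z. z j) = M"
  using distr_PiM_component[of J "\<lambda>_. M" j] prob_space_axioms by simp

lemma integral_component:
  "j \<in> J ==> F \<in> borel_measurable M ==> (\<integral>z. F (z j) \<partial>\<Omega>) = (\<integral>x. F x \<partial>M)" for F :: "'a => real"
  using integral_distr[of "\<lambda>z. z j" \<Omega> M F] distr_component[of j] by simp

lemma AE_component: "j \<in> J ==> AE x in M. Q x ==> AE z in \<Omega>. Q (z j)"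
proof -
  assume j: "j \<in> J" and "AE x in M. Q x"
  then have "AE x in distr \<Omega> M (\<lambda>z. z j). Q x" unfolding distr_component[OF j] by simp
  then show ?thesis by (rule AE_distrD[rotated]) (rule component_measurable[OF j])
qed

lemma integrable_bounded:
  fixes F :: "('i => 'a) => real"
  assumes "F \<in> borel_measurable \<Omega>" "\<And>z. z \<in> space \<Omega> ==> \<bar>F z\<bar> \<le> B"
  shows "integrable \<Omega> F"
proof -
  interpret O: prob_space \<Omega> by (rule prob_\<Omega>)
  show ?thesis using assms by (intro O.integrable_const_bound[of _ B] AE_I2) auto
qed

text \<open>Integrates the coordinate \<open>j\<close> first; this supplies all orthogonality
  relations below.\<close>

lemma integral_update_zero:
  fixes F :: "('i => 'a) => real"
  assumes j: "j \<in> J" and F: "integrable \<Omega> F"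
    and zero: "\<And>z. (\<And>i. i \<in> J - {j} ==> z i \<in> space M) ==> (\<integral>x. F (z(j := x)) \<partial>M) = 0"
  shows "(\<integral>z. F z \<partial>\<Omega>) = 0"
proof -
  interpret P: product_prob_space "\<lambda>_::'i. M" J by (rule product_prob)
  have J: "insert j (J - {j}) = J" using j by auto
  have "(\<integral>z. F z \<partial>\<Omega>) = (\<integral>z. (\<integral>x. F (z(j := x)) \<partial>M) \<partial>Pi\<^sub>M (J - {j}) (\<lambda>_. M))"
    using P.product_integral_insert[of "J - {j}" j F, unfolded J] fin F by simp
  also have "\<dots> = (\<integral>z. 0 \<partial>Pi\<^sub>M (J - {j}) (\<lambda>_. M))"
  proof (rule Bochner_Integration.integral_cong[OF refl])
    fix z assume "z \<in> space (Pi\<^sub>M (J - {j}) (\<lambda>_. M))"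
    then show "(\<integral>x. F (z(j := x)) \<partial>M) = 0" by (intro zero) (auto simp: space_PiM PiE_def Pi_def)
  qed
  finally show ?thesis by simp
qed

lemma second_moment_linear:
  assumes c: "\<And>j. j \<in> J ==> c j \<in> borel_measurable M" "\<And>j x. j \<in> J ==> \<bar>c j x\<bar> \<le> B"
    and mean: "\<And>j. j \<in> J ==> (\<integral>x. c j x \<partial>M) = (0::real)"
  shows "(\<integral>z. (\<Sum>j\<in>J. c j (z j))\<^sup>2 \<partial>\<Omega>) = (\<Sum>j\<in>J. (\<integral>x. (c j x)\<^sup>2 \<partial>M))"
proof -
  have cm: "(\<lambda>z. c j (z j)) \<in> borel_measurable \<Omega>" if "j \<in> J" for j
    by (rule measurable_compose[OF component_measurable[OF that] c(1)[OF that]])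
  have int: "integrable \<Omega> (\<lambda>z. c i (z i) * c j (z j))" if "i \<in> J" "j \<in> J" for i j
  proof (rule integrable_bounded[of _ "\<bar>B\<bar> * \<bar>B\<bar>"])
    show "\<bar>c i (z i) * c j (z j)\<bar> \<le> \<bar>B\<bar> * \<bar>B\<bar>" for z
      unfolding abs_mult using c(2)[OF that(1), of "z i"] c(2)[OF that(2), of "z j"] by (intro mult_mono) auto
  qed (intro borel_measurable_times cm that)
  have "(\<integral>z. (\<Sum>j\<in>J. c j (z j))\<^sup>2 \<partial>\<Omega>) = (\<integral>z. (\<Sum>i\<in>J. \<Sum>j\<in>J. c i (z i) * c j (z j)) \<partial>\<Omega>)"
    by (simp only: power2_eq_square sum_product)
  also have "\<dots> = (\<Sum>i\<in>J. \<Sum>j\<in>J. (\<integral>z. c i (z i) * c j (z j) \<partial>\<Omega>))"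
    using int by (subst Bochner_Integration.integral_sum) (auto intro!: Bochner_Integration.integrable_sum sum.cong Bochner_Integration.integral_sum)
  also have "\<dots> = (\<Sum>i\<in>J. \<Sum>j\<in>J. if i = j then (\<integral>x. (c i x)\<^sup>2 \<partial>M) else 0)"
  proof (intro sum.cong refl)
    fix i j assume ij: "i \<in> J" "j \<in> J"
    show "(\<integral>z. c i (z i) * c j (z j) \<partial>\<Omega>) = (if i = j then (\<integral>x. (c i x)\<^sup>2 \<partial>M) else 0)"
    proof (cases "i = j")
      case True
      have "(\<lambda>x. c i x * c i x) \<in> borel_measurable M" using c(1)[OF ij(1)] by simp
      from integral_component[OF ij(1) this] True show ?thesis by (simp add: power2_eq_square)
    next
      case False
      have "(\<integral>z. c i (z i) * c j (z j) \<partial>\<Omega>) = 0"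
        using False mean[OF ij(2)] by (intro integral_update_zero[OF ij(2) int[OF ij]]) simp
      then show ?thesis using False by simp
    qed
  qed
  also have "\<dots> = (\<Sum>j\<in>J. (\<integral>x. (c j x)\<^sup>2 \<partial>M))" using fin by simp
  finally show ?thesis .
qed

text \<open>An index of \<open>p\<close> that does not occur in \<open>p'\<close> can be integrated
  out to give 0. Hence for each \<open>p\<close> only \<open>p\<close> itself and the reversed pair
  contribute, and the bound is linear in the number of pairs.\<close>

lemma second_moment_degenerate:
  fixes q :: "'a => 'a => real"
  assumes P: "P \<subseteq> J \<times> J" "\<And>i l. (i, l) \<in> P ==> i \<noteq> l"
    and qm: "(\<lambda>p. q (fst p) (snd p)) \<in> borel_measurable (M \<Otimes>\<^sub>M M)" and qb: "\<And>x y. \<bar>q x y\<bar> \<le> Q"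
    and q1: "\<And>y. y \<in> space M ==> (\<integral>x. q x y \<partial>M) = 0" and q2: "\<And>x. x \<in> space M ==> (\<integral>y. q x y \<partial>M) = 0"
  shows "(\<integral>z. (\<Sum>(i, l)\<in>P. q (z i) (z l))\<^sup>2 \<partial>\<Omega>) \<le> 2 * real (card P) * Q\<^sup>2"
proof -
  interpret O: prob_space \<Omega> by (rule prob_\<Omega>)
  have finP: "finite P" using P(1) fin by (meson finite_SigmaI finite_subset)
  let ?q = "\<lambda>p (z::'i => 'a). q (z (fst p)) (z (snd p))"
  have Q: "0 \<le> Q" using qb[of undefined undefined] by linarith
  have qpm: "?q p \<in> borel_measurable \<Omega>" if "p \<in> P" for p
  proof -
    have "(\<lambda>z. (z (fst p), z (snd p))) \<in> \<Omega> \<rightarrow>\<^sub>M M \<Otimes>\<^sub>M M"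
      using that P(1) by (intro measurable_Pair component_measurable) auto
    from measurable_compose[OF this qm] show ?thesis by simp
  qed
  have le: "\<bar>?q p z * ?q p' z\<bar> \<le> Q\<^sup>2" for p p' z
    unfolding abs_mult power2_eq_square using qb Q by (intro mult_mono) auto
  have int: "integrable \<Omega> (\<lambda>z. ?q p z * ?q p' z)" if "p \<in> P" "p' \<in> P" for p p'
    using le qpm[OF that(1)] qpm[OF that(2)] by (intro integrable_bounded[of _ "Q\<^sup>2"]) auto
  have zero: "(\<integral>z. ?q p z * ?q p' z \<partial>\<Omega>) = 0"
    if p: "p \<in> P" "p' \<in> P" and e: "fst p \<notin> {fst p', snd p'} \<or> snd p \<notin> {fst p', snd p'}" for p p'
  proof -
    obtain i l where il: "p = (i, l)" by (cases p)
    have ilJ: "i \<in> J" "l \<in> J" "i \<noteq> l" using p(1) P il by auto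
    show ?thesis using e
    proof
      assume "fst p \<notin> {fst p', snd p'}"
      then have n: "i \<noteq> fst p'" "i \<noteq> snd p'" using il by auto
      show ?thesis
      proof (rule integral_update_zero[OF ilJ(1) int[OF p]])
        fix z :: "'i => 'a" assume z: "\<And>k. k \<in> J - {i} ==> z k \<in> space M"
        have "(\<integral>x. q x (z l) \<partial>M) = 0" using z[of l] ilJ by (intro q1) auto
        then show "(\<integral>x. ?q p (z(i := x)) * ?q p' (z(i := x)) \<partial>M) = 0" using n ilJ il by simp
      qed
    next
      assume "snd p \<notin> {fst p', snd p'}"
      then have n: "l \<noteq> fst p'" "l \<noteq> snd p'" using il by auto
      show ?thesis
      proof (rule integral_update_zero[OF ilJ(2) int[OF p]])
        fix z :: "'i => 'a" assume z: "\<And>k. k \<in> J - {l} ==> z k \<in> space M"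
        have "(\<integral>x. q (z i) x \<partial>M) = 0" using z[of i] ilJ by (intro q2) auto
        then show "(\<integral>x. ?q p (z(l := x)) * ?q p' (z(l := x)) \<partial>M) = 0" using n ilJ il by simp
      qed
    qed
  qed
  have "(\<integral>z. (\<Sum>(i, l)\<in>P. q (z i) (z l))\<^sup>2 \<partial>\<Omega>) = (\<integral>z. (\<Sum>p\<in>P. \<Sum>p'\<in>P. ?q p z * ?q p' z) \<partial>\<Omega>)"
    by (simp only: power2_eq_square sum_product case_prod_unfold)
  also have "\<dots> = (\<Sum>p\<in>P. \<Sum>p'\<in>P. (\<integral>z. ?q p z * ?q p' z \<partial>\<Omega>))"
    using int by (subst Bochner_Integration.integral_sum) (auto intro!: Bochner_Integration.integrable_sum sum.cong Bochner_Integration.integral_sum)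
  also have "\<dots> \<le> (\<Sum>p\<in>P. 2 * Q\<^sup>2)"
  proof (rule sum_mono)
    fix p assume p: "p \<in> P"
    let ?S = "P \<inter> {p, (snd p, fst p)}"
    have pn: "fst p \<noteq> snd p" using p P(2)[of "fst p" "snd p"] by simp
    have "(\<Sum>p'\<in>P. (\<integral>z. ?q p z * ?q p' z \<partial>\<Omega>)) = (\<Sum>p'\<in>?S. (\<integral>z. ?q p z * ?q p' z \<partial>\<Omega>))"
    proof (rule sum.mono_neutral_right[OF finP])
      show "\<forall>p'\<in>P - ?S. (\<integral>z. ?q p z * ?q p' z \<partial>\<Omega>) = 0"
      proof
        fix p' assume p': "p' \<in> P - ?S"
        have "fst p \<notin> {fst p', snd p'} \<or> snd p \<notin> {fst p', snd p'}"
          using p' pn by (cases p; cases p') auto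
        then show "(\<integral>z. ?q p z * ?q p' z \<partial>\<Omega>) = 0" using p p' by (intro zero) auto
      qed
    qed auto
    also have "\<dots> \<le> (\<Sum>p'\<in>?S. Q\<^sup>2)"
    proof (rule sum_mono)
      fix p' assume p': "p' \<in> ?S"
      have "(\<integral>z. ?q p z * ?q p' z \<partial>\<Omega>) \<le> (\<integral>z. Q\<^sup>2 \<partial>\<Omega>)"
      proof (intro integral_mono int)
        have "\<bar>?q p z * ?q p' z\<bar> \<le> Q\<^sup>2" for z by (rule le)
        then show "?q p z * ?q p' z \<le> Q\<^sup>2" for z by (meson abs_le_D1)
      qed (use p p' in auto)
      then show "(\<integral>z. ?q p z * ?q p' z \<partial>\<Omega>) \<le> Q\<^sup>2" by (simp add: O.prob_space)
    qed
    also have "\<dots> = real (card ?S) * Q\<^sup>2" by simp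
    also have "\<dots> \<le> 2 * Q\<^sup>2"
    proof (rule mult_right_mono)
      have "card ?S \<le> card {p, (snd p, fst p)}" by (intro card_mono) auto
      also have "\<dots> \<le> 2" using card_insert_le_m1[of 2 "{(snd p, fst p)}" p] by simp
      finally show "real (card ?S) \<le> 2" by simp
    qed simp
    finally show "(\<Sum>p'\<in>P. (\<integral>z. ?q p z * ?q p' z \<partial>\<Omega>)) \<le> 2 * Q\<^sup>2" .
  qed
  finally show ?thesis by simp
qed

lemma hoeffding_components:
  fixes \<psi> :: "'a => real"
  assumes B: "B \<subseteq> J" "B \<noteq> {}" and \<psi>: "\<psi> \<in> borel_measurable M" "\<And>x. \<bar>\<psi> x\<bar> \<le> R" and R: "0 < R" and \<epsilon>: "0 \<le> \<epsilon>"
  shows "measure \<Omega> {z \<in> space \<Omega>. \<epsilon> \<le> \<bar>\<Sum>i\<in>B. \<psi> (z i) - (\<integral>x. \<psi> x \<partial>M)\<bar>} \<le>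
    2 * exp (- 2 * \<epsilon>\<^sup>2 / (real (card B) * (2 * R)\<^sup>2))"
proof -
  interpret O: prob_space \<Omega> by (rule prob_\<Omega>)
  interpret P: product_prob_space "\<lambda>_::'i. M" J by (rule product_prob)
  have finB: "finite B" using B fin finite_subset by auto
  have cB: "0 < card B" using B finB by (simp add: card_gt_0_iff)
  have ind: "prob_space.indep_vars \<Omega> (\<lambda>_. M) (\<lambda>i z. z i) B"
  proof (subst O.indep_vars_iff_distr_eq_PiM'[OF B(2)])
    show "(\<lambda>z. z i) \<in> \<Omega> \<rightarrow>\<^sub>M M" if "i \<in> B" for i using that B by auto
    have "distr \<Omega> (Pi\<^sub>M B (\<lambda>_. M)) (\<lambda>x. \<lambda>i\<in>B. x i) = Pi\<^sub>M B (\<lambda>_. M)"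
      using P.distr_PiM_restrict_finite[OF finB B(1)] by (simp add: restrict_def)
    also have "\<dots> = Pi\<^sub>M B (\<lambda>i. distr \<Omega> M (\<lambda>z. z i))"
      using distr_component B by (intro PiM_cong refl) auto
    finally show "distr \<Omega> (Pi\<^sub>M B (\<lambda>_. M)) (\<lambda>x. \<lambda>i\<in>B. x i) = Pi\<^sub>M B (\<lambda>i. distr \<Omega> M (\<lambda>z. z i))" .
  qed
  have ind': "prob_space.indep_vars \<Omega> (\<lambda>_. borel) (\<lambda>i z. \<psi> (z i)) B"
    by (rule O.indep_vars_compose2[OF ind \<psi>(1)])
  interpret H: Hoeffding_ineq \<Omega> B "\<lambda>i z. \<psi> (z i)" "\<lambda>_. - R" "\<lambda>_. R" "\<Sum>i\<in>B. O.expectation (\<lambda>z. \<psi> (z i))"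
    using ind' finB \<psi>(2) by unfold_locales (auto simp: abs_le_iff minus_le_iff)
  have exp: "(\<Sum>i\<in>B. O.expectation (\<lambda>z. \<psi> (z i))) = (\<Sum>i\<in>B. (\<integral>x. \<psi> x \<partial>M))"
    using integral_component[OF _ \<psi>(1)] B by (intro sum.cong) auto
  have var: "(\<Sum>i\<in>B. (R - - R)\<^sup>2) = real (card B) * (2 * R)\<^sup>2" by simp
  have "measure \<Omega> {z \<in> space \<Omega>. \<epsilon> \<le> \<bar>(\<Sum>i\<in>B. \<psi> (z i)) - (\<Sum>i\<in>B. (\<integral>x. \<psi> x \<partial>M))\<bar>} \<le>
    2 * exp (- 2 * \<epsilon>\<^sup>2 / (real (card B) * (2 * R)\<^sup>2))"
    using H.Hoeffding_ineq_abs_ge[OF \<epsilon>] cB R unfolding exp var by simp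
  then show ?thesis by (simp only: sum_subtractf)
qed

end

context prob_space begin

text \<open>By Fubini the coordinate \<open>l\<close> is fixed first. The remaining ones are still
  independent and the summands are functions of one coordinate each, so the unconditional bound
  applies with constants that do not depend on the fixed value.\<close>

lemma hoeffding_conditional:
  fixes \<psi> :: "'a => 'a => real" and J :: "'i set"
  assumes fin: "finite J" and l: "l \<in> J" and B: "B \<subseteq> J - {l}" "B \<noteq> {}"
    and \<psi>m: "(\<lambda>p. \<psi> (fst p) (snd p)) \<in> borel_measurable (M \<Otimes>\<^sub>M M)" and \<psi>: "\<And>x y. \<bar>\<psi> x y\<bar> \<le> R" and R: "0 < R" and \<epsilon>: "0 \<le> \<epsilon>"
  shows "measure (Pi\<^sub>M J (\<lambda>_. M)) {z \<in> space (Pi\<^sub>M J (\<lambda>_. M)). \<epsilon> \<le> \<bar>\<Sum>i\<in>B. \<psi> (z i) (z l) - (\<integral>x. \<psi> x (z l) \<partial>M)\<bar>} \<le>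
    2 * exp (- 2 * \<epsilon>\<^sup>2 / (real (card B) * (2 * R)\<^sup>2))"
    and "{z \<in> space (Pi\<^sub>M J (\<lambda>_. M)). \<epsilon> \<le> \<bar>\<Sum>i\<in>B. \<psi> (z i) (z l) - (\<integral>x. \<psi> x (z l) \<partial>M)\<bar>} \<in> sets (Pi\<^sub>M J (\<lambda>_. M))"
proof -
  let ?J' = "J - {l}" let ?\<Omega> = "Pi\<^sub>M J (\<lambda>_. M)" let ?\<Omega>' = "Pi\<^sub>M ?J' (\<lambda>_. M)"
  interpret I: iid M J by unfold_locales (rule fin)
  interpret I': iid M ?J' by unfold_locales (use fin in auto)
  interpret O: prob_space ?\<Omega> by (rule I.prob_\<Omega>)
  interpret O': prob_space ?\<Omega>' by (rule I'.prob_\<Omega>)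
  interpret P: product_prob_space "\<lambda>_::'i. M" J by (rule I.product_prob)
  let ?b = "2 * exp (- 2 * \<epsilon>\<^sup>2 / (real (card B) * (2 * R)\<^sup>2))"
  let ?A = "{z \<in> space ?\<Omega>. \<epsilon> \<le> \<bar>\<Sum>i\<in>B. \<psi> (z i) (z l) - (\<integral>x. \<psi> x (z l) \<partial>M)\<bar>}"
  have J: "insert l ?J' = J" using l by auto
  have mm: "(\<lambda>y. \<integral>x. \<psi> x y \<partial>M) \<in> borel_measurable M"
  proof -
    have "(\<lambda>p. \<psi> (snd p) (fst p)) \<in> borel_measurable (M \<Otimes>\<^sub>M M)"
      using measurable_compose[OF measurable_pair_swap' \<psi>m] by (simp add: case_prod_unfold)
    then show ?thesis by (intro borel_measurable_lebesgue_integral) (simp add: case_prod_unfold)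
  qed
  have Fm: "(\<lambda>z. \<Sum>i\<in>B. \<psi> (z i) (z l) - (\<integral>x. \<psi> x (z l) \<partial>M)) \<in> borel_measurable ?\<Omega>"
  proof (intro borel_measurable_sum borel_measurable_diff)
    fix i assume "i \<in> B"
    then have "i \<in> J" using B by auto
    then have "(\<lambda>z. (z i, z l)) \<in> ?\<Omega> \<rightarrow>\<^sub>M M \<Otimes>\<^sub>M M"
      using l by (intro measurable_Pair I.component_measurable)
    from measurable_compose[OF this \<psi>m] show "(\<lambda>z. \<psi> (z i) (z l)) \<in> borel_measurable ?\<Omega>" by simp
    show "(\<lambda>z. \<integral>x. \<psi> x (z l) \<partial>M) \<in> borel_measurable ?\<Omega>"
      by (rule measurable_compose[OF I.component_measurable[OF l] mm])
  qed
  then show A: "?A \<in> sets ?\<Omega>" by measurable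
  have "emeasure ?\<Omega> ?A = (\<integral>\<^sup>+z. indicator ?A z \<partial>?\<Omega>)" using A by simp
  also have "\<dots> = (\<integral>\<^sup>+y. (\<integral>\<^sup>+z. indicator ?A (z(l := y)) \<partial>?\<Omega>') \<partial>M)"
    using P.product_nn_integral_insert_rev[of ?J' l "indicator ?A", unfolded J] fin A by simp
  also have "\<dots> \<le> (\<integral>\<^sup>+y. ennreal ?b \<partial>M)"
  proof (rule nn_integral_mono)
    fix y assume y: "y \<in> space M"
    let ?A' = "{z \<in> space ?\<Omega>'. \<epsilon> \<le> \<bar>\<Sum>i\<in>B. \<psi> (z i) y - (\<integral>x. \<psi> x y \<partial>M)\<bar>}"
    have \<psi>y: "(\<lambda>x. \<psi> x y) \<in> borel_measurable M"
      using measurable_compose[OF measurable_Pair2'[OF y] \<psi>m] by simp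
    have "?A' \<in> sets ?\<Omega>'"
    proof -
      have "(\<lambda>z. \<Sum>i\<in>B. \<psi> (z i) y - (\<integral>x. \<psi> x y \<partial>M)) \<in> borel_measurable ?\<Omega>'"
        using B by (intro borel_measurable_sum borel_measurable_diff measurable_compose[OF I'.component_measurable \<psi>y]) auto
      then show ?thesis by measurable
    qed
    have "(\<integral>\<^sup>+z. indicator ?A (z(l := y)) \<partial>?\<Omega>') = (\<integral>\<^sup>+z. indicator ?A' z \<partial>?\<Omega>')"
    proof (rule nn_integral_cong)
      fix z assume z: "z \<in> space ?\<Omega>'"
      have sp: "z(l := y) \<in> space ?\<Omega>" using z y l by (auto simp: space_PiM PiE_def Pi_def extensional_def)
      have "(\<Sum>i\<in>B. \<psi> ((z(l := y)) i) ((z(l := y)) l) - (\<integral>x. \<psi> x ((z(l := y)) l) \<partial>M)) =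
        (\<Sum>i\<in>B. \<psi> (z i) y - (\<integral>x. \<psi> x y \<partial>M))"
        using B by (intro sum.cong refl) auto
      then have "z(l := y) \<in> ?A \<longleftrightarrow> z \<in> ?A'" using sp z by simp
      then show "indicator ?A (z(l := y)) = (indicator ?A' z :: ennreal)" by (simp only: indicator_def)
    qed
    also have "\<dots> = emeasure ?\<Omega>' ?A'" using \<open>?A' \<in> sets ?\<Omega>'\<close> by simp
    also have "\<dots> \<le> ennreal ?b"
      unfolding O'.emeasure_eq_measure by (intro ennreal_leI I'.hoeffding_components[OF B \<psi>y \<psi> R \<epsilon>])
    finally show "(\<integral>\<^sup>+z. indicator ?A (z(l := y)) \<partial>?\<Omega>') \<le> ennreal ?b" .
  qed
  also have "\<dots> = ennreal ?b" by (simp add: emeasure_space_1)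
  finally show "measure ?\<Omega> ?A \<le> ?b" unfolding O.emeasure_eq_measure by (simp add: ennreal_le_iff)
qed

end

section \<open>Linearisation of the estimator\<close>

lemma sum_fiber: "(\<Sum>p\<in>{c} \<times> B. F p) = (\<Sum>i\<in>B. F (c, i))" for F :: "'b \<times> 'c => real"
  using sum.cartesian_product[of "\<lambda>x y. F (x, y)" B "{c}"] by simp

lemma abs_inverse_mult_le:
  fixes y B :: real
  assumes "0 < n" "\<bar>y\<bar> \<le> B"
  shows "\<bar>1 / real n * y\<bar> \<le> B"
proof -
  have "\<bar>1 / real n * y\<bar> \<le> 1 * \<bar>y\<bar>"
    unfolding abs_mult using assms(1) by (intro mult_right_mono) (auto simp: divide_le_eq)
  then show ?thesis using assms(2) by simp
qed

text \<open>The number \<open>c\<close> of summands may be smaller than \<open>T\<close>, as one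
  sample point can have been removed. The bound is expressed through a common lower bound
  \<open>N\<close> for all sample sizes.\<close>

lemma exponent_bound:
  fixes T c N t R :: real
  assumes "0 < c" "c \<le> T" "N \<le> T" "0 < R"
  shows "2 * exp (- 2 * (T * t)\<^sup>2 / (c * (2 * R)\<^sup>2)) \<le> 2 * exp (- (N * t\<^sup>2 / (2 * R\<^sup>2)))"
proof -
  have "N * t\<^sup>2 / (2 * R\<^sup>2) \<le> T * t\<^sup>2 / (2 * R\<^sup>2)"
    using assms by (intro divide_right_mono mult_right_mono) auto
  also have "\<dots> \<le> T * t\<^sup>2 / (2 * R\<^sup>2) * (T / c)"
  proof -
    have "1 \<le> T / c" using assms by simp
    moreover have "0 \<le> T * t\<^sup>2 / (2 * R\<^sup>2)" using assms by simp
    ultimately show ?thesis using mult_left_mono[of 1 "T / c" "T * t\<^sup>2 / (2 * R\<^sup>2)"] by simp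
  qed
  also have "\<dots> = 2 * (T * t)\<^sup>2 / (c * (2 * R)\<^sup>2)"
    using assms by (simp add: power2_eq_square field_simps)
  finally show ?thesis by simp
qed

text \<open>The sample is an arbitrary measurable image, so that the result applies both to
  \<open>sample_law\<close> and to the product space used for the estimates.\<close>

lemma theta_check_measurable:
  fixes X :: "'w => nat => point" and Y :: "'w => nat set \<times> nat => point"
  assumes kern: "kern d K \<kappa> h" and SS: "SS \<subseteq> Pow {1..d}" and a: "a \<in> bor d"
    and X: "\<And>i. i \<in> {1..n} ==> (\<lambda>w. X w i) \<in> N \<rightarrow>\<^sub>M leb {1..d}"
    and Y: "\<And>S i j. S \<in> SS ==> i \<in> {1..nS S} ==> j \<in> S ==> (\<lambda>w. Y w (S, i) j) \<in> borel_measurable N"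
  shows "(\<lambda>w. theta_check d K a SS h M n nS (X w, Y w)) \<in> borel_measurable N"
proof -
  interpret kern d K \<kappa> h by (rule kern)
  have Xj: "(\<lambda>w. X w i j) \<in> borel_measurable N" if "i \<in> {1..n}" "j \<in> {1..d}" for i j
    by (rule measurable_compose[OF X[OF that(1)] measurable_leb_component[OF that(2)]])
  have fh: "(\<lambda>w. f_hat d K h n nS (X w, Y w) S (X w i)) \<in> borel_measurable N" if S: "S \<in> SS" and i: "i \<in> {1..n}" for S i
  proof -
    have Sd: "S \<subseteq> {1..d}" using S SS by auto
    have 1: "(\<lambda>w. Kh d K S h (\<lambda>j. Y w (S, i') j - X w i j)) \<in> borel_measurable N" if "i' \<in> {1..nS S}" for i'
      using Sd i by (intro Kh_meas[OF Sd] borel_measurable_diff Y[OF S that] Xj) auto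
    have 2: "(\<lambda>w. Kh d K S h (\<lambda>j. X w i' j - X w i j)) \<in> borel_measurable N" if "i' \<in> {1..n}" for i'
      using Sd i that by (intro Kh_meas[OF Sd] borel_measurable_diff Xj) auto
    show ?thesis unfolding f_hat_def prod.case
      by (intro borel_measurable_times borel_measurable_const borel_measurable_add borel_measurable_sum 1 2)
  qed
  have kh: "(\<lambda>w. k_hat d K a h n nS (X w, Y w) Ss (map (X w) is)) \<in> borel_measurable N"
    if Ss: "Ss \<in> adm_tuples SS m" and "is": "is \<in> index_tuples n (m + 1)" for Ss "is" m
  proof -
    have len: "length Ss = m" "set Ss \<subseteq> SS" "length is = m + 1" "set is \<subseteq> {1..n}"
      using that by (auto simp: adm_tuples_def index_tuples_def)
    have "is ! 0 \<in> {1..n}" using len by (intro subsetD[OF len(4)] nth_mem) simp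
    then have 0: "(\<lambda>w. a (X w (is ! 0))) \<in> borel_measurable N"
      by (intro measurable_compose[OF X a])
    have j: "(\<lambda>w. Kh d K (Ss ! j) h (\<lambda>l. X w (is ! Suc j) l - X w (is ! j) l) /
        f_hat d K h n nS (X w, Y w) (Ss ! j) (X w (is ! j)) - 1) \<in> borel_measurable N" if "j < length Ss" for j
    proof -
      have S: "Ss ! j \<in> SS" using len that by (intro subsetD[OF len(2)] nth_mem) simp
      then have Sd: "Ss ! j \<subseteq> {1..d}" using SS by auto
      have i: "is ! j \<in> {1..n}" using len that by (intro subsetD[OF len(4)] nth_mem) simp
      have i': "is ! Suc j \<in> {1..n}" using len that by (intro subsetD[OF len(4)] nth_mem) simp
      show ?thesis using Sd
        by (intro borel_measurable_diff borel_measurable_divide borel_measurable_const fh[OF S i] Kh_meas[OF Sd] Xj i i') auto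
    qed
    have "(\<lambda>w. k_hat d K a h n nS (X w, Y w) Ss (map (X w) is)) =
      (\<lambda>w. a (X w (is ! 0)) * (\<Prod>j<length Ss. Kh d K (Ss ! j) h (\<lambda>l. X w (is ! Suc j) l - X w (is ! j) l) /
        f_hat d K h n nS (X w, Y w) (Ss ! j) (X w (is ! j)) - 1))"
      unfolding k_hat_def using len by (intro ext arg_cong2[where f = "(*)"] prod.cong refl) (auto simp: nth_map)
    also have "\<dots> \<in> borel_measurable N"
      by (intro borel_measurable_times 0 borel_measurable_prod j) auto
    finally show ?thesis .
  qed
  show ?thesis unfolding theta_check_def fst_conv
    by (intro borel_measurable_add borel_measurable_times borel_measurable_const borel_measurable_sum
        measurable_compose[OF X a] kh) auto
qed

locale risk = jacobi d K \<kappa> h f c0 C0 \<beta> L SS "\<lambda>S. real (nS S) / real n" a A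
  for d K \<kappa> h f c0 C0 \<beta> L SS a A and nS :: "nat set => nat" and n :: nat +
  assumes SS_full: "{1..d} \<notin> SS"
begin

text \<open>All observations are realised as complete points with the same law: the complete ones
  under the key \<open>{1..d}\<close>, the incomplete ones under \<open>S\<close>, where only the
  coordinates in \<open>S\<close> are read. Since \<open>{1..d}\<close> is not in \<open>SS\<close>,
  the keys do not clash and a single i.i.d. family suffices.\<close>

definition J :: "(nat set \<times> nat) set" where "J = {{1..d}} \<times> {1..n} \<union> (SIGMA S:SS. {1..nS S})"

lemma finite_J: "finite J"
  unfolding J_def using finite_SS by auto

sublocale I: iid \<mu> J
  by unfold_locales (rule finite_J)

abbreviation X :: "(nat set \<times> nat => point) => nat => point" where "X z i \<equiv> z ({1..d}, i)"

lemma X_in_J: "i \<in> {1..n} ==> ({1..d}, i) \<in> J" and Y_in_J: "S \<in> SS ==> i \<in> {1..nS S} ==> (S, i) \<in> J"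
  by (auto simp: J_def)

lemma nS_pos: "S \<in> SS ==> 0 < nS S" and n_pos: "0 < n"
proof -
  show "S \<in> SS ==> 0 < nS S" using lam[of S] by (cases "nS S") auto
  obtain S where "S \<in> SS" using SS(2) by auto
  then show "0 < n" using lam[of S] by (cases n) auto
qed

definition fX :: "(nat set \<times> nat => point) => nat set => point => real" where
  "fX z S x = 1 / real n * (\<Sum>i=1..n. k S x (X z i))"
definition fY :: "(nat set \<times> nat => point) => nat set => point => real" where
  "fY z S x = 1 / real (nS S) * (\<Sum>i=1..nS S. k S x (z (S, i)))"

definition MV :: "nat => (nat set \<times> nat => point) => real" where
  "MV M z = 1 / real n * (\<Sum>i=1..n. a (X z i)) -
    (\<Sum>S\<in>SS. v S * (1 / real n * (\<Sum>i=1..n. \<Gamma>t M S (X z i) / fb S (X z i) * (fX z S (X z i) - fY z S (X z i)))))"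

definition est :: "nat => (nat set \<times> nat => point) => real" where
  "est M z = theta_check d K a SS h M n nS (X z, z)"

definition b0 :: real where "b0 = 2 * (\<kappa> / h ^ d) / c1 + 1"

lemma est_minus_MV:
  assumes \<tau>: "0 \<le> \<tau>" "\<tau> \<le> c1 / 2" "\<tau> \<le> 1" and M: "M + 1 \<le> n" and Xc: "\<And>i. i \<in> {1..n} ==> X z i \<in> unit_cube d"
    and gX: "\<And>S l. S \<in> SS ==> l \<in> {1..n} ==> \<bar>fX z S (X z l) - ft S (X z l)\<bar> \<le> \<tau>"
    and gY: "\<And>S l. S \<in> SS ==> l \<in> {1..n} ==> \<bar>fY z S (X z l) - ft S (X z l)\<bar> \<le> \<tau>"
    and gT: "\<And>S m l. S \<in> SS ==> m < M ==> l \<in> {1..n} ==>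
      \<bar>1 / real n * (\<Sum>i=1..n. \<Gamma>t m S (X z i) * (k S (X z i) (X z l) / fb S (X z i) - 1)) - Tt S (\<Gamma>t m S) (X z l)\<bar> \<le> \<tau>"
  shows "\<bar>est M z - MV M z\<bar> \<le> UV n M b0 + HE M \<tau>"
proof -
  interpret dt: data d K \<kappa> h f c0 C0 \<beta> L SS a A nS n "\<lambda>i. X z i" z by unfold_locales
  have e: "dt.fX S x = fX z S x" "dt.fY S x = fY z S x" for S x
    by (simp_all add: dt.fX_def fX_def dt.fY_def fY_def)
  have mv: "dt.MV M = MV M z" by (simp add: dt.MV_def MV_def e)
  have "\<bar>dt.thetaV M - dt.MV M\<bar> \<le> HE M \<tau>"
    by (rule dt.thetaV_minus_MV(1)[OF \<tau> Xc gX[folded e] gY[folded e] gT])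
  moreover have "\<bar>theta_check d K a SS h M n nS (\<lambda>i. X z i, z) - dt.thetaV M\<bar> \<le> UV n M b0"
  proof (rule dt.theta_check_minus_thetaV[OF M])
    show "1 \<le> b0" using \<kappa>_nonneg h_pos c1_pos by (simp add: b0_def)
    show "\<bar>k S (X z i) (X z l) / dt.fh S (X z i) - 1\<bar> \<le> b0" if "S \<in> SS" "i \<in> {1..n}" "l \<in> {1..n}" for S i l
      unfolding b0_def by (rule dt.thetaV_minus_MV(2)[OF \<tau> Xc gX[folded e] gY[folded e] gT that])
  qed
  ultimately show ?thesis unfolding mv est_def by linarith
qed

text \<open>The kernel value in the numerator is one of the nonnegative summands that make up
  \<open>n + nS S\<close> times the density estimate, so the ratio is at most
  \<open>n + nS S\<close>, also where the estimate vanishes and the ratio is 0. The bound is poor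
  but holds for every sample, and it is used on the exceptional event only.\<close>

lemma est_crude:
  assumes M: "M + 1 \<le> n" and Nmax: "\<And>S. S \<in> SS ==> nS S \<le> Nm"
  shows "\<bar>est M z\<bar> \<le> A + real M * (A * (real (card SS) * real (n + Nm + 1)) ^ M)"
proof -
  interpret dt: data d K \<kappa> h f c0 C0 \<beta> L SS a A nS n "\<lambda>i. X z i" z by unfold_locales
  let ?B = "real (n + Nm + 1)" let ?s = "real (card SS)"
  have "0 < card SS" using finite_SS SS(2) by (simp add: card_gt_0_iff)
  then have s: "1 \<le> ?s" by linarith
  have ratio: "\<bar>k S (X z i) (X z l) / dt.fh S (X z i) - 1\<bar> \<le> ?B" if S: "S \<in> SS" and l: "l \<in> {1..n}" for S i l
  proof -
    let ?k = "k S (X z i) (X z l)" let ?F = "dt.fh S (X z i)" let ?N = "real (n + nS S)"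
    have k0: "0 \<le> k S x y" for x y by (rule k_nonneg[OF SS_sub[OF S]])
    have N: "0 < ?N" "?N + 1 \<le> ?B" using n_pos Nmax[OF S] by auto
    have "?k \<le> (\<Sum>i'=1..n. k S (X z i) (X z i'))"
      using member_le_sum[of l "{1..n}" "\<lambda>i'. k S (X z i) (X z i')"] l k0 by auto
    moreover have "0 \<le> (\<Sum>i'=1..nS S. k S (X z i) (z (S, i')))" using k0 by (intro sum_nonneg) auto
    ultimately have "?k \<le> (\<Sum>i'=1..nS S. k S (X z i) (z (S, i'))) + (\<Sum>i'=1..n. k S (X z i) (X z i'))" by linarith
    also have "\<dots> = ?N * ?F" using N by (simp add: dt.fh_def f_hat_def)
    finally have le: "?k \<le> ?N * ?F" .
    have F0: "0 \<le> ?F" using order_trans[OF k0 le] N by (simp add: zero_le_mult_iff)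
    have "?k / ?F \<le> ?N"
    proof (cases "?F = 0")
      case False
      then show ?thesis using le F0 by (simp add: divide_le_eq)
    qed simp
    moreover have "0 \<le> ?k / ?F" using k0 F0 by simp
    ultimately show ?thesis using N by (auto simp: abs_le_iff)
  qed
  have kh: "\<bar>k_hat d K a h n nS (\<lambda>i. X z i, z) Ss (map (\<lambda>i. X z i) is)\<bar> \<le> A * ?B ^ m"
    if Ss: "Ss \<in> adm_tuples SS m" and "is": "is \<in> index_tuples n (m + 1)" for Ss m "is"
  proof -
    have len: "length Ss = m" "set Ss \<subseteq> SS" "length is = m + 1" "set is \<subseteq> {1..n}"
      using that by (auto simp: adm_tuples_def index_tuples_def)
    have "\<bar>\<Prod>j<length Ss. k (Ss ! j) (X z (is ! j)) (X z (is ! Suc j)) / dt.fh (Ss ! j) (X z (is ! j)) - 1\<bar> \<le> (\<Prod>j<length Ss. ?B)"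
      unfolding abs_prod
    proof (intro prod_mono conjI abs_ge_zero)
      fix j assume j: "j \<in> {..<length Ss}"
      have "Ss ! j \<in> SS" using len j by (intro subsetD[OF len(2)] nth_mem) simp
      moreover have "is ! Suc j \<in> {1..n}" using len j by (intro subsetD[OF len(4)] nth_mem) simp
      ultimately show "\<bar>k (Ss ! j) (X z (is ! j)) (X z (is ! Suc j)) / dt.fh (Ss ! j) (X z (is ! j)) - 1\<bar> \<le> ?B" by (rule ratio)
    qed
    then have p: "\<bar>\<Prod>j<length Ss. k (Ss ! j) (X z (is ! j)) (X z (is ! Suc j)) / dt.fh (Ss ! j) (X z (is ! j)) - 1\<bar> \<le> ?B ^ m"
      using len by simp
    have "k_hat d K a h n nS (\<lambda>i. X z i, z) Ss (map (\<lambda>i. X z i) is) =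
      a (X z (is ! 0)) * (\<Prod>j<length Ss. k (Ss ! j) (X z (is ! j)) (X z (is ! Suc j)) / dt.fh (Ss ! j) (X z (is ! j)) - 1)"
      unfolding k_hat_def using len by (intro arg_cong2[where f = "(*)"] prod.cong refl) (auto simp: nth_map dt.fh_def)
    then show ?thesis unfolding abs_mult using p a_le[of "X z (is ! 0)"] A_nonneg by (simp add: abs_mult mult_mono)
  qed
  have avg: "\<bar>1 / falling n (m + 1) * (\<Sum>is\<in>index_tuples n (m + 1). k_hat d K a h n nS (\<lambda>i. X z i, z) Ss (map (\<lambda>i. X z i) is))\<bar> \<le> A * ?B ^ m"
    if Ss: "Ss \<in> adm_tuples SS m" and m: "m \<le> M" for Ss m
  proof -
    have f0: "0 < falling n (m + 1)" using falling_ratio(3)[of "m + 1" n] M m n_pos by auto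
    have "\<bar>\<Sum>is\<in>index_tuples n (m + 1). k_hat d K a h n nS (\<lambda>i. X z i, z) Ss (map (\<lambda>i. X z i) is)\<bar> \<le>
      (\<Sum>is\<in>index_tuples n (m + 1). A * ?B ^ m)"
      by (intro order_trans[OF sum_abs sum_mono] kh[OF Ss])
    also have "\<dots> = falling n (m + 1) * (A * ?B ^ m)" using card_index_tuples[of "m + 1" n] M m by simp
    finally show ?thesis using f0 by (simp add: abs_mult divide_le_eq mult.commute)
  qed
  have est_eq: "est M z = 1 / real n * (\<Sum>i=1..n. a (X z i)) + (\<Sum>m=1..M. (-1) ^ m * (\<Sum>Ss\<in>adm_tuples SS m.
      weight n nS (butlast Ss) * binom_tail M (1 / ?s) m * (1 / falling n (m + 1) *
      (\<Sum>is\<in>index_tuples n (m + 1). k_hat d K a h n nS (\<lambda>i. X z i, z) Ss (map (\<lambda>i. X z i) is)))))"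
    unfolding est_def theta_check_def fst_conv ..
  have "\<bar>est M z\<bar> \<le> A + (\<Sum>m=1..M. A * (?s * ?B) ^ M)"
    unfolding est_eq
  proof (rule order_trans[OF abs_triangle_ineq add_mono])
    show "\<bar>1 / real n * (\<Sum>i=1..n. a (X z i))\<bar> \<le> A" by (rule sum_avg_le[OF n_pos a_le])
    show "\<bar>\<Sum>m=1..M. (-1) ^ m * (\<Sum>Ss\<in>adm_tuples SS m.
      weight n nS (butlast Ss) * binom_tail M (1 / ?s) m * (1 / falling n (m + 1) *
      (\<Sum>is\<in>index_tuples n (m + 1). k_hat d K a h n nS (\<lambda>i. X z i, z) Ss (map (\<lambda>i. X z i) is))))\<bar> \<le> (\<Sum>m=1..M. A * (?s * ?B) ^ M)"
    proof (intro order_trans[OF sum_abs sum_mono])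
      fix m assume m: "m \<in> {1..M}"
      let ?q = "\<lambda>Ss. 1 / falling n (m + 1) * (\<Sum>is\<in>index_tuples n (m + 1). k_hat d K a h n nS (\<lambda>i. X z i, z) Ss (map (\<lambda>i. X z i) is))"
      have "\<bar>(-1) ^ m * (\<Sum>Ss\<in>adm_tuples SS m. weight n nS (butlast Ss) * binom_tail M (1 / ?s) m * ?q Ss)\<bar> =
        \<bar>\<Sum>Ss\<in>adm_tuples SS m. weight n nS (butlast Ss) * binom_tail M (1 / ?s) m * ?q Ss\<bar>"
        by (simp only: abs_mult power_abs abs_neg_one power_one mult_1_left)
      also have "\<dots> \<le> (\<Sum>Ss\<in>adm_tuples SS m. A * ?B ^ m)"
      proof (intro order_trans[OF sum_abs sum_mono])
        fix Ss assume Ss: "Ss \<in> adm_tuples SS m"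
        have w: "0 \<le> weight n nS (butlast Ss) \<and> weight n nS (butlast Ss) \<le> 1"
          using Ss by (intro dt.weight_bounds) (auto simp: adm_tuples_def dest: in_set_butlastD)
        have w1: "\<bar>weight n nS (butlast Ss) * binom_tail M (1 / ?s) m\<bar> \<le> 1"
          using w binom_tail_bounds[of M "1 / ?s" m] by (simp add: abs_mult mult_le_one)
        have "\<bar>?q Ss\<bar> \<le> A * ?B ^ m" using m by (intro avg[OF Ss]) auto
        from mult_mono[OF w1 this zero_le_one abs_ge_zero]
        show "\<bar>weight n nS (butlast Ss) * binom_tail M (1 / ?s) m * ?q Ss\<bar> \<le> A * ?B ^ m"
          by (simp only: abs_mult mult_1_left)
      qed
      also have "\<dots> = real (card (adm_tuples SS m)) * (A * ?B ^ m)" by simp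
      also have "\<dots> \<le> ?s ^ m * (A * ?B ^ m)"
      proof (intro mult_right_mono)
        interpret W: words SS n undefined undefined undefined undefined
          by unfold_locales (use finite_SS SS n_pos in auto)
        show "real (card (adm_tuples SS m)) \<le> ?s ^ m" using W.card_adm[of m] by (metis of_nat_le_iff of_nat_power)
      qed (use A_nonneg in simp)
      also have "\<dots> = A * (?s * ?B) ^ m" by (simp add: power_mult_distrib)
      also have "\<dots> \<le> A * (?s * ?B) ^ M"
      proof (intro mult_left_mono power_increasing A_nonneg)
        show "1 \<le> ?s * ?B" using mult_mono[OF s, of 1 ?B] s by simp
      qed (use m in auto)
      finally show "\<bar>(-1) ^ m * (\<Sum>Ss\<in>adm_tuples SS m. weight n nS (butlast Ss) * binom_tail M (1 / ?s) m * ?q Ss)\<bar> \<le> A * (?s * ?B) ^ M" .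
    qed
  qed
  then show ?thesis by simp
qed

text \<open>The influence of a single observation: the residual
  \<open>a - \<theta> - (\<Sum>S\<in>SS. \<alpha>t M S)\<close> for a complete one, the component
  \<open>\<alpha>t M S\<close> for an incomplete one.\<close>

definition lin_coef :: "nat => nat set \<times> nat => point => real" where
  "lin_coef M p x = (if fst p = {1..d} then 1 / real n * (a x - \<theta> - (\<Sum>S\<in>SS. \<alpha>t M S x))
     else 1 / real (nS (fst p)) * \<alpha>t M (fst p) x)"

definition lin :: "nat => (nat set \<times> nat => point) => real" where
  "lin M z = (\<Sum>p\<in>J. lin_coef M p (z p))"

text \<open>The completely degenerate part of the second order kernel: subtracting \<open>ft\<close>
  centres it in \<open>y\<close>, subtracting \<open>Tt\<close> removes its projection onto
  functions of \<open>y\<close>.\<close>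

definition qk :: "nat => nat set => point => point => real" where
  "qk M S x y = \<Gamma>t M S x / fb S x * (k S x y - ft S x) - Tt S (\<Gamma>t M S) y"

definition DX :: "nat => nat set => (nat set \<times> nat => point) => real" where
  "DX M S z = 1 / (real n * real n) * (\<Sum>i=1..n. \<Sum>l=1..n. qk M S (X z i) (X z l))"
definition DY :: "nat => nat set => (nat set \<times> nat => point) => real" where
  "DY M S z = 1 / (real n * real (nS S)) * (\<Sum>i=1..n. \<Sum>l=1..nS S. qk M S (X z i) (z (S, l)))"

lemma sum_J: "(\<Sum>p\<in>J. F p) = (\<Sum>i=1..n. F ({1..d}, i)) + (\<Sum>S\<in>SS. \<Sum>l=1..nS S. F (S, l))" for F :: "_ => real"
proof -
  have "(\<Sum>p\<in>J. F p) = (\<Sum>p\<in>{{1..d}} \<times> {1..n}. F p) + (\<Sum>p\<in>(SIGMA S:SS. {1..nS S}). F p)"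
    unfolding J_def using SS_full finite_SS by (intro sum.union_disjoint) auto
  moreover have "(\<Sum>p\<in>(SIGMA S:SS. {1..nS S}). F p) = (\<Sum>S\<in>SS. \<Sum>l=1..nS S. F (S, l))"
    using finite_SS by (simp add: sum.Sigma)
  ultimately show ?thesis by (simp add: sum_fiber)
qed

text \<open>Both kernel averages are centred at \<open>ft\<close>, which cancels in the difference.
  Each of the two V-statistics then splits into its projection, a mean of \<open>Tt\<close>, and a
  degenerate remainder.\<close>

lemma V_decomposition:
  assumes S: "S \<in> SS"
  shows "1 / real n * (\<Sum>i=1..n. \<Gamma>t M S (X z i) / fb S (X z i) * (fX z S (X z i) - fY z S (X z i))) =
    1 / real n * (\<Sum>l=1..n. Tt S (\<Gamma>t M S) (X z l)) - 1 / real (nS S) * (\<Sum>l=1..nS S. Tt S (\<Gamma>t M S) (z (S, l)))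
    + (DX M S z - DY M S z)"
proof -
  let ?w = "\<lambda>i. \<Gamma>t M S (X z i) / fb S (X z i)" let ?f = "\<lambda>i. ft S (X z i)"
  have avg: "1 / real N * (\<Sum>l=1..N. k S x (y l)) - c = 1 / real N * (\<Sum>l=1..N. k S x (y l) - c)" if "0 < N" for N c y x
    using that by (simp add: sum_subtractf right_diff_distrib)
  have part: "1 / real n * (\<Sum>i=1..n. ?w i * (1 / real N * (\<Sum>l=1..N. k S (X z i) (y l)) - ?f i)) =
    1 / real N * (\<Sum>l=1..N. Tt S (\<Gamma>t M S) (y l)) + 1 / (real n * real N) * (\<Sum>i=1..n. \<Sum>l=1..N. qk M S (X z i) (y l))"
    if N: "0 < N" for N y
  proof -
    have "(\<Sum>i=1..n. \<Sum>l=1..N. qk M S (X z i) (y l)) =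
      (\<Sum>i=1..n. \<Sum>l=1..N. ?w i * (k S (X z i) (y l) - ?f i)) - real n * (\<Sum>l=1..N. Tt S (\<Gamma>t M S) (y l))"
      by (simp add: qk_def sum_subtractf)
    moreover have "(\<Sum>i=1..n. \<Sum>l=1..N. ?w i * (k S (X z i) (y l) - ?f i)) = (\<Sum>i=1..n. ?w i * (real N * (1 / real N * (\<Sum>l=1..N. k S (X z i) (y l)) - ?f i)))"
      using N by (simp only: avg sum_distrib_left[symmetric]) simp
    moreover have "\<dots> = real N * (\<Sum>i=1..n. ?w i * (1 / real N * (\<Sum>l=1..N. k S (X z i) (y l)) - ?f i))"
      by (simp only: sum_distrib_left mult.left_commute)
    moreover have "1 / a * s = 1 / b * t + 1 / (a * b) * (b * s - a * t)" if "a \<noteq> 0" "b \<noteq> 0" for a b s t :: real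
      using that by (simp add: field_simps)
    ultimately show ?thesis using N n_pos by simp
  qed
  have "1 / real n * (\<Sum>i=1..n. ?w i * (fX z S (X z i) - fY z S (X z i))) =
    1 / real n * (\<Sum>i=1..n. ?w i * (fX z S (X z i) - ?f i)) - 1 / real n * (\<Sum>i=1..n. ?w i * (fY z S (X z i) - ?f i))"
    by (simp only: right_diff_distrib[symmetric] sum_subtractf[symmetric]) simp
  then show ?thesis unfolding fX_def fY_def part[OF n_pos] part[OF nS_pos[OF S]] DX_def DY_def by simp
qed

lemma lin_alt: "lin M z = 1 / real n * (\<Sum>i=1..n. a (X z i)) - \<theta> - (\<Sum>S\<in>SS. 1 / real n * (\<Sum>i=1..n. \<alpha>t M S (X z i)))
    + (\<Sum>S\<in>SS. 1 / real (nS S) * (\<Sum>l=1..nS S. \<alpha>t M S (z (S, l))))"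
proof -
  have ne: "S \<noteq> {1..d}" if "S \<in> SS" for S using that SS_full by auto
  show ?thesis
  proof -
    have "(\<Sum>i=1..n. lin_coef M ({1..d}, i) (X z i)) =
      1 / real n * ((\<Sum>i=1..n. a (X z i)) - real n * \<theta> - (\<Sum>S\<in>SS. \<Sum>i=1..n. \<alpha>t M S (X z i)))"
      by (subst sum.swap) (simp add: lin_coef_def sum_distrib_left[symmetric] sum_subtractf sum_divide_distrib[symmetric])
    also have "\<dots> = 1 / real n * (\<Sum>i=1..n. a (X z i)) - \<theta> - (\<Sum>S\<in>SS. 1 / real n * (\<Sum>i=1..n. \<alpha>t M S (X z i)))"
      using n_pos by (simp add: right_diff_distrib sum_distrib_left diff_divide_distrib sum_divide_distrib)
    moreover have "(\<Sum>S\<in>SS. \<Sum>l=1..nS S. lin_coef M (S, l) (z (S, l))) = (\<Sum>S\<in>SS. 1 / real (nS S) * (\<Sum>l=1..nS S. \<alpha>t M S (z (S, l))))"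
      using ne by (intro sum.cong refl) (auto simp: lin_coef_def sum_divide_distrib)
    ultimately show ?thesis unfolding lin_def sum_J by simp
  qed
qed

lemma MV_decomposition: "MV M z - \<theta> = lin M z - (\<Sum>S\<in>SS. v S * (DX M S z - DY M S z))"
proof -
  have 2: "v S * (1 / real n * (\<Sum>i=1..n. \<Gamma>t M S (X z i) / fb S (X z i) * (fX z S (X z i) - fY z S (X z i)))) =
    1 / real n * (\<Sum>i=1..n. \<alpha>t M S (X z i)) - 1 / real (nS S) * (\<Sum>l=1..nS S. \<alpha>t M S (z (S, l))) + v S * (DX M S z - DY M S z)"
    if "S \<in> SS" for S
    unfolding V_decomposition[OF that] by (simp add: \<alpha>t_def sum_distrib_left[symmetric] algebra_simps)
  have "MV M z = 1 / real n * (\<Sum>i=1..n. a (X z i)) - (\<Sum>S\<in>SS. 1 / real n * (\<Sum>i=1..n. \<alpha>t M S (X z i)) -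
      1 / real (nS S) * (\<Sum>l=1..nS S. \<alpha>t M S (z (S, l))) + v S * (DX M S z - DY M S z))"
    unfolding MV_def using 2 by simp
  then show ?thesis unfolding lin_alt by (simp add: sum.distrib sum_subtractf)
qed

text \<open>All summands are independent with mean zero. The \<open>n\<close> complete ones have
  weight \<open>1 / n\<close>, giving the residual variance after scaling; the incomplete ones give
  \<open>n / nS S\<close>, the penalty of the objective at the actual sampling ratio.\<close>

lemma second_moment_lin: "real n * (\<integral>z. (lin M z)\<^sup>2 \<partial>I.\<Omega>) = Lob SS (\<lambda>S. real (nS S) / real n) (\<lambda>x. a x - \<theta>) (\<alpha>t M)"
proof -
  have ne: "S \<noteq> {1..d}" if "S \<in> SS" for S using that SS_full by auto
  let ?r = "\<lambda>x. a x - \<theta> - (\<Sum>S\<in>SS. \<alpha>t M S x)"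
  have rm: "?r \<in> bor d"
    by (intro borel_measurable_diff a_meas borel_measurable_const borel_measurable_sum \<alpha>t_props(1))
  have sa: "\<bar>\<Sum>S\<in>SS. \<alpha>t M S x\<bar> \<le> real (card SS) * (A * (2 + C1) ^ M * C1)" for x
    using order_trans[OF sum_abs sum_mono[of SS "\<lambda>S. \<bar>\<alpha>t M S x\<bar>" "\<lambda>_. A * (2 + C1) ^ M * C1"]] \<alpha>t_props(2) by simp
  have rb: "\<bar>?r x\<bar> \<le> 2 * A + real (card SS) * (A * (2 + C1) ^ M * C1)" for x
    using a_le[of x] \<theta>_le sa[of x] by linarith
  have ri: "integrable \<mu> ?r" by (rule integrable_bdd[OF rm rb])
  have r0: "(\<integral>x. ?r x \<partial>\<mu>) = 0"
  proof -
    have i1: "integrable \<mu> (\<lambda>x. a x - \<theta>)" using integrable_bdd[OF a_meas a_le] by simp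
    have i2: "integrable \<mu> (\<lambda>x. \<Sum>S\<in>SS. \<alpha>t M S x)"
      by (intro Bochner_Integration.integrable_sum sq_integrable \<alpha>t_props(5))
    have "(\<integral>x. ?r x \<partial>\<mu>) = (\<integral>x. a x - \<theta> \<partial>\<mu>) - (\<integral>x. (\<Sum>S\<in>SS. \<alpha>t M S x) \<partial>\<mu>)"
      by (rule Bochner_Integration.integral_diff[OF i1 i2])
    also have "(\<integral>x. (\<Sum>S\<in>SS. \<alpha>t M S x) \<partial>\<mu>) = (\<Sum>S\<in>SS. (\<integral>x. \<alpha>t M S x \<partial>\<mu>))"
      by (intro Bochner_Integration.integral_sum sq_integrable \<alpha>t_props(5))
    finally show ?thesis using integrable_bdd[OF a_meas a_le] by (simp add: \<alpha>t_props(4) \<theta>_def prob_space)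
  qed
  let ?B = "2 * A + real (card SS) * (A * (2 + C1) ^ M * C1) + A * (2 + C1) ^ M * C1"
  have G0: "0 \<le> A * (2 + C1) ^ M * C1" using A_nonneg C1_pos by simp
  have "(\<integral>z. (lin M z)\<^sup>2 \<partial>I.\<Omega>) = (\<Sum>p\<in>J. (\<integral>x. (lin_coef M p x)\<^sup>2 \<partial>\<mu>))"
    unfolding lin_def
  proof (rule I.second_moment_linear)
    fix p assume p: "p \<in> J"
    then consider i where "p = ({1..d}, i)" "i \<in> {1..n}" | S l where "p = (S, l)" "S \<in> SS" "l \<in> {1..nS S}"
      by (auto simp: J_def)
    then have "lin_coef M p \<in> borel_measurable \<mu> \<and> (\<forall>x. \<bar>lin_coef M p x\<bar> \<le> ?B) \<and> (\<integral>x. lin_coef M p x \<partial>\<mu>) = 0"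
    proof cases
      case 1
      have eq: "lin_coef M p = (\<lambda>x. 1 / real n * ?r x)" using 1 by (simp add: lin_coef_def fun_eq_iff)
      have "\<bar>1 / real n * ?r x\<bar> \<le> ?B" for x
        by (rule abs_inverse_mult_le[OF n_pos]) (use rb[of x] G0 in linarith)
      then have "\<forall>x. \<bar>1 / real n * ?r x\<bar> \<le> ?B" by blast
      moreover have "(\<lambda>x. 1 / real n * ?r x) \<in> borel_measurable \<mu>"
        using rm by (intro borel_measurable_times borel_measurable_const) simp
      moreover have "(\<integral>x. 1 / real n * ?r x \<partial>\<mu>) = 0"
        unfolding integral_mult_right_zero r0 by simp
      ultimately show ?thesis unfolding eq by blast
    next
      case 2
      have eq: "lin_coef M p = (\<lambda>x. 1 / real (nS S) * \<alpha>t M S x)" using 2 ne by (auto simp: lin_coef_def fun_eq_iff)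
      have s0: "0 \<le> 2 * A + real (card SS) * (A * (2 + C1) ^ M * C1)" using A_nonneg G0 by simp
      have "\<bar>1 / real (nS S) * \<alpha>t M S x\<bar> \<le> ?B" for x
        by (rule abs_inverse_mult_le[OF nS_pos[OF 2(2)]]) (use \<alpha>t_props(2)[OF 2(2), of M x] s0 in linarith)
      then have "\<forall>x. \<bar>1 / real (nS S) * \<alpha>t M S x\<bar> \<le> ?B" by blast
      moreover have "(\<lambda>x. 1 / real (nS S) * \<alpha>t M S x) \<in> borel_measurable \<mu>"
        using \<alpha>t_props(1)[OF 2(2), of M] by (intro borel_measurable_times borel_measurable_const) simp
      moreover have "(\<integral>x. 1 / real (nS S) * \<alpha>t M S x \<partial>\<mu>) = 0"
        unfolding integral_mult_right_zero \<alpha>t_props(4)[OF 2(2), of M] by simp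
      ultimately show ?thesis unfolding eq by blast
    qed
    then show "lin_coef M p \<in> borel_measurable \<mu>" "\<bar>lin_coef M p x\<bar> \<le> ?B" "(\<integral>x. lin_coef M p x \<partial>\<mu>) = 0" for x by auto
  qed
  also have "\<dots> = (\<Sum>i=1..n. (1 / real n)\<^sup>2 * (\<integral>x. (?r x)\<^sup>2 \<partial>\<mu>)) + (\<Sum>S\<in>SS. \<Sum>l=1..nS S. (1 / real (nS S))\<^sup>2 * (\<integral>x. (\<alpha>t M S x)\<^sup>2 \<partial>\<mu>))"
    unfolding sum_J
  proof (intro arg_cong2[where f = "(+)"] sum.cong refl)
    show "(\<integral>x. (lin_coef M ({1..d}, i) x)\<^sup>2 \<partial>\<mu>) = (1 / real n)\<^sup>2 * (\<integral>x. (?r x)\<^sup>2 \<partial>\<mu>)" for i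
      unfolding integral_mult_right_zero[symmetric] by (simp add: lin_coef_def power_mult_distrib power_divide)
    show "(\<integral>x. (lin_coef M (S, l) x)\<^sup>2 \<partial>\<mu>) = (1 / real (nS S))\<^sup>2 * (\<integral>x. (\<alpha>t M S x)\<^sup>2 \<partial>\<mu>)" if "S \<in> SS" for S l
      unfolding integral_mult_right_zero[symmetric] using ne[OF that] by (simp add: lin_coef_def power_mult_distrib power_divide)
  qed
  finally have m: "(\<integral>z. (lin M z)\<^sup>2 \<partial>I.\<Omega>) =
    (\<Sum>i=1..n. (1 / real n)\<^sup>2 * (\<integral>x. (?r x)\<^sup>2 \<partial>\<mu>)) + (\<Sum>S\<in>SS. \<Sum>l=1..nS S. (1 / real (nS S))\<^sup>2 * (\<integral>x. (\<alpha>t M S x)\<^sup>2 \<partial>\<mu>))" .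
  have "real n * (\<Sum>i=1..n. (1 / real n)\<^sup>2 * (\<integral>x. (?r x)\<^sup>2 \<partial>\<mu>)) = (\<integral>x. (?r x)\<^sup>2 \<partial>\<mu>)"
    using n_pos by (simp add: power2_eq_square)
  moreover have "real n * (\<Sum>S\<in>SS. \<Sum>l=1..nS S. (1 / real (nS S))\<^sup>2 * (\<integral>x. (\<alpha>t M S x)\<^sup>2 \<partial>\<mu>)) =
    (\<Sum>S\<in>SS. 1 / (real (nS S) / real n) * (\<integral>x. (\<alpha>t M S x)\<^sup>2 \<partial>\<mu>))"
    unfolding sum_distrib_left[of "real n" _ SS]
  proof (intro sum.cong refl)
    fix S assume "S \<in> SS"
    then show "real n * (\<Sum>l=1..nS S. (1 / real (nS S))\<^sup>2 * (\<integral>x. (\<alpha>t M S x)\<^sup>2 \<partial>\<mu>)) =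
      1 / (real (nS S) / real n) * (\<integral>x. (\<alpha>t M S x)\<^sup>2 \<partial>\<mu>)"
      using nS_pos[of S] by (simp add: power2_eq_square)
  qed
  ultimately show ?thesis unfolding m Lob_def by (simp only: distrib_left)
qed

end

lemma young_square:
  fixes p q \<epsilon> :: real
  assumes "0 < \<epsilon>"
  shows "(p + q)\<^sup>2 \<le> (1 + \<epsilon>) * p\<^sup>2 + (1 + 1 / \<epsilon>) * q\<^sup>2"
proof -
  have "0 \<le> (\<epsilon> * p - q)\<^sup>2 / \<epsilon>" using assms by simp
  also have "\<dots> = \<epsilon> * p\<^sup>2 - 2 * p * q + 1 / \<epsilon> * q\<^sup>2" using assms by (simp add: field_simps power2_eq_square)
  finally show ?thesis by (simp add: power2_sum algebra_simps)
qed

section \<open>Degenerate remainder, exceptional event and the resulting risk bounds\<close>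

context risk begin

lemma X_meas: "i \<in> {1..n} ==> (\<lambda>z. X z i) \<in> I.\<Omega> \<rightarrow>\<^sub>M leb {1..d}"
  using I.component_measurable[OF X_in_J] unfolding measurable_cong_sets[OF refl sets_law] .

lemma Y_meas: "S \<in> SS ==> i \<in> {1..nS S} ==> (\<lambda>z. z (S, i)) \<in> I.\<Omega> \<rightarrow>\<^sub>M leb {1..d}"
  using I.component_measurable[OF Y_in_J] unfolding measurable_cong_sets[OF refl sets_law] .

lemma est_meas: "est M \<in> borel_measurable I.\<Omega>"
proof -
  have "(\<lambda>z. theta_check d K a SS h M n nS (X z, z)) \<in> borel_measurable I.\<Omega>"
  proof (rule theta_check_measurable[OF kern_axioms SS(1) a_meas X_meas])
    fix S i j assume S: "S \<in> SS" "i \<in> {1..nS S}" "j \<in> S"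
    then have "j \<in> {1..d}" using SS_sub[OF S(1)] by (intro subsetD[of S "{1..d}"])
    from measurable_compose[OF Y_meas[OF S(1,2)] measurable_leb_component[OF this]]
    show "(\<lambda>z. z (S, i) j) \<in> borel_measurable I.\<Omega>" .
  qed
  then show ?thesis by (simp only: est_def[abs_def])
qed

definition Q :: "nat => real" where "Q M = A * (2 + C1) ^ M * ((\<kappa> / h ^ d + C0) / c1 + C1)"

lemma kap_nonneg: "0 \<le> \<kappa> / h ^ d" using \<kappa>_nonneg h_pos by simp

lemma qk_joint:
  assumes S: "S \<in> SS"
  shows "(\<lambda>p. qk M S (fst p) (snd p)) \<in> bor2 d"
proof -
  note Sd = SS_sub[OF S]
  note [measurable] = k_joint[OF Sd] \<Gamma>t_le(1)[OF S] fb_meas[OF Sd] ft_meas[OF Sd] Tt_meas[OF Sd \<Gamma>t_le(1)[OF S]]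
  show ?thesis unfolding qk_def by measurable
qed

text \<open>The mean over \<open>x\<close> vanishes because \<open>fb\<close> equals
  \<open>ft\<close> almost surely; the mean over \<open>y\<close> because \<open>ft\<close> is the
  mean of the kernel and \<open>Tt\<close> has mean zero.\<close>

lemma qk_props:
  assumes S: "S \<in> SS"
  shows "\<bar>qk M S x y\<bar> \<le> Q M" "(\<integral>x. qk M S x y \<partial>\<mu>) = 0" "(\<integral>y. qk M S x y \<partial>\<mu>) = 0"
proof -
  note Sd = SS_sub[OF S]
  note g = \<Gamma>t_le[OF S, of M]
  have tt: "\<bar>Tt S (\<Gamma>t M S) y\<bar> \<le> A * (2 + C1) ^ M * C1" for y
    using Tt_le[OF Sd g(1) g(2), of y] by (simp add: C1_def)
  show "\<bar>qk M S x y\<bar> \<le> Q M"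
  proof -
    have "\<bar>k S x y - ft S x\<bar> \<le> \<kappa> / h ^ d + C0"
      using k_nonneg[OF Sd, of y x] k_le[OF Sd, of y x] ft_nonneg[OF Sd, of x] ft_le[OF Sd, of x] C0_pos by linarith
    moreover have "0 \<le> \<kappa> / h ^ d + C0" using kap_nonneg C0_pos by simp
    ultimately have 2: "\<bar>(k S x y - ft S x) / fb S x\<bar> \<le> (\<kappa> / h ^ d + C0) / c1"
      using fb_ge[of S x] fb_pos[of S x] c1_pos by (simp add: abs_divide frac_le)
    have "\<bar>\<Gamma>t M S x / fb S x * (k S x y - ft S x)\<bar> = \<bar>\<Gamma>t M S x\<bar> * \<bar>(k S x y - ft S x) / fb S x\<bar>"
      by (simp add: abs_mult)
    also have "\<dots> \<le> A * (2 + C1) ^ M * ((\<kappa> / h ^ d + C0) / c1)"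
      using 2 g(2)[of x] by (intro mult_mono) auto
    finally show ?thesis using tt[of y] unfolding qk_def Q_def distrib_left by linarith
  qed
  have i2: "integrable \<mu> (\<Gamma>t M S)" by (rule integrable_bdd[OF g])
  show "(\<integral>x. qk M S x y \<partial>\<mu>) = 0"
  proof -
    have "(\<integral>x. qk M S x y \<partial>\<mu>) = (\<integral>x. \<Gamma>t M S x * (k S x y / fb S x - 1) - Tt S (\<Gamma>t M S) y \<partial>\<mu>)"
    proof (rule integral_cong_AE)
      have bm: "F \<in> borel_measurable \<mu>" if "F \<in> bor d" for F :: "point => real"
        using that unfolding measurable_cong_sets[OF sets_law refl] .
      have "qk M S x y = \<Gamma>t M S x * (k S x y / fb S x) - \<Gamma>t M S x * (ft S x / fb S x) - Tt S (\<Gamma>t M S) y" for x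
        by (simp add: qk_def right_diff_distrib diff_divide_distrib)
      then have e: "(\<lambda>x. qk M S x y) = (\<lambda>x. \<Gamma>t M S x * (k S x y / fb S x) - \<Gamma>t M S x * (ft S x / fb S x) - Tt S (\<Gamma>t M S) y)"
        by (rule ext)
      show "(\<lambda>x. qk M S x y) \<in> borel_measurable \<mu>" unfolding e
        by (intro bm borel_measurable_diff borel_measurable_times borel_measurable_divide borel_measurable_const
            ratio_meas[OF Sd] g(1) fb_meas[OF Sd] ft_meas[OF Sd])
      show "(\<lambda>x. \<Gamma>t M S x * (k S x y / fb S x - 1) - Tt S (\<Gamma>t M S) y) \<in> borel_measurable \<mu>"
        by (intro bm borel_measurable_diff borel_measurable_times borel_measurable_const ratio_meas[OF Sd] g(1))
      show "AE x in \<mu>. qk M S x y = \<Gamma>t M S x * (k S x y / fb S x - 1) - Tt S (\<Gamma>t M S) y"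
        using AE_cube
      proof eventually_elim
        case (elim x)
        then have e: "ft S x = fb S x" using fb_eq[OF Sd] by simp
        have "\<Gamma>t M S x / fb S x * (k S x y - fb S x) = \<Gamma>t M S x * (k S x y / fb S x - 1)"
          using fb_pos[of S x] by (simp add: field_simps)
        then show ?case unfolding qk_def e by simp
      qed
    qed
    also have "\<dots> = 0"
      using Tt_integrable(1)[OF Sd i2, of y] by (simp add: Tt_def prob_space)
    finally show ?thesis .
  qed
  show "(\<integral>y. qk M S x y \<partial>\<mu>) = 0"
  proof -
    have it: "integrable \<mu> (Tt S (\<Gamma>t M S))" by (rule integrable_bdd[OF Tt_meas[OF Sd g(1)] tt])
    have ik: "integrable \<mu> (\<lambda>y. k S x y)" by (rule k_integrable[OF Sd])
    have "(\<integral>y. \<Gamma>t M S x / fb S x * (k S x y - ft S x) \<partial>\<mu>) = \<Gamma>t M S x / fb S x * ((\<integral>y. k S x y \<partial>\<mu>) - ft S x)"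
      unfolding integral_mult_right_zero using ik by (simp add: prob_space)
    also have "\<dots> = 0" by (simp add: ft_def)
    finally have 1: "(\<integral>y. \<Gamma>t M S x / fb S x * (k S x y - ft S x) \<partial>\<mu>) = 0" .
    have "integrable \<mu> (\<lambda>y. \<Gamma>t M S x / fb S x * (k S x y - ft S x))" using ik by simp
    from Bochner_Integration.integral_diff[OF this it]
    show ?thesis unfolding qk_def 1 by (simp add: Tt_mean_zero[OF Sd g])
  qed
qed

lemma Q_nonneg: "0 \<le> Q M"
proof -
  obtain S where "S \<in> SS" using SS by auto
  from order_trans[OF abs_ge_zero qk_props(1)[OF this]] show ?thesis .
qed

lemma qk_pair_meas: "S \<in> SS ==> i \<in> J ==> l \<in> J ==> (\<lambda>z. qk M S (z i) (z l)) \<in> borel_measurable I.\<Omega>"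
proof -
  assume S: "S \<in> SS" and il: "i \<in> J" "l \<in> J"
  have "(\<lambda>z. (z i, z l)) \<in> I.\<Omega> \<rightarrow>\<^sub>M \<mu> \<Otimes>\<^sub>M \<mu>" using il by (intro measurable_Pair I.component_measurable)
  moreover have "sets (\<mu> \<Otimes>\<^sub>M \<mu>) = sets (leb {1..d} \<Otimes>\<^sub>M leb {1..d})" by (intro sets_pair_measure_cong) simp_all
  ultimately have "(\<lambda>z. (z i, z l)) \<in> I.\<Omega> \<rightarrow>\<^sub>M leb {1..d} \<Otimes>\<^sub>M leb {1..d}"
    using measurable_cong_sets[OF refl, of "\<mu> \<Otimes>\<^sub>M \<mu>" "leb {1..d} \<Otimes>\<^sub>M leb {1..d}" I.\<Omega>] by simp
  from measurable_compose[OF this qk_joint[OF S]] show ?thesis by simp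
qed

lemma pair_second_moment:
  assumes S: "S \<in> SS" and P: "P \<subseteq> J \<times> J" "\<And>i l. (i, l) \<in> P ==> i \<noteq> l"
  shows "(\<integral>z. (\<Sum>(i, l)\<in>P. qk M S (z i) (z l))\<^sup>2 \<partial>I.\<Omega>) \<le> 2 * real (card P) * (Q M)\<^sup>2"
proof (rule I.second_moment_degenerate[OF P])
  have "sets (\<mu> \<Otimes>\<^sub>M \<mu>) = sets (leb {1..d} \<Otimes>\<^sub>M leb {1..d})" by (intro sets_pair_measure_cong) simp_all
  then show "(\<lambda>p. qk M S (fst p) (snd p)) \<in> borel_measurable (\<mu> \<Otimes>\<^sub>M \<mu>)"
    using qk_joint[OF S] measurable_cong_sets[of "\<mu> \<Otimes>\<^sub>M \<mu>" "leb {1..d} \<Otimes>\<^sub>M leb {1..d}" borel borel] by simp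
qed (use qk_props[OF S] in auto)

definition DD :: "nat => (nat set \<times> nat => point) => real" where
  "DD M z = (\<Sum>S\<in>SS. v S * (DX M S z - DY M S z))"

lemma DX_meas: "S \<in> SS ==> DX M S \<in> borel_measurable I.\<Omega>"
  unfolding DX_def[abs_def]
  by (intro borel_measurable_times borel_measurable_const borel_measurable_sum qk_pair_meas X_in_J)

lemma DY_meas: "S \<in> SS ==> DY M S \<in> borel_measurable I.\<Omega>"
  unfolding DY_def[abs_def]
  by (intro borel_measurable_times borel_measurable_const borel_measurable_sum qk_pair_meas X_in_J Y_in_J)

text \<open>Splitting a square into three parts costs 3. The off-diagonal pairs of complete points
  and the mixed pairs each give \<open>3 * 2\<close>, the diagonal gives 3, in total 15; another
  \<open>(card SS)\<^sup>2\<close> comes from the sum over \<open>SS\<close>.\<close>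

lemma DD_second_moment:
  assumes N: "0 < N" "N \<le> n" "\<And>S. S \<in> SS ==> N \<le> nS S"
  shows "(\<integral>z. (DD M z)\<^sup>2 \<partial>I.\<Omega>) \<le> 15 * (real (card SS))\<^sup>2 * (Q M)\<^sup>2 / (real n * real N)"
    and "integrable I.\<Omega> (\<lambda>z. (DD M z)\<^sup>2)" and "DD M \<in> borel_measurable I.\<Omega>"
proof -
  interpret O: prob_space I.\<Omega> by (rule I.prob_\<Omega>)
  let ?D = "{1..d}" let ?q = "\<lambda>S i l z. qk M S (z i) (z l)"
  define P1 where "P1 = {((?D, i), (?D, l)) |i l. i \<in> {1..n} \<and> l \<in> {1..n} \<and> i \<noteq> l}"
  define P2 where "P2 S = {((?D, i), (S, l)) |i l. i \<in> {1..n} \<and> l \<in> {1..nS S}}" for S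
  define F1 where "F1 S z = (\<Sum>(i, l)\<in>P1. qk M S (z i) (z l))" for S z
  define F2 where "F2 S z = (\<Sum>(i, l)\<in>P2 S. qk M S (z i) (z l))" for S z
  have P1_im: "P1 = (\<lambda>(i, l). ((?D, i), (?D, l))) ` {(i, l). i \<in> {1..n} \<and> l \<in> {1..n} \<and> i \<noteq> l}"
    by (auto simp: P1_def image_iff)
  have P2_im: "P2 S = (\<lambda>(i, l). ((?D, i), (S, l))) ` ({1..n} \<times> {1..nS S})" for S
    by (auto simp: P2_def image_iff)
  have inj1: "inj_on (\<lambda>(i, l). ((?D, i), (?D, l))) B" for B :: "(nat \<times> nat) set" by (auto simp: inj_on_def)
  have inj2: "inj_on (\<lambda>(i, l). ((?D, i), (S, l))) B" for B :: "(nat \<times> nat) set" and S :: "nat set" by (auto simp: inj_on_def)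
  have off: "{(i, l). i \<in> {1..n} \<and> l \<in> {1..n} \<and> i \<noteq> l} = {1..n} \<times> {1..n} - (\<lambda>i. (i, i)) ` {1..n}" by auto
  have c1: "real (card P1) \<le> real n * real n"
  proof -
    have "card P1 \<le> card ({1..n} \<times> {1..n})"
      unfolding P1_im card_image[OF inj1] by (rule card_mono) auto
    then show ?thesis by (simp flip: of_nat_mult)
  qed
  have c2: "real (card (P2 S)) = real n * real (nS S)" for S unfolding P2_im card_image[OF inj2] by simp
  have ne: "S \<noteq> ?D" if "S \<in> SS" for S using that SS_full by auto
  have P1J: "P1 \<subseteq> J \<times> J" using X_in_J by (auto simp: P1_def)
  have P2J: "P2 S \<subseteq> J \<times> J" if "S \<in> SS" for S using X_in_J Y_in_J[OF that] by (auto simp: P2_def)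
  have m1: "(\<integral>z. (F1 S z)\<^sup>2 \<partial>I.\<Omega>) \<le> 2 * (real n * real n) * (Q M)\<^sup>2" if S: "S \<in> SS" for S
  proof -
    have "(\<integral>z. (F1 S z)\<^sup>2 \<partial>I.\<Omega>) \<le> 2 * real (card P1) * (Q M)\<^sup>2"
      unfolding F1_def by (rule pair_second_moment[OF S P1J]) (auto simp: P1_def)
    also have "\<dots> \<le> 2 * (real n * real n) * (Q M)\<^sup>2" using c1 by (intro mult_right_mono) auto
    finally show ?thesis .
  qed
  have m2: "(\<integral>z. (F2 S z)\<^sup>2 \<partial>I.\<Omega>) \<le> 2 * (real n * real (nS S)) * (Q M)\<^sup>2" if S: "S \<in> SS" for S
    unfolding F2_def c2[symmetric] by (rule pair_second_moment[OF S P2J[OF S]]) (use ne[OF S] in \<open>auto simp: P2_def\<close>)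
  have sum1: "F1 S z = (\<Sum>i=1..n. \<Sum>l=1..n. qk M S (X z i) (X z l)) - (\<Sum>i=1..n. qk M S (X z i) (X z i))" for S z
  proof -
    have "F1 S z = (\<Sum>p\<in>{1..n} \<times> {1..n} - (\<lambda>i. (i, i)) ` {1..n}. qk M S (X z (fst p)) (X z (snd p)))"
      unfolding F1_def P1_im sum.reindex[OF inj1] off by (intro sum.cong refl) (auto simp: case_prod_unfold)
    also have "\<dots> = (\<Sum>p\<in>{1..n} \<times> {1..n}. qk M S (X z (fst p)) (X z (snd p))) -
      (\<Sum>p\<in>(\<lambda>i. (i, i)) ` {1..n}. qk M S (X z (fst p)) (X z (snd p)))"
      by (intro sum_diff) auto
    also have "(\<Sum>p\<in>(\<lambda>i. (i, i)) ` {1..n}. qk M S (X z (fst p)) (X z (snd p))) = (\<Sum>i=1..n. qk M S (X z i) (X z i))"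
      by (subst sum.reindex) (auto simp: inj_on_def)
    also have "(\<Sum>p\<in>{1..n} \<times> {1..n}. qk M S (X z (fst p)) (X z (snd p))) = (\<Sum>i=1..n. \<Sum>l=1..n. qk M S (X z i) (X z l))"
      by (simp add: sum.cartesian_product case_prod_unfold)
    finally show ?thesis .
  qed
  have sum2: "F2 S z = (\<Sum>i=1..n. \<Sum>l=1..nS S. qk M S (X z i) (z (S, l)))" for S z
    unfolding F2_def P2_im sum.reindex[OF inj2] by (simp add: sum.cartesian_product case_prod_unfold)
  have pt: "(DX M S z - DY M S z)\<^sup>2 \<le> 3 * (F1 S z / (real n * real n))\<^sup>2 + 3 * (Q M / real n)\<^sup>2 + 3 * (F2 S z / (real n * real (nS S)))\<^sup>2"
    if S: "S \<in> SS" for S z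
  proof -
    \<comment> \<open>On the diagonal degeneracy is of no help, but only \<open>n\<close> of the
      \<open>n\<^sup>2\<close> terms lie there, so the crude bound \<open>Q M / n\<close> is
      enough.\<close>
    let ?g = "\<Sum>i=1..n. qk M S (X z i) (X z i)"
    have "\<bar>1 / real n * ?g\<bar> \<le> Q M" by (rule sum_avg_le[OF n_pos qk_props(1)[OF S]])
    then have g: "\<bar>?g / (real n * real n)\<bar> \<le> Q M / real n"
      using n_pos by (simp add: abs_mult abs_divide divide_right_mono flip: divide_divide_eq_left)
    have "DX M S z - DY M S z = F1 S z / (real n * real n) + ?g / (real n * real n) - F2 S z / (real n * real (nS S))"
      unfolding DX_def DY_def sum1 sum2 by (simp add: diff_divide_distrib)
    moreover have "(p + q - r)\<^sup>2 \<le> 3 * p\<^sup>2 + 3 * q\<^sup>2 + 3 * r\<^sup>2" for p q r :: real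
    proof -
      have "3 * p\<^sup>2 + 3 * q\<^sup>2 + 3 * r\<^sup>2 - (p + q - r)\<^sup>2 = (p - q)\<^sup>2 + (p + r)\<^sup>2 + (q + r)\<^sup>2"
        by (simp add: power2_eq_square algebra_simps)
      then show ?thesis using zero_le_power2[of "p - q"] zero_le_power2[of "p + r"] zero_le_power2[of "q + r"] by linarith
    qed
    moreover have "(?g / (real n * real n))\<^sup>2 \<le> (Q M / real n)\<^sup>2"
      using power_mono[OF g abs_ge_zero, of 2] by (simp only: power2_abs)
    ultimately show ?thesis by (smt (verit))
  qed
  have F1m: "F1 S \<in> borel_measurable I.\<Omega>" "F2 S \<in> borel_measurable I.\<Omega>" if S: "S \<in> SS" for S
    unfolding F1_def[abs_def] F2_def[abs_def] case_prod_unfold using P1J P2J[OF S]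
    by (intro borel_measurable_sum qk_pair_meas[OF S]; auto)+
  have F1b: "\<bar>F1 S z\<bar> \<le> real (card P1) * Q M" "\<bar>F2 S z\<bar> \<le> real (card (P2 S)) * Q M" if S: "S \<in> SS" for S z
    unfolding F1_def F2_def case_prod_unfold
    by (rule order_trans[OF sum_abs sum_bounded_above[OF qk_props(1)[OF S]]])+
  have F1i: "integrable I.\<Omega> (\<lambda>z. (F1 S z)\<^sup>2)" "integrable I.\<Omega> (\<lambda>z. (F2 S z)\<^sup>2)" if S: "S \<in> SS" for S
    using F1m[OF S] power_mono[OF F1b(1)[OF S] abs_ge_zero, where n = 2] power_mono[OF F1b(2)[OF S] abs_ge_zero, where n = 2]
    by (auto intro!: I.integrable_bounded borel_measurable_power)
  let ?G = "\<lambda>S z. 3 * (F1 S z / (real n * real n))\<^sup>2 + 3 * (Q M / real n)\<^sup>2 + 3 * (F2 S z / (real n * real (nS S)))\<^sup>2"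
  have Gi: "integrable I.\<Omega> (?G S)" if S: "S \<in> SS" for S
    unfolding power_divide using F1i[OF S] by (intro Bochner_Integration.integrable_add integrable_mult_right integrable_divide) auto
  have GI: "(\<integral>z. ?G S z \<partial>I.\<Omega>) \<le> 15 * (Q M)\<^sup>2 / (real n * real N)" if S: "S \<in> SS" for S
  proof -
    have "(\<integral>z. ?G S z \<partial>I.\<Omega>) = 3 * ((\<integral>z. (F1 S z)\<^sup>2 \<partial>I.\<Omega>) / (real n * real n)\<^sup>2) + 3 * (Q M / real n)\<^sup>2 +
      3 * ((\<integral>z. (F2 S z)\<^sup>2 \<partial>I.\<Omega>) / (real n * real (nS S))\<^sup>2)"
      unfolding power_divide using F1i[OF S] by (simp add: O.prob_space)
    also have "\<dots> \<le> 3 * (2 * (real n * real n) * (Q M)\<^sup>2 / (real n * real n)\<^sup>2) + 3 * (Q M / real n)\<^sup>2 +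
      3 * (2 * (real n * real (nS S)) * (Q M)\<^sup>2 / (real n * real (nS S))\<^sup>2)"
      using m1[OF S] m2[OF S] by (intro add_mono mult_left_mono divide_right_mono) auto
    also have "\<dots> = 9 * ((Q M)\<^sup>2 / (real n * real n)) + 6 * ((Q M)\<^sup>2 / (real n * real (nS S)))"
      using n_pos nS_pos[OF S] by (simp add: power2_eq_square)
    also have "\<dots> \<le> 9 * ((Q M)\<^sup>2 / (real n * real N)) + 6 * ((Q M)\<^sup>2 / (real n * real N))"
      using N(1,2) N(3)[OF S] n_pos by (intro add_mono mult_left_mono divide_left_mono) auto
    finally show ?thesis by (simp add: mult.commute)
  qed
  have DDp: "(DD M z)\<^sup>2 \<le> real (card SS) * (\<Sum>S\<in>SS. ?G S z)" for z
  proof -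
    have "(DD M z)\<^sup>2 \<le> (\<Sum>S\<in>SS. (v S * (DX M S z - DY M S z))\<^sup>2) * real (card SS)"
      unfolding DD_def by (rule sum_squared_le_sum_of_squares)
    also have "\<dots> \<le> (\<Sum>S\<in>SS. ?G S z) * real (card SS)"
    proof (intro mult_right_mono sum_mono)
      fix S assume S: "S \<in> SS"
      have "(v S)\<^sup>2 \<le> 1" using v_bounds(1)[OF S] by (simp add: power_le_one)
      then have "(v S * (DX M S z - DY M S z))\<^sup>2 \<le> 1 * (DX M S z - DY M S z)\<^sup>2"
        unfolding power_mult_distrib by (intro mult_right_mono) auto
      then show "(v S * (DX M S z - DY M S z))\<^sup>2 \<le> ?G S z" using pt[OF S, of z] by linarith
    qed simp
    finally show ?thesis by (simp add: mult.commute)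
  qed
  show dm: "DD M \<in> borel_measurable I.\<Omega>"
    unfolding DD_def[abs_def] by (intro borel_measurable_sum borel_measurable_times borel_measurable_const borel_measurable_diff DX_meas DY_meas)
  have sGi: "integrable I.\<Omega> (\<lambda>z. real (card SS) * (\<Sum>S\<in>SS. ?G S z))"
    by (intro integrable_mult_right Bochner_Integration.integrable_sum Gi)
  show di: "integrable I.\<Omega> (\<lambda>z. (DD M z)\<^sup>2)"
  proof (rule Bochner_Integration.integrable_bound[OF sGi])
    show "(\<lambda>z. (DD M z)\<^sup>2) \<in> borel_measurable I.\<Omega>" using dm by (rule borel_measurable_power)
    show "AE z in I.\<Omega>. norm ((DD M z)\<^sup>2) \<le> norm (real (card SS) * (\<Sum>S\<in>SS. ?G S z))"
      using DDp by (intro AE_I2) (smt (verit) real_norm_def zero_le_power2)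
  qed
  have "(\<integral>z. (DD M z)\<^sup>2 \<partial>I.\<Omega>) \<le> (\<integral>z. real (card SS) * (\<Sum>S\<in>SS. ?G S z) \<partial>I.\<Omega>)"
    by (rule integral_mono[OF di sGi DDp])
  also have "\<dots> = real (card SS) * (\<Sum>S\<in>SS. (\<integral>z. ?G S z \<partial>I.\<Omega>))"
    unfolding integral_mult_right_zero by (subst Bochner_Integration.integral_sum) (auto intro: Gi)
  also have "\<dots> \<le> real (card SS) * (real (card SS) * (15 * (Q M)\<^sup>2 / (real n * real N)))"
    by (intro mult_left_mono sum_bounded_above GI) auto
  finally show "(\<integral>z. (DD M z)\<^sup>2 \<partial>I.\<Omega>) \<le> 15 * (real (card SS))\<^sup>2 * (Q M)\<^sup>2 / (real n * real N)"
    by (simp add: power2_eq_square mult_ac)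
qed

text \<open>The points \<open>X z l\<close> at which the averages are evaluated belong to the sample, so one summand has to be
  split off before Hoeffding's inequality applies conditionally on \<open>X z l\<close>; this costs \<open>2 * R / N\<close>.\<close>

lemma avg_tail:
  assumes B: "{c} \<times> {1..T} \<subseteq> J" and N: "2 \<le> N" "N \<le> T" and l: "l \<in> {1..n}"
    and \<psi>m: "(\<lambda>p. \<psi> (fst p) (snd p)) \<in> bor2 d"
    and \<psi>: "\<And>x y. \<bar>\<psi> x y\<bar> \<le> R" and R: "0 < R" and t: "0 \<le> t"
  shows "\<exists>E\<in>sets I.\<Omega>. measure I.\<Omega> E \<le> 2 * exp (- (real N * t\<^sup>2 / (2 * R\<^sup>2))) \<and>
    (\<forall>z\<in>space I.\<Omega>. z \<notin> E \<longrightarrow> \<bar>1 / real T * (\<Sum>i=1..T. \<psi> (z (c, i)) (X z l)) - (\<integral>x. \<psi> x (X z l) \<partial>\<mu>)\<bar> \<le> t + 2 * R / real N)"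
proof -
  let ?l = "({1..d}, l)" let ?B = "{c} \<times> {1..T} - {?l}"
  let ?m = "\<lambda>z. \<integral>x. \<psi> x (X z l) \<partial>\<mu>"
  define E where "E = {z \<in> space I.\<Omega>. real T * t \<le> \<bar>\<Sum>i\<in>?B. \<psi> (z i) (z ?l) - (\<integral>x. \<psi> x (z ?l) \<partial>\<mu>)\<bar>}"
  have T: "2 \<le> T" using N by simp
  have fB: "finite ({c} \<times> {1..T})" by simp
  have cc: "card ({c} \<times> {1..T}) = T" by simp
  have cB: "card ?B \<le> T" "T - 1 \<le> card ?B"
    using card_mono[OF fB, of ?B] cc diff_card_le_card_Diff[of "{?l}" "{c} \<times> {1..T}"] by auto
  have Bne: "?B \<noteq> {}"
  proof
    assume "?B = {}"
    then have "card ?B = 0" by (simp only: card.empty)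
    then show False using cB(2) T by linarith
  qed
  have Bs: "?B \<subseteq> J - {?l}" using B by auto
  have "sets (\<mu> \<Otimes>\<^sub>M \<mu>) = sets (leb {1..d} \<Otimes>\<^sub>M leb {1..d})" by (intro sets_pair_measure_cong) simp_all
  then have \<psi>m': "(\<lambda>p. \<psi> (fst p) (snd p)) \<in> borel_measurable (\<mu> \<Otimes>\<^sub>M \<mu>)"
    using \<psi>m measurable_cong_sets[of "\<mu> \<Otimes>\<^sub>M \<mu>" "leb {1..d} \<Otimes>\<^sub>M leb {1..d}" borel borel] by simp
  have \<epsilon>: "0 \<le> real T * t" using t by simp
  note H = hoeffding_conditional[OF finite_J X_in_J[OF l] Bs Bne \<psi>m' \<psi> R \<epsilon>]
  have "measure I.\<Omega> E \<le> 2 * exp (- 2 * (real T * t)\<^sup>2 / (real (card ?B) * (2 * R)\<^sup>2))"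
    unfolding E_def by (rule H(1))
  also have "\<dots> \<le> 2 * exp (- (real N * t\<^sup>2 / (2 * R\<^sup>2)))"
    using Bne cB(1) N(2) R by (intro exponent_bound) (auto simp: card_gt_0_iff)
  finally have 1: "measure I.\<Omega> E \<le> 2 * exp (- (real N * t\<^sup>2 / (2 * R\<^sup>2)))" .
  have 2: "\<bar>1 / real T * (\<Sum>i=1..T. \<psi> (z (c, i)) (X z l)) - ?m z\<bar> \<le> t + 2 * R / real N"
    if z: "z \<in> space I.\<Omega>" "z \<notin> E" for z
  proof -
    let ?g = "\<lambda>i. \<psi> (z i) (X z l) - ?m z"
    have s: "\<bar>\<Sum>i\<in>?B. ?g i\<bar> < real T * t" using z unfolding E_def by simp
    have "\<bar>?m z\<bar> \<le> R"
    proof -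
      have Xl: "X z l \<in> euclid d" using measurable_space[OF X_meas[OF l] z(1)] by (simp add: space_PiM)
      have "(\<lambda>x. \<psi> x (X z l)) \<in> bor d"
        using measurable_compose[OF measurable_Pair2'[of "X z l"] \<psi>m] Xl by (simp add: space_PiM)
      then show ?thesis by (intro integral_abs_le \<psi>)
    qed
    then have g: "\<bar>?g i\<bar> \<le> 2 * R" for i using \<psi>[of "z i" "X z l"] by linarith
    have "\<bar>(\<Sum>i\<in>{c} \<times> {1..T}. ?g i) - (\<Sum>i\<in>?B. ?g i)\<bar> \<le> 2 * R"
      using sum_diff1[OF fB, of ?g ?l] g[of ?l] R by (auto split: if_splits)
    moreover have "(\<Sum>i\<in>{c} \<times> {1..T}. ?g i) = (\<Sum>i=1..T. \<psi> (z (c, i)) (X z l)) - real T * ?m z"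
      unfolding sum_fiber by (simp add: sum_subtractf)
    ultimately have "\<bar>(\<Sum>i=1..T. \<psi> (z (c, i)) (X z l)) - real T * ?m z\<bar> \<le> real T * t + 2 * R" using s by linarith
    then have "\<bar>(\<Sum>i=1..T. \<psi> (z (c, i)) (X z l)) - real T * ?m z\<bar> / real T \<le> (real T * t + 2 * R) / real T"
      by (intro divide_right_mono) auto
    also have "\<dots> = t + 2 * R / real T" using T by (simp add: add_divide_distrib)
    also have "\<dots> \<le> t + 2 * R / real N" using N R by (intro add_left_mono divide_left_mono) auto
    also have "\<bar>(\<Sum>i=1..T. \<psi> (z (c, i)) (X z l)) - real T * ?m z\<bar> / real T = \<bar>1 / real T * (\<Sum>i=1..T. \<psi> (z (c, i)) (X z l)) - ?m z\<bar>"
    proof -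
      have "1 / real T * (\<Sum>i=1..T. \<psi> (z (c, i)) (X z l)) - ?m z = ((\<Sum>i=1..T. \<psi> (z (c, i)) (X z l)) - real T * ?m z) / real T"
        using T by (simp add: diff_divide_distrib)
      then show ?thesis by (simp only: abs_divide abs_of_nat)
    qed
    finally show ?thesis .
  qed
  show ?thesis using 1 2 H(2) by (intro bexI[of _ E]) (auto simp: E_def)
qed

text \<open>A common bound for all summands to which Hoeffding's inequality is applied;
  \<open>A + 1\<close> in place of \<open>A\<close> makes it positive.\<close>

definition R\<psi> :: "nat => real" where
  "R\<psi> M = (A + 1) * (2 + C1) ^ M * (\<kappa> / h ^ d / c1 + 1) + \<kappa> / h ^ d"

text \<open>A union bound over the sets in \<open>SS\<close>, the \<open>n\<close> sample points and
  \<open>M + 2\<close> averages: one for each of the \<open>M\<close> iterates, one for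
  \<open>fX\<close> and one for \<open>fY\<close>.\<close>

definition PB :: "nat => nat => real => real" where
  "PB M N t = real (card SS) * (real M + 2) * real n * (2 * exp (- (real N * t\<^sup>2 / (2 * (R\<psi> M)\<^sup>2))))"

lemma kc_nonneg: "0 \<le> \<kappa> / h ^ d / c1" using kap_nonneg c1_pos by (rule divide_nonneg_pos)

lemma R\<psi>_pos: "0 < R\<psi> M"
proof -
  have h: "0 < A + 1" "0 < 2 + C1" "0 < \<kappa> / h ^ d / c1 + 1" using A_nonneg C1_pos kc_nonneg by linarith+
  show ?thesis unfolding R\<psi>_def
    by (rule add_pos_nonneg[OF mult_pos_pos[OF mult_pos_pos[OF h(1) zero_less_power[OF h(2)]] h(3)] kap_nonneg])
qed

lemma k_dev: "S \<in> SS ==> \<bar>k S x y\<bar> \<le> R\<psi> M"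
proof -
  assume S: "S \<in> SS"
  have "0 \<le> (A + 1) * (2 + C1) ^ M * (\<kappa> / h ^ d / c1 + 1)"
    using A_nonneg C1_pos kc_nonneg by (intro mult_nonneg_nonneg zero_le_power) linarith+
  then show ?thesis unfolding R\<psi>_def
    using k_nonneg[OF SS_sub[OF S], of y x] k_le[OF SS_sub[OF S], of y x] by linarith
qed

lemma T_dev:
  assumes S: "S \<in> SS" and m: "m \<le> M"
  shows "\<bar>\<Gamma>t m S x * (k S x y / fb S x - 1)\<bar> \<le> R\<psi> M"
proof -
  have C1: "1 \<le> 2 + C1" using C1_pos by simp
  have "\<bar>\<Gamma>t m S x\<bar> \<le> A * (2 + C1) ^ m" by (rule \<Gamma>t_le(2)[OF S])
  also have "\<dots> \<le> (A + 1) * (2 + C1) ^ M"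
    using A_nonneg C1 m by (intro mult_mono power_increasing) auto
  finally have g: "\<bar>\<Gamma>t m S x\<bar> \<le> (A + 1) * (2 + C1) ^ M" .
  have "\<bar>k S x y / fb S x - 1\<bar> \<le> \<kappa> / h ^ d / c1 + 1"
    using ratio_bound(1)[OF SS_sub[OF S], of y x] ratio_bound(3)[OF SS_sub[OF S], of y x] by linarith
  with g have "\<bar>\<Gamma>t m S x * (k S x y / fb S x - 1)\<bar> \<le> (A + 1) * (2 + C1) ^ M * (\<kappa> / h ^ d / c1 + 1)"
    unfolding abs_mult using A_nonneg C1_pos by (intro mult_mono) auto
  then show ?thesis using kap_nonneg unfolding R\<psi>_def by linarith
qed

text \<open>The three kinds of deviation under one index: the iterates for \<open>m < M\<close>,
  then \<open>fX\<close> at \<open>M\<close> and \<open>fY\<close> at \<open>M + 1\<close>.\<close>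

definition dev :: "nat => nat set => nat => nat => (nat set \<times> nat => point) => real" where
  "dev M S m l z = (if m < M then 1 / real n * (\<Sum>i=1..n. \<Gamma>t m S (X z i) * (k S (X z i) (X z l) / fb S (X z i) - 1)) - Tt S (\<Gamma>t m S) (X z l)
    else if m = M then fX z S (X z l) - ft S (X z l) else fY z S (X z l) - ft S (X z l))"

text \<open>Because deviations are only needed at sample points, a finite union suffices and no
  covering of the cube enters.\<close>

lemma bad_event:
  assumes N: "2 \<le> N" "N \<le> n" "\<And>S. S \<in> SS ==> N \<le> nS S" and t: "0 \<le> t"
  shows "\<exists>E\<in>sets I.\<Omega>. measure I.\<Omega> E \<le> PB M N t \<and>
    (\<forall>z\<in>space I.\<Omega>. z \<notin> E \<longrightarrow> (\<forall>S\<in>SS. \<forall>m<M + 2. \<forall>l\<in>{1..n}. \<bar>dev M S m l z\<bar> \<le> t + 2 * R\<psi> M / real N))"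
proof -
  interpret O: prob_space I.\<Omega> by (rule I.prob_\<Omega>)
  let ?p = "2 * exp (- (real N * t\<^sup>2 / (2 * (R\<psi> M)\<^sup>2)))" let ?\<tau> = "t + 2 * R\<psi> M / real N"
  let ?I = "SS \<times> {..<M + 2} \<times> {1..n}"
  have XJ: "{{1..d}} \<times> {1..n} \<subseteq> J" using X_in_J by auto
  have YJ: "{S} \<times> {1..nS S} \<subseteq> J" if "S \<in> SS" for S using Y_in_J[OF that] by auto
  have ft_eq: "(\<integral>x. k S x y \<partial>\<mu>) = ft S y" if S: "S \<in> SS" for S y
    unfolding ft_def by (simp only: k_sym[OF SS_sub[OF S], of _ y])
  have fX_eq: "1 / real n * (\<Sum>i=1..n. k S (X z i) y) = fX z S y"
    and fY_eq: "1 / real (nS S) * (\<Sum>i=1..nS S. k S (z (S, i)) y) = fY z S y" if S: "S \<in> SS" for S y z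
    unfolding fX_def fY_def by (simp_all only: k_sym[OF SS_sub[OF S], of _ y])
  have kj: "(\<lambda>p. k S (fst p) (snd p)) \<in> bor2 d" if "S \<in> SS" for S
    by (rule k_joint[OF SS_sub[OF that]])
  have "\<exists>E. E \<in> sets I.\<Omega> \<and> measure I.\<Omega> E \<le> ?p \<and> (\<forall>z\<in>space I.\<Omega>. z \<notin> E \<longrightarrow> \<bar>dev M S m l z\<bar> \<le> ?\<tau>)"
    if S: "S \<in> SS" and m: "m < M + 2" and l: "l \<in> {1..n}" for S m l
  proof -
    consider "m < M" | "m = M" | "m = M + 1" using m by linarith
    then show ?thesis
    proof cases
      case 1
      note Sd = SS_sub[OF S]
      note [measurable] = kj[OF S] \<Gamma>t_le(1)[OF S] fb_meas[OF Sd]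
      have jm: "(\<lambda>p. (\<lambda>x y. \<Gamma>t m S x * (k S x y / fb S x - 1)) (fst p) (snd p)) \<in> bor2 d"
        by measurable
      from avg_tail[OF XJ N(1,2) l jm T_dev[OF S] R\<psi>_pos t, of M] 1
      show ?thesis by (auto simp: dev_def Tt_def)
    next
      case 2
      from avg_tail[OF XJ N(1,2) l kj[OF S] k_dev[OF S] R\<psi>_pos t, of M] 2
      show ?thesis unfolding ft_eq[OF S] fX_eq[OF S] by (auto simp: dev_def)
    next
      case 3
      from avg_tail[OF YJ[OF S] N(1) N(3)[OF S] l kj[OF S] k_dev[OF S] R\<psi>_pos t, of M] 3
      show ?thesis unfolding ft_eq[OF S] fY_eq[OF S] by (auto simp: dev_def)
    qed
  qed
  then have "\<forall>p\<in>?I. \<exists>E. E \<in> sets I.\<Omega> \<and> measure I.\<Omega> E \<le> ?p \<and> (\<forall>z\<in>space I.\<Omega>. z \<notin> E \<longrightarrow> \<bar>dev M (fst p) (fst (snd p)) (snd (snd p)) z\<bar> \<le> ?\<tau>)"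
    by auto
  from bchoice[OF this] obtain E where
    E0: "\<forall>p\<in>?I. E p \<in> sets I.\<Omega> \<and> measure I.\<Omega> (E p) \<le> ?p \<and>
      (\<forall>z\<in>space I.\<Omega>. z \<notin> E p \<longrightarrow> \<bar>dev M (fst p) (fst (snd p)) (snd (snd p)) z\<bar> \<le> ?\<tau>)" ..
  have E: "E p \<in> sets I.\<Omega>" "measure I.\<Omega> (E p) \<le> ?p" if "p \<in> ?I" for p
    using bspec[OF E0 that] by simp_all
  have Ez: "\<bar>dev M (fst p) (fst (snd p)) (snd (snd p)) z\<bar> \<le> ?\<tau>" if "p \<in> ?I" "z \<in> space I.\<Omega>" "z \<notin> E p" for p z
    using bspec[OF E0 that(1)] that(2,3) by simp
  have fI: "finite ?I" using finite_SS by auto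
  have "measure I.\<Omega> (\<Union>p\<in>?I. E p) \<le> (\<Sum>p\<in>?I. measure I.\<Omega> (E p))"
    using fI E(1) by (intro O.finite_measure_subadditive_finite) auto
  also have "\<dots> \<le> real (card ?I) * ?p" by (intro sum_bounded_above E(2))
  also have "\<dots> = PB M N t" by (simp add: PB_def card_cartesian_product algebra_simps)
  finally have P: "measure I.\<Omega> (\<Union>p\<in>?I. E p) \<le> PB M N t" .
  have U: "(\<Union>p\<in>?I. E p) \<in> sets I.\<Omega>" by (rule sets.finite_UN[OF fI E(1)])
  show ?thesis
  proof (intro bexI[OF _ U] conjI P ballI impI allI)
    fix z S m l assume z: "z \<in> space I.\<Omega>" "z \<notin> (\<Union>p\<in>?I. E p)" and i: "S \<in> SS" "m < M + 2" "l \<in> {1..n}"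
    then have p: "(S, m, l) \<in> ?I" by simp
    then have "z \<notin> E (S, m, l)" using z(2) by blast
    from Ez[OF p z(1) this] show "\<bar>dev M S m l z\<bar> \<le> ?\<tau>" by simp
  qed
qed

text \<open>A bound for \<open>est - \<theta> - lin\<close> valid for every sample. In
  \<open>4 * A\<close>, one \<open>A\<close> comes from the estimator, one from
  \<open>\<theta>\<close> and two from \<open>lin\<close>.\<close>

definition Cr :: "nat => nat => real" where
  "Cr M Nm = 4 * A + real M * (A * (real (card SS) * real (n + Nm + 1)) ^ M) + 2 * (real (card SS) * (A * (2 + C1) ^ M * C1))"

text \<open>The three sources of error: index coincidences together with the replacement of
  empirical factors, the degenerate part, and the exceptional event with the crude bound.\<close>

definition EB :: "nat => nat => nat => real => real" where
  "EB M N Nm t = 2 * (UV n M b0 + HE M (t + 2 * R\<psi> M / real N))\<^sup>2 +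
    30 * (real (card SS))\<^sup>2 * (Q M)\<^sup>2 / (real n * real N) + (Cr M Nm)\<^sup>2 * PB M N t"

lemma lin_meas: "lin M \<in> borel_measurable I.\<Omega>"
proof -
  have "lin_coef M p \<in> borel_measurable \<mu>" if "p \<in> J" for p
  proof -
    have "lin_coef M p \<in> bor d"
    proof (cases "fst p = {1..d}")
      case True
      then have e: "lin_coef M p = (\<lambda>x. 1 / real n * (a x - \<theta> - (\<Sum>S\<in>SS. \<alpha>t M S x)))" by (simp add: lin_coef_def fun_eq_iff)
      show ?thesis unfolding e by (intro borel_measurable_times borel_measurable_diff borel_measurable_const borel_measurable_sum a_meas \<alpha>t_props(1))
    next
      case False
      then have S: "fst p \<in> SS" using that by (auto simp: J_def)
      have e: "lin_coef M p = (\<lambda>x. 1 / real (nS (fst p)) * \<alpha>t M (fst p) x)" using False by (simp add: lin_coef_def fun_eq_iff)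
      show ?thesis unfolding e by (intro borel_measurable_times borel_measurable_const \<alpha>t_props(1)[OF S])
    qed
    then show ?thesis unfolding measurable_cong_sets[OF sets_law refl] .
  qed
  then show ?thesis unfolding lin_def[abs_def]
    by (intro borel_measurable_sum measurable_compose[OF I.component_measurable])
qed

lemma lin_le: "\<bar>lin M z\<bar> \<le> 2 * A + 2 * (real (card SS) * (A * (2 + C1) ^ M * C1))"
proof -
  let ?G = "A * (2 + C1) ^ M * C1"
  have 1: "\<bar>1 / real n * (\<Sum>i=1..n. a (X z i))\<bar> \<le> A" by (rule sum_avg_le[OF n_pos a_le])
  have 2: "\<bar>\<Sum>S\<in>SS. 1 / real n * (\<Sum>i=1..n. \<alpha>t M S (X z i))\<bar> \<le> real (card SS) * ?G"
    by (intro order_trans[OF sum_abs] sum_bounded_above sum_avg_le n_pos \<alpha>t_props(2))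
  have 3: "\<bar>\<Sum>S\<in>SS. 1 / real (nS S) * (\<Sum>l=1..nS S. \<alpha>t M S (z (S, l)))\<bar> \<le> real (card SS) * ?G"
    by (intro order_trans[OF sum_abs] sum_bounded_above sum_avg_le nS_pos \<alpha>t_props(2))
  show ?thesis unfolding lin_alt using 1 2 3 \<theta>_le by linarith
qed

text \<open>Off the exceptional event, \<open>est - \<theta> - lin\<close> is
  \<open>est - MV\<close> minus the degenerate part. The latter is bounded in mean square over the
  whole space, so no conditioning on the event is necessary.\<close>

lemma risk_error:
  assumes N: "2 \<le> N" "N \<le> n" "\<And>S. S \<in> SS ==> N \<le> nS S" and Nm: "\<And>S. S \<in> SS ==> nS S \<le> Nm"
    and M: "M + 1 \<le> n" and t: "0 \<le> t"
    and \<tau>: "t + 2 * R\<psi> M / real N \<le> c1 / 2" "t + 2 * R\<psi> M / real N \<le> 1"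
  shows "(\<integral>z. (est M z - \<theta> - lin M z)\<^sup>2 \<partial>I.\<Omega>) \<le> EB M N Nm t"
    and "integrable I.\<Omega> (\<lambda>z. (est M z - \<theta> - lin M z)\<^sup>2)"
    and "integrable I.\<Omega> (\<lambda>z. (est M z - \<theta>)\<^sup>2)"
    and "integrable I.\<Omega> (\<lambda>z. (lin M z)\<^sup>2)"
proof -
  interpret O: prob_space I.\<Omega> by (rule I.prob_\<Omega>)
  let ?\<tau> = "t + 2 * R\<psi> M / real N" let ?r = "\<lambda>z. est M z - \<theta> - lin M z" let ?e = "UV n M b0 + HE M ?\<tau>"
  note ec = est_crude[OF M Nm]
  have \<tau>0: "0 \<le> ?\<tau>" using t R\<psi>_pos[of M] by simp
  have rb: "\<bar>?r z\<bar> \<le> Cr M Nm" for z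
    using ec[of z] \<theta>_le lin_le[of M z] unfolding Cr_def by linarith
  have etb: "\<bar>est M z - \<theta>\<bar> \<le> 2 * A + real M * (A * (real (card SS) * real (n + Nm + 1)) ^ M)" for z
    using ec[of z] \<theta>_le by linarith
  have sqi: "integrable I.\<Omega> (\<lambda>z. (F z)\<^sup>2)" if "F \<in> borel_measurable I.\<Omega>" "\<And>z. \<bar>F z\<bar> \<le> B" for F :: "_ => real" and B
  proof (rule I.integrable_bounded)
    show "(\<lambda>z. (F z)\<^sup>2) \<in> borel_measurable I.\<Omega>" by (rule borel_measurable_power[OF that(1)])
    show "\<bar>(F z)\<^sup>2\<bar> \<le> B\<^sup>2" for z using power_mono[OF that(2)[of z] abs_ge_zero, of 2] by simp
  qed
  show ri: "integrable I.\<Omega> (\<lambda>z. (?r z)\<^sup>2)"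
    by (rule sqi[OF _ rb]) (intro borel_measurable_diff borel_measurable_const est_meas lin_meas)
  show "integrable I.\<Omega> (\<lambda>z. (est M z - \<theta>)\<^sup>2)"
    by (rule sqi[OF _ etb]) (intro borel_measurable_diff borel_measurable_const est_meas)
  show "integrable I.\<Omega> (\<lambda>z. (lin M z)\<^sup>2)" by (rule sqi[OF lin_meas lin_le])
  obtain E where E0: "E \<in> sets I.\<Omega> \<and> measure I.\<Omega> E \<le> PB M N t \<and>
    (\<forall>z\<in>space I.\<Omega>. z \<notin> E \<longrightarrow> (\<forall>S\<in>SS. \<forall>m<M + 2. \<forall>l\<in>{1..n}. \<bar>dev M S m l z\<bar> \<le> ?\<tau>))"
    using bad_event[OF N t, of M] unfolding Bex_def ..
  then have E: "E \<in> sets I.\<Omega>" "measure I.\<Omega> E \<le> PB M N t" by simp_all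
  have dev: "\<bar>dev M S m l z\<bar> \<le> ?\<tau>" if "z \<in> space I.\<Omega>" "z \<notin> E" "S \<in> SS" "m < M + 2" "l \<in> {1..n}" for z S m l
    using E0 that by simp
  have "AE z in I.\<Omega>. \<forall>i\<in>{1..n}. X z i \<in> unit_cube d"
    by (rule AE_finite_allI) (auto intro!: I.AE_component[OF X_in_J AE_cube] simp del: One_nat_def)
  then have pt: "AE z in I.\<Omega>. (?r z)\<^sup>2 \<le> 2 * ?e\<^sup>2 + 2 * (DD M z)\<^sup>2 + (Cr M Nm)\<^sup>2 * indicator E z"
    using AE_space
  proof eventually_elim
    case (elim z)
    show ?case
    proof (cases "z \<in> E")
      case True
      have "(?r z)\<^sup>2 \<le> (Cr M Nm)\<^sup>2" using power_mono[OF rb[of z] abs_ge_zero, of 2] by (simp only: power2_abs)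
      moreover have "0 \<le> 2 * ?e\<^sup>2 + 2 * (DD M z)\<^sup>2" by simp
      ultimately have "(?r z)\<^sup>2 \<le> 2 * ?e\<^sup>2 + 2 * (DD M z)\<^sup>2 + (Cr M Nm)\<^sup>2" by linarith
      then show ?thesis using True by simp
    next
      case False
      note D = dev[OF elim(2) False]
      have "\<bar>est M z - MV M z\<bar> \<le> ?e"
      proof (rule est_minus_MV[OF \<tau>0 \<tau> M])
        show "X z i \<in> unit_cube d" if "i \<in> {1..n}" for i using elim(1) that by blast
        show "\<bar>fX z S (X z l) - ft S (X z l)\<bar> \<le> ?\<tau>" if "S \<in> SS" "l \<in> {1..n}" for S l
          using D[OF that(1) _ that(2), of M] by (simp add: dev_def)
        show "\<bar>fY z S (X z l) - ft S (X z l)\<bar> \<le> ?\<tau>" if "S \<in> SS" "l \<in> {1..n}" for S l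
          using D[OF that(1) _ that(2), of "M + 1"] by (simp add: dev_def)
        show "\<bar>1 / real n * (\<Sum>i=1..n. \<Gamma>t m S (X z i) * (k S (X z i) (X z l) / fb S (X z i) - 1)) - Tt S (\<Gamma>t m S) (X z l)\<bar> \<le> ?\<tau>"
          if "S \<in> SS" "m < M" "l \<in> {1..n}" for S m l
          using D[OF that(1) _ that(3), of m] that(2) unfolding dev_def by simp
      qed
      then have "(est M z - MV M z)\<^sup>2 \<le> ?e\<^sup>2" using power_mono[of "\<bar>est M z - MV M z\<bar>" ?e 2] by simp
      moreover have r: "?r z = (est M z - MV M z) + (- DD M z)" using MV_decomposition[of M z] by (simp add: DD_def)
      have "(?r z)\<^sup>2 \<le> 2 * (est M z - MV M z)\<^sup>2 + 2 * (DD M z)\<^sup>2"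
        unfolding r using young_square[of 1 "est M z - MV M z" "- DD M z"] by simp
      ultimately have "(?r z)\<^sup>2 \<le> 2 * ?e\<^sup>2 + 2 * (DD M z)\<^sup>2" by linarith
      then show ?thesis using False by simp
    qed
  qed
  note DDm = DD_second_moment(1,2)[OF _ N(2,3), of M]
  have N0: "0 < N" using N(1) by simp
  have Ei: "integrable I.\<Omega> (\<lambda>z. (Cr M Nm)\<^sup>2 * indicator E z)"
    using E(1) by (intro integrable_mult_right integrable_real_indicator) (simp_all add: O.emeasure_eq_measure)
  have Di: "integrable I.\<Omega> (\<lambda>z. 2 * ?e\<^sup>2 + 2 * (DD M z)\<^sup>2)" using DDm(2)[OF N0] by simp
  have "(\<integral>z. (?r z)\<^sup>2 \<partial>I.\<Omega>) \<le> (\<integral>z. 2 * ?e\<^sup>2 + 2 * (DD M z)\<^sup>2 + (Cr M Nm)\<^sup>2 * indicator E z \<partial>I.\<Omega>)"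
    by (rule integral_mono_AE[OF ri Bochner_Integration.integrable_add[OF Di Ei] pt])
  also have "\<dots> = (\<integral>z. 2 * ?e\<^sup>2 + 2 * (DD M z)\<^sup>2 \<partial>I.\<Omega>) + (\<integral>z. (Cr M Nm)\<^sup>2 * indicator E z \<partial>I.\<Omega>)"
    by (rule Bochner_Integration.integral_add[OF Di Ei])
  also have "(\<integral>z. (Cr M Nm)\<^sup>2 * indicator E z \<partial>I.\<Omega>) = (Cr M Nm)\<^sup>2 * measure I.\<Omega> E"
    unfolding integral_mult_right_zero using E(1) by simp
  also have "(\<integral>z. 2 * ?e\<^sup>2 + 2 * (DD M z)\<^sup>2 \<partial>I.\<Omega>) = 2 * ?e\<^sup>2 + 2 * (\<integral>z. (DD M z)\<^sup>2 \<partial>I.\<Omega>)"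
    using DDm(2)[OF N0] by (simp add: O.prob_space)
  also have "2 * ?e\<^sup>2 + 2 * (\<integral>z. (DD M z)\<^sup>2 \<partial>I.\<Omega>) + (Cr M Nm)\<^sup>2 * measure I.\<Omega> E \<le>
    2 * ?e\<^sup>2 + 2 * (15 * (real (card SS))\<^sup>2 * (Q M)\<^sup>2 / (real n * real N)) + (Cr M Nm)\<^sup>2 * PB M N t"
    using DDm(1)[OF N0] E(2) by (intro add_mono mult_left_mono) auto
  finally show "(\<integral>z. (?r z)\<^sup>2 \<partial>I.\<Omega>) \<le> EB M N Nm t" by (simp add: EB_def)
qed

text \<open>Young's inequality in both directions: the risk and the variance of \<open>lin\<close>
  bound one another up to \<open>1 + \<epsilon>\<close> and the remainder. The second direction is
  needed for the lower bound in the limit.\<close>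

lemma risk_sandwich:
  assumes N: "2 \<le> N" "N \<le> n" "\<And>S. S \<in> SS ==> N \<le> nS S" and Nm: "\<And>S. S \<in> SS ==> nS S \<le> Nm"
    and M: "M + 1 \<le> n" and t: "0 \<le> t"
    and \<tau>: "t + 2 * R\<psi> M / real N \<le> c1 / 2" "t + 2 * R\<psi> M / real N \<le> 1" and \<epsilon>: "0 < \<epsilon>"
  shows "real n * (\<integral>z. (est M z - \<theta>)\<^sup>2 \<partial>I.\<Omega>) \<le>
      (1 + \<epsilon>) * Lob SS (\<lambda>S. real (nS S) / real n) (\<lambda>x. a x - \<theta>) (\<alpha>t M) + (1 + 1 / \<epsilon>) * (real n * EB M N Nm t)"
    and "Lob SS (\<lambda>S. real (nS S) / real n) (\<lambda>x. a x - \<theta>) (\<alpha>t M) \<le>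
      (1 + \<epsilon>) * (real n * (\<integral>z. (est M z - \<theta>)\<^sup>2 \<partial>I.\<Omega>)) + (1 + 1 / \<epsilon>) * (real n * EB M N Nm t)"
proof -
  note R = risk_error[OF N Nm M t \<tau>]
  let ?E = "\<lambda>z. est M z - \<theta>"
  have "(\<integral>z. (?E z)\<^sup>2 \<partial>I.\<Omega>) \<le> (\<integral>z. (1 + \<epsilon>) * (lin M z)\<^sup>2 + (1 + 1 / \<epsilon>) * (?E z - lin M z)\<^sup>2 \<partial>I.\<Omega>)"
  proof (rule integral_mono)
    show "(?E z)\<^sup>2 \<le> (1 + \<epsilon>) * (lin M z)\<^sup>2 + (1 + 1 / \<epsilon>) * (?E z - lin M z)\<^sup>2" for z
      using young_square[OF \<epsilon>, of "lin M z" "?E z - lin M z"] by simp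
  qed (use R(2-4) in auto)
  also have "\<dots> = (1 + \<epsilon>) * (\<integral>z. (lin M z)\<^sup>2 \<partial>I.\<Omega>) + (1 + 1 / \<epsilon>) * (\<integral>z. (?E z - lin M z)\<^sup>2 \<partial>I.\<Omega>)"
    using R(2-4) by simp
  also have "\<dots> \<le> (1 + \<epsilon>) * (\<integral>z. (lin M z)\<^sup>2 \<partial>I.\<Omega>) + (1 + 1 / \<epsilon>) * EB M N Nm t"
    using R(1) \<epsilon> by (intro add_left_mono mult_left_mono) auto
  finally have 1: "(\<integral>z. (?E z)\<^sup>2 \<partial>I.\<Omega>) \<le> (1 + \<epsilon>) * (\<integral>z. (lin M z)\<^sup>2 \<partial>I.\<Omega>) + (1 + 1 / \<epsilon>) * EB M N Nm t" .
  have "(\<integral>z. (lin M z)\<^sup>2 \<partial>I.\<Omega>) \<le> (\<integral>z. (1 + \<epsilon>) * (?E z)\<^sup>2 + (1 + 1 / \<epsilon>) * (?E z - lin M z)\<^sup>2 \<partial>I.\<Omega>)"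
  proof (rule integral_mono)
    show "(lin M z)\<^sup>2 \<le> (1 + \<epsilon>) * (?E z)\<^sup>2 + (1 + 1 / \<epsilon>) * (?E z - lin M z)\<^sup>2" for z
      using young_square[OF \<epsilon>, of "?E z" "lin M z - ?E z"] power2_commute[of "lin M z" "?E z"] by simp
  qed (use R(2-4) in auto)
  also have "\<dots> = (1 + \<epsilon>) * (\<integral>z. (?E z)\<^sup>2 \<partial>I.\<Omega>) + (1 + 1 / \<epsilon>) * (\<integral>z. (?E z - lin M z)\<^sup>2 \<partial>I.\<Omega>)"
    using R(2-4) by simp
  also have "\<dots> \<le> (1 + \<epsilon>) * (\<integral>z. (?E z)\<^sup>2 \<partial>I.\<Omega>) + (1 + 1 / \<epsilon>) * EB M N Nm t"
    using R(1) \<epsilon> by (intro add_left_mono mult_left_mono) auto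
  finally have 2: "(\<integral>z. (lin M z)\<^sup>2 \<partial>I.\<Omega>) \<le> (1 + \<epsilon>) * (\<integral>z. (?E z)\<^sup>2 \<partial>I.\<Omega>) + (1 + 1 / \<epsilon>) * EB M N Nm t" .
  have e: "real n * (x * p + y * q) = x * (real n * p) + y * (real n * q)" for x y p q by (simp add: algebra_simps)
  show "real n * (\<integral>z. (?E z)\<^sup>2 \<partial>I.\<Omega>) \<le>
      (1 + \<epsilon>) * Lob SS (\<lambda>S. real (nS S) / real n) (\<lambda>x. a x - \<theta>) (\<alpha>t M) + (1 + 1 / \<epsilon>) * (real n * EB M N Nm t)"
    using mult_left_mono[OF 1, of "real n"] unfolding e second_moment_lin by simp
  show "Lob SS (\<lambda>S. real (nS S) / real n) (\<lambda>x. a x - \<theta>) (\<alpha>t M) \<le>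
      (1 + \<epsilon>) * (real n * (\<integral>z. (?E z)\<^sup>2 \<partial>I.\<Omega>)) + (1 + 1 / \<epsilon>) * (real n * EB M N Nm t)"
    using mult_left_mono[OF 2, of "real n"] unfolding e second_moment_lin by simp
qed

end

section \<open>The law of the sample\<close>

lemma distr_PiM_map:
  assumes fin: "finite I" and M: "prob_space M" and g: "\<And>i. g i \<in> M \<rightarrow>\<^sub>M N i"
  shows "distr (Pi\<^sub>M I (\<lambda>_. M)) (Pi\<^sub>M I N) (\<lambda>z. \<lambda>i\<in>I. g i (z i)) = Pi\<^sub>M I (\<lambda>i. distr M (N i) (g i))"
proof -
  interpret M: prob_space M by (rule M)
  interpret P: product_prob_space "\<lambda>_. M" I by unfold_locales
  have pd: "prob_space (distr M (N i) (g i))" for i by (rule M.prob_space_distr[OF g])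
  interpret Q: product_prob_space "\<lambda>i. distr M (N i) (g i)" I
    by (intro product_prob_spaceI pd)
  have tm: "(\<lambda>z. \<lambda>i\<in>I. g i (z i)) \<in> Pi\<^sub>M I (\<lambda>_. M) \<rightarrow>\<^sub>M Pi\<^sub>M I N"
  proof (rule measurable_restrict)
    fix i assume "i \<in> I"
    from measurable_component_singleton[OF this, of "\<lambda>_. M"]
    show "(\<lambda>z. g i (z i)) \<in> Pi\<^sub>M I (\<lambda>_. M) \<rightarrow>\<^sub>M N i" by (rule measurable_compose[OF _ g])
  qed
  show ?thesis
  proof (rule Q.PiM_eqI[OF fin])
    show "sets (distr (Pi\<^sub>M I (\<lambda>_. M)) (Pi\<^sub>M I N) (\<lambda>z. \<lambda>i\<in>I. g i (z i))) = sets (Pi\<^sub>M I (\<lambda>i. distr M (N i) (g i)))"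
      unfolding sets_distr by (intro sets_PiM_cong refl) simp
    fix A assume "\<And>i. i \<in> I ==> A i \<in> sets (distr M (N i) (g i))"
    then have A: "A i \<in> sets (N i)" if "i \<in> I" for i using that by simp
    have "emeasure (distr (Pi\<^sub>M I (\<lambda>_. M)) (Pi\<^sub>M I N) (\<lambda>z. \<lambda>i\<in>I. g i (z i))) (Pi\<^sub>E I A) =
      emeasure (Pi\<^sub>M I (\<lambda>_. M)) ((\<lambda>z. \<lambda>i\<in>I. g i (z i)) -` Pi\<^sub>E I A \<inter> space (Pi\<^sub>M I (\<lambda>_. M)))"
      using A fin by (intro emeasure_distr tm sets_PiM_I_finite)
    also have "(\<lambda>z. \<lambda>i\<in>I. g i (z i)) -` Pi\<^sub>E I A \<inter> space (Pi\<^sub>M I (\<lambda>_. M)) = Pi\<^sub>E I (\<lambda>i. g i -` A i \<inter> space M)"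
      by (auto simp: space_PiM PiE_def Pi_def)
    also have "emeasure (Pi\<^sub>M I (\<lambda>_. M)) \<dots> = (\<Prod>i\<in>I. emeasure M (g i -` A i \<inter> space M))"
      using fin by (intro P.emeasure_PiM measurable_sets[OF g A]) auto
    also have "\<dots> = (\<Prod>i\<in>I. emeasure (distr M (N i) (g i)) (A i))"
      by (intro prod.cong refl emeasure_distr[symmetric] g A)
    finally show "emeasure (distr (Pi\<^sub>M I (\<lambda>_. M)) (Pi\<^sub>M I N) (\<lambda>z. \<lambda>i\<in>I. g i (z i))) (Pi\<^sub>E I A) =
      (\<Prod>i\<in>I. emeasure (distr M (N i) (g i)) (A i))" .
  qed
qed

context dens begin

text \<open>Identifies an incomplete observation with the projection of a complete one, which
  justifies the single i.i.d. family indexed by \<open>J\<close>.\<close>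

lemma marginal_law_eq:
  assumes S: "S \<subseteq> {1..d}"
  shows "marginal_law d f S = distr \<mu> (leb S) (\<lambda>x. restrict x S)"
proof (rule measure_eqI)
  have r: "(\<lambda>x. restrict x S) \<in> leb {1..d} \<rightarrow>\<^sub>M leb S" by (rule restrict_measurable_leb[OF S])
  then have r': "(\<lambda>x. restrict x S) \<in> \<mu> \<rightarrow>\<^sub>M leb S" unfolding measurable_cong_sets[OF sets_law refl] .
  show "sets (marginal_law d f S) = sets (distr \<mu> (leb S) (\<lambda>x. restrict x S))" by (simp add: marginal_law_def)
  fix B assume "B \<in> sets (marginal_law d f S)"
  then have B: "B \<in> sets (leb S)" by (simp add: marginal_law_def)
  let ?T = "{1..d} - S"
  have m: "(\<lambda>x. indicator B (restrict x S) :: ennreal) \<in> bor d"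
    by (rule measurable_compose[OF r borel_measurable_indicator[OF B]])
  have "emeasure (distr \<mu> (leb S) (\<lambda>x. restrict x S)) B = (\<integral>\<^sup>+y. indicator B y \<partial>distr \<mu> (leb S) (\<lambda>x. restrict x S))"
    using B by simp
  also have "\<dots> = (\<integral>\<^sup>+x. indicator B (restrict x S) \<partial>\<mu>)"
    by (rule nn_integral_distr[OF r']) (use B in simp)
  also have "\<dots> = (\<integral>\<^sup>+x. ennreal (f x) * indicator B (restrict x S) \<partial>leb {1..d})" by (rule nn_integral_law[OF m])
  also have "\<dots> = (\<integral>\<^sup>+y. (\<integral>\<^sup>+u. ennreal (f (merge S ?T (y, u))) * indicator B (restrict (merge S ?T (y, u)) S) \<partial>leb ?T) \<partial>leb S)"
    by (rule leb_fold[OF S]) (intro borel_measurable_times_ennreal m measurable_compose[OF f_meas measurable_ennreal])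
  also have "\<dots> = (\<integral>\<^sup>+y. ennreal (marginal d S f y) * indicator B y \<partial>leb S)"
  proof (rule nn_integral_cong)
    fix y assume y: "y \<in> space (leb S)"
    have i: "integrable (leb ?T) (\<lambda>u. f (merge S ?T (y, u)))"
    proof (rule section_integrable_cube(1)[OF S f_meas _ _ y])
      show "\<bar>f x\<bar> \<le> C0" if "x \<in> unit_cube d" for x
        using f_ge[OF that] f_le[OF that] c0_pos by linarith
      show "f x = 0" if "x \<in> euclid d - unit_cube d" for x by (rule f_out[OF that])
    qed
    have "(\<integral>\<^sup>+u. ennreal (f (merge S ?T (y, u))) \<partial>leb ?T) = ennreal (marginal d S f y)"
      unfolding marginal_def by (rule nn_integral_eq_integral[OF i]) (intro AE_I2 f_nonneg merge_in_euclid[OF S])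
    moreover have "(\<integral>\<^sup>+u. ennreal (f (merge S ?T (y, u))) * indicator B y \<partial>leb ?T) =
      (\<integral>\<^sup>+u. ennreal (f (merge S ?T (y, u))) \<partial>leb ?T) * indicator B y"
      by (rule nn_integral_multc) (intro measurable_compose[OF section_measurable[OF S f_meas y] measurable_ennreal])
    ultimately show "(\<integral>\<^sup>+u. ennreal (f (merge S ?T (y, u))) * indicator B (restrict (merge S ?T (y, u)) S) \<partial>leb ?T) =
      ennreal (marginal d S f y) * indicator B y"
      using restrict_merge_left[OF y] by (simp only:)
  qed
  also have "\<dots> = emeasure (marginal_law d f S) B"
    unfolding marginal_law_def
    by (rule emeasure_density[OF measurable_compose[OF marginal_measurable[OF S f_meas] measurable_ennreal] B, symmetric])
  finally show "emeasure (marginal_law d f S) B = emeasure (distr \<mu> (leb S) (\<lambda>x. restrict x S)) B" ..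
qed

text \<open>The law of the data is the image of the i.i.d. family under restriction of the
  incomplete observations; the product of the two groups is then merged into one product over the
  disjoint union of their index sets.\<close>

lemma nn_integral_sample_law:
  fixes SS :: "nat set set" and n :: nat and nS :: "nat set => nat" and F :: "sample => ennreal"
  defines "J2 \<equiv> (SIGMA S:SS. {1..nS S})"
  assumes SS: "SS \<subseteq> Pow {1..d}" "{1..d} \<notin> SS" and F: "F \<in> borel_measurable (sample_law d f SS n nS)"
  shows "(\<integral>\<^sup>+\<omega>. F \<omega> \<partial>sample_law d f SS n nS) =
    (\<integral>\<^sup>+z. F (\<lambda>i\<in>{1..n}. z ({1..d}, i), \<lambda>p\<in>J2. restrict (z p) (fst p)) \<partial>Pi\<^sub>M ({{1..d}} \<times> {1..n} \<union> J2) (\<lambda>_. \<mu>))"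
proof -
  let ?J1 = "{{1..d}} \<times> {1..n}"
  let ?T1 = "\<lambda>z. \<lambda>i\<in>{1..n}. z ({1..d}, i)" and ?T2 = "\<lambda>z. \<lambda>p\<in>J2. restrict (z p) (fst p)"
  have finSS: "finite SS" using SS(1) by (rule finite_subset) simp
  have fin: "finite ?J1" "finite J2" using finSS by (auto simp: J2_def)
  have dis: "?J1 \<inter> J2 = {}" using SS by (auto simp: J2_def)
  interpret P: product_prob_space "\<lambda>_::nat set \<times> nat. \<mu>" UNIV by unfold_locales
  have P1: "distr (Pi\<^sub>M ?J1 (\<lambda>_. \<mu>)) (Pi\<^sub>M {1..n} (\<lambda>_. \<mu>)) ?T1 = Pi\<^sub>M {1..n} (\<lambda>_. \<mu>)"
    by (rule distr_PiM_reindex[of ?J1 "\<lambda>_. \<mu>" "\<lambda>i. ({1..d}, i)"]) (auto simp: inj_on_def prob_space_axioms)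
  \<comment> \<open>\<open>distr_PiM_map\<close> asks for measurability at every index. Intersecting
    with \<open>{1..d}\<close> achieves this and changes nothing on \<open>J2\<close>.\<close>
  let ?g = "\<lambda>p x. restrict x (fst p \<inter> {1..d}) :: point"
  let ?N = "\<lambda>p :: nat set \<times> nat. leb (fst p \<inter> {1..d})"
  have g: "?g p \<in> \<mu> \<rightarrow>\<^sub>M ?N p" for p :: "nat set \<times> nat"
    using restrict_measurable_leb[of "fst p \<inter> {1..d}" d] unfolding measurable_cong_sets[OF sets_law refl] by simp
  have J2d: "fst p \<inter> {1..d} = fst p" if "p \<in> J2" for p
  proof -
    have "fst p \<in> SS" using that by (auto simp: J2_def)
    then have "fst p \<subseteq> {1..d}" using SS(1) by blast
    then show ?thesis by (rule Int_absorb2)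
  qed
  have P2: "distr (Pi\<^sub>M J2 (\<lambda>_. \<mu>)) (Pi\<^sub>M J2 ?N) ?T2 = Pi\<^sub>M J2 (\<lambda>(S, i). marginal_law d f S)"
  proof -
    have "?T2 = (\<lambda>z. \<lambda>p\<in>J2. ?g p (z p))" by (rule ext, rule restrict_ext) (simp only: J2d)
    then have "distr (Pi\<^sub>M J2 (\<lambda>_. \<mu>)) (Pi\<^sub>M J2 ?N) ?T2 = Pi\<^sub>M J2 (\<lambda>p. distr \<mu> (?N p) (?g p))"
      using distr_PiM_map[OF fin(2) prob_space_axioms g] by simp
    also have "\<dots> = Pi\<^sub>M J2 (\<lambda>(S, i). marginal_law d f S)"
    proof (rule PiM_cong[OF refl])
      fix p assume p: "p \<in> J2"
      then have "fst p \<subseteq> {1..d}" using J2d by blast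
      then show "distr \<mu> (?N p) (?g p) = (case p of (S, i) => marginal_law d f S)"
        using marginal_law_eq[of "fst p"] J2d[OF p] by (simp add: case_prod_unfold)
    qed
    finally show ?thesis .
  qed
  have m1: "?T1 \<in> Pi\<^sub>M I (\<lambda>_. \<mu>) \<rightarrow>\<^sub>M Pi\<^sub>M {1..n} (\<lambda>_. \<mu>)" if "?J1 \<subseteq> I" for I
    using that by (intro measurable_restrict measurable_component_singleton) auto
  have m2: "?T2 \<in> Pi\<^sub>M I (\<lambda>_. \<mu>) \<rightarrow>\<^sub>M Pi\<^sub>M J2 ?N" if "J2 \<subseteq> I" for I
  proof (rule measurable_restrict)
    fix p assume p: "p \<in> J2"
    have "(\<lambda>z. z p) \<in> Pi\<^sub>M I (\<lambda>_. \<mu>) \<rightarrow>\<^sub>M \<mu>" using p that by (intro measurable_component_singleton) auto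
    then have "(\<lambda>z. ?g p (z p)) \<in> Pi\<^sub>M I (\<lambda>_. \<mu>) \<rightarrow>\<^sub>M ?N p" by (rule measurable_compose[OF _ g])
    then show "(\<lambda>z. restrict (z p) (fst p)) \<in> Pi\<^sub>M I (\<lambda>_. \<mu>) \<rightarrow>\<^sub>M ?N p" by (simp only: J2d[OF p])
  qed
  have sf: "sigma_finite_measure (Pi\<^sub>M J2 (\<lambda>(S, i). marginal_law d f S))"
  proof -
    have "prob_space (distr (Pi\<^sub>M J2 (\<lambda>_. \<mu>)) (Pi\<^sub>M J2 ?N) ?T2)"
      by (intro prob_space.prob_space_distr prob_space_PiM prob_space_axioms m2 subset_refl)
    then interpret Q: prob_space "Pi\<^sub>M J2 (\<lambda>(S, i). marginal_law d f S)" unfolding P2 .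
    show ?thesis by unfold_locales
  qed
  have law: "sample_law d f SS n nS = distr (Pi\<^sub>M ?J1 (\<lambda>_. \<mu>) \<Otimes>\<^sub>M Pi\<^sub>M J2 (\<lambda>_. \<mu>))
      (Pi\<^sub>M {1..n} (\<lambda>_. \<mu>) \<Otimes>\<^sub>M Pi\<^sub>M J2 ?N) (\<lambda>(x, y). (?T1 x, ?T2 y))"
  proof -
    have "sigma_finite_measure (distr (Pi\<^sub>M J2 (\<lambda>_. \<mu>)) (Pi\<^sub>M J2 ?N) ?T2)" unfolding P2 by (rule sf)
    from pair_measure_distr[OF m1[OF subset_refl] m2[OF subset_refl] this]
    show ?thesis unfolding P1 P2 unfolding sample_law_def J2_def .
  qed
  have F': "F \<in> borel_measurable (Pi\<^sub>M {1..n} (\<lambda>_. \<mu>) \<Otimes>\<^sub>M Pi\<^sub>M J2 ?N)" using F unfolding law by simp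
  have TT: "(\<lambda>(x, y). (?T1 x, ?T2 y)) \<in> Pi\<^sub>M ?J1 (\<lambda>_. \<mu>) \<Otimes>\<^sub>M Pi\<^sub>M J2 (\<lambda>_. \<mu>) \<rightarrow>\<^sub>M Pi\<^sub>M {1..n} (\<lambda>_. \<mu>) \<Otimes>\<^sub>M Pi\<^sub>M J2 ?N"
    unfolding case_prod_unfold
    by (intro measurable_Pair measurable_compose[OF measurable_fst m1] measurable_compose[OF measurable_snd m2] subset_refl)
  have G: "(\<lambda>z. F (?T1 z, ?T2 z)) \<in> borel_measurable (Pi\<^sub>M (?J1 \<union> J2) (\<lambda>_. \<mu>))"
    by (rule measurable_compose[OF measurable_Pair[OF m1 m2] F']) auto
  have "(\<integral>\<^sup>+\<omega>. F \<omega> \<partial>sample_law d f SS n nS) = (\<integral>\<^sup>+p. F (case p of (x, y) => (?T1 x, ?T2 y)) \<partial>(Pi\<^sub>M ?J1 (\<lambda>_. \<mu>) \<Otimes>\<^sub>M Pi\<^sub>M J2 (\<lambda>_. \<mu>)))"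
    unfolding law by (rule nn_integral_distr[OF TT]) (use F' in simp)
  also have "\<dots> = (\<integral>\<^sup>+p. F (?T1 (merge ?J1 J2 p), ?T2 (merge ?J1 J2 p)) \<partial>(Pi\<^sub>M ?J1 (\<lambda>_. \<mu>) \<Otimes>\<^sub>M Pi\<^sub>M J2 (\<lambda>_. \<mu>)))"
  proof (intro nn_integral_cong arg_cong[of _ _ F])
    fix p :: "(nat set \<times> nat => point) \<times> (nat set \<times> nat => point)"
    have "({1..d}, i) \<notin> J2" for i using SS(2) by (auto simp: J2_def)
    then have "?T1 (merge ?J1 J2 p) = ?T1 (fst p)" by (cases p) (auto simp: fun_eq_iff merge_def)
    moreover have "?T2 (merge ?J1 J2 p) = ?T2 (snd p)"
    proof (rule restrict_ext)
      fix q assume q: "q \<in> J2"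
      then have "q \<notin> ?J1" using dis by blast
      with q have "merge ?J1 J2 p q = snd p q" unfolding merge_def by (simp only: case_prod_unfold if_True if_False)
      then show "restrict (merge ?J1 J2 p q) (fst q) = restrict (snd p q) (fst q)" by (simp only:)
    qed
    ultimately show "(case p of (x, y) => (?T1 x, ?T2 y)) = (?T1 (merge ?J1 J2 p), ?T2 (merge ?J1 J2 p))"
      by (simp only: case_prod_unfold)
  qed
  also have "\<dots> = (\<integral>\<^sup>+z. F (?T1 z, ?T2 z) \<partial>distr (Pi\<^sub>M ?J1 (\<lambda>_. \<mu>) \<Otimes>\<^sub>M Pi\<^sub>M J2 (\<lambda>_. \<mu>)) (Pi\<^sub>M (?J1 \<union> J2) (\<lambda>_. \<mu>)) (merge ?J1 J2))"
    by (rule nn_integral_distr[symmetric, OF measurable_merge]) (use G in simp)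
  also have "\<dots> = (\<integral>\<^sup>+z. F (?T1 z, ?T2 z) \<partial>Pi\<^sub>M (?J1 \<union> J2) (\<lambda>_. \<mu>))"
    unfolding P.distr_merge[OF dis fin] ..
  finally show ?thesis .
qed

end

text \<open>The estimator reads incomplete observations only through the coordinates in
  \<open>S\<close>, and \<open>a\<close> only at the complete sample points. This permits both the
  restriction of the data and the change of \<open>a\<close> off the cube.\<close>

lemma theta_check_cong:
  assumes SS: "SS \<subseteq> Pow {1..d}" and X: "\<And>i. i \<in> {1..n} ==> X i = X' i"
    and Y: "\<And>S i j. S \<in> SS ==> i \<in> {1..nS S} ==> j \<in> S ==> Y (S, i) j = Y' (S, i) j"
    and a: "\<And>i. i \<in> {1..n} ==> a (X i) = a' (X i)"
  shows "theta_check d K a SS h M n nS (X, Y) = theta_check d K a' SS h M n nS (X', Y')"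
proof -
  have Kc: "Kh d K S h u = Kh d K S h u'" if "\<And>j. j \<in> S ==> u j = u' j" for S u u'
    unfolding Kh_def using that by (simp cong: restrict_cong)
  have fh: "f_hat d K h n nS (X, Y) S x = f_hat d K h n nS (X', Y') S x" if S: "S \<in> SS" for S x
    unfolding f_hat_def prod.case
    by (intro arg_cong2[where f = "(*)"] arg_cong2[where f = "(+)"] refl sum.cong Kc) (simp_all add: X Y[OF S] del: One_nat_def)
  have kh: "k_hat d K a h n nS (X, Y) Ss (map X is) = k_hat d K a' h n nS (X', Y') Ss (map X' is)"
    if Ss: "Ss \<in> adm_tuples SS m" and "is": "is \<in> index_tuples n (m + 1)" for Ss "is" m
  proof -
    have len: "length Ss = m" "set Ss \<subseteq> SS" "length is = m + 1" "set is \<subseteq> {1..n}"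
      using that by (auto simp: adm_tuples_def index_tuples_def)
    have mp: "map X is = map X' is" using X len(4) by (intro map_cong refl) blast
    have 0: "is ! 0 \<in> {1..n}" using len by (intro subsetD[OF len(4)] nth_mem) simp
    have "a (map X' is ! 0) = a' (map X' is ! 0)"
      using a[OF 0] X[OF 0] len(3) by simp
    moreover have "f_hat d K h n nS (X, Y) (Ss ! j) x = f_hat d K h n nS (X', Y') (Ss ! j) x" if "j < length Ss" for j x
      using len that by (intro fh subsetD[OF len(2)] nth_mem) simp
    ultimately show ?thesis unfolding mp k_hat_def by (intro arg_cong2[where f = "(*)"] prod.cong refl) auto
  qed
  have "a (X i) = a' (X' i)" if "i \<in> {1..n}" for i using a[OF that] X[OF that] by simp
  then show ?thesis unfolding theta_check_def fst_conv
    by (intro arg_cong2[where f = "(+)"] arg_cong2[where f = "(*)"] refl sum.cong kh) auto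
qed

context risk begin

text \<open>Here \<open>a'\<close> is the given function and \<open>a\<close> its bounded
  modification. Almost surely all complete observations lie in the cube, where the two
  agree.\<close>

lemma scaled_risk_eq:
  assumes a'm: "a' \<in> bor d" and a': "\<And>x. x \<in> unit_cube d ==> a' x = a x"
    and \<theta>: "functional d a' f = \<theta>" and M: "M + 1 \<le> n"
  shows "scaled_risk d f K a' SS h M n nS = ennreal (real n * (\<integral>z. (est M z - \<theta>)\<^sup>2 \<partial>I.\<Omega>))"
proof -
  let ?L = "sample_law d f SS n nS"
  let ?F = "\<lambda>\<omega>. ennreal (real n * (theta_check d K a' SS h M n nS \<omega> - \<theta>)\<^sup>2)"
  have sets_ml: "sets (marginal_law d f S) = sets (leb S)" for S by (simp add: marginal_law_def)
  have "(\<lambda>\<omega>. theta_check d K a' SS h M n nS (fst \<omega>, snd \<omega>)) \<in> borel_measurable ?L"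
  proof (rule theta_check_measurable[OF kern_axioms SS(1) a'm])
    show "(\<lambda>\<omega>. fst \<omega> i) \<in> ?L \<rightarrow>\<^sub>M leb {1..d}" if "i \<in> {1..n}" for i
    proof -
      have "(\<lambda>\<omega>. fst \<omega> i) \<in> ?L \<rightarrow>\<^sub>M \<mu>"
        unfolding sample_law_def by (intro measurable_compose[OF measurable_fst measurable_component_singleton] that)
      then show ?thesis unfolding measurable_cong_sets[OF refl sets_law] .
    qed
    show "(\<lambda>\<omega>. snd \<omega> (S, i) j) \<in> borel_measurable ?L" if "S \<in> SS" "i \<in> {1..nS S}" "j \<in> S" for S i j
    proof -
      have "(\<lambda>\<omega>. snd \<omega> (S, i)) \<in> ?L \<rightarrow>\<^sub>M (\<lambda>(S, i). marginal_law d f S) (S, i)"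
        unfolding sample_law_def using that
        by (intro measurable_compose[OF measurable_snd measurable_component_singleton]) auto
      then have "(\<lambda>\<omega>. snd \<omega> (S, i)) \<in> ?L \<rightarrow>\<^sub>M marginal_law d f S" by simp
      then have "(\<lambda>\<omega>. snd \<omega> (S, i)) \<in> ?L \<rightarrow>\<^sub>M leb S" unfolding measurable_cong_sets[OF refl sets_ml] .
      from measurable_compose[OF this measurable_leb_component[OF that(3)]] show ?thesis .
    qed
  qed
  then have "theta_check d K a' SS h M n nS \<in> borel_measurable ?L" by simp
  then have F: "?F \<in> borel_measurable ?L"
    by (intro measurable_compose[OF _ measurable_ennreal] borel_measurable_times borel_measurable_const
        borel_measurable_power borel_measurable_diff)
  have "scaled_risk d f K a' SS h M n nS = (\<integral>\<^sup>+\<omega>. ?F \<omega> \<partial>?L)" unfolding scaled_risk_def \<theta> ..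
  also have "\<dots> = (\<integral>\<^sup>+z. ?F (\<lambda>i\<in>{1..n}. z ({1..d}, i), \<lambda>p\<in>(SIGMA S:SS. {1..nS S}). restrict (z p) (fst p)) \<partial>I.\<Omega>)"
    unfolding J_def by (rule nn_integral_sample_law[OF SS(1) SS_full F])
  also have "\<dots> = (\<integral>\<^sup>+z. ennreal (real n * (est M z - \<theta>)\<^sup>2) \<partial>I.\<Omega>)"
  proof (rule nn_integral_cong_AE)
    have "AE z in I.\<Omega>. \<forall>i\<in>{1..n}. X z i \<in> unit_cube d"
      by (rule AE_finite_allI) (auto intro!: I.AE_component[OF X_in_J AE_cube] simp del: One_nat_def)
    then show "AE z in I.\<Omega>. ?F (\<lambda>i\<in>{1..n}. z ({1..d}, i), \<lambda>p\<in>(SIGMA S:SS. {1..nS S}). restrict (z p) (fst p)) =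
      ennreal (real n * (est M z - \<theta>)\<^sup>2)"
    proof eventually_elim
      case (elim z)
      have "theta_check d K a' SS h M n nS (\<lambda>i\<in>{1..n}. z ({1..d}, i), \<lambda>p\<in>(SIGMA S:SS. {1..nS S}). restrict (z p) (fst p)) =
        theta_check d K a SS h M n nS (\<lambda>i. z ({1..d}, i), z)"
      proof (rule theta_check_cong[OF SS(1)])
        show "a' ((\<lambda>i\<in>{1..n}. z ({1..d}, i)) i) = a ((\<lambda>i\<in>{1..n}. z ({1..d}, i)) i)" if "i \<in> {1..n}" for i
          using a'[of "z ({1..d}, i)"] elim that by simp
      qed auto
      then show ?case unfolding est_def by (simp only:)
    qed
  qed
  also have "\<dots> = ennreal (\<integral>z. real n * (est M z - \<theta>)\<^sup>2 \<partial>I.\<Omega>)"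
  proof (rule nn_integral_eq_integral)
    have "nS S \<le> Max (nS ` SS)" if "S \<in> SS" for S using finite_SS that by simp
    note ec = est_crude[OF M this]
    let ?B = "A + real M * (A * (real (card SS) * real (n + Max (nS ` SS) + 1)) ^ M) + A"
    have "\<bar>est M z - \<theta>\<bar> \<le> ?B" for z using ec[of z] \<theta>_le by linarith
    then have "\<bar>(est M z - \<theta>)\<^sup>2\<bar> \<le> ?B\<^sup>2" for z using power_mono[of "\<bar>est M z - \<theta>\<bar>" ?B 2] by simp
    then have "integrable I.\<Omega> (\<lambda>z. (est M z - \<theta>)\<^sup>2)"
      by (intro I.integrable_bounded borel_measurable_power borel_measurable_diff est_meas borel_measurable_const)
    then show "integrable I.\<Omega> (\<lambda>z. real n * (est M z - \<theta>)\<^sup>2)" by simp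
  qed simp
  finally show ?thesis by simp
qed

end

section \<open>Rates\<close>

text \<open>Here \<open>r\<close> is the 60th root of \<open>n\<close> and the deviation level is
  \<open>1 / r ^ 24\<close>. The first term is of order \<open>r ^ -34\<close>, the second
  \<open>r ^ -58\<close>; in the third the tail exponent is of order \<open>r ^ 10\<close> and beats
  \<open>exp (2 * b * r\<^sup>2)\<close> from the crude bound. The unsimplified form is the one in
  which the bounds arise.\<close>

definition remainder :: "real => real => real => real => real => real => real" where
  "remainder p1 p2 p3 b e r = p1 * (r ^ 60 * ((1 / r ^ 24)\<^sup>2 * r)\<^sup>2) + p2 * (r\<^sup>2 / r ^ 60) +
     p3 * (r ^ 60 * (r * exp (b * r\<^sup>2))\<^sup>2 * (r * r ^ 60 * exp (- (e * (r ^ 60 * (1 / r ^ 24)\<^sup>2 / r\<^sup>2)))))"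

lemma remainder_tendsto:
  assumes "0 < b" "0 < e"
  shows "(remainder p1 p2 p3 b e \<longlongrightarrow> 0) at_top"
proof -
  have 1: "((\<lambda>r::real. r ^ 60 * ((1 / r ^ 24)\<^sup>2 * r)\<^sup>2) \<longlongrightarrow> 0) at_top" by real_asymp
  have 2: "((\<lambda>r::real. r\<^sup>2 / r ^ 60) \<longlongrightarrow> 0) at_top" by real_asymp
  have 3: "((\<lambda>r::real. r ^ 60 * (r * exp (b * r\<^sup>2))\<^sup>2 * (r * r ^ 60 * exp (- (e * (r ^ 60 * (1 / r ^ 24)\<^sup>2 / r\<^sup>2))))) \<longlongrightarrow> 0) at_top"
    using assms by real_asymp
  show ?thesis unfolding remainder_def[abs_def]
    using tendsto_add[OF tendsto_add[OF tendsto_mult_right_zero[OF 1, of p1] tendsto_mult_right_zero[OF 2, of p2]]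
      tendsto_mult_right_zero[OF 3, of p3]] by simp
qed

context jacobi begin

text \<open>\<open>K1\<close>, \<open>K2\<close>, \<open>K3\<close>, \<open>K4\<close> and
  \<open>K7\<close> collect the factors in the error bounds that depend on none of \<open>n\<close>,
  \<open>h\<close> and \<open>M\<close>.\<close>

definition K1 :: real where
  "K1 = 2 * real (card SS) * ((1 + A * (2 / c1\<^sup>2) * (C0 + 1)) * (2 / c1) + A * (2 / c1\<^sup>2))"
definition K2 :: real where "K2 = (A + 1) * (\<kappa> / c1 + 1) + \<kappa>"
definition K3 :: real where "K3 = A * ((\<kappa> + C0) / c1 + C1)"
definition K7 :: real where "K7 = 5 * A + 2 * (real (card SS) * (A * C1))"
definition K4 :: "real => real" where "K4 l = 1 + 2 * K2 / l"

definition rest :: "real => real => real => real" where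
  "rest l \<Lambda> = remainder (4 * (K1\<^sup>2 * ((K4 l)\<^sup>2)\<^sup>2)) (30 * (real (card SS))\<^sup>2 * K3\<^sup>2 / l) (6 * real (card SS) * K7\<^sup>2)
     (real (card SS) * (2 + \<Lambda>) + 60) (l / (2 * K2\<^sup>2))"

lemma K2_pos: "0 < K2"
proof -
  have "0 < A + 1" "0 < \<kappa> / c1 + 1" using A_nonneg \<kappa>_nonneg c1_pos by (auto intro: add_nonneg_pos)
  then have "0 < (A + 1) * (\<kappa> / c1 + 1)" by (rule mult_pos_pos)
  then show ?thesis using \<kappa>_nonneg by (simp add: K2_def add_pos_nonneg)
qed

lemma rest_tendsto: "0 < l ==> 0 \<le> \<Lambda> ==> (rest l \<Lambda> \<longlongrightarrow> 0) at_top"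
  unfolding rest_def using K2_pos by (intro remainder_tendsto) (auto intro: add_nonneg_pos)

end

context risk begin

text \<open>The hypothesis \<open>y\<close> is the budget: powers with exponent \<open>M\<close> and
  the factor \<open>1 / h ^ d\<close> together stay below \<open>r\<close>. Only the index
  coincidences need \<open>h ^ d\<close> to the power \<open>M\<close>, and they produce exactly the
  term \<open>(E / h ^ d) ^ (2 * M + 2) / n\<close>.\<close>

lemma EB_bound:
  assumes r: "1 \<le> r" "r ^ 60 = real n"
    and E: "8 * (real (card SS) * (2 * \<kappa> / c1 + 1)) \<le> E" "(2 + C1) * (2 + C2) \<le> E" "2 \<le> E" and y: "E ^ M * (1 / h ^ d) \<le> r"
    and l: "0 < l" "l * r ^ 60 \<le> real N" and \<Lambda>: "0 \<le> \<Lambda>" "real Nm \<le> \<Lambda> * r ^ 60"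
  shows "1 / r ^ 24 + 2 * R\<psi> M / real N \<le> K4 l / r ^ 24"
    and "real n * EB M N Nm (1 / r ^ 24) \<le> 16 * A\<^sup>2 * ((E * (1 / h ^ d)) ^ (2 * M + 2) / real n) + rest l \<Lambda> r"
    and "M + 1 \<le> n"
proof -
  define q where "q = 1 / h ^ d"
  define X where "X = 1 / r ^ 24"
  let ?w1 = "(2 + C1) ^ M" let ?w2 = "(2 + C2) ^ M" let ?s = "real (card SS)"
  have r0: "0 < r" using r by simp
  have X0: "0 < X" unfolding X_def using r0 by simp
  have rn: "0 < r ^ 60" using r0 by simp
  have "h ^ d \<le> 1" using h_pos h_lt by (intro power_le_one) auto
  then have q1: "1 \<le> q" unfolding q_def using h_pos by simp
  have kq: "\<kappa> / h ^ d = \<kappa> * q" unfolding q_def by simp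
  have y: "E ^ M * q \<le> r" using y unfolding q_def .
  have C2_pos: "0 < C2" using C0_pos c1_pos by (simp add: C2_def add_pos_pos)
  have E1: "1 \<le> E" using E(3) by simp
  have EM1: "1 \<le> E ^ M" by (rule one_le_power[OF E1])
  have EMr: "E ^ M \<le> r" using mult_left_mono[OF q1, of "E ^ M"] EM1 y by linarith
  have w1: "1 \<le> ?w1" using C1_pos by (intro one_le_power) simp
  have w2: "1 \<le> ?w2" using C2_pos by (intro one_le_power) simp
  have w12E: "?w1 * ?w2 \<le> E ^ M"
    unfolding power_mult_distrib[symmetric] using E(2) C1_pos C2_pos by (intro power_mono) auto
  then have w12: "?w1 * ?w2 \<le> r" using EMr by linarith
  have w1E: "?w1 \<le> E ^ M" using w12E mult_left_mono[OF w2, of ?w1] w1 by linarith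
  then have w1r: "?w1 \<le> r" using EMr by linarith
  have w1q: "?w1 * q \<le> r" using mult_right_mono[OF w1E, of q] q1 y by linarith
  have M2: "real M + 1 \<le> 2 ^ M" by (induction M) auto
  have "2 ^ M \<le> E ^ M" using E(3) by (intro power_mono) auto
  then have Mr: "real M + 1 \<le> r" using M2 EMr by linarith
  have "r ^ 1 \<le> r ^ 60" using r(1) by (intro power_increasing) auto
  then have "real (M + 1) \<le> real n" using Mr r(2) by simp
  then show "M + 1 \<le> n" by (simp only: of_nat_le_iff)
  have s1: "1 \<le> ?s"
  proof -
    have "0 < card SS" using SS(2) finite_SS by (simp add: card_gt_0_iff)
    then show ?thesis by linarith
  qed
  have kc: "0 \<le> \<kappa> / c1" using \<kappa>_nonneg c1_pos by (intro divide_nonneg_pos)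
  have R: "R\<psi> M \<le> K2 * r"
  proof -
    have "\<kappa> * q / c1 + 1 \<le> \<kappa> / c1 * q + 1 * q" using q1 by simp
    then have 1: "\<kappa> * q / c1 + 1 \<le> (\<kappa> / c1 + 1) * q" by (simp only: distrib_right)
    have "(A + 1) * ?w1 * (\<kappa> * q / c1 + 1) \<le> (A + 1) * ?w1 * ((\<kappa> / c1 + 1) * q)"
      using A_nonneg w1 by (intro mult_left_mono 1) auto
    moreover have "\<kappa> * (1 * q) \<le> \<kappa> * (?w1 * q)"
      using w1 q1 \<kappa>_nonneg by (intro mult_left_mono mult_right_mono) auto
    ultimately have "R\<psi> M \<le> (A + 1) * ?w1 * ((\<kappa> / c1 + 1) * q) + \<kappa> * (?w1 * q)" unfolding R\<psi>_def kq by simp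
    also have "\<dots> = K2 * (?w1 * q)" unfolding K2_def
      by (simp only: distrib_left distrib_right mult_1_left mult_1_right mult_ac)
    also have "\<dots> \<le> K2 * r" using K2_pos w1q by (intro mult_left_mono) auto
    finally show ?thesis .
  qed
  have \<tau>: "X + 2 * R\<psi> M / real N \<le> K4 l * X"
  proof -
    have "2 * R\<psi> M / real N \<le> 2 * (K2 * r) / (l * r ^ 60)"
      using R K2_pos l rn r0 by (intro frac_le) auto
    also have "\<dots> = 2 * K2 / l * (r / r ^ 60)" by (simp only: times_divide_times_eq mult_ac)
    also have "\<dots> \<le> 2 * K2 / l * X"
    proof (intro mult_left_mono)
      have "r ^ 25 \<le> r ^ 60" using r(1) by (intro power_increasing) auto
      moreover have "r ^ 25 = r * r ^ 24" using power_add[of r 1 24] by simp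
      ultimately show "r / r ^ 60 \<le> X" unfolding X_def using r0 by (simp add: divide_simps)
    qed (use K2_pos l in auto)
    finally show ?thesis unfolding K4_def distrib_right by simp
  qed
  then show "1 / r ^ 24 + 2 * R\<psi> M / real N \<le> K4 l / r ^ 24" unfolding X_def by simp
  let ?\<tau> = "X + 2 * R\<psi> M / real N"
  have \<tau>0: "0 \<le> ?\<tau>" using X0 R\<psi>_pos[of M] by simp
  have HE0: "0 \<le> HE M ?\<tau>" and HEb: "HE M ?\<tau> \<le> K1 * (K4 l * X)\<^sup>2 * r"
  proof -
    have id: "s * (2 * t * ((t + A * w * (2 * t / c1\<^sup>2) * (C0 + 1)) * w' * z + A * w * (2 * t / c1\<^sup>2))) =
      2 * s * t\<^sup>2 * ((1 + A * w * u * (C0 + 1)) * w' * z + A * w * u)" if "u = 2 / c1\<^sup>2" for s t w w' z u :: real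
    proof -
      have "2 * t / c1\<^sup>2 = t * u" unfolding that by simp
      then show ?thesis by (simp only: power2_eq_square[of t]) (simp only: distrib_left distrib_right mult_1_left mult_1_right mult_ac)
    qed
    let ?u = "2 / c1\<^sup>2" let ?z = "2 / c1"
    have u0: "0 \<le> ?u" "0 \<le> ?z" using c1_pos by auto
    have HEe: "HE M ?\<tau> = 2 * ?s * ?\<tau>\<^sup>2 * ((1 + A * ?w1 * ?u * (C0 + 1)) * ?w2 * ?z + A * ?w1 * ?u)"
      unfolding HE_def by (rule id[OF refl])
    have w0: "0 \<le> ?w1" "0 \<le> ?w2" using w1 w2 by linarith+
    have Au: "0 \<le> A * ?u" using A_nonneg u0 by (intro mult_nonneg_nonneg)
    have Awu: "0 \<le> A * ?w1 * ?u" using A_nonneg u0 w0 by (intro mult_nonneg_nonneg)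
    have Awuc: "0 \<le> A * ?w1 * ?u * (C0 + 1)" by (rule mult_nonneg_nonneg[OF Awu]) (use C0_pos in linarith)
    have "0 \<le> 1 + A * ?w1 * ?u * (C0 + 1)" using Awuc by linarith
    then have P1: "0 \<le> (1 + A * ?w1 * ?u * (C0 + 1)) * ?w2 * ?z"
      by (rule mult_nonneg_nonneg[OF mult_nonneg_nonneg[OF _ w0(2)] u0(2)])
    show "0 \<le> HE M ?\<tau>" unfolding HEe by (rule mult_nonneg_nonneg[OF _ add_nonneg_nonneg[OF P1 Awu]]) simp
    have "0 \<le> A * ?u * (C0 + 1)" by (rule mult_nonneg_nonneg[OF Au]) (use C0_pos in linarith)
    then have "0 \<le> 1 + A * ?u * (C0 + 1)" by linarith
    then have in0: "0 \<le> (1 + A * ?u * (C0 + 1)) * ?z + A * ?u"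
      by (rule add_nonneg_nonneg[OF mult_nonneg_nonneg[OF _ u0(2)] Au])
    have "(1 + A * ?w1 * ?u * (C0 + 1)) * ?w2 * ?z + A * ?w1 * ?u \<le>
      (?w1 + A * ?w1 * ?u * (C0 + 1)) * ?w2 * ?z + A * ?w1 * ?u * ?w2"
    proof (rule add_mono)
      show "(1 + A * ?w1 * ?u * (C0 + 1)) * ?w2 * ?z \<le> (?w1 + A * ?w1 * ?u * (C0 + 1)) * ?w2 * ?z"
        by (rule mult_right_mono[OF mult_right_mono[OF add_right_mono[OF w1] w0(2)] u0(2)])
      show "A * ?w1 * ?u \<le> A * ?w1 * ?u * ?w2" using mult_left_mono[OF w2 Awu] by simp
    qed
    also have "\<dots> = (?w1 * ?w2) * ((1 + A * ?u * (C0 + 1)) * ?z + A * ?u)"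
      by (simp only: distrib_left distrib_right mult_1_left mult_1_right mult_ac)
    finally have "(1 + A * ?w1 * ?u * (C0 + 1)) * ?w2 * ?z + A * ?w1 * ?u \<le> (?w1 * ?w2) * ((1 + A * ?u * (C0 + 1)) * ?z + A * ?u)" .
    also have "\<dots> \<le> r * ((1 + A * ?u * (C0 + 1)) * ?z + A * ?u)" by (rule mult_right_mono[OF w12 in0])
    finally have in_le: "(1 + A * ?w1 * ?u * (C0 + 1)) * ?w2 * ?z + A * ?w1 * ?u \<le> r * ((1 + A * ?u * (C0 + 1)) * ?z + A * ?u)" .
    have K10: "0 \<le> K1" unfolding K1_def by (rule mult_nonneg_nonneg[OF _ in0]) simp
    have "HE M ?\<tau> \<le> 2 * ?s * ?\<tau>\<^sup>2 * (r * ((1 + A * ?u * (C0 + 1)) * ?z + A * ?u))"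
      unfolding HEe by (intro mult_left_mono in_le) auto
    also have "\<dots> = K1 * ?\<tau>\<^sup>2 * r" unfolding K1_def by (simp only: mult_ac)
    also have "\<dots> \<le> K1 * (K4 l * X)\<^sup>2 * r"
    proof (intro mult_right_mono mult_left_mono)
      show "?\<tau>\<^sup>2 \<le> (K4 l * X)\<^sup>2" using \<tau> \<tau>0 by (intro power_mono) auto
    qed (use K10 r0 in auto)
    finally show "HE M ?\<tau> \<le> K1 * (K4 l * X)\<^sup>2 * r" .
  qed
  have b0_le: "b0 \<le> (2 * \<kappa> / c1 + 1) * q"
  proof -
    have "b0 \<le> 2 * \<kappa> / c1 * q + 1 * q" unfolding b0_def kq using q1 by simp
    then show ?thesis by (simp only: distrib_right)
  qed
  have b00: "0 \<le> b0"
  proof -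
    have "2 * (\<kappa> / h ^ d) / c1 = 2 * (\<kappa> / h ^ d / c1)" by (simp only: times_divide_eq_right)
    then show ?thesis unfolding b0_def using kc_nonneg by linarith
  qed
  let ?V = "real M * (real M + 1)\<^sup>2 * (?s * b0) ^ M"
  have V: "?V \<le> (E * q) ^ (M + 1)"
  proof -
    \<comment> \<open>The polynomial in \<open>M\<close> is absorbed into \<open>8 ^ M\<close>,
      which is the origin of the 8 in the first condition on \<open>E\<close>.\<close>
    have "real M * (real M + 1)\<^sup>2 \<le> 2 ^ M * (2 ^ M)\<^sup>2" using M2 by (intro mult_mono power_mono) auto
    also have "\<dots> = (8::real) ^ M"
    proof -
      have "(2::real) ^ M * (2 ^ M)\<^sup>2 = (2 * (2 * 2)) ^ M" by (simp only: power2_eq_square power_mult_distrib)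
      then show ?thesis by simp
    qed
    finally have "?V \<le> 8 ^ M * (?s * b0) ^ M" using b00 s1 by (intro mult_right_mono) auto
    also have "\<dots> = (8 * (?s * b0)) ^ M" by (simp only: power_mult_distrib)
    also have "\<dots> \<le> (E * q) ^ M"
    proof (intro power_mono)
      have "?s * b0 \<le> ?s * ((2 * \<kappa> / c1 + 1) * q)" using b0_le s1 by (intro mult_left_mono) auto
      then have "8 * (?s * b0) \<le> (8 * (?s * (2 * \<kappa> / c1 + 1))) * q" by linarith
      also have "\<dots> \<le> E * q" using E(1) q1 by (intro mult_right_mono) auto
      finally show "8 * (?s * b0) \<le> E * q" .
    qed (use b00 s1 in auto)
    also have "\<dots> \<le> (E * q) ^ (M + 1)"
    proof (intro power_increasing)
      show "1 \<le> E * q" using mult_mono[OF E1 q1] E1 by simp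
    qed simp
    finally show ?thesis .
  qed
  have V0: "0 \<le> ?V" using b00 s1 by (intro mult_nonneg_nonneg zero_le_power) auto
  have UV: "real n * (UV n M b0)\<^sup>2 \<le> 4 * A\<^sup>2 * ((E * q) ^ (2 * M + 2) / real n)"
  proof -
    have "real n * (2 * A * w / real n)\<^sup>2 = 4 * A\<^sup>2 * (w\<^sup>2 / real n)" for w
      using n_pos by (simp add: power_divide power_mult_distrib power2_eq_square[of "real n"])
    then have "real n * (UV n M b0)\<^sup>2 = 4 * A\<^sup>2 * (?V\<^sup>2 / real n)" unfolding UV_def .
    also have "\<dots> \<le> 4 * A\<^sup>2 * (((E * q) ^ (M + 1))\<^sup>2 / real n)"
      using V V0 by (intro mult_left_mono divide_right_mono power_mono) auto
    also have "((E * q) ^ (M + 1))\<^sup>2 = (E * q) ^ (2 * M + 2)"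
    proof -
      have "2 * M + 2 = (M + 1) * 2" by simp
      then show ?thesis by (simp only: power_mult)
    qed
    finally show ?thesis .
  qed
  have HE: "real n * (HE M ?\<tau>)\<^sup>2 \<le> K1\<^sup>2 * ((K4 l)\<^sup>2)\<^sup>2 * (r ^ 60 * (X\<^sup>2 * r)\<^sup>2)"
  proof -
    have "real n * (HE M ?\<tau>)\<^sup>2 \<le> r ^ 60 * (K1 * (K4 l * X)\<^sup>2 * r)\<^sup>2"
      unfolding r(2)[symmetric] using HE0 HEb rn by (intro mult_left_mono power_mono) auto
    also have "\<dots> = K1\<^sup>2 * ((K4 l)\<^sup>2)\<^sup>2 * (r ^ 60 * (X\<^sup>2 * r)\<^sup>2)" by (simp only: power_mult_distrib mult_ac)
    finally show ?thesis .
  qed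
  have QQ: "30 * ?s\<^sup>2 * (Q M)\<^sup>2 / real N \<le> 30 * ?s\<^sup>2 * K3\<^sup>2 / l * (r\<^sup>2 / r ^ 60)"
  proof -
    have cc: "0 \<le> (\<kappa> + C0) / c1 + C1" using \<kappa>_nonneg C0_pos c1_pos C1_pos by (intro add_nonneg_nonneg divide_nonneg_pos) auto
    have "(\<kappa> / h ^ d + C0) / c1 + C1 \<le> ((\<kappa> + C0) / c1 + C1) * q"
    proof -
      have "C0 * 1 \<le> C0 * q" "C1 * 1 \<le> C1 * q" using q1 C0_pos C1_pos by (intro mult_left_mono; simp)+
      then have "(\<kappa> * q + C0) / c1 + C1 \<le> (\<kappa> * q + C0 * q) / c1 + C1 * q"
        using c1_pos by (intro add_mono divide_right_mono) auto
      also have "\<dots> = ((\<kappa> + C0) / c1 + C1) * q" by (simp only: distrib_right times_divide_eq_left)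
      finally show ?thesis unfolding kq .
    qed
    then have "Q M \<le> A * ?w1 * (((\<kappa> + C0) / c1 + C1) * q)"
      unfolding Q_def using A_nonneg w1 by (intro mult_left_mono) auto
    also have "\<dots> = K3 * (?w1 * q)" unfolding K3_def by (simp only: mult_ac)
    also have "\<dots> \<le> K3 * r" using w1q A_nonneg cc unfolding K3_def by (intro mult_left_mono mult_nonneg_nonneg)
    finally have "(Q M)\<^sup>2 \<le> (K3 * r)\<^sup>2" using Q_nonneg by (intro power_mono)
    then have "30 * ?s\<^sup>2 * (Q M)\<^sup>2 / real N \<le> 30 * ?s\<^sup>2 * (K3 * r)\<^sup>2 / (l * r ^ 60)"
      using l rn by (intro frac_le mult_left_mono) auto
    also have "\<dots> = 30 * ?s\<^sup>2 * K3\<^sup>2 / l * (r\<^sup>2 / r ^ 60)" by (simp add: power_mult_distrib)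
    finally show ?thesis .
  qed
  let ?b = "?s * (2 + \<Lambda>) + 60" let ?e = "l / (2 * K2\<^sup>2)" let ?G = "r * exp (?b * r\<^sup>2)"
  have b_pos: "0 < ?b" using s1 \<Lambda> by (intro add_nonneg_pos mult_nonneg_nonneg) auto
  have ex1: "1 \<le> exp (?b * r\<^sup>2)" using b_pos by simp
  have G1: "r \<le> ?G" using mult_left_mono[OF ex1, of r] r0 by simp
  then have "1 \<le> ?G" using r(1) by linarith
  note G = G1 this
  have Cr0: "0 \<le> Cr M Nm" unfolding Cr_def using A_nonneg C1_pos w1
    by (intro add_nonneg_nonneg mult_nonneg_nonneg zero_le_power) auto
  have Cr: "Cr M Nm \<le> K7 * ?G"
  proof -
    \<comment> \<open>Sample sizes are polynomial in \<open>r\<close>, so the base is at most an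
      exponential of a multiple of \<open>r\<close>; with \<open>M \<le> r\<close> the power is at
      most \<open>exp (?b * r\<^sup>2)\<close>.\<close>
    have "?s * real (n + Nm + 1) \<le> ?s * ((2 + \<Lambda>) * r ^ 60)"
    proof (intro mult_left_mono)
      have "1 \<le> r ^ 60" using r(1) by (rule one_le_power)
      then show "real (n + Nm + 1) \<le> (2 + \<Lambda>) * r ^ 60" using r(2) \<Lambda>(2) by (simp add: distrib_right)
    qed simp
    also have "\<dots> = (?s * (2 + \<Lambda>)) * r ^ 60" by (simp only: mult_ac)
    also have "\<dots> \<le> exp (?s * (2 + \<Lambda>) * r) * exp (60 * r)"
    proof (intro mult_mono)
      have k0: "0 \<le> ?s * (2 + \<Lambda>)" using \<Lambda> by (intro mult_nonneg_nonneg) auto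
      have "?s * (2 + \<Lambda>) * 1 \<le> ?s * (2 + \<Lambda>) * r" using k0 r(1) by (intro mult_left_mono)
      then show "?s * (2 + \<Lambda>) \<le> exp (?s * (2 + \<Lambda>) * r)" using exp_ge_add_one_self[of "?s * (2 + \<Lambda>) * r"] by linarith
      have "r ^ 60 \<le> exp r ^ 60" using exp_ge_add_one_self[of r] r0 by (intro power_mono) linarith+
      then show "r ^ 60 \<le> exp (60 * r)" using exp_of_nat_mult[of 60 r] by simp
    qed (use r0 in auto)
    also have "\<dots> = exp (?b * r)" by (simp add: exp_add[symmetric] distrib_right)
    finally have "(?s * real (n + Nm + 1)) ^ M \<le> exp (?b * r) ^ M" using s1 by (intro power_mono) auto
    also have "\<dots> = exp (real M * (?b * r))" by (rule exp_of_nat_mult[symmetric])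
    also have "\<dots> \<le> exp (r * (?b * r))" using Mr b_pos r0 by (intro iffD2[OF exp_le_cancel_iff] mult_right_mono) auto
    also have "r * (?b * r) = ?b * r\<^sup>2" by (simp only: power2_eq_square mult_ac)
    finally have pw: "(?s * real (n + Nm + 1)) ^ M \<le> exp (?b * r\<^sup>2)" .
    have "real M * (A * (?s * real (n + Nm + 1)) ^ M) \<le> r * (A * exp (?b * r\<^sup>2))"
      using Mr pw A_nonneg r0 s1 by (intro mult_mono mult_left_mono mult_nonneg_nonneg zero_le_power) auto
    also have "\<dots> = A * ?G" by (simp only: mult_ac)
    finally have 2: "real M * (A * (?s * real (n + Nm + 1)) ^ M) \<le> A * ?G" .
    have 1: "4 * A \<le> 4 * A * ?G" using mult_left_mono[OF G(2), of "4 * A"] A_nonneg by simp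
    have "?s * (A * ?w1 * C1) \<le> ?s * (A * ?G * C1)"
      using w1r G(1) A_nonneg C1_pos by (intro mult_left_mono mult_right_mono) auto
    then have "2 * (?s * (A * ?w1 * C1)) \<le> 2 * (?s * (A * C1)) * ?G" by (simp add: mult_ac)
    with 1 2 have "Cr M Nm \<le> 4 * A * ?G + A * ?G + 2 * (?s * (A * C1)) * ?G" unfolding Cr_def by linarith
    also have "\<dots> = K7 * ?G" unfolding K7_def by (simp only: distrib_right[symmetric]) simp
    finally show ?thesis .
  qed
  have PB: "PB M N X \<le> 6 * ?s * (r * r ^ 60 * exp (- (?e * (r ^ 60 * X\<^sup>2 / r\<^sup>2))))"
  proof -
    have "l * r ^ 60 * X\<^sup>2 / (2 * (K2 * r)\<^sup>2) \<le> real N * X\<^sup>2 / (2 * (R\<psi> M)\<^sup>2)"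
      using l R R\<psi>_pos[of M] by (intro frac_le mult_right_mono mult_left_mono power_mono) auto
    moreover have "l * z * Z / (2 * (K2 * r)\<^sup>2) = ?e * (z * Z / r\<^sup>2)" for z Z by (simp add: power_mult_distrib)
    ultimately have ex: "exp (- (real N * X\<^sup>2 / (2 * (R\<psi> M)\<^sup>2))) \<le> exp (- (?e * (r ^ 60 * X\<^sup>2 / r\<^sup>2)))" by simp
    have "PB M N X \<le> ?s * (3 * r) * r ^ 60 * (2 * exp (- (?e * (r ^ 60 * X\<^sup>2 / r\<^sup>2))))"
      unfolding PB_def r(2)[symmetric] using Mr r(1) ex rn by (intro mult_mono mult_left_mono mult_nonneg_nonneg) auto
    then show ?thesis by linarith
  qed
  have PB0: "0 \<le> PB M N X" unfolding PB_def by (intro mult_nonneg_nonneg) auto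
  have CP: "real n * ((Cr M Nm)\<^sup>2 * PB M N X) \<le> 6 * ?s * K7\<^sup>2 *
    (r ^ 60 * ?G\<^sup>2 * (r * r ^ 60 * exp (- (?e * (r ^ 60 * X\<^sup>2 / r\<^sup>2)))))"
  proof -
    have "real n * ((Cr M Nm)\<^sup>2 * PB M N X) \<le> r ^ 60 * ((K7 * ?G)\<^sup>2 * (6 * ?s * (r * r ^ 60 * exp (- (?e * (r ^ 60 * X\<^sup>2 / r\<^sup>2))))))"
      unfolding r(2)[symmetric] using Cr Cr0 PB PB0 rn by (intro mult_left_mono mult_mono power_mono) auto
    also have "\<dots> = 6 * ?s * K7\<^sup>2 * (r ^ 60 * ?G\<^sup>2 * (r * r ^ 60 * exp (- (?e * (r ^ 60 * X\<^sup>2 / r\<^sup>2)))))"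
      unfolding power_mult_distrib[of K7 ?G] by (simp only: mult_ac)
    finally show ?thesis .
  qed
  have "(UV n M b0 + HE M ?\<tau>)\<^sup>2 \<le> 2 * (UV n M b0)\<^sup>2 + 2 * (HE M ?\<tau>)\<^sup>2"
    using young_square[of 1 "UV n M b0" "HE M ?\<tau>"] by simp
  then have "real n * (2 * (UV n M b0 + HE M ?\<tau>)\<^sup>2) \<le> real n * (4 * (UV n M b0)\<^sup>2 + 4 * (HE M ?\<tau>)\<^sup>2)"
    by (intro mult_left_mono) auto
  also have "\<dots> = 4 * (real n * (UV n M b0)\<^sup>2) + 4 * (real n * (HE M ?\<tau>)\<^sup>2)" by (simp add: distrib_left)
  also have "\<dots> \<le> 4 * (4 * A\<^sup>2 * ((E * q) ^ (2 * M + 2) / real n)) + 4 * (K1\<^sup>2 * ((K4 l)\<^sup>2)\<^sup>2 * (r ^ 60 * (X\<^sup>2 * r)\<^sup>2))"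
    using UV HE by (intro add_mono mult_left_mono) auto
  finally have a: "real n * (2 * (UV n M b0 + HE M ?\<tau>)\<^sup>2) \<le>
    4 * (4 * A\<^sup>2 * ((E * q) ^ (2 * M + 2) / real n)) + 4 * (K1\<^sup>2 * ((K4 l)\<^sup>2)\<^sup>2 * (r ^ 60 * (X\<^sup>2 * r)\<^sup>2))" .
  have "real n * EB M N Nm X = real n * (2 * (UV n M b0 + HE M ?\<tau>)\<^sup>2) + 30 * ?s\<^sup>2 * (Q M)\<^sup>2 / real N +
    real n * ((Cr M Nm)\<^sup>2 * PB M N X)"
    unfolding EB_def distrib_left using n_pos by simp
  also have "\<dots> \<le> 4 * (4 * A\<^sup>2 * ((E * q) ^ (2 * M + 2) / real n)) + 4 * (K1\<^sup>2 * ((K4 l)\<^sup>2)\<^sup>2 * (r ^ 60 * (X\<^sup>2 * r)\<^sup>2)) +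
    30 * ?s\<^sup>2 * K3\<^sup>2 / l * (r\<^sup>2 / r ^ 60) + 6 * ?s * K7\<^sup>2 * (r ^ 60 * ?G\<^sup>2 * (r * r ^ 60 * exp (- (?e * (r ^ 60 * X\<^sup>2 / r\<^sup>2)))))"
    by (intro add_mono a QQ CP)
  also have "\<dots> = 16 * A\<^sup>2 * ((E * q) ^ (2 * M + 2) / real n) + rest l \<Lambda> r"
    unfolding rest_def remainder_def X_def[symmetric] by linarith
  finally show "real n * EB M N Nm (1 / r ^ 24) \<le> 16 * A\<^sup>2 * ((E * q) ^ (2 * M + 2) / real n) + rest l \<Lambda> r" unfolding q_def X_def .
qed

end

text \<open>The order of choices is a value \<open>P\<close> close to the infimum, then
  \<open>\<epsilon>\<close>, then \<open>n\<close>. For fixed \<open>\<epsilon>\<close> the factors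
  \<open>1 + 1 / \<epsilon>\<close> are constants and are beaten by the null sequences.\<close>

lemma squeeze_inf:
  fixes g \<delta> \<zeta> \<sigma> :: "nat => real" and I0 :: real and V :: "real set"
  assumes \<delta>: "\<delta> \<longlonglongrightarrow> 0" and \<zeta>: "\<zeta> \<longlonglongrightarrow> 0" and \<sigma>: "\<sigma> \<longlonglongrightarrow> 0"
    and inf: "\<And>b. I0 < b ==> \<exists>P\<in>V. P < b"
    and up: "\<And>P \<epsilon>. P \<in> V ==> 0 < \<epsilon> ==> eventually (\<lambda>n. g n \<le>
      (1 + \<epsilon>) * ((1 + \<epsilon>) * ((1 + 1 / real n) * P + \<sigma> n) + (1 + 1 / \<epsilon>) * \<zeta> n) + (1 + 1 / \<epsilon>) * \<delta> n) sequentially"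
    and low: "\<And>\<epsilon>. 0 < \<epsilon> ==> eventually (\<lambda>n. (1 - 1 / real n) * I0 \<le> (1 + \<epsilon>) * g n + (1 + 1 / \<epsilon>) * \<delta> n) sequentially"
  shows "g \<longlonglongrightarrow> I0"
proof (rule order_tendstoI)
  let ?u = "\<lambda>k. inverse (real (Suc k))"
  have u: "?u \<longlonglongrightarrow> 0" by (rule LIMSEQ_inverse_real_of_nat)
  fix b assume "I0 < b"
  from inf[OF this] obtain P where P: "P \<in> V" "P < b" by blast
  have "(\<lambda>k. (1 + ?u k) * ((1 + ?u k) * P)) \<longlonglongrightarrow> (1 + 0) * ((1 + 0) * P)"
    by (intro tendsto_mult tendsto_add tendsto_const u)
  then have "(\<lambda>k. (1 + ?u k) * ((1 + ?u k) * P)) \<longlonglongrightarrow> P" by simp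
  from order_tendstoD(2)[OF this P(2)] obtain k where k: "(1 + ?u k) * ((1 + ?u k) * P) < b"
    unfolding eventually_sequentially by blast
  define e c where "e = 1 + ?u k" and "c = 1 + 1 / ?u k"
  have "(\<lambda>n. e * (e * ((1 + 1 / real n) * P + \<sigma> n) + c * \<zeta> n) + c * \<delta> n) \<longlonglongrightarrow> e * (e * ((1 + 0) * P + 0) + c * 0) + c * 0"
    by (intro tendsto_mult tendsto_add tendsto_const lim_1_over_n \<sigma> \<zeta> \<delta>)
  then have "(\<lambda>n. e * (e * ((1 + 1 / real n) * P + \<sigma> n) + c * \<zeta> n) + c * \<delta> n) \<longlonglongrightarrow> e * (e * P)" by simp
  moreover have "e * (e * P) < b" using k unfolding e_def .
  ultimately have "eventually (\<lambda>n. e * (e * ((1 + 1 / real n) * P + \<sigma> n) + c * \<zeta> n) + c * \<delta> n < b) sequentially"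
    by (rule order_tendstoD(2))
  moreover have "eventually (\<lambda>n. g n \<le> e * (e * ((1 + 1 / real n) * P + \<sigma> n) + c * \<zeta> n) + c * \<delta> n) sequentially"
    unfolding e_def c_def by (rule up[OF P(1)]) simp
  ultimately show "eventually (\<lambda>n. g n < b) sequentially" by eventually_elim linarith
next
  let ?u = "\<lambda>k. inverse (real (Suc k))"
  have u: "?u \<longlonglongrightarrow> 0" by (rule LIMSEQ_inverse_real_of_nat)
  fix b assume b: "b < I0"
  have "(\<lambda>k. (1 + ?u k) * b) \<longlonglongrightarrow> (1 + 0) * b" by (intro tendsto_mult tendsto_add tendsto_const u)
  then have "(\<lambda>k. (1 + ?u k) * b) \<longlonglongrightarrow> b" by simp
  from order_tendstoD(2)[OF this b] obtain k where k: "(1 + ?u k) * b < I0"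
    unfolding eventually_sequentially by blast
  define e c where "e = 1 + ?u k" and "c = 1 + 1 / ?u k"
  have e: "0 < e" unfolding e_def by (intro add_pos_pos) auto
  have "(\<lambda>n. (1 - 1 / real n) * I0 - c * \<delta> n) \<longlonglongrightarrow> (1 - 0) * I0 - c * 0"
    by (intro tendsto_mult tendsto_diff tendsto_const lim_1_over_n \<delta>)
  then have "(\<lambda>n. (1 - 1 / real n) * I0 - c * \<delta> n) \<longlonglongrightarrow> I0" by simp
  moreover have "e * b < I0" using k unfolding e_def .
  ultimately have "eventually (\<lambda>n. e * b < (1 - 1 / real n) * I0 - c * \<delta> n) sequentially" by (rule order_tendstoD(1))
  moreover have "eventually (\<lambda>n. (1 - 1 / real n) * I0 \<le> e * g n + c * \<delta> n) sequentially"
    unfolding e_def c_def by (rule low) simp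
  ultimately have "eventually (\<lambda>n. e * b < e * g n) sequentially" by eventually_elim linarith
  then show "eventually (\<lambda>n. b < g n) sequentially" using e by simp
qed

lemma sup_norm_bounds:
  assumes d: "1 \<le> d" and le: "\<And>j. j \<in> {1..d} ==> \<bar>x j\<bar> \<le> r"
  shows "sup_norm d x \<le> r" "0 \<le> sup_norm d x"
proof -
  have fin: "finite ((\<lambda>j. \<bar>x j\<bar>) ` {1..d})" by simp
  show "sup_norm d x \<le> r" unfolding sup_norm_def using d le by (intro Max.boundedI) auto
  have "\<bar>x 1\<bar> \<le> sup_norm d x" unfolding sup_norm_def using d by (intro Max_ge[OF fin] imageI) simp
  then show "0 \<le> sup_norm d x" using abs_ge_zero[of "x 1"] by linarith
qed

text \<open>Radii are at most 1, so an exponent may be lowered; in this way \<open>a\<close> and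
  \<open>f\<close> are brought to the common exponent \<open>min \<beta>1 \<beta>2\<close>.\<close>

lemma holder_osc:
  assumes d: "1 \<le> d" and g: "holder_on_cube d b B g" and b: "0 < \<beta>" "\<beta> \<le> b" and B: "0 \<le> B" "B \<le> A"
  shows "osc d \<beta> A g"
  unfolding osc_def
proof (intro ballI allI impI)
  fix x x' r assume x: "x \<in> unit_cube d" "x' \<in> unit_cube d" and r: "0 \<le> r" "r \<le> (1::real)"
    and j: "\<forall>j\<in>{1..d}. \<bar>x j - x' j\<bar> \<le> r"
  note sn = sup_norm_bounds[OF d, of "\<lambda>j. x j - x' j" r]
  have s: "sup_norm d (\<lambda>j. x j - x' j) \<le> r" "0 \<le> sup_norm d (\<lambda>j. x j - x' j)" using sn j by auto
  have "\<bar>g x - g x'\<bar> \<le> B * sup_norm d (\<lambda>j. x j - x' j) powr b" using g x unfolding holder_on_cube_def by blast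
  also have "\<dots> \<le> B * r powr b" using s b B by (intro mult_left_mono powr_mono2) auto
  also have "\<dots> \<le> B * r powr \<beta>" using r b B by (intro mult_left_mono powr_mono') auto
  also have "\<dots> \<le> A * r powr \<beta>" using B by (intro mult_right_mono) auto
  finally show "\<bar>g x - g x'\<bar> \<le> A * r powr \<beta>" .
qed

section \<open>The objective as a quadratic form and its dependence on the sampling ratios\<close>

context dens begin

lemma law_meas: "F \<in> bor d ==> F \<in> borel_measurable \<mu>" for F :: "point => real"
  unfolding measurable_cong_sets[OF sets_law refl] .

lemma H_iff: "\<alpha> \<in> H d f S \<longleftrightarrow> sq \<alpha> \<and> dep_on d S \<alpha> \<and> (\<integral>x. \<alpha> x \<partial>\<mu>) = 0"
proof (cases "\<alpha> \<in> bor d")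
  case True
  then have m2: "(\<lambda>x. (\<alpha> x)\<^sup>2) \<in> bor d" by (rule borel_measurable_power)
  have 1: "integrable (leb {1..d}) (\<lambda>x. (\<alpha> x)\<^sup>2 * f x) \<longleftrightarrow> integrable \<mu> (\<lambda>x. (\<alpha> x)\<^sup>2)"
    unfolding integrable_law[OF m2] by (simp only: mult.commute)
  have 2: "(\<integral>x. \<alpha> x * f x \<partial>leb {1..d}) = (\<integral>x. \<alpha> x \<partial>\<mu>)"
    unfolding integral_law[OF True] by (simp only: mult.commute)
  show ?thesis unfolding H_def L2_def sq_def dep_on_def mem_Collect_eq 1 2 using True by blast
next
  case False
  then show ?thesis unfolding H_def L2_def sq_def by blast
qed

lemma HH_D:
  assumes "\<alpha> \<in> HH d f SS" "S \<in> SS"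
  shows "sq (\<alpha> S)" "dep_on d S (\<alpha> S)" "(\<integral>x. \<alpha> S x \<partial>\<mu>) = 0"
  using PiE_mem[of \<alpha> SS "H d f" S] assms unfolding HH_def H_iff by auto

text \<open>The components of \<open>\<alpha>\<close> have mean zero, so the variance is a second
  moment around the mean of \<open>a\<close>; changing \<open>a\<close> off the cube affects null
  sets only.\<close>

lemma objective_eq:
  assumes fin: "finite SS" and am: "a' \<in> bor d" and a: "a \<in> bor d" "\<And>x. \<bar>a x\<bar> \<le> A"
    and eq: "\<And>x. x \<in> unit_cube d ==> a' x = a x" and \<alpha>: "\<alpha> \<in> HH d f SS"
  shows "objective d f a' SS lam \<alpha> = Lob SS lam (\<lambda>x. a x - (\<integral>x. a x \<partial>\<mu>)) \<alpha>"
proof -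
  note P = HH_D[OF \<alpha>]
  let ?s = "\<lambda>x. \<Sum>S\<in>SS. \<alpha> S x"
  have si: "integrable \<mu> ?s" by (intro Bochner_Integration.integrable_sum sq_integrable P(1))
  have "(\<integral>x. ?s x \<partial>\<mu>) = (\<Sum>S\<in>SS. (\<integral>x. \<alpha> S x \<partial>\<mu>))"
    by (intro Bochner_Integration.integral_sum sq_integrable P(1))
  then have s0: "(\<integral>x. ?s x \<partial>\<mu>) = 0" using P(3) by simp
  have ai: "integrable \<mu> a" by (rule integrable_bdd[OF a])
  have sm: "?s \<in> bor d" by (intro borel_measurable_sum sq_meas P(1))
  have E: "(\<integral>x. a' x - ?s x \<partial>\<mu>) = (\<integral>x. a x \<partial>\<mu>)"
  proof -
    have "(\<integral>x. a' x - ?s x \<partial>\<mu>) = (\<integral>x. a x - ?s x \<partial>\<mu>)"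
    proof (rule integral_cong_AE)
      show "AE x in \<mu>. a' x - ?s x = a x - ?s x" using AE_cube by eventually_elim (simp add: eq)
    qed (intro law_meas borel_measurable_diff am a(1) sm)+
    also have "\<dots> = (\<integral>x. a x \<partial>\<mu>)" using Bochner_Integration.integral_diff[OF ai si] s0 by simp
    finally show ?thesis .
  qed
  have "(\<integral>x. (a' x - ?s x - (\<integral>x. a x \<partial>\<mu>))\<^sup>2 \<partial>\<mu>) = (\<integral>x. (a x - (\<integral>x. a x \<partial>\<mu>) - ?s x)\<^sup>2 \<partial>\<mu>)"
  proof (rule integral_cong_AE)
    show "AE x in \<mu>. (a' x - ?s x - (\<integral>x. a x \<partial>\<mu>))\<^sup>2 = (a x - (\<integral>x. a x \<partial>\<mu>) - ?s x)\<^sup>2"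
      using AE_cube by eventually_elim (simp add: eq algebra_simps)
  qed (intro law_meas borel_measurable_power borel_measurable_diff borel_measurable_const am a(1) sm)+
  then show ?thesis unfolding objective_def E Lob_def by simp
qed

lemma objective_nonneg: "(\<And>S. S \<in> SS ==> 0 < lam S) ==> 0 \<le> objective d f a SS lam \<alpha>"
  unfolding objective_def by (intro add_nonneg_nonneg sum_nonneg mult_nonneg_nonneg integral_nonneg) (auto simp: less_imp_le)

lemma HH_nonempty: "HH d f SS \<noteq> {}"
proof -
  have "(\<lambda>_. 0) \<in> H d f S" for S unfolding H_iff by (simp add: sq_def dep_on_def)
  then have "restrict (\<lambda>_ _. 0) SS \<in> HH d f SS" unfolding HH_def by simp
  then show ?thesis by blast
qed

text \<open>Every penalty term changes by the factor \<open>lam S / \<rho> S\<close>, which lies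
  between \<open>1 - e\<close> and \<open>1 + e\<close>, and all terms are nonnegative. The
  comparison is multiplicative, hence uniform in \<open>\<alpha>\<close>, which may vary with
  \<open>n\<close>.\<close>

lemma Lob_ratio:
  assumes \<rho>: "\<And>S. S \<in> SS ==> 0 < lam S" "\<And>S. S \<in> SS ==> \<bar>lam S / \<rho> S - 1\<bar> \<le> e" and e: "0 \<le> e"
  shows "Lob SS \<rho> b \<alpha> \<le> (1 + e) * Lob SS lam b \<alpha>" "(1 - e) * Lob SS lam b \<alpha> \<le> Lob SS \<rho> b \<alpha>"
proof -
  let ?P = "\<integral>x. (b x - (\<Sum>S\<in>SS. \<alpha> S x))\<^sup>2 \<partial>\<mu>" let ?q = "\<lambda>S. 1 / lam S * (\<integral>x. (\<alpha> S x)\<^sup>2 \<partial>\<mu>)"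
  have P: "0 \<le> ?P" by simp
  have q: "0 \<le> ?q S" if "S \<in> SS" for S using \<rho>(1)[OF that] by (intro mult_nonneg_nonneg integral_nonneg) auto
  have e1: "1 / \<rho> S * (\<integral>x. (\<alpha> S x)\<^sup>2 \<partial>\<mu>) = lam S / \<rho> S * ?q S" if "S \<in> SS" for S using \<rho>(1)[OF that] by simp
  have L: "Lob SS \<rho> b \<alpha> = ?P + (\<Sum>S\<in>SS. lam S / \<rho> S * ?q S)" unfolding Lob_def using e1 by simp
  have "?P + (\<Sum>S\<in>SS. lam S / \<rho> S * ?q S) \<le> (1 + e) * ?P + (\<Sum>S\<in>SS. (1 + e) * ?q S)"
  proof (intro add_mono sum_mono mult_right_mono q)
    show "?P \<le> (1 + e) * ?P" using mult_right_mono[of 1 "1 + e" ?P] e P by simp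
    show "lam S / \<rho> S \<le> 1 + e" if "S \<in> SS" for S using \<rho>(2)[OF that] by linarith
  qed
  then show "Lob SS \<rho> b \<alpha> \<le> (1 + e) * Lob SS lam b \<alpha>"
    unfolding L unfolding Lob_def distrib_left sum_distrib_left by simp
  have "(1 - e) * ?P + (\<Sum>S\<in>SS. (1 - e) * ?q S) \<le> ?P + (\<Sum>S\<in>SS. lam S / \<rho> S * ?q S)"
  proof (intro add_mono sum_mono mult_right_mono q)
    show "(1 - e) * ?P \<le> ?P" using mult_right_mono[of "1 - e" 1 ?P] e P by simp
    show "1 - e \<le> lam S / \<rho> S" if "S \<in> SS" for S using \<rho>(2)[OF that] by linarith
  qed
  then show "(1 - e) * Lob SS lam b \<alpha> \<le> Lob SS \<rho> b \<alpha>"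
    unfolding L unfolding Lob_def distrib_left sum_distrib_left by simp
qed

end

context risk begin

text \<open>Joins the stochastic and the numerical analysis for one \<open>n\<close>. The upper
  bound runs from \<open>\<alpha>t\<close> to \<open>\<alpha>p\<close> to an arbitrary competitor
  and then from the actual to the limiting ratios.\<close>

lemma risk_bounds:
  fixes lm :: "nat set => real" and r E l \<Lambda> :: real and a' :: "point => real"
  assumes a'm: "a' \<in> bor d" and a': "\<And>x. x \<in> unit_cube d ==> a' x = a x"
    and \<theta>: "functional d a' f = \<theta>"
    and r: "1 \<le> r" "r ^ 60 = real n"
    and E: "8 * (real (card SS) * (2 * \<kappa> / c1 + 1)) \<le> E" "(2 + C1) * (2 + C2) \<le> E" "2 \<le> E" and y: "E ^ M * (1 / h ^ d) \<le> r"
    and l: "0 < l" "l \<le> 1" "2 \<le> l * real n" and \<Lambda>: "0 \<le> \<Lambda>"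
    and nS: "\<And>S. S \<in> SS ==> l \<le> real (nS S) / real n" "\<And>S. S \<in> SS ==> real (nS S) / real n \<le> \<Lambda>"
    and \<tau>: "K4 l / r ^ 24 \<le> c1 / 2" "K4 l / r ^ 24 \<le> 1"
    and lm: "\<And>S. S \<in> SS ==> 0 < lm S" "\<And>S. S \<in> SS ==> \<bar>real n * lm S / real (nS S) - 1\<bar> \<le> 1 / real n"
    and I0: "\<And>\<alpha>. \<alpha> \<in> HH d f SS ==> I0 \<le> objective d f a' SS lm \<alpha>"
  defines "\<delta> \<equiv> 16 * A\<^sup>2 * ((E * (1 / h ^ d)) ^ (2 * M + 2) / real n) + rest l \<Lambda> r"
    and "\<sigma> \<equiv> (1 - 1 / real (card SS) / (1 + \<Lambda>)) ^ M * (2 * A)\<^sup>2"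
    and "\<zeta> \<equiv> (real (card SS) + 1 / l) * (real (card SS) * (3 * A\<^sup>2 * (C1 + 2) * Cc * (4 * W\<^sup>2) ^ M * h powr \<beta>))"
  shows "\<exists>g\<ge>0. scaled_risk d f K a' SS h M n nS = ennreal g \<and>
    (\<forall>\<gamma>\<in>HH d f SS. \<forall>\<epsilon>>0. g \<le> (1 + \<epsilon>) * ((1 + \<epsilon>) * ((1 + 1 / real n) * objective d f a' SS lm \<gamma> + \<sigma>) + (1 + 1 / \<epsilon>) * \<zeta>) + (1 + 1 / \<epsilon>) * \<delta>) \<and>
    (\<forall>\<epsilon>>0. (1 - 1 / real n) * I0 \<le> (1 + \<epsilon>) * g + (1 + 1 / \<epsilon>) * \<delta>)"
proof -
  let ?\<rho> = "\<lambda>S. real (nS S) / real n" let ?b = "\<lambda>x. a x - \<theta>"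
  let ?L = "Lob SS ?\<rho> ?b (\<alpha>t M)"
  define N where "N = Min (insert n (nS ` SS))"
  define Nm where "Nm = Max (nS ` SS)"
  have fin: "finite (insert n (nS ` SS))" using finite_SS by simp
  have N1: "N \<le> n" unfolding N_def using fin by (intro Min_le) auto
  have N2: "N \<le> nS S" if "S \<in> SS" for S unfolding N_def using fin that by (intro Min_le) auto
  have Nm1: "nS S \<le> Nm" if "S \<in> SS" for S unfolding Nm_def using finite_SS that by simp
  have n0: "0 < real n" using n_pos by simp
  have ln: "l * r ^ 60 \<le> real N"
  proof -
    have "N \<in> insert n (nS ` SS)" unfolding N_def using fin by (intro Min_in) auto
    then consider "N = n" | S where "S \<in> SS" "N = nS S" by blast
    then show ?thesis
    proof cases
      case 1
      then show ?thesis unfolding r(2) using l n0 by (simp add: mult_left_le_one_le)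
    next
      case 2
      then show ?thesis unfolding r(2) using nS(1)[OF 2(1)] n0 by (simp add: pos_le_divide_eq)
    qed
  qed
  have Nml: "real Nm \<le> \<Lambda> * r ^ 60"
  proof -
    have "Nm \<in> nS ` SS" unfolding Nm_def using finite_SS SS(2) by (intro Max_in) auto
    then obtain S where S: "S \<in> SS" "Nm = nS S" by blast
    then show ?thesis unfolding r(2) using nS(2)[OF S(1)] n0 by (simp add: pos_divide_le_eq)
  qed
  have N3: "2 \<le> N" using ln l(3) unfolding r(2) by linarith
  note EB = EB_bound[OF r E y l(1) ln \<Lambda> Nml]
  have r0: "0 < r" using r(1) by simp
  have t0: "0 \<le> 1 / r ^ 24" using r0 by simp
  have \<tau>': "1 / r ^ 24 + 2 * R\<psi> M / real N \<le> c1 / 2" "1 / r ^ 24 + 2 * R\<psi> M / real N \<le> 1"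
    using EB(1) \<tau> by linarith+
  define g where "g = real n * (\<integral>z. (est M z - \<theta>)\<^sup>2 \<partial>I.\<Omega>)"
  have g0: "0 \<le> g" unfolding g_def by (intro mult_nonneg_nonneg integral_nonneg) auto
  have sr: "scaled_risk d f K a' SS h M n nS = ennreal g"
    unfolding g_def by (rule scaled_risk_eq[OF a'm a' \<theta> EB(3)])
  have sw: "g \<le> (1 + \<epsilon>) * ?L + (1 + 1 / \<epsilon>) * \<delta>" "?L \<le> (1 + \<epsilon>) * g + (1 + 1 / \<epsilon>) * \<delta>" if \<epsilon>: "0 < \<epsilon>" for \<epsilon>
  proof -
    note S = risk_sandwich[OF N3 N1 N2 Nm1 EB(3) t0 \<tau>' \<epsilon>, folded g_def]
    have "(1 + 1 / \<epsilon>) * (real n * EB M N Nm (1 / r ^ 24)) \<le> (1 + 1 / \<epsilon>) * \<delta>"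
      unfolding \<delta>_def using EB(2) \<epsilon> by (intro mult_left_mono) auto
    with S show "g \<le> (1 + \<epsilon>) * ?L + (1 + 1 / \<epsilon>) * \<delta>" "?L \<le> (1 + \<epsilon>) * g + (1 + 1 / \<epsilon>) * \<delta>" by linarith+
  qed
  have n1: "0 \<le> 1 / real n" "1 / real n \<le> 1" using n0 n_pos by auto
  have rat: "\<bar>lm S / ?\<rho> S - 1\<bar> \<le> 1 / real n" if "S \<in> SS" for S
    using lm(2)[OF that] by (simp add: mult.commute)
  have obj: "objective d f a' SS lm \<gamma> = Lob SS lm ?b \<gamma>" if "\<gamma> \<in> HH d f SS" for \<gamma>
    unfolding \<theta>_def by (rule objective_eq[OF finite_SS a'm a_meas a_le a' that])
  have up: "g \<le> (1 + \<epsilon>) * ((1 + \<epsilon>) * ((1 + 1 / real n) * objective d f a' SS lm \<gamma> + \<sigma>) + (1 + 1 / \<epsilon>) * \<zeta>) + (1 + 1 / \<epsilon>) * \<delta>"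
    if \<gamma>: "\<gamma> \<in> HH d f SS" and \<epsilon>: "0 < \<epsilon>" for \<gamma> \<epsilon>
  proof -
    note P = HH_D[OF \<gamma>]
    have "Lob SS ?\<rho> ?b (\<alpha>p M) \<le> Lob SS ?\<rho> ?b \<gamma> + \<sigma>"
      unfolding \<sigma>_def by (rule Lob_\<alpha>p[OF nS(2) P])
    also have "Lob SS ?\<rho> ?b \<gamma> \<le> (1 + 1 / real n) * objective d f a' SS lm \<gamma>"
      unfolding obj[OF \<gamma>] by (rule Lob_ratio(1)[OF lm(1) rat n1(1)])
    finally have 1: "Lob SS ?\<rho> ?b (\<alpha>p M) \<le> (1 + 1 / real n) * objective d f a' SS lm \<gamma> + \<sigma>" by simp
    have "?L \<le> (1 + \<epsilon>) * Lob SS ?\<rho> ?b (\<alpha>p M) + (1 + 1 / \<epsilon>) * \<zeta>"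
      unfolding \<zeta>_def by (rule Lob_\<alpha>t[OF \<epsilon> l(1) nS(1)])
    also have "\<dots> \<le> (1 + \<epsilon>) * ((1 + 1 / real n) * objective d f a' SS lm \<gamma> + \<sigma>) + (1 + 1 / \<epsilon>) * \<zeta>"
      using 1 \<epsilon> by (intro add_right_mono mult_left_mono) auto
    finally have "(1 + \<epsilon>) * ?L \<le> (1 + \<epsilon>) * ((1 + \<epsilon>) * ((1 + 1 / real n) * objective d f a' SS lm \<gamma> + \<sigma>) + (1 + 1 / \<epsilon>) * \<zeta>)"
      using \<epsilon> by (intro mult_left_mono) auto
    then show ?thesis using sw(1)[OF \<epsilon>] by linarith
  qed
  have low: "(1 - 1 / real n) * I0 \<le> ?L"
  proof -
    \<comment> \<open>Elements of \<open>HH\<close> are extensional, so the family is cut off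
      outside \<open>SS\<close>; the objective sees only indices in \<open>SS\<close>.\<close>
    have HHt: "restrict (\<alpha>t M) SS \<in> HH d f SS"
      unfolding HH_def using \<alpha>t_props(3,4,5) by (simp add: H_iff)
    have "(1 - 1 / real n) * I0 \<le> (1 - 1 / real n) * Lob SS lm ?b (restrict (\<alpha>t M) SS)"
      using I0[OF HHt] n1 unfolding obj[OF HHt] by (intro mult_left_mono) auto
    also have "\<dots> \<le> Lob SS ?\<rho> ?b (restrict (\<alpha>t M) SS)" by (rule Lob_ratio(2)[OF lm(1) rat n1(1)])
    also have "\<dots> = ?L" unfolding Lob_def by simp
    finally show ?thesis .
  qed
  show ?thesis
  proof (intro exI[of _ g] conjI g0 sr ballI allI impI)
    show "(1 - 1 / real n) * I0 \<le> (1 + \<epsilon>) * g + (1 + 1 / \<epsilon>) * \<delta>" if "0 < \<epsilon>" for \<epsilon>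
      using low sw(2)[OF that] by linarith
  qed (use up in auto)
qed

end

theorem theorem21:
  fixes d :: nat and \<beta>1 \<beta>2 L1 L2 c0 C0 \<kappa> :: real
  assumes "2 \<le> d"
    and "0 < \<beta>1" "\<beta>1 \<le> 1" "0 < \<beta>2" "\<beta>2 \<le> 1"
    and "0 < L1" "0 < L2" "0 < c0" "0 < C0"
  shows "\<exists>C>0. \<forall>(SS :: nat set set) (f :: point \<Rightarrow> real) (a :: point \<Rightarrow> real) (K :: point \<Rightarrow> real)
      (lam :: nat set \<Rightarrow> real) (nS :: nat \<Rightarrow> nat set \<Rightarrow> nat) (h :: nat \<Rightarrow> real) (M :: nat \<Rightarrow> nat).
    SS \<noteq> {} \<longrightarrow> SS \<subseteq> Pow {1..d} - {{1..d}} \<longrightarrow>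
    density_on_cube d f \<longrightarrow>
    a \<in> borel_measurable (leb {1..d}) \<longrightarrow>
    holder_on_cube d \<beta>1 L1 a \<longrightarrow>
    holder_on_cube d \<beta>2 L2 f \<longrightarrow>
    (\<forall>x\<in>unit_cube d. c0 \<le> f x \<and> f x \<le> C0) \<longrightarrow>
    is_kernel d K \<longrightarrow> kernel_sup d K = \<kappa> \<longrightarrow>
    sample_sizes SS lam nS \<longrightarrow>
    (\<forall>n. 0 < h n \<and> h n < 1) \<longrightarrow>
    filterlim M at_top sequentially \<longrightarrow>
    (\<lambda>n. h n * C ^ M n) \<longlonglongrightarrow> 0 \<longrightarrow>
    (\<lambda>n. (C / h n ^ d) ^ (2 * M n + 2) / real n) \<longlonglongrightarrow> 0 \<longrightarrow>
    (\<lambda>n. scaled_risk d f K a SS (h n) (M n) n (nS n))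
      \<longlonglongrightarrow> ennreal (INF \<alpha>\<in>HH d f SS. objective d f a SS lam \<alpha>)"
proof -
  define \<beta> where "\<beta> = min \<beta>1 \<beta>2"
  define k1 where "k1 = c0 / 2 ^ d"
  define D1 where "D1 = C0 / k1 + 1"
  define D2 where "D2 = (C0 + 1) * 2 / k1 + 1"
  define DH where "DH = 2 + (C0 + 2 * L2) / c0"
  \<comment> \<open>Chosen with \<open>w powr \<beta> = 4 * R.W\<^sup>2\<close>, so that the
    smoothing error becomes \<open>(h * w ^ M) powr \<beta>\<close> up to constants and the
    hypothesis on \<open>h * C ^ M\<close> applies.\<close>
  define w where "w = (4 * ((2 + D1) * (2 + DH))\<^sup>2) powr (1 / \<beta>)"
  \<comment> \<open>\<open>2 ^ d\<close> takes the place of \<open>card SS\<close>, because the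
    constant is fixed before \<open>SS\<close>. The absolute value is there since
    \<open>\<kappa>\<close> is at this point an arbitrary real number.\<close>
  define E where "E = 8 * (2 ^ d * (2 * \<bar>\<kappa>\<bar> / k1 + 1)) + (2 + D1) * (2 + D2) + 2"
  \<comment> \<open>The 60th power matches the 60th root of \<open>n\<close> that serves as budget
    for \<open>E ^ M / h ^ d\<close>.\<close>
  define C where "C = E ^ 60 + w"
  have \<beta>: "0 < \<beta>" "\<beta> \<le> 1" "\<beta> \<le> \<beta>1" "\<beta> \<le> \<beta>2" using assms by (auto simp: \<beta>_def)
  have k1: "0 < k1" using assms by (simp add: k1_def)
  have D1: "0 < D1" unfolding D1_def using assms k1 by (intro add_pos_pos divide_pos_pos) auto
  have D2: "0 < D2" unfolding D2_def using assms k1 by (intro add_pos_pos divide_pos_pos mult_pos_pos) auto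
  have DH: "0 < DH" unfolding DH_def using assms by (intro add_pos_pos divide_pos_pos mult_pos_pos) auto
  have W0: "0 < 4 * ((2 + D1) * (2 + DH))\<^sup>2" using D1 DH by (intro mult_pos_pos zero_less_power) auto
  have w0: "0 < w" unfolding w_def using W0 by simp
  have w\<beta>: "w powr \<beta> = 4 * ((2 + D1) * (2 + DH))\<^sup>2" unfolding w_def powr_powr using \<beta>(1) W0 by simp
  have kk: "0 \<le> 2 * \<bar>\<kappa>\<bar> / k1 + 1" using k1 by (intro add_nonneg_nonneg divide_nonneg_pos) auto
  have E1: "0 \<le> 8 * (2 ^ d * (2 * \<bar>\<kappa>\<bar> / k1 + 1))" using kk by (intro mult_nonneg_nonneg) auto
  have E2: "0 \<le> (2 + D1) * (2 + D2)" using D1 D2 by (intro mult_nonneg_nonneg) auto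
  have E: "8 * (2 ^ d * (2 * \<bar>\<kappa>\<bar> / k1 + 1)) \<le> E" "(2 + D1) * (2 + D2) \<le> E" "2 \<le> E"
    unfolding E_def using E1 E2 by linarith+
  have E60: "E ^ 1 \<le> E ^ 60" using E(3) by (intro power_increasing) auto
  have C: "E \<le> C" "E ^ 60 \<le> C" "1 \<le> C" "w \<le> C" "0 < C"
    unfolding C_def using E60 E(3) w0 by auto
  show ?thesis
  proof (intro exI[of _ C] conjI allI impI)
    show "0 < C" by (rule C(5))
    fix SS :: "nat set set" and f a K :: "point => real" and lam :: "nat set => real"
      and nS :: "nat => nat set => nat" and h :: "nat => real" and M :: "nat => nat"
    assume SSne: "SS \<noteq> {}" and SSs: "SS \<subseteq> Pow {1..d} - {{1..d}}" and dc: "density_on_cube d f"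
      and am: "a \<in> bor d" and ha: "holder_on_cube d \<beta>1 L1 a" and hf: "holder_on_cube d \<beta>2 L2 f"
      and fb: "\<forall>x\<in>unit_cube d. c0 \<le> f x \<and> f x \<le> C0" and ker: "is_kernel d K" and sup: "kernel_sup d K = \<kappa>"
      and ss: "sample_sizes SS lam nS" and hh: "\<forall>n. 0 < h n \<and> h n < 1" and M: "filterlim M at_top sequentially"
      and hC: "(\<lambda>n. h n * C ^ M n) \<longlonglongrightarrow> 0" and XC: "(\<lambda>n. (C / h n ^ d) ^ (2 * M n + 2) / real n) \<longlonglongrightarrow> 0"
    have finSS: "finite SS" by (rule finite_subset[OF SSs]) simp
    have SS1: "SS \<subseteq> Pow {1..d}" "{1..d} \<notin> SS" using SSs by blast+
    let ?s = "real (card SS)"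
    have "0 < card SS" using SSne finSS by (simp add: card_gt_0_iff)
    then have s1: "1 \<le> ?s" by linarith
    have "card SS \<le> 2 ^ d" using card_mono[OF _ SS1(1)] by (simp add: card_Pow)
    then have "?s \<le> real (2 ^ d)" by (rule of_nat_mono)
    then have s2: "?s \<le> 2 ^ d" by simp
    have d1: "1 \<le> d" using assms(1) by simp
    have hp: "0 < h n" "h n < 1" for n using hh by auto
    have fge: "c0 \<le> f x" and fle: "f x \<le> C0" if "x \<in> unit_cube d" for x using fb that by auto
    interpret D: dens d f c0 C0 by unfold_locales (assumption | rule dc fge fle assms(8))+
    define z0 :: point where "z0 = (\<lambda>j\<in>{1..d}. 0)"
    have z0: "z0 \<in> unit_cube d" by (simp add: unit_cube_iff z0_def)
    define A where "A = \<bar>a z0\<bar> + L1"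
    have osc_a: "osc d \<beta> L1 a" by (rule holder_osc[OF d1 ha \<beta>(1,3)]) (use assms(6) in auto)
    have osc_f: "osc d \<beta> L2 f" by (rule holder_osc[OF d1 hf \<beta>(1,4)]) (use assms(7) in auto)
    have a_b: "\<bar>a x\<bar> \<le> A" if x: "x \<in> unit_cube d" for x
    proof -
      have "\<bar>x j - z0 j\<bar> \<le> 1" if "j \<in> {1..d}" for j using x that by (auto simp: unit_cube_iff z0_def)
      from oscD[OF osc_a x z0 zero_le_one order_refl this] have "\<bar>a x - a z0\<bar> \<le> L1" by simp
      then show ?thesis unfolding A_def by linarith
    qed
    have A0: "0 \<le> A" using assms(6) unfolding A_def by linarith
    \<comment> \<open>The given \<open>a\<close> is controlled only on the cube, whereas the
      estimates use a bound valid everywhere.\<close>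
    define a0 where "a0 x = (if x \<in> unit_cube d then a x else 0)" for x
    have a_a0: "a x = a0 x" if "x \<in> unit_cube d" for x using that by (simp add: a0_def)
    have "a0 = (\<lambda>x. a x * indicator (unit_cube d) x)" by (rule ext) (simp add: a0_def)
    then have a0m: "a0 \<in> bor d"
      using borel_measurable_times[OF am borel_measurable_indicator[OF unit_cube_sets]] by simp
    have a0_le: "\<bar>a0 x\<bar> \<le> A" for x using a_b[of x] A0 by (simp add: a0_def)
    have "osc d \<beta> A a" by (rule holder_osc[OF d1 ha \<beta>(1,3)]) (use assms(6) in \<open>auto simp: A_def\<close>)
    then have osc_a0: "osc d \<beta> A a0" unfolding osc_def using a_a0 by simp
    have \<theta>: "functional d a f = (\<integral>x. a0 x \<partial>law d f)"
      unfolding functional_def D.integral_law[OF a0m]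
    proof (rule Bochner_Integration.integral_cong[OF refl])
      fix x assume "x \<in> space (leb {1..d})"
      then have x: "x \<in> euclid d" by simp
      show "a x * f x = f x * a0 x"
      proof (cases "x \<in> unit_cube d")
        case True
        then show ?thesis by (simp add: a0_def)
      next
        case False
        then show ?thesis using D.f_out[of x] x by simp
      qed
    qed
    have lam0: "0 < lam S" and lim: "(\<lambda>n. real (nS n S) / real n) \<longlonglongrightarrow> lam S"
      and nS1: "\<And>n. 1 \<le> n ==> 1 \<le> nS n S" and lamd: "\<And>n. 1 \<le> n ==> \<bar>real n * lam S / real (nS n S) - 1\<bar> \<le> 1 / real n"
      if "S \<in> SS" for S using ss that unfolding sample_sizes_def by auto
    have rk: "risk d K \<kappa> (h n) f c0 C0 \<beta> L2 SS a0 A (nS n) n" if n: "1 \<le> n" for n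
    proof -
      have rpos: "0 < real (nS n S) / real n" if "S \<in> SS" for S using nS1[OF that n] n by simp
      show ?thesis
        by unfold_locales (assumption | rule ker sup hp dc fge fle assms(8) \<beta>(1,2) osc_f SS1 SSne rpos a0m a0_le osc_a0)+
    qed
    \<comment> \<open>The constants depend neither on \<open>n\<close> nor on \<open>h\<close>; the
      instance at 1 merely gives them names that are fixed before the limit is taken.\<close>
    interpret R: risk d K \<kappa> "h 1" f c0 C0 \<beta> L2 SS a0 A "nS 1" 1 by (rule rk) simp
    have Rc1: "R.c1 = k1" by (simp add: R.c1_def k1_def)
    have RC1: "R.C1 = D1" by (simp add: R.C1_def Rc1 D1_def)
    have RC2: "R.C2 = D2" by (simp add: R.C2_def Rc1 D2_def)
    have RCH: "R.CH = DH" by (simp add: R.CH_def DH_def)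
    have RW: "R.W = (2 + D1) * (2 + DH)" by (simp add: R.W_def RC1 RCH)
    have R\<theta>: "functional d a f = R.\<theta>" unfolding R.\<theta>_def by (rule \<theta>)
    have \<kappa>0: "0 \<le> \<kappa>" by (rule R.\<kappa>_nonneg)
    have ER: "8 * (?s * (2 * \<kappa> / R.c1 + 1)) \<le> E" "(2 + R.C1) * (2 + R.C2) \<le> E"
    proof -
      have "?s * (2 * \<kappa> / k1 + 1) \<le> 2 ^ d * (2 * \<bar>\<kappa>\<bar> / k1 + 1)"
        using s2 \<kappa>0 kk by (intro mult_mono) auto
      then show "8 * (?s * (2 * \<kappa> / R.c1 + 1)) \<le> E" unfolding Rc1 using E(1) by linarith
      show "(2 + R.C1) * (2 + R.C2) \<le> E" unfolding RC1 RC2 by (rule E(2))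
    qed
    \<comment> \<open>Strictly below every limiting ratio, hence eventually below the actual ones.
      It is also at most 1, because \<open>n\<close> itself is among the sample sizes bounded below
      by \<open>l * n\<close>.\<close>
    define l where "l = min 1 (Min (lam ` SS) / 2)"
    define \<Lambda> where "\<Lambda> = Max (lam ` SS) + 1"
    have "0 < Min (lam ` SS)" using finSS SSne lam0 by (subst Min_gr_iff) auto
    then have l0: "0 < l" "l \<le> 1" "l \<le> Min (lam ` SS) / 2" unfolding l_def by auto
    have lS: "l < lam S" "lam S < \<Lambda>" if "S \<in> SS" for S
    proof -
      have "Min (lam ` SS) \<le> lam S" "lam S \<le> Max (lam ` SS)" using finSS that by auto
      then show "l < lam S" "lam S < \<Lambda>" using l0(3) lam0[OF that] unfolding \<Lambda>_def by linarith+
    qed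
    obtain S0 where "S0 \<in> SS" using SSne by auto
    then have \<Lambda>0: "0 \<le> \<Lambda>" using lS[of S0] lam0[of S0] by linarith
    have ev_nS: "eventually (\<lambda>n. \<forall>S\<in>SS. l \<le> real (nS n S) / real n \<and> real (nS n S) / real n \<le> \<Lambda>) sequentially"
    proof (intro eventually_ball_finite[OF finSS] ballI)
      fix S assume S: "S \<in> SS"
      show "eventually (\<lambda>n. l \<le> real (nS n S) / real n \<and> real (nS n S) / real n \<le> \<Lambda>) sequentially"
        using order_tendstoD(1)[OF lim[OF S] lS(1)[OF S]] order_tendstoD(2)[OF lim[OF S] lS(2)[OF S]]
        by eventually_elim auto
    qed
    define r where "r n = root 60 (real n)" for n
    have r_top: "filterlim r at_top sequentially" unfolding r_def by real_asymp
    have r60: "r n ^ 60 = real n" for n unfolding r_def by (simp add: real_root_pow_pos2)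
    define q where "q n = 1 / h n ^ d" for n
    have q1: "1 \<le> q n" for n
    proof -
      have "h n ^ d \<le> 1" using hp[of n] by (intro power_le_one) auto
      then show ?thesis unfolding q_def using hp[of n] by simp
    qed
    have Cq: "C / h n ^ d = C * q n" for n unfolding q_def by simp
    note X = XC[unfolded Cq]
    have ev1: "eventually (\<lambda>n. 1 \<le> n) sequentially" by (rule eventually_ge_at_top)
    have evX: "eventually (\<lambda>n. (C * q n) ^ (2 * M n + 2) / real n < 1) sequentially" by (rule order_tendstoD(2)[OF X]) simp
    \<comment> \<open>Ensures \<open>60 \<le> 2 * M + 2\<close>, so that the 60th power of
      \<open>q\<close> is covered by the power in the hypothesis.\<close>
    have evM: "eventually (\<lambda>n. 30 \<le> M n) sequentially" using M unfolding filterlim_at_top by blast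
    have evy: "eventually (\<lambda>n. E ^ M n * q n \<le> r n) sequentially"
      using ev1 evX evM
    proof eventually_elim
      case (elim n)
      have q0: "0 \<le> q n" using q1[of n] by linarith
      have Eq0: "0 \<le> E ^ M n * q n" using E(3) q0 by (intro mult_nonneg_nonneg zero_le_power) auto
      \<comment> \<open>The budget condition follows from the hypothesis on
        \<open>(C / h ^ d) ^ (2 * M + 2) / n\<close> alone: \<open>E ^ 60 \<le> C\<close> handles
        the powers of \<open>E\<close>, and \<open>q \<ge> 1\<close> those of
        \<open>q\<close>.\<close>
      have "(E ^ M n * q n) ^ 60 = (E ^ 60) ^ M n * q n ^ 60"
        by (simp only: power_mult_distrib power_mult[symmetric] mult.commute[of 60])
      also have "\<dots> \<le> C ^ M n * q n ^ (2 * M n + 2)"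
        using C(2,5) E(3) q1[of n] elim(3) by (intro mult_mono power_mono power_increasing) auto
      also have "\<dots> \<le> C ^ (2 * M n + 2) * q n ^ (2 * M n + 2)"
        using C(3) q0 by (intro mult_right_mono power_increasing) auto
      also have "\<dots> = (C * q n) ^ (2 * M n + 2)" by (simp only: power_mult_distrib)
      also have "\<dots> \<le> real n" using elim(1,2) by (simp add: pos_divide_less_eq)
      finally have "root 60 ((E ^ M n * q n) ^ 60) \<le> r n" unfolding r_def by (intro real_root_le_mono) auto
      then show ?case using real_root_power_cancel[OF _ Eq0, of 60] by simp
    qed
    have evr: "eventually (\<lambda>n. 1 \<le> r n) sequentially" using r_top unfolding filterlim_at_top by blast
    have evl: "eventually (\<lambda>n. 2 \<le> l * real n) sequentially"
    proof -
      have "eventually (\<lambda>n. 2 / l \<le> real n) sequentially"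
        using filterlim_real_sequentially unfolding filterlim_at_top by blast
      then show ?thesis by eventually_elim (use l0(1) in \<open>simp add: pos_divide_le_eq mult.commute\<close>)
    qed
    have ev\<tau>: "eventually (\<lambda>n. R.K4 l / r n ^ 24 < min (R.c1 / 2) 1) sequentially"
    proof (rule order_tendstoD(2))
      have "((\<lambda>x::real. 1 / x ^ 24) \<longlongrightarrow> 0) at_top" by real_asymp
      from tendsto_mult_right_zero[OF filterlim_compose[OF this r_top], of "R.K4 l"]
      show "(\<lambda>n. R.K4 l / r n ^ 24) \<longlonglongrightarrow> 0" by simp
      show "0 < min (R.c1 / 2) 1" using R.c1_pos by simp
    qed
    define \<delta> where "\<delta> n = 16 * A\<^sup>2 * ((E * (1 / h n ^ d)) ^ (2 * M n + 2) / real n) + R.rest l \<Lambda> (r n)" for n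
    define \<sigma> where "\<sigma> n = (1 - 1 / ?s / (1 + \<Lambda>)) ^ M n * (2 * A)\<^sup>2" for n
    define \<zeta> where "\<zeta> n = (?s + 1 / l) * (?s * (3 * A\<^sup>2 * (R.C1 + 2) * R.Cc * (4 * R.W\<^sup>2) ^ M n * h n powr \<beta>))" for n
    have \<delta>_lim: "\<delta> \<longlonglongrightarrow> 0"
    proof -
      have "(\<lambda>n. (E * q n) ^ (2 * M n + 2) / real n) \<longlonglongrightarrow> 0"
      proof (rule tendsto_sandwich[OF _ _ tendsto_const X])
        have Eq: "0 \<le> E * q n" "E * q n \<le> C * q n" for n
          using E(3) C(1) q1[of n] by (auto intro!: mult_nonneg_nonneg mult_right_mono)
        show "eventually (\<lambda>n. 0 \<le> (E * q n) ^ (2 * M n + 2) / real n) sequentially"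
          using Eq by (intro always_eventually allI divide_nonneg_nonneg zero_le_power) auto
        show "eventually (\<lambda>n. (E * q n) ^ (2 * M n + 2) / real n \<le> (C * q n) ^ (2 * M n + 2) / real n) sequentially"
          using Eq by (intro always_eventually allI divide_right_mono power_mono) auto
      qed
      from tendsto_add[OF tendsto_mult_right_zero[OF this, of "16 * A\<^sup>2"] filterlim_compose[OF R.rest_tendsto[OF l0(1) \<Lambda>0] r_top]]
      show ?thesis unfolding \<delta>_def q_def by simp
    qed
    have \<sigma>_lim: "\<sigma> \<longlonglongrightarrow> 0"
    proof -
      have p: "1 \<le> ?s * (1 + \<Lambda>)" using mult_mono[OF s1, of 1 "1 + \<Lambda>"] \<Lambda>0 by simp
      have e: "1 / ?s / (1 + \<Lambda>) = 1 / (?s * (1 + \<Lambda>))" by simp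
      have "0 < 1 / (?s * (1 + \<Lambda>))" "1 / (?s * (1 + \<Lambda>)) \<le> 1" using p by (auto simp: divide_le_eq)
      then have "\<bar>1 - 1 / ?s / (1 + \<Lambda>)\<bar> < 1" unfolding e by linarith
      then have "(\<lambda>k. (1 - 1 / ?s / (1 + \<Lambda>)) ^ k) \<longlonglongrightarrow> 0" by (rule LIMSEQ_abs_realpow_zero2)
      from tendsto_mult_left_zero[OF filterlim_compose[OF this M], of "(2 * A)\<^sup>2"]
      show ?thesis unfolding \<sigma>_def .
    qed
    have \<zeta>_lim: "\<zeta> \<longlonglongrightarrow> 0"
    proof -
      have hw: "(\<lambda>n. h n * w ^ M n) \<longlonglongrightarrow> 0"
      proof (rule tendsto_sandwich[OF _ _ tendsto_const hC])
        show "eventually (\<lambda>n. 0 \<le> h n * w ^ M n) sequentially"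
          using hp w0 by (intro always_eventually allI mult_nonneg_nonneg zero_le_power) (auto simp: less_imp_le)
        show "eventually (\<lambda>n. h n * w ^ M n \<le> h n * C ^ M n) sequentially"
          using hp w0 C(4) by (intro always_eventually allI mult_left_mono power_mono) (auto simp: less_imp_le)
      qed
      have e: "(h n * w ^ M n) powr \<beta> = (4 * R.W\<^sup>2) ^ M n * h n powr \<beta>" for n
      proof -
        have "(w ^ M n) powr \<beta> = (w powr real (M n)) powr \<beta>" using w0 by (simp add: powr_realpow)
        also have "\<dots> = (w powr \<beta>) powr real (M n)" unfolding powr_powr by (simp only: mult.commute)
        also have "\<dots> = (4 * R.W\<^sup>2) ^ M n" unfolding w\<beta> RW by (rule powr_realpow[OF W0])
        finally show ?thesis using hp[of n] w0 by (simp add: powr_mult mult.commute)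
      qed
      have "(\<lambda>n. (h n * w ^ M n) powr \<beta>) \<longlonglongrightarrow> 0"
        by (rule tendsto_zero_powrI[OF hw tendsto_const])
          (use \<beta>(1) hp w0 in \<open>auto intro!: always_eventually mult_nonneg_nonneg simp: less_imp_le\<close>)
      then have "(\<lambda>n. (4 * R.W\<^sup>2) ^ M n * h n powr \<beta>) \<longlonglongrightarrow> 0" unfolding e .
      from tendsto_mult_right_zero[OF this, of "(?s + 1 / l) * (?s * (3 * A\<^sup>2 * (R.C1 + 2) * R.Cc))"]
      show ?thesis unfolding \<zeta>_def by (simp only: mult.assoc)
    qed
    define I0 where "I0 = (INF \<alpha>\<in>HH d f SS. objective d f a SS lam \<alpha>)"
    have bdd: "bdd_below (objective d f a SS lam ` HH d f SS)"
      by (rule bdd_belowI2[of _ 0]) (rule D.objective_nonneg[OF lam0])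
    have I0_le: "I0 \<le> objective d f a SS lam \<alpha>" if "\<alpha> \<in> HH d f SS" for \<alpha>
      unfolding I0_def by (rule cINF_lower[OF bdd that])
    \<comment> \<open>The risk is an extended real that is shown to be finite for large
      \<open>n\<close>; the limit is computed for its real part and then transferred back.\<close>
    define sr where "sr n = scaled_risk d f K a SS (h n) (M n) n (nS n)" for n
    define g where "g n = enn2real (sr n)" for n
    have main: "eventually (\<lambda>n. sr n = ennreal (g n) \<and>
      (\<forall>\<gamma>\<in>HH d f SS. \<forall>\<epsilon>>0. g n \<le> (1 + \<epsilon>) * ((1 + \<epsilon>) * ((1 + 1 / real n) * objective d f a SS lam \<gamma> + \<sigma> n) + (1 + 1 / \<epsilon>) * \<zeta> n) + (1 + 1 / \<epsilon>) * \<delta> n) \<and>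
      (\<forall>\<epsilon>>0. (1 - 1 / real n) * I0 \<le> (1 + \<epsilon>) * g n + (1 + 1 / \<epsilon>) * \<delta> n)) sequentially"
      using ev1 ev_nS evy evr evl ev\<tau>
    proof eventually_elim
      case (elim n)
      have y: "E ^ M n * (1 / h n ^ d) \<le> r n" using elim(3) unfolding q_def .
      have b: "l \<le> real (nS n S) / real n" "real (nS n S) / real n \<le> \<Lambda>" if "S \<in> SS" for S using elim(2) that by auto
      have t: "R.K4 l / r n ^ 24 \<le> R.c1 / 2" "R.K4 l / r n ^ 24 \<le> 1" using elim(6) by auto
      have ld: "\<bar>real n * lam S / real (nS n S) - 1\<bar> \<le> 1 / real n" if "S \<in> SS" for S by (rule lamd[OF that elim(1)])
      obtain g' where g': "0 \<le> g'" "sr n = ennreal g'"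
        and u: "\<forall>\<gamma>\<in>HH d f SS. \<forall>\<epsilon>>0. g' \<le> (1 + \<epsilon>) * ((1 + \<epsilon>) * ((1 + 1 / real n) * objective d f a SS lam \<gamma> + \<sigma> n) + (1 + 1 / \<epsilon>) * \<zeta> n) + (1 + 1 / \<epsilon>) * \<delta> n"
        and lo: "\<forall>\<epsilon>>0. (1 - 1 / real n) * I0 \<le> (1 + \<epsilon>) * g' + (1 + 1 / \<epsilon>) * \<delta> n"
        using risk.risk_bounds[OF rk[OF elim(1)] am a_a0 R\<theta> elim(4) r60 ER E(3) y l0(1,2) elim(5) \<Lambda>0 b t lam0 ld I0_le]
        unfolding sr_def \<delta>_def \<sigma>_def \<zeta>_def by blast
      have "g n = g'" unfolding g_def g'(2) using g'(1) by simp
      then show ?case using g'(2) u lo by blast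
    qed
    have "g \<longlonglongrightarrow> I0"
    proof (rule squeeze_inf[OF \<delta>_lim \<zeta>_lim \<sigma>_lim, of I0 "objective d f a SS lam ` HH d f SS"])
      show "\<exists>P\<in>objective d f a SS lam ` HH d f SS. P < b" if "I0 < b" for b
        using that unfolding I0_def cINF_less_iff[OF D.HH_nonempty bdd] by blast
      show "eventually (\<lambda>n. g n \<le> (1 + \<epsilon>) * ((1 + \<epsilon>) * ((1 + 1 / real n) * P + \<sigma> n) + (1 + 1 / \<epsilon>) * \<zeta> n) + (1 + 1 / \<epsilon>) * \<delta> n) sequentially"
        if "P \<in> objective d f a SS lam ` HH d f SS" "0 < \<epsilon>" for P \<epsilon>
        using main by eventually_elim (use that in blast)
      show "eventually (\<lambda>n. (1 - 1 / real n) * I0 \<le> (1 + \<epsilon>) * g n + (1 + 1 / \<epsilon>) * \<delta> n) sequentially" if "0 < \<epsilon>" for \<epsilon>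
        using main by eventually_elim (use that in blast)
    qed
    then have "(\<lambda>n. ennreal (g n)) \<longlonglongrightarrow> ennreal I0" by (rule tendsto_ennrealI)
    moreover have "eventually (\<lambda>n. ennreal (g n) = sr n) sequentially" using main by eventually_elim simp
    ultimately have "sr \<longlonglongrightarrow> ennreal I0" by (rule Lim_transform_eventually)
    then show "(\<lambda>n. scaled_risk d f K a SS (h n) (M n) n (nS n)) \<longlonglongrightarrow> ennreal (INF \<alpha>\<in>HH d f SS. objective d f a SS lam \<alpha>)"
      unfolding sr_def[abs_def] I0_def .
  qed
qed

end
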